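(* Let $\mathfrak{g}$ be a symmetrizable Kac--Moody algebra, let $\lambda_1,\lambda_2,\mu_1,\mu_2\in P^+$ and $w_1,w_2\in W$. If $K(\lambda_1,w_1,\mu_1)\ominus K(\lambda_2,w_2,\mu_2)$ is Schur positive, then $$\lambda_1+\mu_1\ \ge\ \lambda_2+\mu_2\ \ge\ \overline{\lambda_2+w_2\mu_2}\ \ge\ \overline{\lambda_1+w_1\mu_1}.$$
   Context: Base field $\mathbb{C}$. $W$ is the Weyl group, $P$ the integral weights, $P^+$ the dominant integral weights. $V(\lambda)$ is the irreducible integrable highest weight module of highest weight $\lambda\in P^+$, and $v_{\sigma\lambda}$ ($\sigma\in W$) is a nonzero vector of weight $\sigma\lambda$ in $V(\lambda)$. For $\alpha,\beta\in P$, $\alpha\ge\beta$ means that $\alpha-\beta$ is a nonnegative integer combination of simple roots. For $\gamma$ in the Tits cone $WP^+$, $\overline{\gamma}$ is the unique dominant element of $W\gamma$ (the weights $\lambda+w\mu$ with $\lambda,\mu\in P^+$, $w\in W$ lie in $WP^+$). Kostant--Kumar module: $K(\lambda,w,\mu)=U\mathfrak{g}(v_\lambda\otimes v_{w\mu})\subseteq V(\lambda)\otimes V(\mu)$. For integrable modules $V,V'$ in category $\mathcal{O}$, $V\ominus V'$ is called Schur positive if there exists a $U\mathfrak{g}$-linear surjection $V\twoheadrightarrow V'$, equivalently a $U\mathfrak{g}$-linear injection $V'\hookrightarrow V$. *)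

theory Defs
  imports
    "HOL-Analysis.Analysis"
    "HOL-Library.Function_Algebras"
    "HOL-Library.Poly_Mapping"
begin

class scaleC =
  fixes scaleC :: "complex \<Rightarrow> 'a \<Rightarrow> 'a" (infixr "*\<^sub>C" 75)

class complex_vector = scaleC + ab_group_add +
  assumes scaleC_add_right: "a *\<^sub>C (x + y) = a *\<^sub>C x + a *\<^sub>C y"
    and scaleC_add_left: "(a + b) *\<^sub>C x = a *\<^sub>C x + b *\<^sub>C x"
    and scaleC_scaleC: "a *\<^sub>C (b *\<^sub>C x) = (a * b) *\<^sub>C x"
    and scaleC_one: "1 *\<^sub>C x = x"

global_interpretation complex_vector:
  vector_space "scaleC :: complex \<Rightarrow> 'a \<Rightarrow> 'a::complex_vector"
  defines cdependent = complex_vector.dependent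
    and csubspace = complex_vector.subspace
    and cspan = complex_vector.span
    and cdim = complex_vector.dim
  by unfold_locales (simp_all add: scaleC_add_right scaleC_add_left scaleC_scaleC scaleC_one)

abbreviation cindependent :: "'a::complex_vector set \<Rightarrow> bool"
  where "cindependent B \<equiv> \<not> cdependent B"

abbreviation clinear :: "('a::complex_vector \<Rightarrow> 'b::complex_vector) \<Rightarrow> bool"
  where "clinear \<equiv> Vector_Spaces.linear scaleC scaleC"

definition cbilinear :: "('a::complex_vector \<Rightarrow> 'b::complex_vector \<Rightarrow> 'c::complex_vector) \<Rightarrow> bool"
  where "cbilinear B \<longleftrightarrow> (\<forall>x. clinear (B x)) \<and> (\<forall>y. clinear (\<lambda>x. B x y))"

lemma clinearI:
  assumes "\<And>x y. f (x + y) = f x + f y" and "\<And>c x. f (c *\<^sub>C x) = c *\<^sub>C f x"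
  shows "clinear f"
  by unfold_locales (simp_all add: assms scaleC_add_right scaleC_add_left scaleC_scaleC scaleC_one)

lemma clinear_add: "clinear f \<Longrightarrow> f (x + y) = f x + f y"
  using module_hom.add[of scaleC scaleC f] by (simp add: module_hom_iff_linear)

lemma clinear_scale: "clinear f \<Longrightarrow> f (c *\<^sub>C x) = c *\<^sub>C f x"
  using module_hom.scale[of scaleC scaleC f] by (simp add: module_hom_iff_linear)

instantiation complex :: complex_vector
begin
definition scaleC_complex :: "complex \<Rightarrow> complex \<Rightarrow> complex"
  where "scaleC_complex c x = c * x"
instance by standard (simp_all add: scaleC_complex_def algebra_simps)
end

instantiation "fun" :: (type, complex_vector) complex_vector
begin
definition scaleC_fun :: "complex \<Rightarrow> ('a \<Rightarrow> 'b) \<Rightarrow> 'a \<Rightarrow> 'b"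
  where "scaleC_fun c f = (\<lambda>x. c *\<^sub>C f x)"
instance
  by standard (simp_all add: scaleC_fun_def fun_eq_iff scaleC_add_right scaleC_add_left
      scaleC_scaleC scaleC_one)
end

instantiation poly_mapping :: (type, complex_vector) complex_vector
begin
definition scaleC_poly_mapping :: "complex \<Rightarrow> ('a \<Rightarrow>\<^sub>0 'b) \<Rightarrow> 'a \<Rightarrow>\<^sub>0 'b"
  where "scaleC_poly_mapping c p = Poly_Mapping.map (scaleC c) p"

lemma lookup_scaleC: "Poly_Mapping.lookup (c *\<^sub>C (p :: 'a \<Rightarrow>\<^sub>0 'b)) k = c *\<^sub>C Poly_Mapping.lookup p k"
  by (simp add: scaleC_poly_mapping_def Poly_Mapping.map.rep_eq when_def complex_vector.scale_zero_right)

instance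
  by standard (rule poly_mapping_eqI; simp add: lookup_scaleC lookup_add scaleC_add_right
      scaleC_add_left scaleC_scaleC scaleC_one)+
end

text \<open>The tensor product is the quotient of the free vector space on pairs by the
  bilinearity relations.\<close>

definition tensor_relators :: "(('v::complex_vector \<times> 'w::complex_vector) \<Rightarrow>\<^sub>0 complex) set"
  where "tensor_relators =
      {Poly_Mapping.single (v + v', w) 1 - Poly_Mapping.single (v, w) 1
        - Poly_Mapping.single (v', w) 1 | v v' w. True}
    \<union> {Poly_Mapping.single (v, w + w') 1 - Poly_Mapping.single (v, w) 1
        - Poly_Mapping.single (v, w') 1 | v w w'. True}
    \<union> {Poly_Mapping.single (c *\<^sub>C v, w) 1 - c *\<^sub>C Poly_Mapping.single (v, w) 1 | c v w. True}
    \<union> {Poly_Mapping.single (v, c *\<^sub>C w) 1 - c *\<^sub>C Poly_Mapping.single (v, w) 1 | c v w. True}"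

definition tensor_eq ::
    "(('v::complex_vector \<times> 'w::complex_vector) \<Rightarrow>\<^sub>0 complex) \<Rightarrow> ('v \<times> 'w \<Rightarrow>\<^sub>0 complex) \<Rightarrow> bool"
  where "tensor_eq p q \<longleftrightarrow> p - q \<in> cspan tensor_relators"

quotient_type (overloaded) ('v, 'w) tensor =
    "('v::complex_vector \<times> 'w::complex_vector) \<Rightarrow>\<^sub>0 complex" / tensor_eq
proof (rule equivpI)
  show "reflp tensor_eq"
    by (simp add: reflp_def tensor_eq_def complex_vector.span_zero)
  show "symp tensor_eq"
    unfolding symp_def tensor_eq_def
    using complex_vector.span_neg by (metis minus_diff_eq)
  show "transp tensor_eq"
  proof (rule transpI)
    fix p q r
    assume "tensor_eq p q" and "tensor_eq q r"
    moreover have "p - r = (p - q) + (q - r)" by simp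
    ultimately show "tensor_eq p r"
      unfolding tensor_eq_def by (simp only: complex_vector.span_add)
  qed
qed

instantiation tensor :: (complex_vector, complex_vector) complex_vector
begin

lift_definition zero_tensor :: "('a, 'b) tensor" is 0 .

lift_definition plus_tensor :: "('a, 'b) tensor \<Rightarrow> ('a, 'b) tensor \<Rightarrow> ('a, 'b) tensor" is "(+)"
  unfolding tensor_eq_def add_diff_add by (rule complex_vector.span_add)

lift_definition uminus_tensor :: "('a, 'b) tensor \<Rightarrow> ('a, 'b) tensor" is uminus
  unfolding tensor_eq_def minus_diff_minus by (rule complex_vector.span_neg)

lift_definition minus_tensor :: "('a, 'b) tensor \<Rightarrow> ('a, 'b) tensor \<Rightarrow> ('a, 'b) tensor" is "(-)"
proof -
  fix p p' :: "'a \<times> 'b \<Rightarrow>\<^sub>0 complex" and q q' :: "'a \<times> 'b \<Rightarrow>\<^sub>0 complex"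
  assume "tensor_eq p p'" and "tensor_eq q q'"
  moreover have "(p - q) - (p' - q') = (p - p') - (q - q')" by simp
  ultimately show "tensor_eq (p - q) (p' - q')"
    unfolding tensor_eq_def by (simp only: complex_vector.span_diff)
qed

lift_definition scaleC_tensor :: "complex \<Rightarrow> ('a, 'b) tensor \<Rightarrow> ('a, 'b) tensor" is scaleC
  unfolding tensor_eq_def complex_vector.scale_right_diff_distrib[symmetric]
  by (rule complex_vector.span_scale)

instance
  by standard (transfer; simp add: tensor_eq_def complex_vector.span_zero algebra_simps
      scaleC_add_right scaleC_add_left scaleC_scaleC scaleC_one)+

end

lift_definition tens :: "'v::complex_vector \<Rightarrow> 'w::complex_vector \<Rightarrow> ('v, 'w) tensor"
    (infixl "\<otimes>\<^sub>C" 70)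
  is "\<lambda>v w. Poly_Mapping.single (v, w) 1" .

definition free_extension ::
    "('v \<Rightarrow> 'w \<Rightarrow> 'u::complex_vector) \<Rightarrow> ('v \<times> 'w \<Rightarrow>\<^sub>0 complex) \<Rightarrow> 'u"
  where "free_extension \<beta> p = (\<Sum>k\<in>Poly_Mapping.keys p. Poly_Mapping.lookup p k *\<^sub>C \<beta> (fst k) (snd k))"

text \<open>The linear map on the tensor product induced by \<open>\<beta>\<close>; it is independent of the
  representative as soon as \<open>\<beta>\<close> is bilinear.\<close>

definition tensor_lift ::
    "('v::complex_vector \<Rightarrow> 'w::complex_vector \<Rightarrow> 'u::complex_vector) \<Rightarrow> ('v, 'w) tensor \<Rightarrow> 'u"
  where "tensor_lift \<beta> t = free_extension \<beta> (rep_tensor t)"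

lemma free_extension_superset:
  assumes "finite S" "Poly_Mapping.keys p \<subseteq> S"
  shows "free_extension \<beta> p = (\<Sum>k\<in>S. Poly_Mapping.lookup p k *\<^sub>C \<beta> (fst k) (snd k))"
  unfolding free_extension_def
  by (rule sum.mono_neutral_left) (use assms in \<open>auto simp: in_keys_iff\<close>)

lemma clinear_free_extension: "clinear (free_extension \<beta>)"
proof (rule clinearI)
  fix p q :: "'a \<times> 'b \<Rightarrow>\<^sub>0 complex"
  let ?S = "Poly_Mapping.keys p \<union> Poly_Mapping.keys q"
  have "Poly_Mapping.keys (p + q) \<subseteq> ?S" by (rule keys_add)
  then show "free_extension \<beta> (p + q) = free_extension \<beta> p + free_extension \<beta> q"
    by (simp add: free_extension_superset[of ?S] lookup_add scaleC_add_left sum.distrib)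
next
  fix c and p :: "'a \<times> 'b \<Rightarrow>\<^sub>0 complex"
  have "Poly_Mapping.keys (c *\<^sub>C p) \<subseteq> Poly_Mapping.keys p"
    by (auto simp: in_keys_iff lookup_scaleC)
  then show "free_extension \<beta> (c *\<^sub>C p) = c *\<^sub>C free_extension \<beta> p"
    by (simp add: free_extension_superset[of "Poly_Mapping.keys p"] lookup_scaleC
        complex_vector.scale_sum_right scaleC_scaleC scaleC_complex_def)
qed

lemma free_extension_single: "free_extension \<beta> (Poly_Mapping.single (v, w) 1) = \<beta> v w"
  by (simp add: free_extension_def scaleC_one)

lemma clinear_diff: "clinear f \<Longrightarrow> f (x - y) = f x - f y"
  using module_hom.diff[of scaleC scaleC f] by (simp add: module_hom_iff_linear)

lemma clinear_zero: "clinear f \<Longrightarrow> f 0 = 0"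
  using module_hom.zero[of scaleC scaleC f] by (simp add: module_hom_iff_linear)

lemma free_extension_relators:
  assumes "cbilinear \<beta>" and "p \<in> cspan tensor_relators"
  shows "free_extension \<beta> p = 0"
  using assms(2)
proof (induction p rule: complex_vector.span_induct)
  show "complex_vector.subspace {p. free_extension \<beta> p = 0}"
    by (auto simp: complex_vector.subspace_def clinear_zero[OF clinear_free_extension]
        clinear_add[OF clinear_free_extension] clinear_scale[OF clinear_free_extension])
next
  fix p assume "p \<in> (tensor_relators :: ('a \<times> 'b \<Rightarrow>\<^sub>0 complex) set)"
  then show "free_extension \<beta> p = 0"
    using assms(1) unfolding tensor_relators_def cbilinear_def
    by (auto simp: clinear_diff[OF clinear_free_extension] clinear_scale[OF clinear_free_extension]
        free_extension_single clinear_add clinear_scale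
        clinear_add[where f = "\<lambda>x. \<beta> x _"] clinear_scale[where f = "\<lambda>x. \<beta> x _"])
qed

lemma tensor_lift_abs:
  assumes "cbilinear \<beta>"
  shows "tensor_lift \<beta> (abs_tensor p) = free_extension \<beta> p"
proof -
  have "tensor_eq (rep_tensor (abs_tensor p)) p"
    by (rule Quotient3_rep_abs[OF Quotient3_tensor])
       (simp add: tensor_eq_def complex_vector.span_zero)
  then have "free_extension \<beta> (rep_tensor (abs_tensor p) - p) = 0"
    unfolding tensor_eq_def by (rule free_extension_relators[OF assms])
  then show ?thesis
    by (simp add: tensor_lift_def clinear_diff[OF clinear_free_extension])
qed

lemma tensor_lift_tens: "cbilinear \<beta> \<Longrightarrow> tensor_lift \<beta> (v \<otimes>\<^sub>C w) = \<beta> v w"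
  by (simp add: tens.abs_eq tensor_lift_abs free_extension_single)

lemma clinear_tensor_lift:
  assumes "cbilinear \<beta>" shows "clinear (tensor_lift \<beta>)"
proof (rule clinearI)
  fix s t :: "('a, 'b) tensor" and c
  obtain p q where [simp]: "s = abs_tensor p" "t = abs_tensor q"
    by (metis Quotient3_abs_rep[OF Quotient3_tensor])
  show "tensor_lift \<beta> (s + t) = tensor_lift \<beta> s + tensor_lift \<beta> t"
    by (simp add: plus_tensor.abs_eq tensor_lift_abs assms clinear_add[OF clinear_free_extension])
  show "tensor_lift \<beta> (c *\<^sub>C s) = c *\<^sub>C tensor_lift \<beta> s"
    by (simp add: scaleC_tensor.abs_eq tensor_lift_abs assms clinear_scale[OF clinear_free_extension])
qed

definition generalized_cartan_matrix :: "int ^ 'n ^ 'n \<Rightarrow> bool"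
  where "generalized_cartan_matrix A \<longleftrightarrow>
    (\<forall>i. A $ i $ i = 2) \<and> (\<forall>i j. i \<noteq> j \<longrightarrow> A $ i $ j \<le> 0) \<and>
    (\<forall>i j. A $ i $ j = 0 \<longrightarrow> A $ j $ i = 0)"

definition complex_matrix :: "int ^ 'n ^ 'm \<Rightarrow> complex ^ 'n ^ 'm"
  where "complex_matrix A = (\<chi> i j. of_int (A $ i $ j))"

definition symmetrizable :: "int ^ 'n ^ 'n \<Rightarrow> bool"
  where "symmetrizable A \<longleftrightarrow>
    (\<exists>d B. (\<forall>i. d i \<noteq> 0) \<and> transpose B = B \<and>
      complex_matrix A = (\<chi> i j. if i = j then d i else 0) ** B)"

text \<open>A (minimal) realization of \<open>A\<close>. The Cartan subalgebra is the whole type \<open>'h\<close>, with simple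
  coroots \<open>\<alpha>v i\<close> and simple roots \<open>\<alpha> i\<close>; weights are functions on it, added pointwise.\<close>

definition realization ::
    "int ^ 'n ^ 'n \<Rightarrow> ('n \<Rightarrow> 'h::complex_vector) \<Rightarrow> ('n \<Rightarrow> 'h \<Rightarrow> complex) \<Rightarrow> bool"
  where "realization A \<alpha>v \<alpha> \<longleftrightarrow>
    (\<exists>B :: 'h set. finite B \<and> cspan B = UNIV) \<and>
    cdim (UNIV :: 'h set) + rank (complex_matrix A) = 2 * CARD('n) \<and>
    inj \<alpha>v \<and> cindependent (range \<alpha>v) \<and>
    (\<forall>j. clinear (\<alpha> j)) \<and> inj \<alpha> \<and> cindependent (range \<alpha>) \<and>
    (\<forall>i j. \<alpha> j (\<alpha>v i) = of_int (A $ i $ j))"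

definition lie_bracket :: "('g::complex_vector \<Rightarrow> 'g \<Rightarrow> 'g) \<Rightarrow> bool"
  where "lie_bracket br \<longleftrightarrow> cbilinear br \<and> (\<forall>x. br x x = 0) \<and>
    (\<forall>x y z. br x (br y z) + br y (br z x) + br z (br x y) = 0)"

text \<open>Formal Lie algebra expressions in the Kac--Moody generators.\<close>

datatype ('n, 'h) km_term =
    Cartan_T 'h | E_T 'n | F_T 'n
  | Zero_T
  | Add_T "('n, 'h) km_term" "('n, 'h) km_term"
  | Scale_T complex "('n, 'h) km_term"
  | Br_T "('n, 'h) km_term" "('n, 'h) km_term"

text \<open>The congruence on expressions generated by the Lie algebra axioms and the defining
  relations of the Kac--Moody algebra. Its classes form the complex Lie algebra presented by
  the Cartan subalgebra, \<open>e\<^sub>i\<close>, \<open>f\<^sub>i\<close> and these relations.\<close>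

inductive km_eq ::
    "int ^ 'n ^ 'n \<Rightarrow> ('n \<Rightarrow> 'h::complex_vector) \<Rightarrow> ('n \<Rightarrow> 'h \<Rightarrow> complex) \<Rightarrow>
      ('n, 'h) km_term \<Rightarrow> ('n, 'h) km_term \<Rightarrow> bool"
  for A \<alpha>v \<alpha>
  where
    refl: "km_eq A \<alpha>v \<alpha> s s"
  | sym: "km_eq A \<alpha>v \<alpha> s t \<Longrightarrow> km_eq A \<alpha>v \<alpha> t s"
  | trans: "km_eq A \<alpha>v \<alpha> s t \<Longrightarrow> km_eq A \<alpha>v \<alpha> t u \<Longrightarrow> km_eq A \<alpha>v \<alpha> s u"
  | cong_add: "km_eq A \<alpha>v \<alpha> s s' \<Longrightarrow> km_eq A \<alpha>v \<alpha> t t' \<Longrightarrow>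
      km_eq A \<alpha>v \<alpha> (Add_T s t) (Add_T s' t')"
  | cong_scale: "km_eq A \<alpha>v \<alpha> s s' \<Longrightarrow> km_eq A \<alpha>v \<alpha> (Scale_T c s) (Scale_T c s')"
  | cong_br: "km_eq A \<alpha>v \<alpha> s s' \<Longrightarrow> km_eq A \<alpha>v \<alpha> t t' \<Longrightarrow>
      km_eq A \<alpha>v \<alpha> (Br_T s t) (Br_T s' t')"
  | add_assoc: "km_eq A \<alpha>v \<alpha> (Add_T (Add_T s t) u) (Add_T s (Add_T t u))"
  | add_comm: "km_eq A \<alpha>v \<alpha> (Add_T s t) (Add_T t s)"
  | add_zero: "km_eq A \<alpha>v \<alpha> (Add_T Zero_T s) s"
  | add_inv: "km_eq A \<alpha>v \<alpha> (Add_T (Scale_T (- 1) s) s) Zero_T"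
  | scale_add_right:
      "km_eq A \<alpha>v \<alpha> (Scale_T c (Add_T s t)) (Add_T (Scale_T c s) (Scale_T c t))"
  | scale_add_left:
      "km_eq A \<alpha>v \<alpha> (Scale_T (c + d) s) (Add_T (Scale_T c s) (Scale_T d s))"
  | scale_scale: "km_eq A \<alpha>v \<alpha> (Scale_T c (Scale_T d s)) (Scale_T (c * d) s)"
  | scale_one: "km_eq A \<alpha>v \<alpha> (Scale_T 1 s) s"
  | br_add_left: "km_eq A \<alpha>v \<alpha> (Br_T (Add_T s t) u) (Add_T (Br_T s u) (Br_T t u))"
  | br_add_right: "km_eq A \<alpha>v \<alpha> (Br_T u (Add_T s t)) (Add_T (Br_T u s) (Br_T u t))"
  | br_scale_left: "km_eq A \<alpha>v \<alpha> (Br_T (Scale_T c s) t) (Scale_T c (Br_T s t))"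
  | br_scale_right: "km_eq A \<alpha>v \<alpha> (Br_T s (Scale_T c t)) (Scale_T c (Br_T s t))"
  | br_self: "km_eq A \<alpha>v \<alpha> (Br_T s s) Zero_T"
  | jacobi: "km_eq A \<alpha>v \<alpha>
      (Add_T (Br_T s (Br_T t u)) (Add_T (Br_T t (Br_T u s)) (Br_T u (Br_T s t)))) Zero_T"
  | cartan_add: "km_eq A \<alpha>v \<alpha> (Cartan_T (h + h')) (Add_T (Cartan_T h) (Cartan_T h'))"
  | cartan_scale: "km_eq A \<alpha>v \<alpha> (Cartan_T (c *\<^sub>C h)) (Scale_T c (Cartan_T h))"
  | cartan_comm: "km_eq A \<alpha>v \<alpha> (Br_T (Cartan_T h) (Cartan_T h')) Zero_T"
  | cartan_e: "km_eq A \<alpha>v \<alpha> (Br_T (Cartan_T h) (E_T i)) (Scale_T (\<alpha> i h) (E_T i))"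
  | cartan_f: "km_eq A \<alpha>v \<alpha> (Br_T (Cartan_T h) (F_T i)) (Scale_T (- \<alpha> i h) (F_T i))"
  | e_f_same: "km_eq A \<alpha>v \<alpha> (Br_T (E_T i) (F_T i)) (Cartan_T (\<alpha>v i))"
  | e_f_diff: "i \<noteq> j \<Longrightarrow> km_eq A \<alpha>v \<alpha> (Br_T (E_T i) (F_T j)) Zero_T"
  | serre_e: "i \<noteq> j \<Longrightarrow>
      km_eq A \<alpha>v \<alpha> ((Br_T (E_T i) ^^ nat (1 - A $ i $ j)) (E_T j)) Zero_T"
  | serre_f: "i \<noteq> j \<Longrightarrow>
      km_eq A \<alpha>v \<alpha> ((Br_T (F_T i) ^^ nat (1 - A $ i $ j)) (F_T j)) Zero_T"

primrec km_eval ::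
    "('g::complex_vector \<Rightarrow> 'g \<Rightarrow> 'g) \<Rightarrow> ('h \<Rightarrow> 'g) \<Rightarrow> ('n \<Rightarrow> 'g) \<Rightarrow> ('n \<Rightarrow> 'g) \<Rightarrow>
      ('n, 'h) km_term \<Rightarrow> 'g"
  where
    "km_eval br \<iota> e f (Cartan_T h) = \<iota> h"
  | "km_eval br \<iota> e f (E_T i) = e i"
  | "km_eval br \<iota> e f (F_T i) = f i"
  | "km_eval br \<iota> e f Zero_T = 0"
  | "km_eval br \<iota> e f (Add_T s t) = km_eval br \<iota> e f s + km_eval br \<iota> e f t"
  | "km_eval br \<iota> e f (Scale_T c s) = c *\<^sub>C km_eval br \<iota> e f s"
  | "km_eval br \<iota> e f (Br_T s t) = br (km_eval br \<iota> e f s) (km_eval br \<iota> e f t)"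

text \<open>The Lie algebra \<open>'g\<close> with bracket \<open>br\<close> is the Kac--Moody algebra of the given realization,
  \<open>\<iota>\<close> being the inclusion of the Cartan subalgebra and \<open>e\<close>, \<open>f\<close> the Chevalley generators:
  evaluation of expressions identifies \<open>'g\<close> with the presented Lie algebra.\<close>

definition kac_moody_algebra ::
    "int ^ 'n ^ 'n \<Rightarrow> ('n \<Rightarrow> 'h::complex_vector) \<Rightarrow> ('n \<Rightarrow> 'h \<Rightarrow> complex) \<Rightarrow>
      ('g::complex_vector \<Rightarrow> 'g \<Rightarrow> 'g) \<Rightarrow> ('h \<Rightarrow> 'g) \<Rightarrow> ('n \<Rightarrow> 'g) \<Rightarrow> ('n \<Rightarrow> 'g) \<Rightarrow> bool"
  where "kac_moody_algebra A \<alpha>v \<alpha> br \<iota> e f \<longleftrightarrow>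
    generalized_cartan_matrix A \<and> realization A \<alpha>v \<alpha> \<and> lie_bracket br \<and>
    surj (km_eval br \<iota> e f) \<and>
    (\<forall>s t. km_eval br \<iota> e f s = km_eval br \<iota> e f t \<longleftrightarrow> km_eq A \<alpha>v \<alpha> s t)"

definition integral_weights :: "('n \<Rightarrow> 'h::complex_vector) \<Rightarrow> ('h \<Rightarrow> complex) set"
  where "integral_weights \<alpha>v = {\<gamma>. clinear \<gamma> \<and> (\<forall>i. \<gamma> (\<alpha>v i) \<in> \<int>)}"

definition dominant_weights :: "('n \<Rightarrow> 'h::complex_vector) \<Rightarrow> ('h \<Rightarrow> complex) set"
  where "dominant_weights \<alpha>v =
    {\<gamma> \<in> integral_weights \<alpha>v. \<forall>i. 0 \<le> Re (\<gamma> (\<alpha>v i))}"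

definition simple_reflection ::
    "('n \<Rightarrow> 'h::complex_vector) \<Rightarrow> ('n \<Rightarrow> 'h \<Rightarrow> complex) \<Rightarrow> 'n \<Rightarrow> ('h \<Rightarrow> complex) \<Rightarrow> 'h \<Rightarrow> complex"
  where "simple_reflection \<alpha>v \<alpha> i \<gamma> = \<gamma> - \<gamma> (\<alpha>v i) *\<^sub>C \<alpha> i"

text \<open>The simple reflections are involutions, so closing under left multiplication by them
  yields the group they generate.\<close>

inductive_set weyl_group ::
    "('n \<Rightarrow> 'h::complex_vector) \<Rightarrow> ('n \<Rightarrow> 'h \<Rightarrow> complex) \<Rightarrow> (('h \<Rightarrow> complex) \<Rightarrow> 'h \<Rightarrow> complex) set"
  for \<alpha>v \<alpha>
  where
    one: "id \<in> weyl_group \<alpha>v \<alpha>"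
  | step: "\<sigma> \<in> weyl_group \<alpha>v \<alpha> \<Longrightarrow>
      simple_reflection \<alpha>v \<alpha> i \<circ> \<sigma> \<in> weyl_group \<alpha>v \<alpha>"

definition weight_ge ::
    "('n::finite \<Rightarrow> 'h \<Rightarrow> complex) \<Rightarrow> ('h \<Rightarrow> complex) \<Rightarrow> ('h \<Rightarrow> complex) \<Rightarrow> bool"
  where "weight_ge \<alpha> \<gamma> \<gamma>' \<longleftrightarrow>
    (\<exists>k :: 'n \<Rightarrow> nat. \<gamma> - \<gamma>' = (\<Sum>i\<in>UNIV. of_nat (k i) *\<^sub>C \<alpha> i))"

text \<open>Meaningful for \<open>\<gamma>\<close> in the Tits cone, where the dominant element of the orbit exists and
  is unique.\<close>

definition dominant_conjugate ::
    "('n \<Rightarrow> 'h::complex_vector) \<Rightarrow> ('n \<Rightarrow> 'h \<Rightarrow> complex) \<Rightarrow> ('h \<Rightarrow> complex) \<Rightarrow> 'h \<Rightarrow> complex"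
  where "dominant_conjugate \<alpha>v \<alpha> \<gamma> =
    (THE \<nu>. \<nu> \<in> dominant_weights \<alpha>v \<and> (\<exists>\<sigma>\<in>weyl_group \<alpha>v \<alpha>. \<nu> = \<sigma> \<gamma>))"

definition lie_module ::
    "('g::complex_vector \<Rightarrow> 'g \<Rightarrow> 'g) \<Rightarrow> ('g \<Rightarrow> 'v::complex_vector \<Rightarrow> 'v) \<Rightarrow> bool"
  where "lie_module br act \<longleftrightarrow> cbilinear act \<and>
    (\<forall>x y v. act (br x y) v = act x (act y v) - act y (act x v))"

definition submodule :: "('g \<Rightarrow> 'v::complex_vector \<Rightarrow> 'v) \<Rightarrow> 'v set \<Rightarrow> bool"
  where "submodule act N \<longleftrightarrow> csubspace N \<and> (\<forall>x. \<forall>v\<in>N. act x v \<in> N)"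

definition irreducible_module :: "('g \<Rightarrow> 'v::complex_vector \<Rightarrow> 'v) \<Rightarrow> bool"
  where "irreducible_module act \<longleftrightarrow> (UNIV :: 'v set) \<noteq> {0} \<and>
    (\<forall>N. submodule act N \<longrightarrow> N = {0} \<or> N = UNIV)"

text \<open>\<open>U(g) v\<close>: the enveloping algebra is spanned by the monomials \<open>x\<^sub>1 \<dots> x\<^sub>k\<close> with
  \<open>x\<^sub>1, \<dots>, x\<^sub>k\<close> in the Lie algebra.\<close>

definition Ug_span :: "('g \<Rightarrow> 'v::complex_vector \<Rightarrow> 'v) \<Rightarrow> 'v \<Rightarrow> 'v set"
  where "Ug_span act v = cspan {foldr act xs v | xs. True}"

definition weight_space ::
    "('h \<Rightarrow> 'g) \<Rightarrow> ('g \<Rightarrow> 'v::complex_vector \<Rightarrow> 'v) \<Rightarrow> ('h \<Rightarrow> complex) \<Rightarrow> 'v set"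
  where "weight_space \<iota> act \<gamma> = {v. \<forall>h. act (\<iota> h) v = \<gamma> h *\<^sub>C v}"

definition integrable_module ::
    "('h \<Rightarrow> 'g) \<Rightarrow> ('n \<Rightarrow> 'g) \<Rightarrow> ('n \<Rightarrow> 'g) \<Rightarrow> ('g \<Rightarrow> 'v::complex_vector \<Rightarrow> 'v) \<Rightarrow> bool"
  where "integrable_module \<iota> e f act \<longleftrightarrow>
    cspan (\<Union>\<gamma>. weight_space \<iota> act \<gamma>) = UNIV \<and>
    (\<forall>i v. \<exists>k. (act (e i) ^^ k) v = 0) \<and> (\<forall>i v. \<exists>k. (act (f i) ^^ k) v = 0)"

definition highest_weight_module ::
    "('h \<Rightarrow> 'g) \<Rightarrow> ('n \<Rightarrow> 'g) \<Rightarrow> ('g \<Rightarrow> 'v::complex_vector \<Rightarrow> 'v) \<Rightarrow> ('h \<Rightarrow> complex) \<Rightarrow> bool"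
  where "highest_weight_module \<iota> e act \<gamma> \<longleftrightarrow>
    (\<exists>v. v \<noteq> 0 \<and> v \<in> weight_space \<iota> act \<gamma> \<and> (\<forall>i. act (e i) v = 0) \<and> Ug_span act v = UNIV)"

text \<open>The module \<open>'v\<close> is a copy of \<open>V(\<gamma>)\<close>, which is determined up to isomorphism.\<close>

definition is_V ::
    "('g::complex_vector \<Rightarrow> 'g \<Rightarrow> 'g) \<Rightarrow> ('h \<Rightarrow> 'g) \<Rightarrow> ('n \<Rightarrow> 'g) \<Rightarrow> ('n \<Rightarrow> 'g) \<Rightarrow>
      ('g \<Rightarrow> 'v::complex_vector \<Rightarrow> 'v) \<Rightarrow> ('h \<Rightarrow> complex) \<Rightarrow> bool"
  where "is_V br \<iota> e f act \<gamma> \<longleftrightarrow>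
    lie_module br act \<and> irreducible_module act \<and> integrable_module \<iota> e f act \<and>
    highest_weight_module \<iota> e act \<gamma>"

definition tensor_action ::
    "('g \<Rightarrow> 'v::complex_vector \<Rightarrow> 'v) \<Rightarrow> ('g \<Rightarrow> 'w::complex_vector \<Rightarrow> 'w) \<Rightarrow>
      'g \<Rightarrow> ('v, 'w) tensor \<Rightarrow> ('v, 'w) tensor"
  where "tensor_action act act' x = tensor_lift (\<lambda>v w. act x v \<otimes>\<^sub>C w + v \<otimes>\<^sub>C act' x w)"

lemma cbilinear_tens: "cbilinear (\<otimes>\<^sub>C)"
proof -
  note base = complex_vector.span_base[of _ tensor_relators]
  have "(v + v') \<otimes>\<^sub>C w = v \<otimes>\<^sub>C w + v' \<otimes>\<^sub>C w" for v v' :: 'a and w :: 'b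
    by transfer (unfold tensor_eq_def diff_diff_eq[symmetric], rule base,
        unfold tensor_relators_def, blast)
  moreover have "v \<otimes>\<^sub>C (w + w') = v \<otimes>\<^sub>C w + v \<otimes>\<^sub>C w'" for v :: 'a and w w' :: 'b
    by transfer (unfold tensor_eq_def diff_diff_eq[symmetric], rule base,
        unfold tensor_relators_def, blast)
  moreover have "(c *\<^sub>C v) \<otimes>\<^sub>C w = c *\<^sub>C (v \<otimes>\<^sub>C w)" for c and v :: 'a and w :: 'b
    by transfer (unfold tensor_eq_def, rule base, unfold tensor_relators_def, blast)
  moreover have "v \<otimes>\<^sub>C (c *\<^sub>C w) = c *\<^sub>C (v \<otimes>\<^sub>C w)" for c and v :: 'a and w :: 'b
    by transfer (unfold tensor_eq_def, rule base, unfold tensor_relators_def, blast)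
  ultimately show ?thesis
    unfolding cbilinear_def by (auto intro!: clinearI)
qed

lemma tensor_action_tens:
  assumes "lie_module br act" and "lie_module br act'"
  shows "tensor_action act act' x (v \<otimes>\<^sub>C w) = act x v \<otimes>\<^sub>C w + v \<otimes>\<^sub>C act' x w"
    and "clinear (tensor_action act act' x)"
proof -
  have lin: "clinear (act x)" "clinear (act' x)"
    using assms by (auto simp: lie_module_def cbilinear_def)
  have tens: "clinear (\<lambda>v. v \<otimes>\<^sub>C w)" "clinear (\<lambda>w. v \<otimes>\<^sub>C w)" for v :: 'b and w :: 'c
    using cbilinear_tens by (auto simp: cbilinear_def)
  have "cbilinear (\<lambda>v w. act x v \<otimes>\<^sub>C w + v \<otimes>\<^sub>C act' x w)"
    unfolding cbilinear_def
    by (auto intro!: clinearI simp: clinear_add[OF lin(1)] clinear_add[OF lin(2)]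
        clinear_scale[OF lin(1)] clinear_scale[OF lin(2)] clinear_add[OF tens(1)]
        clinear_add[OF tens(2)] clinear_scale[OF tens(1)] clinear_scale[OF tens(2)]
        scaleC_add_right)
  then show "tensor_action act act' x (v \<otimes>\<^sub>C w) = act x v \<otimes>\<^sub>C w + v \<otimes>\<^sub>C act' x w"
    and "clinear (tensor_action act act' x)"
    unfolding tensor_action_def by (simp_all add: tensor_lift_tens clinear_tensor_lift)
qed

text \<open>With \<open>v\<close> a nonzero vector of weight \<open>\<lambda>\<close> in \<open>V(\<lambda>)\<close> and \<open>v'\<close> one of weight \<open>w\<mu>\<close> in
  \<open>V(\<mu>)\<close>, this is the Kostant--Kumar module \<open>K(\<lambda>,w,\<mu>)\<close>.\<close>

definition kostant_kumar ::
    "('g \<Rightarrow> 'v::complex_vector \<Rightarrow> 'v) \<Rightarrow> ('g \<Rightarrow> 'w::complex_vector \<Rightarrow> 'w) \<Rightarrow>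
      'v \<Rightarrow> 'w \<Rightarrow> ('v, 'w) tensor set"
  where "kostant_kumar act act' v v' = Ug_span (tensor_action act act') (v \<otimes>\<^sub>C v')"

text \<open>For submodules \<open>M\<close> and \<open>M'\<close> of the modules given by the two actions: there is a
  \<open>U(g)\<close>-linear surjection from \<open>M\<close> onto \<open>M'\<close>. The values of \<open>\<phi>\<close> outside \<open>M\<close> are irrelevant.\<close>

definition schur_positive ::
    "('g \<Rightarrow> 'v::complex_vector \<Rightarrow> 'v) \<Rightarrow> 'v set \<Rightarrow>
      ('g \<Rightarrow> 'w::complex_vector \<Rightarrow> 'w) \<Rightarrow> 'w set \<Rightarrow> bool"
  where "schur_positive act M act' M' \<longleftrightarrow>
    (\<exists>\<phi>. (\<forall>u\<in>M. \<forall>v\<in>M. \<phi> (u + v) = \<phi> u + \<phi> v) \<and> (\<forall>c. \<forall>v\<in>M. \<phi> (c *\<^sub>C v) = c *\<^sub>C \<phi> v) \<and>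
      (\<forall>x. \<forall>v\<in>M. \<phi> (act x v) = act' x (\<phi> v)) \<and> \<phi> ` M = M')"

end

theory Submission
  imports Defs
begin

text \<open>Every \<open>V(\<kappa>)\<close> is the free algebra on the \<open>f\<^sub>i\<close> modulo \<open>Jk \<kappa>\<close>, the sum of the two-sided ideal
  of the Serre relations and the left ideal generated by the powers \<open>f\<^sub>i\<^bsup>\<kappa> i + 1\<^esup>\<close> (Gabber--Kac, through the Casimir element), and homomorphisms
  \<open>V(\<kappa>) \<otimes> V(m) \<rightarrow> V(\<nu>)\<close> correspond to linear functionals on this algebra.

  The inequalities follow from a refined theorem of Parthasarathy, Ranga Rao and Varadarajan: for
  the dominant conjugate \<open>\<nu>\<close> of \<open>\<lambda> + w \<mu>\<close> there is a homomorphism \<open>V(\<lambda>) \<otimes> V(\<mu>) \<rightarrow> V(\<nu>)\<close> that does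
  not vanish on \<open>v\<^sub>\<lambda> \<otimes> v\<^bsub>w\<mu>\<^esub>\<close>. Its proof is by induction on \<open>\<mu> - w \<mu>\<close>. Splitting \<open>\<mu>\<close> at the first wall met by
  the path from \<open>\<lambda>\<close> in direction \<open>w \<mu>\<close> gives the claim for \<open>M \<lambda>\<close>, \<open>M \<mu>\<close> with \<open>M\<close> in the multiples of some
  level, and composing with the easy case of a dominant \<open>\<lambda> + w \<mu>\<close> gives two consecutive levels, hence all
  large levels, in particular a large prime \<open>p\<close>. At level \<open>p\<close> the functional can be taken integral on
  divided powers; restricted to the divided powers \<open>f\<^sub>i\<^sup>p/p!\<close> it satisfies the relations of level 1 modulo
  \<open>p\<close>, and since these are rational linear conditions a complex solution of level 1 follows.

  Applied to \<open>(\<lambda>\<^sub>2, w\<^sub>2, \<mu>\<^sub>2)\<close>, the composite of this homomorphism with the surjection between the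
  Kostant--Kumar modules is nonzero on the generator of the first one, so \<open>\<lambda>\<^sub>1 + w\<^sub>1 \<mu>\<^sub>1\<close> is a weight of
  \<open>V(\<nu>)\<close>, and so is its dominant conjugate.\<close>

section \<open>Linear maps and the free algebra\<close>

text \<open>The path from \<lambda> towards \<lambda> + w \<mu> meets a wall at a rational point,
  and the denominator can be cleared only by scaling \<lambda> and \<mu>; this is why the induction
  yields multiples of the weights and a descent to level 1 is needed. The descent works because
  integral functionals multiply along the coproduct, and at extremal words exactly one term of the
  product survives. Fixed nonzero integers v1, v2 at levels B and B + 1 thus give the value v1^a
  v2^b at level p = a B + b (B + 1), and a large prime p does not divide it although the level grows
  with p. If level 1 had no solution, a fixed multiple of the extremal word would be an integral
  combination of the relations, which such a p contradicts. Words in the free algebra replace a PBW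
  basis: the operators on words are explicit, and the radical of the contravariant form shows that
  the relations suffice. Nonvanishing on a pair of extremal vectors depends only on the simultaneous
  Weyl orbit of the pair, which allows passing to a pair with dominant sum.\<close>

lemma clinear_compose: "clinear f \<Longrightarrow> clinear g \<Longrightarrow> clinear (\<lambda>x. f (g x))"
  by (rule clinearI) (simp_all add: clinear_add clinear_scale)

lemma clinear_plus: "clinear f \<Longrightarrow> clinear g \<Longrightarrow> clinear (\<lambda>x. f x + g x)"
  by (rule clinearI) (simp_all add: clinear_add clinear_scale scaleC_add_right)

lemma clinear_minus: "clinear f \<Longrightarrow> clinear g \<Longrightarrow> clinear (\<lambda>x. f x - g x)"
  by (rule clinearI) (simp_all add: clinear_add clinear_scale complex_vector.scale_right_diff_distrib)

lemma clinear_smult: "clinear f \<Longrightarrow> clinear (\<lambda>x. c *\<^sub>C f x)"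
  by (rule clinearI) (simp_all add: clinear_add clinear_scale scaleC_add_right scaleC_scaleC mult.commute)

lemma clinear_zero_map: "clinear (\<lambda>x. 0)"
  by (rule clinearI) simp_all

lemma clinear_id: "clinear (\<lambda>x. x)"
  by (rule clinearI) simp_all

lemma clinear_neg_map: "clinear f \<Longrightarrow> clinear (\<lambda>x. - f x)"
  using clinear_minus[OF clinear_zero_map] by simp

lemma clinear_sum_map: "(\<And>i. i \<in> I \<Longrightarrow> clinear (f i)) \<Longrightarrow> clinear (\<lambda>x. \<Sum>i\<in>I. f i x)"
  by (induction I rule: infinite_finite_induct) (simp_all add: clinear_zero_map clinear_plus)

lemma clinear_sum: "clinear f \<Longrightarrow> f (sum g I) = (\<Sum>i\<in>I. f (g i))"
  by (induction I rule: infinite_finite_induct) (simp_all add: clinear_zero clinear_add)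

lemma clinear_neg: "clinear f \<Longrightarrow> f (- x) = - f x"
  using clinear_diff[of f 0 x] by (simp add: clinear_zero)

lemma clinear_pow:
  fixes f :: "'a::complex_vector \<Rightarrow> 'a"
  shows "clinear f \<Longrightarrow> clinear (f ^^ n)"
proof (induction n)
  case (Suc n)
  then show ?case using clinear_compose[of f "f ^^ n"] by (simp add: o_def)
qed (simp add: clinear_id id_def)

lemma scaleC_zero [simp]: "c *\<^sub>C (0::'a::complex_vector) = 0" "0 *\<^sub>C (x::'a) = 0"
  by (simp_all add: complex_vector.scale_zero_right complex_vector.scale_zero_left)

lemma scaleC_one' [simp]: "1 *\<^sub>C (x::'a::complex_vector) = x"
  by (rule scaleC_one)

lemma scaleC_eq_0 [simp]: "c *\<^sub>C (x::'a::complex_vector) = 0 \<longleftrightarrow> c = 0 \<or> x = 0"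
  by (rule complex_vector.scale_eq_0_iff)

lemma scaleC_fun_apply [simp]: "(c *\<^sub>C f) x = c *\<^sub>C f x"
  by (simp add: scaleC_fun_def)

lemma scaleC_cmul: "(c::complex) *\<^sub>C d = c * d"
  by (simp add: scaleC_complex_def)

lemmas subspace_intros = complex_vector.subspace_add complex_vector.subspace_diff
  complex_vector.subspace_scale complex_vector.subspace_0 complex_vector.subspace_neg
  complex_vector.subspace_sum

lemma clinear_vimage_subspace: "clinear f \<Longrightarrow> csubspace S \<Longrightarrow> csubspace {x. f x \<in> S}"
  by (auto simp: complex_vector.subspace_def clinear_zero clinear_add clinear_scale)

lemma clinear_ker_subspace: "clinear f \<Longrightarrow> csubspace {x. f x = 0}"
  by (auto simp: complex_vector.subspace_def clinear_zero clinear_add clinear_scale)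

lemma span_image_sub:
  assumes "clinear f" "csubspace S" "\<And>x. x \<in> B \<Longrightarrow> f x \<in> S" "x \<in> cspan B"
  shows "f x \<in> S"
  using complex_vector.span_minimal[OF _ clinear_vimage_subspace[OF assms(1,2)]] assms(3,4) by blast

lemma span_eqI:
  assumes "clinear f" "clinear g" "\<And>x. x \<in> B \<Longrightarrow> f x = g x" "x \<in> cspan B"
  shows "f x = g x"
  using span_image_sub[OF clinear_minus[OF assms(1,2)] complex_vector.subspace_single_0 _ assms(4)]
    assms(3) by auto

definition ext :: "('a \<Rightarrow> 'v::complex_vector) \<Rightarrow> ('a \<Rightarrow>\<^sub>0 complex) \<Rightarrow> 'v"
  where "ext g X = (\<Sum>u\<in>Poly_Mapping.keys X. Poly_Mapping.lookup X u *\<^sub>C g u)"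

lemma ext_superset:
  "finite S \<Longrightarrow> Poly_Mapping.keys X \<subseteq> S \<Longrightarrow> ext g X = (\<Sum>u\<in>S. Poly_Mapping.lookup X u *\<^sub>C g u)"
  unfolding ext_def by (rule sum.mono_neutral_left) (auto simp: in_keys_iff)

lemma clinear_ext: "clinear (ext g)"
proof (rule clinearI)
  fix X Y :: "'a \<Rightarrow>\<^sub>0 complex"
  let ?S = "Poly_Mapping.keys X \<union> Poly_Mapping.keys Y"
  have "Poly_Mapping.keys (X + Y) \<subseteq> ?S" by (rule keys_add)
  then show "ext g (X + Y) = ext g X + ext g Y"
    by (simp add: ext_superset[of ?S] lookup_add scaleC_add_left sum.distrib)
next
  fix c and X :: "'a \<Rightarrow>\<^sub>0 complex"
  have "Poly_Mapping.keys (c *\<^sub>C X) \<subseteq> Poly_Mapping.keys X"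
    by (auto simp: in_keys_iff lookup_scaleC)
  then show "ext g (c *\<^sub>C X) = c *\<^sub>C ext g X"
    by (simp add: ext_superset[of "Poly_Mapping.keys X"] lookup_scaleC
        complex_vector.scale_sum_right scaleC_scaleC scaleC_cmul)
qed

lemma ext_single [simp]: "ext g (Poly_Mapping.single u c) = c *\<^sub>C g u"
  by (cases "c = 0") (simp_all add: ext_def)

lemma ext_id: "ext (\<lambda>u. Poly_Mapping.single u (1::complex)) X = X"
proof (rule poly_mapping_eqI)
  fix k
  have "Poly_Mapping.lookup (ext (\<lambda>u. Poly_Mapping.single u (1::complex)) X) k
     = (\<Sum>u\<in>Poly_Mapping.keys X. Poly_Mapping.lookup X u * (if u = k then 1 else 0))"
    unfolding ext_def by (simp add: lookup_sum lookup_scaleC lookup_single when_def scaleC_cmul)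
  also have "\<dots> = Poly_Mapping.lookup X k"
    by (simp add: sum.delta' if_distrib[of "\<lambda>x. _ * x"] in_keys_iff cong: if_cong)
  finally show "Poly_Mapping.lookup (ext (\<lambda>u. Poly_Mapping.single u (1::complex)) X) k = Poly_Mapping.lookup X k" .
qed

lemma span_single: "(X :: 'a \<Rightarrow>\<^sub>0 complex) \<in> cspan {Poly_Mapping.single u (1::complex) | u. u \<in> Poly_Mapping.keys X}"
proof -
  have "ext (\<lambda>u. Poly_Mapping.single u (1::complex)) X \<in> cspan {Poly_Mapping.single u (1::complex) | u. u \<in> Poly_Mapping.keys X}"
    unfolding ext_def
    by (intro complex_vector.span_sum complex_vector.span_scale complex_vector.span_base) auto
  then show ?thesis by (simp add: ext_id)
qed

lemma span_single_UNIV: "(X :: 'a \<Rightarrow>\<^sub>0 complex) \<in> cspan (range (\<lambda>u. Poly_Mapping.single u (1::complex)))"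
  by (rule set_mp[OF complex_vector.span_mono span_single]) auto

lemma clinear_eq_singleI:
  assumes "clinear f" "clinear g" "\<And>u. f (Poly_Mapping.single u (1::complex)) = g (Poly_Mapping.single u (1::complex))"
  shows "f X = g X"
  by (rule span_eqI[OF assms(1,2) _ span_single_UNIV]) (use assms(3) in auto)

lemma clinear_sub_singleI:
  assumes "clinear f" "csubspace S" "\<And>u. f (Poly_Mapping.single u (1::complex)) \<in> S"
  shows "f X \<in> S"
  by (rule span_image_sub[OF assms(1,2) _ span_single_UNIV]) (use assms(3) in auto)

lemma clinear_ext_eq: "clinear h \<Longrightarrow> h X = ext (\<lambda>u. h (Poly_Mapping.single u (1::complex))) X"
  by (rule clinear_eq_singleI) (simp_all add: clinear_ext)

text \<open>With concatenation as addition of exponents, the convolution product of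
  \<open>poly_mapping\<close> becomes the product of the free associative algebra on the
  letters.\<close>

instantiation list :: (type) monoid_add
begin
definition zero_list :: "'a list" where "zero_list = []"
definition plus_list :: "'a list \<Rightarrow> 'a list \<Rightarrow> 'a list" where "plus_list u v = u @ v"
instance by standard (simp_all add: zero_list_def plus_list_def)
end

type_synonym 'n falg = "'n list \<Rightarrow>\<^sub>0 complex"

abbreviation wd :: "'n list \<Rightarrow> 'n falg" where "wd u \<equiv> Poly_Mapping.single u 1"

lemma wd_Nil: "wd [] = 1"
  by (metis single_one zero_list_def)

lemma wd_mult: "wd u * wd v = wd (u @ v)"
  by (simp add: mult_single plus_list_def)

lemma wd_Cons: "wd (i # u) = wd [i] * wd u"
  by (simp add: wd_mult)

lemma scaleC_single: "c *\<^sub>C Poly_Mapping.single u d = Poly_Mapping.single u (c * d)"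
  by (rule poly_mapping_eqI) (simp add: lookup_scaleC lookup_single when_def scaleC_cmul)

lemma scaleC_falg: "c *\<^sub>C (X :: 'n falg) = Poly_Mapping.single [] c * X"
proof -
  have "scaleC c = ((*) c :: complex \<Rightarrow> complex)"
    by (simp add: fun_eq_iff scaleC_cmul)
  then show ?thesis
    using mult_map_scale_conv_mult[of c X] by (simp add: scaleC_poly_mapping_def zero_list_def)
qed

lemma single_Nil_commute: "(X :: 'n falg) * Poly_Mapping.single [] c = Poly_Mapping.single [] c * X"
proof -
  have X: "X = (\<Sum>u\<in>Poly_Mapping.keys X. Poly_Mapping.single u (Poly_Mapping.lookup X u))"
    using ext_id[of X] by (simp add: ext_def scaleC_single)
  show ?thesis
    by (subst (1 2) X) (simp add: sum_distrib_left sum_distrib_right mult_single plus_list_def mult.commute)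
qed

lemma falg_scale_left: "(c *\<^sub>C X) * Y = c *\<^sub>C ((X :: 'n falg) * Y)"
  by (simp add: scaleC_falg mult.assoc)

lemma falg_scale_right: "X * (c *\<^sub>C Y) = c *\<^sub>C ((X :: 'n falg) * Y)"
  by (metis scaleC_falg mult.assoc single_Nil_commute)

lemma clinear_mult_left: "clinear f \<Longrightarrow> clinear (\<lambda>x. (X :: 'n falg) * f x)"
  by (rule clinearI) (simp_all add: clinear_add clinear_scale distrib_left falg_scale_right)

lemma clinear_mult_right: "clinear f \<Longrightarrow> clinear (\<lambda>x. f x * (X :: 'n falg))"
  by (rule clinearI) (simp_all add: clinear_add clinear_scale distrib_right falg_scale_left)

lemmas clinear_intros = clinear_ext clinear_plus clinear_minus clinear_smult clinear_zero_map clinear_id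
  clinear_neg_map clinear_mult_left clinear_mult_right

lemma wd_pow: "((\<lambda>X. wd [j] * X) ^^ n) X = wd (replicate n j) * X"
  by (induction n) (simp_all add: wd_Nil mult.assoc[symmetric] wd_mult)

text \<open>Iteration is harmless because \<open>G\<close> preserves \<open>M\<close>, so errors in
  \<open>M\<close> stay there. The general \<open>B\<close> covers products of words, tensors and
  the homomorphisms of \<open>tri\<close>, which are equivariant only modulo the maximal
  submodule.\<close>

lemma leibniz_mod:
  fixes G :: "'v::complex_vector \<Rightarrow> 'v"
  assumes G: "clinear G" and M: "csubspace M" "\<And>v. v \<in> M \<Longrightarrow> G v \<in> M"
    and step: "\<And>x y. G (B x y) - (B (a x) y + B x (b y)) \<in> M"
  shows "(G ^^ n) (B x y) - (\<Sum>k\<le>n. of_nat (n choose k) *\<^sub>C B ((a ^^ k) x) ((b ^^ (n - k)) y)) \<in> M"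
proof (induction n)
  case 0
  then show ?case by (simp add: complex_vector.subspace_0[OF M(1)])
next
  case (Suc n)
  let ?t = "\<lambda>k l. B ((a ^^ k) x) ((b ^^ l) y)"
  have "(\<Sum>k\<le>n. of_nat (n choose k) *\<^sub>C (?t (Suc k) (n - k) + ?t k (Suc (n - k))))
      = (\<Sum>k\<le>n. of_nat (n choose k) *\<^sub>C ?t (Suc k) (n - k)) + (\<Sum>k\<le>n. of_nat (n choose k) *\<^sub>C ?t k (Suc n - k))"
    by (simp add: scaleC_add_right sum.distrib Suc_diff_le)
  also have "(\<Sum>k\<le>n. of_nat (n choose k) *\<^sub>C ?t k (Suc n - k)) = (\<Sum>k\<le>Suc n. of_nat (n choose k) *\<^sub>C ?t k (Suc n - k))"
    by (simp add: binomial_eq_0)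
  also have "\<dots> = ?t 0 (Suc n) + (\<Sum>k\<le>n. of_nat (n choose Suc k) *\<^sub>C ?t (Suc k) (n - k))"
    by (subst sum.atMost_Suc_shift) simp
  also have "(\<Sum>k\<le>n. of_nat (n choose k) *\<^sub>C ?t (Suc k) (n - k)) + (?t 0 (Suc n) + (\<Sum>k\<le>n. of_nat (n choose Suc k) *\<^sub>C ?t (Suc k) (n - k)))
     = ?t 0 (Suc n) + (\<Sum>k\<le>n. of_nat (Suc n choose Suc k) *\<^sub>C ?t (Suc k) (n - k))"
    by (simp add: scaleC_add_left sum.distrib algebra_simps)
  also have "\<dots> = (\<Sum>k\<le>Suc n. of_nat (Suc n choose k) *\<^sub>C ?t k (Suc n - k))"
    by (simp only: sum.atMost_Suc_shift) simp
  finally have sum: "(\<Sum>k\<le>n. of_nat (n choose k) *\<^sub>C (?t (Suc k) (n - k) + ?t k (Suc (n - k)))) = \<dots>" .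
  have "(\<Sum>k\<le>n. of_nat (n choose k) *\<^sub>C (G (?t k (n - k)) - (?t (Suc k) (n - k) + ?t k (Suc (n - k))))) \<in> M"
  proof (intro complex_vector.subspace_sum[OF M(1)] complex_vector.subspace_scale[OF M(1)])
    show "G (?t k (n - k)) - (?t (Suc k) (n - k) + ?t k (Suc (n - k))) \<in> M" for k
      using step[of "(a ^^ k) x" "(b ^^ (n - k)) y"] by simp
  qed
  from complex_vector.subspace_add[OF M(1) M(2)[OF Suc] this]
  show ?case
    unfolding sum[symmetric]
    by (simp add: clinear_diff[OF G] clinear_sum[OF G] clinear_scale[OF G] complex_vector.scale_right_diff_distrib sum_subtractf)
qed

lemma leibniz:
  fixes G :: "'v::complex_vector \<Rightarrow> 'v"
  assumes "clinear G" and "\<And>x y. G (B x y) = B (a x) y + B x (b y)"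
  shows "(G ^^ n) (B x y) = (\<Sum>k\<le>n. of_nat (n choose k) *\<^sub>C B ((a ^^ k) x) ((b ^^ (n - k)) y))"
  using leibniz_mod[OF assms(1) complex_vector.subspace_single_0, of B a b n x y]
  by (simp add: assms clinear_zero)

text \<open>Used with local nilpotency: some power lies in the submodule, and sl_2 arithmetic
  removes one factor at a time.\<close>

lemma descend: "(\<And>n. P (Suc n) \<Longrightarrow> P n) \<Longrightarrow> P N \<Longrightarrow> P 0" for P :: "nat \<Rightarrow> bool"
  by (induction N) auto

lemma clinear_comps:
  assumes "clinear f"
  shows "clinear g \<Longrightarrow> clinear (\<lambda>x. f (g x))"
  using clinear_compose[OF assms] .

section \<open>Verma modules\<close>

text \<open>\<open>d i\<close> is half the squared length of \<alpha>_i, so (\<alpha>_i, \<alpha>_j)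
  = \<open>d i * A $ i $ j\<close> is the symmetric form on the root lattice. Positivity of
  \<open>d\<close> gives the Casimir eigenvalues below a sign.\<close>

locale km =
  fixes A :: "int ^ 'n ^ 'n" and d :: "'n \<Rightarrow> real"
  assumes diag [simp]: "A $ i $ i = 2"
    and off: "i \<noteq> j \<Longrightarrow> A $ i $ j \<le> 0"
    and zero_sym: "A $ i $ j = 0 \<Longrightarrow> A $ j $ i = 0"
    and d_pos: "d i > 0"
    and d_sym: "d i * of_int (A $ i $ j) = d j * of_int (A $ j $ i)"
begin

text \<open>The pairing of the i-th simple coroot with the sum of the simple roots in
  \<open>c\<close>: in highest weight \<kappa>, vectors of degree \<open>c\<close> have weight
  \<open>\<kappa> i - pm i c\<close> under that coroot.\<close>

definition pm :: "'n \<Rightarrow> 'n multiset \<Rightarrow> int"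
  where "pm i c = (\<Sum>j\<in>#c. A $ i $ j)"

lemma pm_simps [simp]: "pm i {#} = 0" "pm i (add_mset j c) = A $ i $ j + pm i c"
  "pm i (c + c') = pm i c + pm i c'"
  by (simp_all add: pm_def)

text \<open>The free algebra models the Verma module of highest weight \<open>\<kappa>\<close> (before imposing the Serre
  relations): \<open>f\<^sub>i\<close> acts as multiplication by \<open>wd [i]\<close>, \<open>e\<^sub>i\<close> as \<open>EE \<kappa> i\<close> and the coroots as \<open>Hp \<kappa> i\<close>;
  \<open>Fc c\<close> is the space of weight \<open>\<kappa> - \<Sum>c\<close>.\<close>

primrec Ew :: "('n \<Rightarrow> int) \<Rightarrow> 'n \<Rightarrow> 'n list \<Rightarrow> 'n falg" where
  "Ew \<kappa> i [] = 0"
| "Ew \<kappa> i (j # u) = wd [j] * Ew \<kappa> i u + (if i = j then of_int (\<kappa> i - pm i (mset u)) *\<^sub>C wd u else 0)"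

definition EE :: "('n \<Rightarrow> int) \<Rightarrow> 'n \<Rightarrow> 'n falg \<Rightarrow> 'n falg" where "EE \<kappa> i = ext (Ew \<kappa> i)"

definition Hp :: "('n \<Rightarrow> int) \<Rightarrow> 'n \<Rightarrow> 'n falg \<Rightarrow> 'n falg"
  where "Hp \<kappa> i = ext (\<lambda>u. of_int (\<kappa> i - pm i (mset u)) *\<^sub>C wd u)"

lemma lin_EE: "clinear (EE \<kappa> i)" and lin_Hp: "clinear (Hp \<kappa> i)"
  by (simp_all add: EE_def Hp_def clinear_ext)

lemmas EE_simps = clinear_add[OF lin_EE] clinear_diff[OF lin_EE] clinear_scale[OF lin_EE] clinear_zero[OF lin_EE]
lemmas Hp_simps = clinear_add[OF lin_Hp] clinear_diff[OF lin_Hp] clinear_scale[OF lin_Hp] clinear_zero[OF lin_Hp]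

lemma EE_wd: "EE \<kappa> i (wd u) = Ew \<kappa> i u" and Hp_wd: "Hp \<kappa> i (wd u) = of_int (\<kappa> i - pm i (mset u)) *\<^sub>C wd u"
  by (simp_all add: EE_def Hp_def)

lemma EE_one [simp]: "EE \<kappa> i 1 = 0"
  using EE_wd[of \<kappa> i "[]"] by (simp add: wd_Nil)

lemma EE_f: "EE \<kappa> i (wd [j] * X) = wd [j] * EE \<kappa> i X + (if i = j then Hp \<kappa> i X else 0)"
proof (rule clinear_eq_singleI[where X = X])
  show "clinear (\<lambda>X. EE \<kappa> i (wd [j] * X))"
    by (intro clinear_comps[OF lin_EE] clinear_intros)
  show "clinear (\<lambda>X. wd [j] * EE \<kappa> i X + (if i = j then Hp \<kappa> i X else 0))"
    by (cases "i = j") (auto intro!: clinear_intros clinear_plus clinear_mult_left lin_EE lin_Hp)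
qed (simp add: wd_mult EE_wd Hp_wd)

lemma Hp_f: "Hp \<kappa> i (wd [j] * X) = wd [j] * Hp \<kappa> i X - of_int (A $ i $ j) *\<^sub>C (wd [j] * X)"
proof (rule clinear_eq_singleI[where X = X])
  show "clinear (\<lambda>X. Hp \<kappa> i (wd [j] * X))"
    by (intro clinear_comps[OF lin_Hp] clinear_intros)
  show "clinear (\<lambda>X. wd [j] * Hp \<kappa> i X - of_int (A $ i $ j) *\<^sub>C (wd [j] * X))"
    by (intro clinear_intros lin_Hp)
  show "Hp \<kappa> i (wd [j] * wd u) = wd [j] * Hp \<kappa> i (wd u) - of_int (A $ i $ j) *\<^sub>C (wd [j] * wd u)" for u
    by (simp add: wd_mult Hp_wd falg_scale_right complex_vector.scale_left_diff_distrib[symmetric])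
qed

definition Fc :: "'n multiset \<Rightarrow> 'n falg set"
  where "Fc c = cspan {wd u | u. mset u = c}"

lemma Fc_subspace: "csubspace (Fc c)"
  by (simp add: Fc_def complex_vector.subspace_span)

lemma wd_Fc: "mset u = c \<Longrightarrow> wd u \<in> Fc c"
  by (auto simp: Fc_def intro: complex_vector.span_base)

lemma Fc_induct:
  assumes "clinear f" "csubspace S" "\<And>u. mset u = c \<Longrightarrow> f (wd u) \<in> S" "X \<in> Fc c"
  shows "f X \<in> S"
  by (rule span_image_sub[OF assms(1,2) _ assms(4)[unfolded Fc_def]]) (use assms(3) in auto)

lemma Fc_eqI:
  assumes "clinear f" "clinear g" "\<And>u. mset u = c \<Longrightarrow> f (wd u) = g (wd u)" "X \<in> Fc c"
  shows "f X = g X"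
  by (rule span_eqI[OF assms(1,2) _ assms(4)[unfolded Fc_def]]) (use assms(3) in auto)

lemma Fc_mult: "X \<in> Fc c \<Longrightarrow> Y \<in> Fc c' \<Longrightarrow> X * Y \<in> Fc (c + c')"
proof (erule Fc_induct[rotated -1])
  show "Y \<in> Fc c' \<Longrightarrow> mset u = c \<Longrightarrow> wd u * Y \<in> Fc (c + c')" for u
    by (erule Fc_induct[rotated -1]) (auto intro!: clinear_intros Fc_subspace wd_Fc simp: wd_mult)
qed (intro clinear_intros Fc_subspace)+

lemma Hp_Fc: "X \<in> Fc c \<Longrightarrow> Hp \<kappa> i X = of_int (\<kappa> i - pm i c) *\<^sub>C X"
  by (erule Fc_eqI[rotated -1]) (auto intro!: lin_Hp clinear_intros simp: Hp_wd)

lemma Ew_Fc: "Ew \<kappa> i u \<in> (if i \<in># mset u then Fc (mset u - {#i#}) else {0})"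
proof (induction u)
  case (Cons j u)
  have 1: "wd [j] * Ew \<kappa> i u \<in> Fc (mset (j # u) - {#i#})"
  proof (cases "i \<in># mset u")
    case True
    have "wd [j] * Ew \<kappa> i u \<in> Fc ({#j#} + (mset u - {#i#}))"
      by (rule Fc_mult) (use True Cons in \<open>auto intro: wd_Fc\<close>)
    with True show ?thesis by simp
  qed (use Cons in \<open>simp add: complex_vector.subspace_0[OF Fc_subspace]\<close>)
  have 2: "i = j \<Longrightarrow> of_int (\<kappa> i - pm i (mset u)) *\<^sub>C wd u \<in> Fc (mset (j # u) - {#i#})"
    by (intro subspace_intros Fc_subspace wd_Fc) simp
  show ?case
    using 1 2 Cons by (auto intro!: complex_vector.subspace_add Fc_subspace)
qed simp

lemma EE_Fc: "X \<in> Fc c \<Longrightarrow> i \<in># c \<Longrightarrow> EE \<kappa> i X \<in> Fc (c - {#i#})"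
  and EE_Fc0: "X \<in> Fc c \<Longrightarrow> i \<notin># c \<Longrightarrow> EE \<kappa> i X = 0"
proof -
  show "X \<in> Fc c \<Longrightarrow> i \<in># c \<Longrightarrow> EE \<kappa> i X \<in> Fc (c - {#i#})"
  proof (erule Fc_induct[rotated -1])
    show "i \<in># c \<Longrightarrow> mset u = c \<Longrightarrow> EE \<kappa> i (wd u) \<in> Fc (c - {#i#})" for u
      using Ew_Fc[of \<kappa> i u] by (auto simp: EE_wd)
  qed (intro lin_EE Fc_subspace)+
  show "X \<in> Fc c \<Longrightarrow> i \<notin># c \<Longrightarrow> EE \<kappa> i X = 0"
  proof (erule Fc_eqI[rotated -1, where g="\<lambda>_. 0"])
    show "i \<notin># c \<Longrightarrow> mset u = c \<Longrightarrow> EE \<kappa> i (wd u) = 0" for u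
      using Ew_Fc[of \<kappa> i u] by (auto simp: EE_wd)
  qed (intro lin_EE clinear_intros)+
qed

section \<open>Lie elements inside the free algebra\<close>

abbreviation E0 :: "'n \<Rightarrow> 'n falg \<Rightarrow> 'n falg" where "E0 \<equiv> EE (\<lambda>_. 0)"

definition ad :: "'n \<Rightarrow> 'n falg \<Rightarrow> 'n falg" where "ad i X = wd [i] * X - X * wd [i]"

lemma lin_ad: "clinear (ad i)"
  unfolding ad_def[abs_def] by (intro clinear_intros)

lemmas ad_simps = clinear_add[OF lin_ad] clinear_diff[OF lin_ad] clinear_scale[OF lin_ad] clinear_zero[OF lin_ad]

lemma ad_Fc: "X \<in> Fc c \<Longrightarrow> ad i X \<in> Fc (add_mset i c)"
  using Fc_mult[of "wd [i]" "{#i#}" X c] Fc_mult[of X c "wd [i]" "{#i#}"]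
  by (auto simp: ad_def intro!: complex_vector.subspace_diff Fc_subspace wd_Fc)

text \<open>\<open>E0 a x\<close> is \<open>[e\<^sub>a, x]\<close> when this commutator lies in the algebra generated by the \<open>f\<^sub>i\<close>,
  i.e. for Lie elements other than combinations of the generators.\<close>

definition der :: "'n \<Rightarrow> 'n falg \<Rightarrow> bool"
  where "der a X \<longleftrightarrow> (\<forall>\<kappa> Y. EE \<kappa> a (X * Y) = E0 a X * Y + X * EE \<kappa> a Y)"

text \<open>Jacobi identity for e_a, f_i and \<open>X\<close>: besides [f_i, [e_a, X]] there is the
  term [[e_a, f_i], X], which for a = i is a coroot acting on an element of weight minus the sum of
  \<open>c\<close>.\<close>

lemma der_ad:
  assumes "der a X" "X \<in> Fc c"
  shows "E0 a (ad i X) = ad i (E0 a X) - (if a = i then of_int (pm a c) *\<^sub>C X else 0)"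
    and "der a (ad i X)"
proof -
  have *: "EE \<kappa> a (ad i X * Y) = (ad i (E0 a X) - (if a = i then of_int (pm a c) *\<^sub>C X else 0)) * Y
      + ad i X * EE \<kappa> a Y" for \<kappa> Y
  proof -
    have H: "Hp \<kappa> a (X * Y) = X * Hp \<kappa> a Y - of_int (pm a c) *\<^sub>C (X * Y)"
    proof (rule clinear_eq_singleI[where X = Y])
      fix u
      have "X * wd u \<in> Fc (c + mset u)" using assms(2) by (intro Fc_mult wd_Fc) auto
      then show "Hp \<kappa> a (X * wd u) = X * Hp \<kappa> a (wd u) - of_int (pm a c) *\<^sub>C (X * wd u)"
        by (simp add: Hp_Fc[of _ "c + mset u"] Hp_wd falg_scale_right complex_vector.scale_left_diff_distrib[symmetric])
    qed (intro clinear_intros clinear_comps[OF lin_Hp] lin_Hp)+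
    have D: "EE \<kappa> a (X * Z) = E0 a X * Z + X * EE \<kappa> a Z" for Z
      using assms(1) by (simp add: der_def)
    have "EE \<kappa> a (ad i X * Y) = EE \<kappa> a (wd [i] * (X * Y)) - EE \<kappa> a (X * (wd [i] * Y))"
      by (simp add: ad_def left_diff_distrib EE_simps mult.assoc)
    also have "\<dots> = wd [i] * (E0 a X * Y + X * EE \<kappa> a Y) + (if a = i then Hp \<kappa> a (X * Y) else 0)
        - (E0 a X * (wd [i] * Y) + X * (wd [i] * EE \<kappa> a Y + (if a = i then Hp \<kappa> a Y else 0)))"
      unfolding EE_f D ..
    also have "\<dots> = (ad i (E0 a X) - (if a = i then of_int (pm a c) *\<^sub>C X else 0)) * Y + ad i X * EE \<kappa> a Y"
    proof (cases "a = i")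
      case True
      then have "i = a" by simp
      then show ?thesis by (simp add: H ad_def algebra_simps falg_scale_left)
    qed (simp add: ad_def algebra_simps)
    finally show ?thesis .
  qed
  show 1: "E0 a (ad i X) = ad i (E0 a X) - (if a = i then of_int (pm a c) *\<^sub>C X else 0)"
    using *[of "\<lambda>_. 0" 1] by simp
  show "der a (ad i X)"
    unfolding der_def 1 * by simp
qed

text \<open>The commutator [e_j, f_j] is a coroot and not an element of the free algebra, so
  \<open>der j\<close> fails for the letter \<open>wd [j]\<close>; the recursion has to start with
  brackets of two letters.\<close>

lemma der_ad_base:
  shows "E0 a (ad i (wd [j])) = (if a = j then of_int (A $ a $ i) *\<^sub>C wd [i] else 0)
      - (if a = i then of_int (A $ a $ j) *\<^sub>C wd [j] else 0)"
    and "der a (ad i (wd [j]))"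
proof -
  have *: "EE \<kappa> a (ad i (wd [j]) * Y) = ((if a = j then of_int (A $ a $ i) *\<^sub>C wd [i] else 0)
      - (if a = i then of_int (A $ a $ j) *\<^sub>C wd [j] else 0)) * Y + ad i (wd [j]) * EE \<kappa> a Y" for \<kappa> Y
  proof -
    have "EE \<kappa> a (ad i (wd [j]) * Y) = EE \<kappa> a (wd [i] * (wd [j] * Y)) - EE \<kappa> a (wd [j] * (wd [i] * Y))"
      by (simp only: ad_def left_diff_distrib EE_simps mult.assoc)
    also have "\<dots> = wd [i] * (wd [j] * EE \<kappa> a Y + (if a = j then Hp \<kappa> a Y else 0)) + (if a = i then Hp \<kappa> a (wd [j] * Y) else 0)
        - (wd [j] * (wd [i] * EE \<kappa> a Y + (if a = i then Hp \<kappa> a Y else 0)) + (if a = j then Hp \<kappa> a (wd [i] * Y) else 0))"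
      unfolding EE_f ..
    also have "\<dots> = ((if a = j then of_int (A $ a $ i) *\<^sub>C wd [i] else 0)
      - (if a = i then of_int (A $ a $ j) *\<^sub>C wd [j] else 0)) * Y + ad i (wd [j]) * EE \<kappa> a Y"
      unfolding Hp_f ad_def by (simp add: algebra_simps falg_scale_left)
    finally show ?thesis .
  qed
  show 1: "E0 a (ad i (wd [j])) = (if a = j then of_int (A $ a $ i) *\<^sub>C wd [i] else 0)
      - (if a = i then of_int (A $ a $ j) *\<^sub>C wd [j] else 0)"
    using *[of "\<lambda>_. 0" 1] by simp
  show "der a (ad i (wd [j]))"
    unfolding der_def 1 * by simp
qed

fun br :: "'n list \<Rightarrow> 'n falg" where
  "br [] = 0"
| "br [i] = wd [i]"
| "br (i # v) = ad i (br v)"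

lemma br_Cons: "v \<noteq> [] \<Longrightarrow> br (i # v) = ad i (br v)"
  by (cases v) auto

lemma br_Fc: "br u \<in> Fc (mset u)"
  by (induction u rule: br.induct) (auto intro!: ad_Fc wd_Fc simp: complex_vector.subspace_0[OF Fc_subspace])

lemma der_br: "2 \<le> length u \<Longrightarrow> der a (br u)"
proof (induction u rule: br.induct)
  case (3 i j v)
  show ?case
  proof (cases "v = []")
    case False
    then have "der a (br (j # v))" using 3 by (cases v) auto
    from der_ad(2)[OF this br_Fc] show ?thesis by simp
  qed (use der_ad_base in simp)
qed auto

text \<open>Right-normed brackets of words span the free Lie algebra, so this is its component of
  degree \<open>c\<close>. The convention \<open>br [] = 0\<close> makes the component of degree
  zero trivial.\<close>

definition Lie :: "'n multiset \<Rightarrow> 'n falg set" where "Lie c = cspan {br u | u. mset u = c}"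

lemma Lie_subspace: "csubspace (Lie c)"
  by (simp add: Lie_def complex_vector.subspace_span)

lemma br_Lie: "mset u = c \<Longrightarrow> br u \<in> Lie c"
  by (auto simp: Lie_def intro: complex_vector.span_base)

lemma Lie_induct:
  assumes "clinear f" "csubspace S" "\<And>u. mset u = c \<Longrightarrow> f (br u) \<in> S" "X \<in> Lie c"
  shows "f X \<in> S"
  by (rule span_image_sub[OF assms(1,2) _ assms(4)[unfolded Lie_def]]) (use assms(3) in auto)

lemma Lie_Fc: "X \<in> Lie c \<Longrightarrow> X \<in> Fc c"
  by (rule Lie_induct[where f="\<lambda>x. x"]) (use br_Fc in \<open>auto intro!: clinear_id Fc_subspace\<close>)

lemma Lie_empty: "X \<in> Lie {#} \<Longrightarrow> X = 0"
  using Lie_induct[of "\<lambda>x. x" "{0}" "{#}" X] by (auto simp: clinear_id)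

lemma ad_Lie: "X \<in> Lie c \<Longrightarrow> ad i X \<in> Lie (add_mset i c)"
proof (erule Lie_induct[rotated -1])
  fix u assume "mset u = c"
  then show "ad i (br u) \<in> Lie (add_mset i c)"
    by (cases "u = []") (auto simp: br_Cons[symmetric] clinear_zero[OF lin_ad] intro!: br_Lie subspace_intros Lie_subspace)
qed (intro lin_ad Lie_subspace)+

lemma E0_single: "E0 a (wd [j]) = 0"
  by (simp add: EE_wd)

lemma E0_br: "E0 a (br u) \<in> (if a \<in># mset u then Lie (mset u - {#a#}) else {0})"
proof (induction u rule: br.induct)
  case (3 i j v)
  show ?case
  proof (cases "v = []")
    case True
    have "wd [b] \<in> Lie {#b#}" for b
      using br_Lie[of "[b]"] by simp
    then show ?thesis
      using True der_ad_base(1)[of a i j] by (auto intro!: subspace_intros Lie_subspace)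
  next
    case False
    let ?X = "br (j # v)"
    have "E0 a (ad i ?X) = ad i (E0 a ?X) - (if a = i then of_int (pm a (mset (j # v))) *\<^sub>C ?X else 0)"
      using False by (intro der_ad(1) der_br br_Fc) (cases v; auto)
    moreover have "ad i (E0 a ?X) \<in> (if a \<in># mset (i # j # v) then Lie (mset (i # j # v) - {#a#}) else {0})"
    proof (cases "a \<in># mset (j # v)")
      case True
      then have "ad i (E0 a ?X) \<in> Lie (add_mset i (mset (j # v) - {#a#}))"
        using 3 by (intro ad_Lie) auto
      with True show ?thesis by (auto simp: add_mset_diff_bothsides)
    next
      case False
      with 3 have "E0 a ?X = 0" by simp
      then show ?thesis by (auto simp: clinear_zero[OF lin_ad] complex_vector.subspace_0[OF Lie_subspace])
    qed
    moreover have "a = i \<Longrightarrow> of_int (pm a (mset (j # v))) *\<^sub>C ?X \<in> Lie (mset (i # j # v) - {#a#})"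
      by (intro subspace_intros Lie_subspace br_Lie) simp
    ultimately show ?thesis
    proof (cases "a \<in># mset (i # j # v)")
      case True
      let ?L = "Lie (mset (i # j # v) - {#a#})"
      assume *: "E0 a (ad i ?X) = ad i (E0 a ?X) - (if a = i then of_int (pm a (mset (j # v))) *\<^sub>C ?X else 0)"
        "ad i (E0 a ?X) \<in> (if a \<in># mset (i # j # v) then ?L else {0})"
        "a = i \<Longrightarrow> of_int (pm a (mset (j # v))) *\<^sub>C ?X \<in> ?L"
      have "(if a = i then of_int (pm a (mset (j # v))) *\<^sub>C ?X else 0) \<in> ?L"
      proof (cases "a = i")
        case True
        then show ?thesis unfolding if_P[OF True] by (rule *(3))
      next
        case False
        show ?thesis unfolding if_not_P[OF False] by (rule complex_vector.subspace_0[OF Lie_subspace])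
      qed
      moreover have "ad i (E0 a ?X) \<in> ?L"
        using *(2) True by (simp only: if_True)
      ultimately have "E0 a (br (i # j # v)) \<in> ?L"
        unfolding br.simps *(1) by (rule complex_vector.subspace_diff[OF Lie_subspace, rotated])
      with True show ?thesis by (simp only: if_True)
    qed auto
  qed
qed (auto simp: E0_single EE_simps complex_vector.subspace_0[OF Lie_subspace])

lemma E0_Lie: "X \<in> Lie c \<Longrightarrow> a \<in># c \<Longrightarrow> E0 a X \<in> Lie (c - {#a#})"
proof (erule Lie_induct[rotated -1])
  show "a \<in># c \<Longrightarrow> mset u = c \<Longrightarrow> E0 a (br u) \<in> Lie (c - {#a#})" for u
    using E0_br[of a u] by auto
qed (intro lin_EE Lie_subspace)+

text \<open>\<open>BB w x\<close> is the value of the invariant form on \<open>[e\<^bsub>a\<^esub>, [e\<^bsub>b\<^esub>, \<dots>]]\<close> (for \<open>w = a # b # \<dots>\<close>)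
  and the Lie element \<open>x\<close>, computed through invariance; \<open>YY \<kappa> w\<close> is the action of the same
  iterated bracket.\<close>

primrec BB :: "'n list \<Rightarrow> 'n falg \<Rightarrow> complex" where
  "BB [] x = 0"
| "BB (a # w) x = (if w = [] then Poly_Mapping.lookup x [a] / of_real (d a) else - BB w (E0 a x))"

primrec YY :: "('n \<Rightarrow> int) \<Rightarrow> 'n list \<Rightarrow> 'n falg \<Rightarrow> 'n falg" where
  "YY \<kappa> [] X = 0"
| "YY \<kappa> (a # w) X = (if w = [] then EE \<kappa> a X else EE \<kappa> a (YY \<kappa> w X) - YY \<kappa> w (EE \<kappa> a X))"

lemma lin_BB: "clinear (BB w)"
proof (induction w)
  case (Cons a w)
  show ?case
  proof (cases "w = []")
    case True
    have "clinear (\<lambda>x. Poly_Mapping.lookup x [a] / complex_of_real (d a))"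
      by (rule clinearI) (simp_all add: lookup_add lookup_scaleC add_divide_distrib scaleC_cmul)
    moreover have "BB (a # w) = (\<lambda>x. Poly_Mapping.lookup x [a] / complex_of_real (d a))"
      using True by (simp add: fun_eq_iff)
    ultimately show ?thesis by simp
  next
    case False
    then show ?thesis
      using clinear_neg_map[OF clinear_comps[OF Cons lin_EE[of "\<lambda>_. 0" a]]] by (simp add: fun_eq_iff[symmetric])
  qed
qed (simp add: clinear_zero_map)

lemma lin_YY: "clinear (YY \<kappa> w)"
proof (induction w)
  case (Cons a w)
  show ?case
  proof (cases "w = []")
    case False
    have "clinear (\<lambda>X. EE \<kappa> a (YY \<kappa> w X) - YY \<kappa> w (EE \<kappa> a X))"
      by (intro clinear_intros clinear_comps[OF lin_EE] clinear_comps[OF Cons] Cons lin_EE)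
    with False show ?thesis by simp
  qed (simp add: lin_EE)
qed (simp add: clinear_zero_map)

lemmas BB_simps = clinear_add[OF lin_BB] clinear_diff[OF lin_BB] clinear_scale[OF lin_BB, unfolded scaleC_cmul] clinear_zero[OF lin_BB]
lemmas YY_simps = clinear_add[OF lin_YY] clinear_diff[OF lin_YY] clinear_scale[OF lin_YY] clinear_zero[OF lin_YY]

lemma BB_Fc: "x \<in> Fc c \<Longrightarrow> BB w x \<noteq> 0 \<Longrightarrow> mset w = c"
proof (induction w arbitrary: x c)
  case (Cons a w)
  show ?case
  proof (cases "w = []")
    case True
    have "c \<noteq> {#a#} \<Longrightarrow> Poly_Mapping.lookup x [a] = 0"
    proof (rule Fc_induct[where S="{0::complex}" and f="\<lambda>x. Poly_Mapping.lookup x [a]", OF _ _ _ Cons(2), simplified])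
      show "clinear (\<lambda>x::'n falg. Poly_Mapping.lookup x [a])"
        by (rule clinearI) (simp_all add: lookup_add lookup_scaleC)
      show "c \<noteq> {#a#} \<Longrightarrow> mset u = c \<Longrightarrow> Poly_Mapping.lookup (wd u) [a] = 0" for u
        by (auto simp: lookup_single when_def)
    qed
    with True Cons show ?thesis by auto
  next
    case False
    with Cons(3) have *: "BB w (E0 a x) \<noteq> 0" by simp
    have "a \<in># c"
    proof (rule ccontr)
      assume "a \<notin># c"
      from EE_Fc0[OF Cons(2) this] * show False by (simp add: BB_simps)
    qed
    with Cons.IH[OF EE_Fc[OF Cons(2)] *] show ?thesis by auto
  qed
qed simp

lemma Hp_commute: "Hp \<kappa> i (EE \<kappa> a X) = EE \<kappa> a (Hp \<kappa> i X) + of_int (A $ i $ a) *\<^sub>C EE \<kappa> a X"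
proof (rule clinear_eq_singleI[where X=X])
  fix u
  show "Hp \<kappa> i (EE \<kappa> a (wd u)) = EE \<kappa> a (Hp \<kappa> i (wd u)) + of_int (A $ i $ a) *\<^sub>C EE \<kappa> a (wd u)"
  proof (cases "a \<in># mset u")
    case True
    then have "pm i (mset u) = A $ i $ a + pm i (mset u - {#a#})"
      by (metis insert_DiffM pm_simps(2))
    then show ?thesis
      using Hp_Fc[OF EE_Fc[OF wd_Fc[OF HOL.refl] True], of \<kappa> i]
      by (simp add: Hp_wd EE_simps complex_vector.scale_left_diff_distrib scaleC_add_left)
  next
    case False
    then show ?thesis
      using EE_Fc0[OF wd_Fc[OF HOL.refl] False] by (simp add: Hp_wd EE_simps Hp_simps)
  qed
qed (intro clinear_intros clinear_comps[OF lin_EE] clinear_comps[OF lin_Hp] lin_EE lin_Hp)+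

lemma Hp_YY: "Hp \<kappa> i (YY \<kappa> w X) = YY \<kappa> w (Hp \<kappa> i X) + of_int (pm i (mset w)) *\<^sub>C YY \<kappa> w X"
proof (induction w arbitrary: X)
  case (Cons a w)
  then show ?case
    by (simp add: Hp_simps Hp_commute EE_simps YY_simps complex_vector.scale_right_diff_distrib algebra_simps scaleC_add_left scaleC_add_right)
qed (simp add: Hp_simps)

text \<open>The coefficient list does not depend on \<open>g\<close>, so that \<open>rho\<close> can
  assert that one combination of words serves both the action and the form.\<close>

definition lc :: "(complex \<times> 'b) list \<Rightarrow> ('b \<Rightarrow> 'v) \<Rightarrow> 'v::complex_vector"
  where "lc \<rho> g = (\<Sum>(c, w)\<leftarrow>\<rho>. c *\<^sub>C g w)"

lemma lc_simps [simp]: "lc [] g = 0" "lc ((c, w) # \<rho>) g = c *\<^sub>C g w + lc \<rho> g" "lc (\<rho> @ \<rho>') g = lc \<rho> g + lc \<rho>' g"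
  by (simp_all add: lc_def)

lemma lc_map: "clinear f \<Longrightarrow> f (lc \<rho> g) = lc \<rho> (\<lambda>w. f (g w))"
  by (induction \<rho>) (auto simp: clinear_zero clinear_add clinear_scale)

lemma lc_cong: "(\<And>c w. (c, w) \<in> set \<rho> \<Longrightarrow> g w = h w) \<Longrightarrow> lc \<rho> g = lc \<rho> h"
  unfolding lc_def by (intro arg_cong[where f=sum_list] map_cong) auto

lemma lc_reindex: "lc (map (\<lambda>(c, w). (c, h w)) \<rho>) g = lc \<rho> (\<lambda>w. g (h w))"
  by (induction \<rho>) auto

lemma lc_minus: "lc \<rho> (\<lambda>w. g w - h w) = lc \<rho> g - lc \<rho> h"
  for g h :: "'b \<Rightarrow> 'v::complex_vector"
  by (induction \<rho>) (auto simp: complex_vector.scale_right_diff_distrib)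

text \<open>Write e_w for the iterated bracket. The combination \<open>\<rho>\<close> represents
  [e_w, f_i], again a sum of raising elements when \<open>w\<close> has at least two letters.
  Invariance of the form, (e_w, [f_i, x]) = ([e_w, f_i], x), makes the same coefficients appear in
  \<open>BB\<close>.\<close>

lemma rho:
  assumes "2 \<le> length w"
  shows "\<exists>\<rho>. (\<forall>(c, w')\<in>set \<rho>. w' \<noteq> []) \<and>
    (\<forall>\<kappa> X. YY \<kappa> w (wd [i] * X) - wd [i] * YY \<kappa> w X = lc \<rho> (\<lambda>w. YY \<kappa> w X)) \<and>
    (\<forall>u. BB w (ad i (br u)) = lc \<rho> (\<lambda>w. BB w (br u)))"
  using assms
proof (induction w)
  case (Cons a w)
  show ?case
  proof (cases "length w = 1")
    case True
    then obtain b where w: "w = [b]" by (auto simp: length_Suc_conv)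
    \<comment> \<open>[[e_a, e_b], f_i] by the Jacobi identity; what remains is the i-th coroot
      acting on e_a or e_b.\<close>
    let ?\<rho> = "[(if b = i then - of_int (A $ i $ a) else 0, [a]), (if a = i then of_int (A $ i $ b) else 0, [b])] :: (complex \<times> 'n list) list"
    have "YY \<kappa> (a # w) (wd [i] * X) - wd [i] * YY \<kappa> (a # w) X = lc ?\<rho> (\<lambda>w. YY \<kappa> w X)" for \<kappa> X
      by (simp add: w EE_f EE_simps Hp_commute algebra_simps complex_vector.scale_minus_left)
    moreover have "BB (a # w) (ad i (br u)) = lc ?\<rho> (\<lambda>w. BB w (br u))" for u
    proof (cases "length u = 1")
      case True
      then obtain j where u: "u = [j]" by (auto simp: length_Suc_conv)
      \<comment> \<open>Symmetrizability makes the normalization (e_a, f_a) = 1 / \<open>d a\<close>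
        compatible with invariance.\<close>
      have "complex_of_real (d i) * of_int (A $ i $ j) = complex_of_real (d j) * of_int (A $ j $ i)" for i j
        using d_sym[of i j] by (metis of_real_mult of_real_of_int_eq)
      moreover have "complex_of_real (d i) \<noteq> 0" for i using d_pos[of i] by simp
      ultimately have "of_int (A $ i $ j) / complex_of_real (d j) = of_int (A $ j $ i) / complex_of_real (d i)" for i j
        by (simp add: divide_simps) (metis mult.commute)
      from this[of i j] show ?thesis
        by (auto simp: w u der_ad_base lookup_add lookup_minus lookup_scaleC lookup_single when_def scaleC_cmul)
    next
      case False
      have "mset w' \<noteq> mset u" if "length w' = 1" for w' :: "'n list"
        using that False by (metis size_mset)
      then have "BB [c] (br u) = 0" for c
        using BB_Fc[OF br_Fc[of u], of "[c]"] by force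
      moreover have "mset (a # w) \<noteq> add_mset i (mset u)"
        using w False by (metis One_nat_def add_mset_add_single list.size(3) list.size(4) add.commute plus_1_eq_Suc size_add_mset size_mset nat.inject)
      then have "BB (a # w) (ad i (br u)) = 0"
        using BB_Fc[OF ad_Fc[OF br_Fc[of u]], of "a # w" i] by blast
      ultimately show ?thesis by (simp del: BB.simps)
    qed
    ultimately show ?thesis
      by (intro exI[of _ ?\<rho>]) (simp del: BB.simps YY.simps)
  next
    case False
    with Cons.prems have lw: "2 \<le> length w" by (cases "length w") auto
    with Cons obtain \<rho> where \<rho>: "\<forall>(c, w')\<in>set \<rho>. w' \<noteq> []"
      "\<And>\<kappa> X. YY \<kappa> w (wd [i] * X) - wd [i] * YY \<kappa> w X = lc \<rho> (\<lambda>w. YY \<kappa> w X)"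
      "\<And>u. BB w (ad i (br u)) = lc \<rho> (\<lambda>w. BB w (br u))" by blast
    \<comment> \<open>[[e_a, e_w], f_i] is [e_a, [e_w, f_i]] plus, for a = i, the coroot acting on
      e_w through its weight.\<close>
    let ?\<rho> = "map (\<lambda>(c, w). (c, a # w)) \<rho> @ [(if a = i then of_int (pm i (mset w)) else 0, w)]"
    have wn: "w \<noteq> []" using lw by auto
    have "YY \<kappa> (a # w) (wd [i] * X) - wd [i] * YY \<kappa> (a # w) X = lc ?\<rho> (\<lambda>w. YY \<kappa> w X)" for \<kappa> X
    proof -
      have 1: "YY \<kappa> w (wd [i] * X) = wd [i] * YY \<kappa> w X + lc \<rho> (\<lambda>w. YY \<kappa> w X)" for X
        using \<rho>(2)[of \<kappa> X] by (simp add: algebra_simps)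
      have 2: "lc \<rho> (\<lambda>w. YY \<kappa> (a # w) X) = EE \<kappa> a (lc \<rho> (\<lambda>w. YY \<kappa> w X)) - lc \<rho> (\<lambda>w. YY \<kappa> w (EE \<kappa> a X))"
        unfolding lc_map[OF lin_EE] lc_minus[symmetric] using \<rho>(1) by (intro lc_cong) auto
      show ?thesis
        unfolding lc_simps lc_reindex 2 using wn
        by (simp add: 1 EE_f EE_simps YY_simps algebra_simps Hp_YY)
    qed
    moreover have "BB (a # w) (ad i (br u)) = lc ?\<rho> (\<lambda>w. BB w (br u))" for u
    proof (cases "2 \<le> length u")
      case True
      have "E0 a (ad i (br u)) = ad i (E0 a (br u)) - (if a = i then of_int (pm a (mset u)) *\<^sub>C br u else 0)"
        by (rule der_ad(1)[OF der_br[OF True] br_Fc])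
      then have "BB (a # w) (ad i (br u)) = - BB w (ad i (E0 a (br u))) + (if a = i then of_int (pm a (mset u)) * BB w (br u) else 0)"
        using wn by (simp add: BB_simps)
      also have "BB w (ad i (E0 a (br u))) = lc \<rho> (\<lambda>w. BB w (E0 a (br u)))"
      proof (cases "a \<in># mset u")
        case in_u: True
        then have "E0 a (br u) \<in> Lie (mset u - {#a#})" using E0_br[of a u] by simp
        then have "BB w (ad i (E0 a (br u))) - lc \<rho> (\<lambda>w. BB w (E0 a (br u))) \<in> {0}"
        proof (rule Lie_induct[rotated -1])
          have "clinear (\<lambda>x. lc \<rho> (\<lambda>w. BB w x))"
            by (induction \<rho>) (auto intro!: clinear_zero_map clinear_plus clinear_smult[OF lin_BB])
          then show "clinear (\<lambda>x. BB w (ad i x) - lc \<rho> (\<lambda>w. BB w x))"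
            by (intro clinear_minus clinear_comps[OF lin_BB] lin_ad)
        qed (use \<rho>(3) in auto)
        then show ?thesis by simp
      next
        case False
        then have "E0 a (br u) = 0" using E0_br[of a u] by simp
        moreover have "lc \<rho> (\<lambda>w. 0::complex) = 0" by (induction \<rho>) auto
        ultimately show ?thesis by (simp add: BB_simps ad_simps)
      qed
      also have "- lc \<rho> (\<lambda>w. BB w (E0 a (br u))) = lc \<rho> (\<lambda>w. BB (a # w) (br u))"
        unfolding lc_map[OF clinear_neg_map[OF clinear_id]] using \<rho>(1) by (intro lc_cong) auto
      also have "(if a = i then of_int (pm a (mset u)) * BB w (br u) else 0) = (if a = i then of_int (pm i (mset w)) * BB w (br u) else 0)"
        using BB_Fc[OF br_Fc, of w u] by (cases "BB w (br u) = 0") auto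
      finally show ?thesis by (simp add: lc_reindex scaleC_cmul del: BB.simps)
    next
      case False
      have 0: "BB w' (br u) = 0" if "2 \<le> length w'" for w'
        using BB_Fc[OF br_Fc, of w' u] that False by (metis size_mset)
      have "BB (a # w) (ad i (br u)) = 0"
      proof (rule ccontr)
        assume "BB (a # w) (ad i (br u)) \<noteq> 0"
        from BB_Fc[OF ad_Fc[OF br_Fc] this] have "mset w = mset u - {#a#} + {#i#} \<or> size (mset w) = size (mset u)"
          by (metis size_add_mset mset.simps(2) nat.inject)
        then have "length w = length u"
          using \<open>BB (a # w) (ad i (br u)) \<noteq> 0\<close> BB_Fc[OF ad_Fc[OF br_Fc], of "a # w" i u]
          by (metis length_Cons nat.inject size_add_mset size_mset)
        with lw False show False by simp
      qed
      moreover have "lc \<rho> (\<lambda>w. BB (a # w) (br u)) = lc \<rho> (\<lambda>w. 0)"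
        using \<rho>(1) by (intro lc_cong 0) (auto simp: Suc_le_eq)
      moreover have "lc \<rho> (\<lambda>w. 0::complex) = 0" by (induction \<rho>) auto
      ultimately show ?thesis using 0[OF lw] by (simp add: lc_reindex del: BB.simps)
    qed
    ultimately show ?thesis
      using \<rho>(1) wn by (intro exI[of _ ?\<rho>]) (auto simp del: BB.simps YY.simps lc_simps)
  qed
qed simp

end

lemma cbilinearI: "(\<And>x. clinear (B x)) \<Longrightarrow> (\<And>y. clinear (\<lambda>x. B x y)) \<Longrightarrow> cbilinear B"
  by (simp add: cbilinear_def)

lemma clinear_tens1: "clinear f \<Longrightarrow> clinear (\<lambda>x. f x \<otimes>\<^sub>C y)"
  and clinear_tens2: "clinear f \<Longrightarrow> clinear (\<lambda>y. x \<otimes>\<^sub>C f y)"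
  using cbilinear_tens clinear_comps[of "\<lambda>x. x \<otimes>\<^sub>C y" f] clinear_comps[of "\<lambda>y. x \<otimes>\<^sub>C y" f]
  by (auto simp: cbilinear_def)

text \<open>Gaussian elimination on the functionals: a new one enters \<open>J\<close> only if it is
  nonzero somewhere on the common kernel of the earlier ones in \<open>S\<close>. The result works
  like a dual basis of \<open>S\<close> modulo the common kernel.\<close>

lemma finite_dual_basis:
  fixes \<phi> :: "'i \<Rightarrow> 'v::complex_vector \<Rightarrow> complex"
  assumes "finite I" "\<And>i. clinear (\<phi> i)" "csubspace S"
  shows "\<exists>J x. J \<subseteq> I \<and> (\<forall>j\<in>J. x j \<in> S) \<and> (\<forall>y\<in>S. \<forall>i\<in>I. \<phi> i (y - (\<Sum>j\<in>J. \<phi> j y *\<^sub>C x j)) = 0)"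
  using assms(1)
proof (induction I)
  case (insert i I)
  then obtain J x where J: "J \<subseteq> I" "\<And>j. j \<in> J \<Longrightarrow> x j \<in> S"
    "\<And>y i. y \<in> S \<Longrightarrow> i \<in> I \<Longrightarrow> \<phi> i (y - (\<Sum>j\<in>J. \<phi> j y *\<^sub>C x j)) = 0"
    by blast
  note lin = assms(2)
  have finJ: "finite J" using J(1) insert finite_subset by blast
  have res: "y - (\<Sum>j\<in>J. \<phi> j y *\<^sub>C x j) \<in> S" if "y \<in> S" for y
    using that J(2) assms(3) by (auto intro!: subspace_intros)
  show ?case
  proof (cases "\<exists>z\<in>S. (\<forall>k\<in>I. \<phi> k z = 0) \<and> \<phi> i z \<noteq> 0")
    case False
    then have "\<phi> i (y - (\<Sum>j\<in>J. \<phi> j y *\<^sub>C x j)) = 0" if "y \<in> S" for y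
      using res[OF that] J(3)[OF that] by blast
    with J show ?thesis by (intro exI[of _ J] exI[of _ x]) auto
  next
    case True
    then obtain z' where z': "z' \<in> S" "\<And>k. k \<in> I \<Longrightarrow> \<phi> k z' = 0" "\<phi> i z' \<noteq> 0" by blast
    define z where "z = (1 / \<phi> i z') *\<^sub>C z'"
    have z: "z \<in> S" "\<And>k. k \<in> I \<Longrightarrow> \<phi> k z = 0" "\<phi> i z = 1"
      using z' assms(3) by (auto simp: z_def clinear_scale[OF lin] scaleC_cmul intro!: subspace_intros)
    define x' where "x' j = (if j = i then z else x j - \<phi> i (x j) *\<^sub>C z)" for j
    have inotJ: "i \<notin> J" using J(1) insert by blast
    have eq: "y - (\<Sum>j\<in>insert i J. \<phi> j y *\<^sub>C x' j) =
        (y - (\<Sum>j\<in>J. \<phi> j y *\<^sub>C x j)) - \<phi> i (y - (\<Sum>j\<in>J. \<phi> j y *\<^sub>C x j)) *\<^sub>C z" for y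
    proof -
      have "(\<Sum>j\<in>J. \<phi> j y *\<^sub>C x' j) = (\<Sum>j\<in>J. \<phi> j y *\<^sub>C x j - (\<phi> j y * \<phi> i (x j)) *\<^sub>C z)"
        using inotJ by (intro sum.cong) (auto simp: x'_def complex_vector.scale_right_diff_distrib scaleC_scaleC)
      also have "\<dots> = (\<Sum>j\<in>J. \<phi> j y *\<^sub>C x j) - (\<Sum>j\<in>J. \<phi> j y * \<phi> i (x j)) *\<^sub>C z"
        by (simp add: sum_subtractf complex_vector.scale_sum_left)
      finally have 1: "(\<Sum>j\<in>J. \<phi> j y *\<^sub>C x' j) = \<dots>" .
      have 2: "(\<Sum>j\<in>insert i J. \<phi> j y *\<^sub>C x' j) = \<phi> i y *\<^sub>C z + ((\<Sum>j\<in>J. \<phi> j y *\<^sub>C x j) - (\<Sum>j\<in>J. \<phi> j y * \<phi> i (x j)) *\<^sub>C z)"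
        unfolding 1[symmetric] using inotJ finJ by (simp add: x'_def)
      have 3: "\<phi> i (y - (\<Sum>j\<in>J. \<phi> j y *\<^sub>C x j)) = \<phi> i y - (\<Sum>j\<in>J. \<phi> j y * \<phi> i (x j))"
        by (simp add: clinear_diff[OF lin] clinear_sum[OF lin] clinear_scale[OF lin] scaleC_cmul)
      show ?thesis unfolding 2 3 by (simp add: complex_vector.scale_left_diff_distrib)
    qed
    show ?thesis
    proof (intro exI[of _ "insert i J"] exI[of _ x'] conjI ballI)
      show "insert i J \<subseteq> insert i I" using J by auto
      show "x' j \<in> S" if "j \<in> insert i J" for j
        using that J(2) z(1) assms(3) by (auto simp: x'_def intro!: subspace_intros)
      show "\<phi> k (y - (\<Sum>j\<in>insert i J. \<phi> j y *\<^sub>C x' j)) = 0" if "y \<in> S" "k \<in> insert i I" for y k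
        unfolding eq using that J(3)[OF that(1)] z(2,3)
        by (auto simp: clinear_diff[OF lin, of k "y - _"] clinear_diff[OF lin, of i "y - _"] clinear_scale[OF lin] scaleC_cmul)
    qed
  qed
qed auto

section \<open>The Casimir element on Verma modules\<close>

context km
begin

text \<open>f_i acts by the adjoint action on the Lie factor and by multiplication on the module
  factor; \<open>mulT\<close> intertwines this with multiplication by f_i.\<close>

definition actT :: "'n \<Rightarrow> ('n falg, 'n falg) tensor \<Rightarrow> ('n falg, 'n falg) tensor"
  where "actT i = tensor_lift (\<lambda>x Y. ad i x \<otimes>\<^sub>C Y + x \<otimes>\<^sub>C (wd [i] * Y))"

definition mulT :: "('n falg, 'n falg) tensor \<Rightarrow> 'n falg" where "mulT = tensor_lift (*)"

definition cT :: "'n list \<Rightarrow> ('n falg, 'n falg) tensor \<Rightarrow> 'n falg"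
  where "cT w = tensor_lift (\<lambda>x Y. BB w x *\<^sub>C Y)"

lemma bil_act: "cbilinear (\<lambda>x Y. ad i x \<otimes>\<^sub>C Y + x \<otimes>\<^sub>C (wd [i] * Y))"
  by (intro cbilinearI clinear_plus clinear_tens1 clinear_tens2 lin_ad clinear_intros)

lemma bil_mul: "cbilinear ((*) :: 'n falg \<Rightarrow> _)"
  by (intro cbilinearI clinear_intros)

lemma bil_c: "cbilinear (\<lambda>x (Y :: 'n falg). BB w x *\<^sub>C Y)"
  by (intro cbilinearI clinear_intros clinearI) (simp_all add: BB_simps scaleC_add_left scaleC_scaleC scaleC_cmul)

lemma actT_tens: "actT i (x \<otimes>\<^sub>C Y) = ad i x \<otimes>\<^sub>C Y + x \<otimes>\<^sub>C (wd [i] * Y)"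
  and mulT_tens: "mulT (x \<otimes>\<^sub>C Y) = x * Y"
  and cT_tens: "cT w (x \<otimes>\<^sub>C Y) = BB w x *\<^sub>C Y"
  unfolding actT_def mulT_def cT_def
  by (simp_all add: tensor_lift_tens bil_act bil_mul bil_c)

lemma lin_actT: "clinear (actT i)" and lin_mulT: "clinear mulT" and lin_cT: "clinear (cT w)"
  unfolding actT_def mulT_def cT_def
  by (simp_all add: clinear_tensor_lift bil_act bil_mul bil_c)

text \<open>\<open>rw \<kappa> u\<close> is \<open>\<Sum> f\<^sub>\<alpha> \<otimes> e\<^sub>\<alpha> u\<close>, the nilpotent part of the Casimir element applied to
  the word \<open>u\<close> in the Verma module of highest weight \<open>\<kappa>\<close>.\<close>

primrec rw :: "('n \<Rightarrow> int) \<Rightarrow> 'n list \<Rightarrow> ('n falg, 'n falg) tensor" where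
  "rw \<kappa> [] = 0"
| "rw \<kappa> (i # u) = actT i (rw \<kappa> u)
    + complex_of_real (d i * of_int (\<kappa> i - pm i (mset u))) *\<^sub>C (wd [i] \<otimes>\<^sub>C wd u)"

definition LT :: "('n multiset \<Rightarrow> bool) \<Rightarrow> ('n falg, 'n falg) tensor set"
  where "LT Q = cspan {br v \<otimes>\<^sub>C wd u | v u. v \<noteq> [] \<and> Q (mset v)}"

lemma LT_induct:
  assumes "clinear f" "csubspace S" "\<And>v u. v \<noteq> [] \<Longrightarrow> Q (mset v) \<Longrightarrow> f (br v \<otimes>\<^sub>C wd u) \<in> S" "R \<in> LT Q"
  shows "f R \<in> S"
  by (rule span_image_sub[OF assms(1,2) _ assms(4)[unfolded LT_def]]) (use assms(3) in auto)

lemma LT_eqI: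
  assumes "clinear f" "clinear g" "\<And>v u. v \<noteq> [] \<Longrightarrow> Q (mset v) \<Longrightarrow> f (br v \<otimes>\<^sub>C wd u) = g (br v \<otimes>\<^sub>C wd u)" "R \<in> LT Q"
  shows "f R = g R"
  by (rule span_eqI[OF assms(1,2) _ assms(4)[unfolded LT_def]]) (use assms(3) in auto)

text \<open>The last clause matters for the induction in \<open>radL_J0\<close>: for \<kappa> = 0
  the last letter of the word contributes the coefficient \<open>d i * \<kappa> i\<close> = 0, so no
  Lie factor carries the whole degree.\<close>

lemma rw_span: "rw \<kappa> u \<in> cspan {br v \<otimes>\<^sub>C wd u' | v u'. v \<noteq> [] \<and> mset v + mset u' = mset u
    \<and> ((\<forall>i. \<kappa> i = 0) \<longrightarrow> u' \<noteq> [])}"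
proof (induction u)
  case (Cons i u)
  let ?S = "\<lambda>u. {br v \<otimes>\<^sub>C wd u' | v u'. v \<noteq> [] \<and> mset v + mset u' = mset u \<and> ((\<forall>i. \<kappa> i = 0) \<longrightarrow> u' \<noteq> [])}"
  have "actT i (rw \<kappa> u) \<in> cspan (?S (i # u))"
  proof (rule span_image_sub[OF lin_actT complex_vector.subspace_span _ Cons])
    fix x assume "x \<in> ?S u"
    then obtain v u' where x: "x = br v \<otimes>\<^sub>C wd u'" "v \<noteq> []" "mset v + mset u' = mset u" "(\<forall>i. \<kappa> i = 0) \<longrightarrow> u' \<noteq> []"
      by auto
    have "mset (i # v) + mset u' = mset (i # u)" "mset v + mset (i # u') = mset (i # u)"
      using x by auto
    with x have "br (i # v) \<otimes>\<^sub>C wd u' \<in> ?S (i # u)" "br v \<otimes>\<^sub>C wd (i # u') \<in> ?S (i # u)"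
      by blast+
    moreover have "actT i x = br (i # v) \<otimes>\<^sub>C wd u' + br v \<otimes>\<^sub>C wd (i # u')"
      using x by (simp add: actT_tens br_Cons wd_mult)
    ultimately show "actT i x \<in> cspan (?S (i # u))"
      by (simp only: complex_vector.span_add complex_vector.span_base)
  qed
  moreover have "complex_of_real (d i * of_int (\<kappa> i - pm i (mset u))) *\<^sub>C (wd [i] \<otimes>\<^sub>C wd u) \<in> cspan (?S (i # u))"
  proof (cases "(\<forall>i. \<kappa> i = 0) \<and> u = []")
    case False
    moreover have "mset [i] + mset u = mset (i # u)" "[i] \<noteq> []" by auto
    ultimately have "br [i] \<otimes>\<^sub>C wd u \<in> ?S (i # u)" by blast
    from complex_vector.span_scale[OF complex_vector.span_base[OF this]] show ?thesis by simp
  qed (auto simp: complex_vector.span_zero)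
  ultimately show ?case by (simp add: complex_vector.span_add)
qed (simp add: complex_vector.span_zero)

lemma rw_LT: "(\<And>v u'. mset v + mset u' = mset u \<Longrightarrow> ((\<forall>i. \<kappa> i = 0) \<longrightarrow> u' \<noteq> []) \<Longrightarrow> Q (mset v)) \<Longrightarrow> rw \<kappa> u \<in> LT Q"
  unfolding LT_def by (rule set_mp[OF complex_vector.span_mono rw_span]) blast

primrec tc :: "('n \<Rightarrow> int) \<Rightarrow> 'n list \<Rightarrow> real" where
  "tc \<kappa> [] = 0"
| "tc \<kappa> (i # u) = tc \<kappa> u + d i * of_int (\<kappa> i - pm i (mset u))"

text \<open>The full Casimir element is constant on a Verma module, so its nilpotent part is a
  scalar on each weight space. Equivariance of \<open>mulT\<close> lets the scalar be collected
  letter by letter.\<close>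

lemma mulT_rw: "mulT (rw \<kappa> u) = complex_of_real (tc \<kappa> u) *\<^sub>C wd u"
proof (induction u)
  case (Cons i u)
  have "mulT (actT i (rw \<kappa> u)) = wd [i] * mulT (rw \<kappa> u)"
  proof (rule LT_eqI)
    show "rw \<kappa> u \<in> LT (\<lambda>_. True)" by (rule rw_LT) simp
    show "mulT (actT i (br v \<otimes>\<^sub>C wd u)) = wd [i] * mulT (br v \<otimes>\<^sub>C wd u)" for v u
      by (simp only: actT_tens clinear_add[OF lin_mulT] mulT_tens ad_def left_diff_distrib mult.assoc) simp
  qed (intro clinear_comps[OF lin_mulT] clinear_mult_left lin_actT lin_mulT)+
  then show ?case
    by (simp add: Cons clinear_add[OF lin_mulT] clinear_scale[OF lin_mulT] mulT_tens wd_mult falg_scale_right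
        scaleC_add_left[symmetric])
qed (simp add: clinear_zero[OF lin_mulT])

text \<open>Pairing the first factor of the Casimir tensor with e_w returns e_w itself, hence the
  action of the iterated bracket. By \<open>rho\<close> both sides satisfy the same recursion in the
  word \<open>u\<close>.\<close>

lemma cT_rw: "w \<noteq> [] \<Longrightarrow> cT w (rw \<kappa> u) = YY \<kappa> w (wd u)"
proof (induction u arbitrary: w)
  case Nil
  have "YY \<kappa> w 1 = 0" for w by (induction w) (simp_all add: YY_simps EE_simps)
  then show ?case by (simp add: clinear_zero[OF lin_cT] wd_Nil)
next
  case (Cons i u)
  have R: "rw \<kappa> u \<in> LT (\<lambda>_. True)" by (rule rw_LT) simp
  have split: "YY \<kappa> w (wd (i # u)) = YY \<kappa> w (wd [i] * wd u)" by (simp add: wd_mult)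
  show ?case
  proof (cases "2 \<le> length w")
    case True
    obtain \<rho> where \<rho>: "\<forall>(c, w')\<in>set \<rho>. w' \<noteq> []"
      "\<And>\<kappa> X. YY \<kappa> w (wd [i] * X) - wd [i] * YY \<kappa> w X = lc \<rho> (\<lambda>w. YY \<kappa> w X)"
      "\<And>u. BB w (ad i (br u)) = lc \<rho> (\<lambda>w. BB w (br u))"
      using rho[OF True, of i] by blast
    have linlc: "clinear (\<lambda>R. lc \<rho> (\<lambda>w. cT w R))"
      by (induction \<rho>) (auto intro!: clinear_zero_map clinear_plus clinear_smult lin_cT)
    have "cT w (actT i (rw \<kappa> u)) = lc \<rho> (\<lambda>w. cT w (rw \<kappa> u)) + wd [i] * cT w (rw \<kappa> u)"
    proof (rule LT_eqI[OF _ _ _ R])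
      show "cT w (actT i (br v \<otimes>\<^sub>C wd u)) = lc \<rho> (\<lambda>w. cT w (br v \<otimes>\<^sub>C wd u)) + wd [i] * cT w (br v \<otimes>\<^sub>C wd u)" for v u
      proof -
        have "lc \<rho> (\<lambda>w. BB w (br v)) *\<^sub>C wd u = lc \<rho> (\<lambda>w. BB w (br v) *\<^sub>C wd u)"
          by (rule lc_map[of "\<lambda>x. x *\<^sub>C wd u"], rule clinearI) (simp_all add: scaleC_add_left scaleC_scaleC scaleC_cmul)
        then show ?thesis
          by (simp only: actT_tens clinear_add[OF lin_cT] cT_tens \<rho>(3) falg_scale_right wd_mult)
      qed
    qed (intro clinear_intros clinear_comps[OF lin_cT] lin_actT lin_cT linlc)+
    also have "lc \<rho> (\<lambda>w. cT w (rw \<kappa> u)) = lc \<rho> (\<lambda>w. YY \<kappa> w (wd u))"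
      using \<rho>(1) Cons.IH by (intro lc_cong) auto
    also have "\<dots> + wd [i] * cT w (rw \<kappa> u) = YY \<kappa> w (wd (i # u))"
      unfolding split using \<rho>(2)[of \<kappa> "wd u"] Cons by (simp add: algebra_simps)
    moreover have "mset w \<noteq> mset [i]"
      using True mset_eq_length[of w "[i]"] by auto
    then have "BB w (wd [i]) = 0"
      using BB_Fc[of "wd [i]" "mset [i]" w] wd_Fc[of "[i]"] by blast
    ultimately show ?thesis
      by (simp add: clinear_add[OF lin_cT] clinear_scale[OF lin_cT] cT_tens)
  next
    case False
    with Cons.prems have "length w = 1" by (cases "length w") auto
    then obtain b where w: "w = [b]" by (auto simp: length_Suc_conv)
    have "cT w (actT i (rw \<kappa> u)) = wd [i] * cT w (rw \<kappa> u)"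
    proof (rule LT_eqI[OF _ _ _ R])
      show "v \<noteq> [] \<Longrightarrow> cT w (actT i (br v \<otimes>\<^sub>C wd u)) = wd [i] * cT w (br v \<otimes>\<^sub>C wd u)" for v u
      proof -
        assume "v \<noteq> []"
        then have "mset w \<noteq> add_mset i (mset v)"
          using w by (cases v) auto
        then have "BB w (ad i (br v)) = 0"
          using BB_Fc[OF ad_Fc[OF br_Fc]] by blast
        then show ?thesis
          by (simp only: actT_tens clinear_add[OF lin_cT] cT_tens falg_scale_right wd_mult) simp
      qed
    qed (intro clinear_intros clinear_comps[OF lin_cT] lin_actT lin_cT)+
    moreover have "complex_of_real (d i) \<noteq> 0" using d_pos[of i] by simp
    ultimately show ?thesis
      using Cons.IH[OF Cons.prems] unfolding split
      by (simp add: w clinear_add[OF lin_cT] clinear_scale[OF lin_cT] cT_tens EE_f Hp_wd lookup_single when_def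
          scaleC_scaleC scaleC_cmul)
  qed
qed

definition radL :: "'n multiset \<Rightarrow> 'n falg set"
  where "radL c = {x \<in> Lie c. \<forall>w. BB w x = 0}"

text \<open>With \<beta> the sum of \<open>c\<close>, this is half of |\<kappa> + \<rho>|^2 -
  |\<kappa> + \<rho> - \<beta>|^2, where \<rho> is 1 on every simple coroot.\<close>

definition tcm :: "('n \<Rightarrow> int) \<Rightarrow> 'n multiset \<Rightarrow> real"
  where "tcm \<kappa> c = (\<Sum>i\<in>#c. d i * of_int (\<kappa> i + 1)) - (\<Sum>i\<in>#c. d i * of_int (pm i c)) / 2"

lemma bb_sym: "(\<Sum>i\<in>#c. d i * of_int (A $ i $ j)) = d j * of_int (pm j c)"
  by (induction c) (simp_all add: d_sym[of _ j] algebra_simps)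

lemma tc_tcm: "tc \<kappa> u = tcm \<kappa> (mset u)"
proof (induction u)
  case (Cons i u)
  have "(\<Sum>k\<in>#mset (i # u). d k * of_int (pm k (mset (i # u))))
      = d i * (2 + of_int (pm i (mset u))) + (\<Sum>k\<in>#mset u. d k * of_int (A $ k $ i)) + (\<Sum>k\<in>#mset u. d k * of_int (pm k (mset u)))"
    by (simp add: distrib_left sum_mset.distrib)
  then show ?case
    using Cons unfolding bb_sym by (simp add: tcm_def field_simps)
qed (simp add: tcm_def)

text \<open>The contractions of the Casimir element reduce its action to that of iterated brackets of the
  raising operators, up to Lie elements in the radical of the invariant form.\<close>

lemma casimir:
  assumes X: "X \<in> Fc \<beta>" and M: "csubspace M"
    and Q: "\<And>c. c \<subseteq># \<beta> \<Longrightarrow> ((\<forall>i. \<kappa> i = 0) \<longrightarrow> c \<noteq> \<beta>) \<Longrightarrow> Q c"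
    and 1: "\<And>c x Y. Q c \<Longrightarrow> x \<in> radL c \<Longrightarrow> x * Y \<in> M"
    and 2: "\<And>w x. w \<noteq> [] \<Longrightarrow> x * YY \<kappa> w X \<in> M"
  shows "complex_of_real (tcm \<kappa> \<beta>) *\<^sub>C X \<in> M"
proof -
  have "\<forall>c. \<exists>J x. J \<subseteq> {w. mset w = c} \<and> (\<forall>w\<in>J. x w \<in> Lie c) \<and>
      (\<forall>y\<in>Lie c. \<forall>w\<in>{w. mset w = c}. BB w (y - (\<Sum>w\<in>J. BB w y *\<^sub>C x w)) = 0)"
  proof
    fix c :: "'n multiset"
    have "finite {w. mset w = c}"
      by (rule finite_subset[OF _ finite_lists_length_eq[of UNIV "size c"]]) auto
    from finite_dual_basis[OF this lin_BB Lie_subspace, of c]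
    show "\<exists>J x. J \<subseteq> {w. mset w = c} \<and> (\<forall>w\<in>J. x w \<in> Lie c) \<and>
      (\<forall>y\<in>Lie c. \<forall>w\<in>{w. mset w = c}. BB w (y - (\<Sum>w\<in>J. BB w y *\<^sub>C x w)) = 0)" .
  qed
  from choice[OF this] obtain J where "\<forall>c. \<exists>x. J c \<subseteq> {w. mset w = c} \<and> (\<forall>w\<in>J c. x w \<in> Lie c) \<and>
      (\<forall>y\<in>Lie c. \<forall>w\<in>{w. mset w = c}. BB w (y - (\<Sum>w\<in>J c. BB w y *\<^sub>C x w)) = 0)" ..
  from choice[OF this] obtain x where *: "\<forall>c. J c \<subseteq> {w. mset w = c} \<and> (\<forall>w\<in>J c. x c w \<in> Lie c) \<and>
      (\<forall>y\<in>Lie c. \<forall>w\<in>{w. mset w = c}. BB w (y - (\<Sum>w\<in>J c. BB w y *\<^sub>C x c w)) = 0)" ..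
  have J: "\<And>c w. w \<in> J c \<Longrightarrow> mset w = c" "\<And>c w. w \<in> J c \<Longrightarrow> x c w \<in> Lie c"
      "\<And>c y w. y \<in> Lie c \<Longrightarrow> mset w = c \<Longrightarrow> BB w (y - (\<Sum>w\<in>J c. BB w y *\<^sub>C x c w)) = 0"
    using * by blast+
  define W where "W = {w. length w \<le> size \<beta> \<and> w \<noteq> [] \<and> w \<in> J (mset w)}"
  have finW: "finite W"
    by (rule finite_subset[OF _ finite_lists_length_le[of UNIV "size \<beta>"]]) (auto simp: W_def)
  define S where "S R = (\<Sum>w\<in>W. x (mset w) w * cT w R)" for R
  have linS: "clinear S"
    unfolding S_def[abs_def] by (intro clinear_sum_map clinear_mult_left lin_cT)
  let ?Q = "\<lambda>c. c \<subseteq># \<beta> \<and> Q c"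
  \<comment> \<open>Each Lie factor is expanded in the system \<open>x\<close>, dual to the words
    under \<open>BB\<close>; the error lies in the radical of the form, and premise \<open>1\<close>
    puts its products into \<open>M\<close>.\<close>
  have key: "mulT R - S R \<in> M" if "R \<in> LT ?Q" for R
  proof (rule LT_induct[OF clinear_minus[OF lin_mulT linS] M _ that])
    fix v u assume v: "v \<noteq> []" "mset v \<subseteq># \<beta> \<and> Q (mset v)"
    have "S (br v \<otimes>\<^sub>C wd u) = (\<Sum>w\<in>J (mset v). (BB w (br v) *\<^sub>C x (mset v) w) * wd u)"
      unfolding S_def
    proof (rule sum.mono_neutral_cong[OF _ finW])
      show "finite (J (mset v))"
        by (rule finite_subset[OF _ finite_lists_length_eq[of UNIV "length v"]]) (use J(1) in \<open>auto dest: mset_eq_length\<close>)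
      show "(BB w (br v) *\<^sub>C x (mset v) w) * wd u = 0" if "w \<in> J (mset v) - W" for w
        using that J(1)[of w "mset v"] v size_mset_mono[of "mset v" \<beta>] mset_eq_length[of w v]
        by (auto simp: W_def)
      show "x (mset w) w * cT w (br v \<otimes>\<^sub>C wd u) = 0" if "w \<in> W - J (mset v)" for w
        using that BB_Fc[OF br_Fc, of w v] by (cases "BB w (br v) = 0") (auto simp: W_def cT_tens)
      show "x (mset w) w * cT w (br v \<otimes>\<^sub>C wd u) = (BB w (br v) *\<^sub>C x (mset v) w) * wd u" if "w \<in> W \<inter> J (mset v)" for w
        using that J(1) by (auto simp: cT_tens falg_scale_left falg_scale_right)
    qed
    then have "mulT (br v \<otimes>\<^sub>C wd u) - S (br v \<otimes>\<^sub>C wd u) = (br v - (\<Sum>w\<in>J (mset v). BB w (br v) *\<^sub>C x (mset v) w)) * wd u"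
      by (simp add: mulT_tens left_diff_distrib sum_distrib_right)
    also have "\<dots> \<in> M"
    proof (rule 1)
      let ?y = "br v - (\<Sum>w\<in>J (mset v). BB w (br v) *\<^sub>C x (mset v) w)"
      have L: "?y \<in> Lie (mset v)"
        using J(2) by (auto intro!: subspace_intros Lie_subspace br_Lie)
      moreover have "BB w ?y = 0" for w
        using J(3)[OF br_Lie[OF HOL.refl], of w v] BB_Fc[OF Lie_Fc[OF L], of w] by blast
      ultimately show "?y \<in> radL (mset v)" by (simp add: radL_def)
    qed (use v in simp)
    finally show "mulT (br v \<otimes>\<^sub>C wd u) - S (br v \<otimes>\<^sub>C wd u) \<in> M" .
  qed
  have fin: "complex_of_real (tcm \<kappa> \<beta>) *\<^sub>C X - (\<Sum>w\<in>W. x (mset w) w * YY \<kappa> w X) \<in> M"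
  proof (rule Fc_induct[OF _ M _ X])
    show "clinear (\<lambda>X. complex_of_real (tcm \<kappa> \<beta>) *\<^sub>C X - (\<Sum>w\<in>W. x (mset w) w * YY \<kappa> w X))"
      by (intro clinear_minus clinear_smult clinear_id clinear_sum_map clinear_mult_left lin_YY)
    fix u assume u: "mset u = \<beta>"
    have "rw \<kappa> u \<in> LT ?Q"
    proof (rule rw_LT)
      fix v u' assume a: "mset v + mset u' = mset u" "(\<forall>i. \<kappa> i = 0) \<longrightarrow> u' \<noteq> []"
      then have "mset v \<subseteq># \<beta>" "(\<forall>i. \<kappa> i = 0) \<longrightarrow> mset v \<noteq> \<beta>" using u by auto
      with Q show "?Q (mset v)" by blast
    qed
    from key[OF this] show "complex_of_real (tcm \<kappa> \<beta>) *\<^sub>C wd u - (\<Sum>w\<in>W. x (mset w) w * YY \<kappa> w (wd u)) \<in> M"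
      by (simp add: mulT_rw tc_tcm u S_def cT_rw W_def)
  qed
  have "(\<Sum>w\<in>W. x (mset w) w * YY \<kappa> w X) \<in> M"
    by (intro subspace_intros M 2) (simp add: W_def)
  from complex_vector.subspace_add[OF M fin this] show ?thesis by simp
qed

section \<open>Submodules generated by the Serre relations\<close>

definition serre :: "'n \<Rightarrow> 'n \<Rightarrow> 'n falg"
  where "serre i j = (ad i ^^ nat (1 - A $ i $ j)) (wd [j])"

definition J0 :: "'n falg set"
  where "J0 = cspan {wd u * serre i j * wd v | u v i j. i \<noteq> j}"

definition Jk :: "('n \<Rightarrow> nat) \<Rightarrow> 'n falg set"
  where "Jk \<kappa> = cspan ({wd u * serre i j * wd v | u v i j. i \<noteq> j}
    \<union> {wd u * wd (replicate (Suc (\<kappa> j)) j) | u j. True})"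

lemma J0_subspace: "csubspace J0" and Jk_subspace: "csubspace (Jk \<kappa>)"
  by (simp_all add: J0_def Jk_def complex_vector.subspace_span)

lemma J0_Jk: "X \<in> J0 \<Longrightarrow> X \<in> Jk \<kappa>"
  unfolding J0_def Jk_def by (rule set_mp[OF complex_vector.span_mono]) auto

lemma J0_induct:
  assumes "clinear f" "csubspace S" "\<And>u v i j. i \<noteq> j \<Longrightarrow> f (wd u * serre i j * wd v) \<in> S" "X \<in> J0"
  shows "f X \<in> S"
  by (rule span_image_sub[OF assms(1,2) _ assms(4)[unfolded J0_def]]) (use assms(3) in auto)

lemma Jk_induct:
  assumes "clinear f" "csubspace S" "\<And>u v i j. i \<noteq> j \<Longrightarrow> f (wd u * serre i j * wd v) \<in> S"
    "\<And>u j. f (wd u * wd (replicate (Suc (\<kappa> j)) j)) \<in> S" "X \<in> Jk \<kappa>"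
  shows "f X \<in> S"
  by (rule span_image_sub[OF assms(1,2) _ assms(5)[unfolded Jk_def]]) (use assms(3,4) in auto)

lemma J0_base: "i \<noteq> j \<Longrightarrow> wd u * serre i j * wd v \<in> J0"
  and Jk_base: "wd u * wd (replicate (Suc (\<kappa> j)) j) \<in> Jk \<kappa>"
  unfolding J0_def Jk_def by (rule complex_vector.span_base; blast)+

lemma J0_mult_left: "X \<in> J0 \<Longrightarrow> Y * X \<in> J0"
proof (rule clinear_sub_singleI[where X=Y])
  fix u assume "X \<in> J0"
  then show "wd u * X \<in> J0"
    by (rule J0_induct[rotated -1])
       (auto intro!: clinear_intros J0_subspace J0_base simp: mult.assoc[symmetric] wd_mult)
qed (intro clinear_intros J0_subspace)+

lemma J0_mult_right: "X \<in> J0 \<Longrightarrow> X * Y \<in> J0"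
proof (rule clinear_sub_singleI[where X=Y])
  fix u assume "X \<in> J0"
  then show "X * wd u \<in> J0"
  proof (rule J0_induct[rotated -1])
    show "i \<noteq> j \<Longrightarrow> wd u' * serre i j * wd v * wd u \<in> J0" for u' v i j
      using J0_base[of i j u' "v @ u"] by (simp add: mult.assoc wd_mult)
  qed (intro clinear_intros J0_subspace)+
qed (intro clinear_intros J0_subspace)+

lemma serre_J0: "i \<noteq> j \<Longrightarrow> serre i j \<in> J0"
  using J0_base[of i j "[]" "[]"] by (simp add: wd_Nil)

lemma Jk_mult_left: "X \<in> Jk \<kappa> \<Longrightarrow> Y * X \<in> Jk \<kappa>"
proof (rule clinear_sub_singleI[where X=Y])
  fix u assume "X \<in> Jk \<kappa>"
  then show "wd u * X \<in> Jk \<kappa>"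
  proof (rule Jk_induct[rotated -1])
    show "i \<noteq> j \<Longrightarrow> wd u * (wd u' * serre i j * wd v) \<in> Jk \<kappa>" for u' v i j
      by (auto intro!: J0_Jk J0_base simp: mult.assoc[symmetric] wd_mult)
    show "wd u * (wd u' * wd (replicate (Suc (\<kappa> j)) j)) \<in> Jk \<kappa>" for u' j
      unfolding mult.assoc[symmetric] wd_mult[of u u'] by (rule Jk_base)
  qed (intro clinear_intros Jk_subspace)+
qed (intro clinear_intros Jk_subspace)+

lemma ad_pow_br: "(ad i ^^ n) (wd [j]) = br (replicate n i @ [j])"
  by (induction n) (simp_all add: br_Cons)

lemma ad_pow_Fc: "(ad i ^^ n) (wd [j]) \<in> Fc (replicate_mset n i + {#j#})"
  unfolding ad_pow_br using br_Fc[of "replicate n i @ [j]"] by simp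

lemma pm_replicate [simp]: "pm a (replicate_mset n i) = int n * A $ a $ i"
  by (induction n) (simp_all add: distrib_right)

lemma E0_ad_pow:
  assumes "i \<noteq> j"
  shows "E0 a ((ad i ^^ Suc n) (wd [j])) =
    (if a = i then - (of_int (int (Suc n) * (A $ i $ j + int n)) *\<^sub>C (ad i ^^ n) (wd [j]))
     else if a = j \<and> n = 0 then of_int (A $ j $ i) *\<^sub>C wd [i] else 0)"
proof (induction n)
  case 0
  then show ?case using assms der_ad_base(1)[of a i j] by (auto simp: clinear_zero[OF lin_ad])
next
  case (Suc n)
  let ?X = "(ad i ^^ Suc n) (wd [j])"
  have "E0 a (ad i ?X) = ad i (E0 a ?X) - (if a = i then of_int (pm a (replicate_mset (Suc n) i + {#j#})) *\<^sub>C ?X else 0)"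
    using der_ad(1)[OF _ ad_pow_Fc[of "Suc n" i j], of a i] der_br[of "replicate (Suc n) i @ [j]" a]
    by (simp add: ad_pow_br del: replicate_Suc funpow.simps)
  moreover have "ad i (wd [i]) = 0" by (simp add: ad_def)
  ultimately have "E0 a (ad i ?X) = (if a = i then - (of_int (int (Suc n) * (A $ i $ j + int n)) *\<^sub>C ?X)
      - of_int (int (Suc n) * 2 + A $ i $ j) *\<^sub>C ?X else 0)"
    unfolding Suc by (auto simp: clinear_neg[OF lin_ad] ad_simps)
  also have "\<dots> = (if a = i then - (of_int (int (Suc (Suc n)) * (A $ i $ j + int (Suc n))) *\<^sub>C ?X) else 0)"
  proof -
    have "int (Suc (Suc n)) * (A $ i $ j + int (Suc n)) = int (Suc n) * (A $ i $ j + int n) + (int (Suc n) * 2 + A $ i $ j)"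
      by (simp add: algebra_simps)
    then have "complex_of_int (int (Suc (Suc n)) * (A $ i $ j + int (Suc n))) =
        of_int (int (Suc n) * (A $ i $ j + int n)) + of_int (int (Suc n) * 2 + A $ i $ j)"
      by (simp only: of_int_add)
    then show ?thesis by (simp only: scaleC_add_left minus_add_distrib add_uminus_conv_diff)
  qed
  finally show ?case by simp
qed

text \<open>The string computation produces the factor \<open>A $ i $ j + int n\<close>, which
  vanishes at the Serre exponent. When that exponent is 1 there is also a term with
  \<open>A $ j $ i\<close>, which is zero by \<open>zero_sym\<close>.\<close>

lemma E0_serre: "i \<noteq> j \<Longrightarrow> E0 a (serre i j) = 0" and der_serre: "i \<noteq> j \<Longrightarrow> der a (serre i j)"
proof -
  assume ij: "i \<noteq> j"
  obtain n where n: "nat (1 - A $ i $ j) = Suc n" "A $ i $ j + int n = 0"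
    using off[OF ij] by (intro that[of "nat (- (A $ i $ j))"]) auto
  have "n = 0 \<Longrightarrow> A $ j $ i = 0"
    using n zero_sym[of i j] by simp
  then show "E0 a (serre i j) = 0"
    unfolding serre_def n(1) E0_ad_pow[OF ij] n(2) by auto
  show "der a (serre i j)"
    unfolding serre_def n(1) ad_pow_br by (rule der_br) simp
qed

lemma serre_Fc: "serre i j \<in> Fc (replicate_mset (nat (1 - A $ i $ j)) i + {#j#})"
  unfolding serre_def by (rule ad_pow_Fc)

lemma EE_wd_mult:
  assumes S: "csubspace S" "\<And>u. wd u * g \<in> S" "\<And>\<kappa> i. EE \<kappa> i g \<in> S" "\<And>i X. X \<in> S \<Longrightarrow> wd [i] * X \<in> S" and g: "g \<in> Fc c"
  shows "EE \<kappa> i (wd u * g) \<in> S"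
proof (induction u)
  case (Cons j u)
  have "wd u * g \<in> Fc (mset u + c)" by (intro Fc_mult wd_Fc g) simp
  then have "Hp \<kappa> i (wd u * g) \<in> S"
    using S(2) by (simp add: Hp_Fc complex_vector.subspace_scale[OF S(1)])
  with Cons show ?case
    unfolding wd_Cons[of j u] mult.assoc EE_f
    by (auto intro!: complex_vector.subspace_add[OF S(1)] S(4) complex_vector.subspace_0[OF S(1)])
qed (use S in \<open>simp add: wd_Nil\<close>)

lemma EE_J0: "X \<in> J0 \<Longrightarrow> EE \<kappa> i X \<in> J0"
proof (erule J0_induct[rotated -1])
  fix u v i' j assume ij: "(i'::'n) \<noteq> j"
  have "EE \<kappa> i (serre i' j * wd v) = serre i' j * EE \<kappa> i (wd v)" for \<kappa> i
    using der_serre[OF ij, of i] by (simp add: der_def E0_serre[OF ij])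
  then have "EE \<kappa> i (serre i' j * wd v) \<in> J0" for \<kappa> i
    by (simp add: J0_mult_right serre_J0 ij)
  then show "EE \<kappa> i (wd u * serre i' j * wd v) \<in> J0"
    unfolding mult.assoc
    using J0_mult_right[OF serre_J0[OF ij]]
    by (intro EE_wd_mult[OF J0_subspace _ _ _ Fc_mult[OF serre_Fc wd_Fc[OF HOL.refl]]])
       (auto intro: J0_mult_left)
qed (intro lin_EE J0_subspace)+

abbreviation ik :: "('n \<Rightarrow> nat) \<Rightarrow> 'n \<Rightarrow> int" where "ik \<kappa> \<equiv> \<lambda>i. int (\<kappa> i)"

lemma EE_replicate: "EE \<kappa> i (wd (replicate (Suc n) j)) =
    (if i = j then (of_nat (Suc n) * of_int (\<kappa> j - int n)) *\<^sub>C wd (replicate n j) else 0)"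
proof (induction n)
  case (Suc n)
  have *: "EE \<kappa> i (wd (replicate (Suc (Suc n)) j)) = wd [j] * EE \<kappa> i (wd (replicate (Suc n) j))
      + (if i = j then Hp \<kappa> i (wd (replicate (Suc n) j)) else 0)"
    using EE_f[of \<kappa> i j "wd (replicate (Suc n) j)"] by (simp add: wd_mult)
  then show ?case
  proof (cases "i = j")
    case True
    have c: "of_nat (Suc n) * of_int (\<kappa> j - int n) + of_int (\<kappa> j - 2 * int (Suc n)) = (of_nat (Suc (Suc n)) * of_int (\<kappa> j - int (Suc n)) :: complex)"
      by (simp add: algebra_simps)
    have "pm j (mset (replicate (Suc n) j)) = 2 * int (Suc n)"
      by (simp add: algebra_simps)
    then have "EE \<kappa> i (wd (replicate (Suc (Suc n)) j)) = (of_nat (Suc n) * of_int (\<kappa> j - int n)) *\<^sub>C (wd ([j] @ replicate n j))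
        + of_int (\<kappa> j - 2 * int (Suc n)) *\<^sub>C wd (replicate (Suc n) j)"
      using * True unfolding Suc Hp_wd by (simp only: falg_scale_right wd_mult simp_thms if_True)
    then show ?thesis
      using True c by (simp only: append_Cons append_Nil replicate_Suc[symmetric] scaleC_add_left[symmetric] simp_thms if_True)
  qed (use * Suc in simp)
qed (simp add: EE_wd wd_Nil)

text \<open>The generators are singular vectors: Serre elements by \<open>E0_serre\<close>, and the
  power \<open>Suc (\<kappa> j)\<close> of f_j because the sl_2 coefficient in
  \<open>EE_replicate\<close> is then zero.\<close>

lemma EE_Jk: "X \<in> Jk \<kappa> \<Longrightarrow> EE (ik \<kappa>) i X \<in> Jk \<kappa>"
proof (erule Jk_induct[rotated -1])
  show "i' \<noteq> j \<Longrightarrow> EE (ik \<kappa>) i (wd u * serre i' j * wd v) \<in> Jk \<kappa>" for u v i' j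
    by (intro J0_Jk EE_J0 J0_base)
  show "EE (ik \<kappa>) i (wd u * wd (replicate (Suc (\<kappa> j)) j)) \<in> Jk \<kappa>" for u j
  proof (induction u)
    case Nil
    have "EE (ik \<kappa>) i (wd (replicate (Suc (\<kappa> j)) j)) = 0"
      unfolding EE_replicate by simp
    then show ?case by (simp add: wd_Nil complex_vector.subspace_0[OF Jk_subspace] del: replicate_Suc)
  next
    case (Cons k u)
    have "wd u * wd (replicate (Suc (\<kappa> j)) j) \<in> Fc (mset u + mset (replicate (Suc (\<kappa> j)) j))"
      by (intro Fc_mult wd_Fc) auto
    then have "Hp (ik \<kappa>) i (wd u * wd (replicate (Suc (\<kappa> j)) j)) \<in> Jk \<kappa>"
      using Jk_base[of u \<kappa> j] by (simp add: Hp_Fc complex_vector.subspace_scale[OF Jk_subspace] del: replicate_Suc)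
    with Cons show ?case
      unfolding wd_Cons[of k u] mult.assoc EE_f
      by (auto intro!: complex_vector.subspace_add[OF Jk_subspace] Jk_mult_left complex_vector.subspace_0[OF Jk_subspace])
  qed
qed (intro lin_EE Jk_subspace)+

lemma YY_stable:
  assumes S: "csubspace S" "\<And>X i. X \<in> S \<Longrightarrow> EE \<kappa> i X \<in> S"
  shows "X \<in> S \<Longrightarrow> YY \<kappa> w X \<in> S"
    and "(\<And>i. EE \<kappa> i X \<in> S) \<Longrightarrow> YY \<kappa> w X \<in> S"
proof -
  show *: "X \<in> S \<Longrightarrow> YY \<kappa> w X \<in> S" for w X
    by (induction w arbitrary: X) (auto intro!: complex_vector.subspace_0[OF S(1)] complex_vector.subspace_diff[OF S(1)] S(2))
  show "(\<And>i. EE \<kappa> i X \<in> S) \<Longrightarrow> YY \<kappa> w X \<in> S"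
  proof (induction w)
    case (Cons a w)
    then have "YY \<kappa> w X \<in> S" "EE \<kappa> a X \<in> S" by blast+
    then show ?case by (simp add: complex_vector.subspace_diff[OF S(1)] S(2) *[of "EE \<kappa> a X"])
  qed (simp add: complex_vector.subspace_0[OF S(1)])
qed

lemma ad_pow_mult: "(ad i ^^ n) (X * Y) = (\<Sum>k\<le>n. of_nat (n choose k) *\<^sub>C ((ad i ^^ k) X * (ad i ^^ (n - k)) Y))"
  by (rule leibniz[OF lin_ad]) (simp add: ad_def algebra_simps)

lemma pow_mult_ad: "wd (replicate n i) * X = (\<Sum>k\<le>n. of_nat (n choose k) *\<^sub>C ((ad i ^^ k) X * wd (replicate (n - k) i)))"
  using leibniz[where n = n and G = "\<lambda>X. wd [i] * X" and B = "(*)" and a = "ad i" and b = "\<lambda>X. wd [i] * X" and x = X and y = 1]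
  by (simp add: clinear_intros ad_def algebra_simps wd_pow)

lemma ad_J0: "X \<in> J0 \<Longrightarrow> ad i X \<in> J0"
  unfolding ad_def by (intro complex_vector.subspace_diff J0_subspace J0_mult_left J0_mult_right)

lemma eventually_subspace:
  fixes f :: "nat \<Rightarrow> 'v::complex_vector \<Rightarrow> 'w::complex_vector"
  assumes "csubspace S" "\<And>n. clinear (f n)"
  shows "csubspace {X. \<exists>N. \<forall>n\<ge>N. f n X \<in> S}"
proof -
  note S = complex_vector.subspace_0[OF assms(1)] complex_vector.subspace_add[OF assms(1)] complex_vector.subspace_scale[OF assms(1)]
  show ?thesis
    unfolding complex_vector.subspace_def mem_Collect_eq
  proof (intro conjI allI impI ballI)
    show "\<exists>N. \<forall>n\<ge>N. f n 0 \<in> S" using S(1) by (simp add: clinear_zero[OF assms(2)])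
    show "\<exists>N. \<forall>n\<ge>N. f n (c *\<^sub>C x) \<in> S" if "x \<in> {X. \<exists>N. \<forall>n\<ge>N. f n X \<in> S}" for c x
      using that S(3) by (auto simp: clinear_scale[OF assms(2)])
    show "\<exists>N. \<forall>n\<ge>N. f n (x + y) \<in> S" if x: "x \<in> {X. \<exists>N. \<forall>n\<ge>N. f n X \<in> S}" and y: "y \<in> {X. \<exists>N. \<forall>n\<ge>N. f n X \<in> S}" for x y
    proof -
      from x y obtain N M where "\<forall>n\<ge>N. f n x \<in> S" "\<forall>n\<ge>M. f n y \<in> S" by auto
      then show ?thesis
        by (intro exI[of _ "max N M"] allI impI, subst clinear_add[OF assms(2)], intro S(2)) auto
    qed
  qed
qed

text \<open>The Serre relations settle the letters; for a product, every term of the Leibniz formula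
  has a large exponent on one of the factors.\<close>

lemma ad_nilpotent: "\<exists>N. \<forall>n\<ge>N. (ad i ^^ n) X \<in> J0"
proof -
  let ?S = "{X. \<exists>N. \<forall>n\<ge>N. (ad i ^^ n) X \<in> J0}"
  have sub: "csubspace ?S"
    by (rule eventually_subspace[OF J0_subspace clinear_pow[OF lin_ad]])
  have letter: "wd [j] \<in> ?S" for j
  proof (cases "i = j")
    case True
    have "(ad i ^^ Suc n) (wd [i]) = 0" for n
      by (induction n) (simp_all add: ad_def)
    then show ?thesis
      using True complex_vector.subspace_0[OF J0_subspace] by (auto intro!: exI[of _ 1] simp: Suc_le_eq gr0_conv_Suc simp del: funpow.simps)
  next
    case False
    have "(ad i ^^ (n + nat (1 - A $ i $ j))) (wd [j]) \<in> J0" for n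
      by (induction n) (use serre_J0[OF False] in \<open>auto simp: serre_def ad_J0\<close>)
    then show ?thesis by (auto intro!: exI[of _ "nat (1 - A $ i $ j)"]) (metis le_add_diff_inverse2)
  qed
  have "wd u \<in> ?S" for u
  proof (induction u)
    case Nil
    have "(ad i ^^ Suc n) 1 = 0" for n
      by (induction n) (simp_all add: ad_def)
    then show ?case
      using complex_vector.subspace_0[OF J0_subspace] by (auto intro!: exI[of _ 1] simp: wd_Nil Suc_le_eq gr0_conv_Suc simp del: funpow.simps)
  next
    case (Cons j u)
    then obtain N M where N: "\<And>n. n \<ge> N \<Longrightarrow> (ad i ^^ n) (wd [j]) \<in> J0" "\<And>n. n \<ge> M \<Longrightarrow> (ad i ^^ n) (wd u) \<in> J0"
      using letter[of j] by auto
    have "(ad i ^^ n) (wd (j # u)) \<in> J0" if "n \<ge> N + M" for n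
      unfolding wd_Cons[of j u] ad_pow_mult
    proof (intro subspace_intros J0_subspace)
      fix k assume "k \<in> {..n}"
      with that have "k \<ge> N \<or> n - k \<ge> M" by auto
      then consider "k \<ge> N" | "n - k \<ge> M" by blast
      then show "(ad i ^^ k) (wd [j]) * (ad i ^^ (n - k)) (wd u) \<in> J0"
        by cases (auto intro: J0_mult_left J0_mult_right N)
    qed
    then show ?case by auto
  qed
  then have "X \<in> ?S"
    using clinear_sub_singleI[OF clinear_id sub] by blast
  then show ?thesis by simp
qed

text \<open>Integrability of the quotient by \<open>Jk \<kappa>\<close>: commuting f_i^n past the
  first letter leaves in each term either a high commutator, which is in \<open>J0\<close>, or a
  high power of f_i on the shorter word.\<close>

lemma pow_nilpotent: "\<exists>N. \<forall>n\<ge>N. wd (replicate n i) * X \<in> Jk \<kappa>"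
proof -
  let ?S = "{X. \<exists>N. \<forall>n\<ge>N. wd (replicate n i) * X \<in> Jk \<kappa>}"
  have sub: "csubspace ?S"
    by (rule eventually_subspace[OF Jk_subspace]) (intro clinear_intros)
  have "wd u \<in> ?S" for u
  proof (induction u)
    case Nil
    have "wd (replicate n i) \<in> Jk \<kappa>" if "n \<ge> Suc (\<kappa> i)" for n
      using Jk_base[of "replicate (n - Suc (\<kappa> i)) i" \<kappa> i] that
      by (simp add: wd_mult replicate_add[symmetric] del: replicate_Suc)
    then show ?case by (auto simp: wd_Nil)
  next
    case (Cons j u)
    then obtain N where N: "\<And>n. n \<ge> N \<Longrightarrow> wd (replicate n i) * wd u \<in> Jk \<kappa>" by auto
    obtain M where M: "\<And>n. n \<ge> M \<Longrightarrow> (ad i ^^ n) (wd [j]) \<in> J0" using ad_nilpotent by blast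
    have "wd (replicate n i) * wd (j # u) \<in> Jk \<kappa>" if "n \<ge> N + M" for n
      unfolding wd_Cons[of j u] mult.assoc[symmetric] pow_mult_ad sum_distrib_right falg_scale_left
    proof (intro subspace_intros Jk_subspace)
      fix k assume "k \<in> {..n}"
      with that have "k \<ge> M \<or> n - k \<ge> N" by auto
      then consider "k \<ge> M" | "n - k \<ge> N" by blast
      then show "(ad i ^^ k) (wd [j]) * wd (replicate (n - k) i) * wd u \<in> Jk \<kappa>"
      proof cases
        case 1
        then show ?thesis by (intro J0_Jk J0_mult_right M)
      next
        case 2
        then show ?thesis unfolding mult.assoc by (intro Jk_mult_left N)
      qed
    qed
    then show ?case by auto
  qed
  then have "X \<in> ?S"
    using clinear_sub_singleI[OF clinear_id sub] by blast
  then show ?thesis by simp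
qed

lemma sum_mset_nonneg_real: "(\<And>x. x \<in># c \<Longrightarrow> f x \<ge> (0::real)) \<Longrightarrow> (\<Sum>x\<in>#c. f x) \<ge> 0"
  by (induction c) auto

lemma sum_mset_pos_real: "c \<noteq> {#} \<Longrightarrow> (\<And>x. x \<in># c \<Longrightarrow> f x > (0::real)) \<Longrightarrow> (\<Sum>x\<in>#c. f x) > 0"
proof (induction c)
  case (add x c)
  then have "(\<Sum>x\<in>#c. f x) \<ge> 0" by (intro sum_mset_nonneg_real less_imp_le) simp
  with add.prems(2)[of x] show ?case by simp
qed simp

text \<open>The Serre elements generate the radical of the invariant form (Gabber--Kac): the Casimir
  eigenvalue can only vanish in a degree that a simple reflection lowers.\<close>

lemma radL_J0: "x \<in> radL c \<Longrightarrow> x \<in> J0"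
proof (induction "size c" arbitrary: c x rule: less_induct)
  case less
  have L: "x \<in> Lie c" and B: "\<And>w. BB w x = 0" using less.prems by (auto simp: radL_def)
  consider "c = {#}" | i where "c = {#i#}" | "2 \<le> size c"
    by (metis One_nat_def less_2_cases not_le size_1_singleton_mset size_eq_0_iff_empty)
  then show ?case
  proof cases
    case 1
    then show ?thesis using Lie_empty L complex_vector.subspace_0[OF J0_subspace] by auto
  next
    case 2
    have "x - Poly_Mapping.lookup x [i] *\<^sub>C wd [i] \<in> {0}"
    proof (rule Lie_induct[OF _ complex_vector.subspace_single_0 _ L])
      show "clinear (\<lambda>x. x - Poly_Mapping.lookup x [i] *\<^sub>C wd [i])"
        by (rule clinearI) (simp_all add: lookup_add lookup_scaleC algebra_simps scaleC_add_left scaleC_scaleC scaleC_cmul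
          complex_vector.scale_right_diff_distrib)
      show "mset u = c \<Longrightarrow> br u - Poly_Mapping.lookup (br u) [i] *\<^sub>C wd [i] \<in> {0}" for u
        using 2 by auto
    qed
    moreover have "Poly_Mapping.lookup x [i] = 0"
      using B[of "[i]"] d_pos[of i] by auto
    ultimately show ?thesis using complex_vector.subspace_0[OF J0_subspace] by auto
  next
    case 3
    have Ex: "E0 i x \<in> J0" for i
    proof (cases "i \<in># c")
      case True
      have "E0 i x \<in> radL (c - {#i#})"
        unfolding radL_def
      proof (intro CollectI conjI allI)
        show Li: "E0 i x \<in> Lie (c - {#i#})" by (rule E0_Lie[OF L True])
        show "BB w (E0 i x) = 0" for w
          using B[of "i # w"] by (cases "w = []") auto
      qed
      with True less.hyps[of "c - {#i#}"] show ?thesis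
        by (simp add: size_Diff1_less)
    next
      case False
      with EE_Fc0[OF Lie_Fc[OF L]] show ?thesis by (simp add: complex_vector.subspace_0[OF J0_subspace])
    qed
    have main: "complex_of_real (tcm (\<lambda>_. 0) c) *\<^sub>C x \<in> J0"
    proof (rule casimir[where Q="\<lambda>c'. size c' < size c", OF Lie_Fc[OF L] J0_subspace])
      show "c' \<subseteq># c \<Longrightarrow> (\<forall>i. 0 = (0::int)) \<longrightarrow> c' \<noteq> c \<Longrightarrow> size c' < size c" for c'
        using mset_subset_size[of c' c] by (simp add: subset_mset_def)
      show "size c' < size c \<Longrightarrow> x' \<in> radL c' \<Longrightarrow> x' * Y \<in> J0" for c' x' Y
        using less.hyps by (auto intro: J0_mult_right)
      show "x' * YY (\<lambda>_. 0) w x \<in> J0" for w x'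
        by (intro J0_mult_left YY_stable(2) J0_subspace EE_J0 Ex)
    qed
    show ?thesis
    proof (cases "tcm (\<lambda>_. 0) c = 0")
      case False
      then show ?thesis
        using complex_vector.subspace_scale[OF J0_subspace main, of "1 / complex_of_real (tcm (\<lambda>_. 0) c)"]
        by (simp add: scaleC_scaleC)
    next
      \<comment> \<open>With \<beta> the sum of \<open>c\<close>, a zero eigenvalue means (\<beta>,
        \<beta>) = 2 (\<rho>, \<beta>) > 0, so some \<open>i\<close> in \<open>c\<close> has a
        coroot positive on \<beta>. Modulo \<open>J0\<close>, \<open>x\<close> is killed by e_i and
        has negative weight, while ad f_i is nilpotent on it; by sl_2 theory \<open>x\<close> is in
        \<open>J0\<close>.\<close>
      case True
      have "(\<Sum>i\<in>#c. d i) > 0"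
        using 3 d_pos by (intro sum_mset_pos_real) auto
      with True have "(\<Sum>i\<in>#c. d i * of_int (pm i c)) > 0" by (simp add: tcm_def)
      then obtain i where i: "i \<in># c" "pm i c > 0"
      proof -
        have "\<exists>i\<in>#c. d i * of_int (pm i c) > 0"
        proof (rule ccontr)
          assume "\<not> ?thesis"
          then have "(\<Sum>i\<in>#c. d i * of_int (pm i c)) \<le> (\<Sum>i\<in>#c. 0)"
            by (intro sum_mset_mono) auto
          with \<open>(\<Sum>i\<in>#c. d i * of_int (pm i c)) > 0\<close> show False by simp
        qed
        then show ?thesis using that d_pos by (auto simp: zero_less_mult_iff not_less[symmetric] dest: less_asym)
      qed
      have dx: "der i (br u)" if "mset u = c" for u
        using that 3 by (intro der_br) auto
      have sub: "csubspace {X. der i X}"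
        unfolding complex_vector.subspace_def der_def
        by (auto simp: EE_simps distrib_right falg_scale_left falg_scale_right scaleC_add_right)
      have "der i x"
        using Lie_induct[OF clinear_id sub _ L] dx by auto
      have an: "der i ((ad i ^^ n) x) \<and> (ad i ^^ n) x \<in> Fc (replicate_mset n i + c)" for n
      proof (induction n)
        case 0
        then show ?case using \<open>der i x\<close> Lie_Fc[OF L] by simp
      next
        case (Suc n)
        then show ?case using der_ad(2)[of i "(ad i ^^ n) x" _ i] ad_Fc[of "(ad i ^^ n) x" _ i] by auto
      qed
      have E: "E0 i ((ad i ^^ n) x) + of_int (int n * (pm i c + int n - 1)) *\<^sub>C (ad i ^^ (n - 1)) x \<in> J0" for n
      proof (induction n)
        case 0
        then show ?case using Ex by simp
      next
        case (Suc n)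
        have 1: "E0 i ((ad i ^^ Suc n) x) = ad i (E0 i ((ad i ^^ n) x)) - of_int (2 * int n + pm i c) *\<^sub>C (ad i ^^ n) x"
          using der_ad(1)[of i "(ad i ^^ n) x" "replicate_mset n i + c" i] an[of n] by (simp add: mult.commute)
        have "ad i ((ad i ^^ (n - 1)) x) = (ad i ^^ n) x" if "n \<noteq> 0"
          using that by (cases n) auto
        then have 2: "ad i (E0 i ((ad i ^^ n) x) + of_int (int n * (pm i c + int n - 1)) *\<^sub>C (ad i ^^ (n - 1)) x)
           = ad i (E0 i ((ad i ^^ n) x)) + of_int (int n * (pm i c + int n - 1)) *\<^sub>C (ad i ^^ n) x"
          by (cases "n = 0") (auto simp: ad_simps)
        have "E0 i ((ad i ^^ Suc n) x) + of_int (int (Suc n) * (pm i c + int (Suc n) - 1)) *\<^sub>C (ad i ^^ n) x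
           = ad i (E0 i ((ad i ^^ n) x)) + of_int (int n * (pm i c + int n - 1)) *\<^sub>C (ad i ^^ n) x"
        proof -
          have "a - u *\<^sub>C y + s *\<^sub>C y = a + t *\<^sub>C y" if "s = t + u" for a y :: "'n falg" and s t u
            unfolding that scaleC_add_left by simp
          from this[of "of_int (int (Suc n) * (pm i c + int (Suc n) - 1))" "of_int (int n * (pm i c + int n - 1))"
              "of_int (2 * int n + pm i c)"]
          show ?thesis unfolding 1 of_int_add[symmetric] of_int_eq_iff by (simp add: algebra_simps)
        qed
        also have "\<dots> \<in> J0" unfolding 2[symmetric] by (rule ad_J0[OF Suc])
        finally show ?case by simp
      qed
      have step: "(ad i ^^ n) x \<in> J0" if "(ad i ^^ Suc n) x \<in> J0" for n
      proof -
        have "E0 i ((ad i ^^ Suc n) x) \<in> J0" by (rule EE_J0[OF that])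
        from complex_vector.subspace_diff[OF J0_subspace E[of "Suc n"] this]
        have "of_int (int (Suc n) * (pm i c + int n)) *\<^sub>C (ad i ^^ n) x \<in> J0" by simp
        from complex_vector.subspace_scale[OF J0_subspace this, of "1 / of_int (int (Suc n) * (pm i c + int n))"]
        show ?thesis using i(2) by (simp add: scaleC_scaleC del: of_int_mult of_int_add)
      qed
      obtain N where "(ad i ^^ N) x \<in> J0" using ad_nilpotent by blast
      from descend[of "\<lambda>n. (ad i ^^ n) x \<in> J0", OF step this] show ?thesis by simp
    qed
  qed
qed

text \<open>\<open>ecoef \<kappa> w X\<close> is the coefficient of the highest weight vector in \<open>e\<^sub>w X\<close>; hence \<open>Rad_Jk\<close> below
  says that \<open>Jk \<kappa>\<close> is the maximal proper submodule.\<close>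

primrec ecoef :: "('n \<Rightarrow> int) \<Rightarrow> 'n list \<Rightarrow> 'n falg \<Rightarrow> complex" where
  "ecoef \<kappa> [] X = Poly_Mapping.lookup X []"
| "ecoef \<kappa> (i # w) X = ecoef \<kappa> w (EE \<kappa> i X)"

lemma lin_ecoef: "clinear (ecoef \<kappa> w)"
proof (induction w)
  case Nil
  show ?case by (rule clinearI) (simp_all add: lookup_add lookup_scaleC scaleC_cmul)
next
  case (Cons i w)
  from clinear_comps[OF this lin_EE[of \<kappa> i]] show ?case by simp
qed

lemma ecoef_Fc: "X \<in> Fc c \<Longrightarrow> ecoef \<kappa> w X \<noteq> 0 \<Longrightarrow> mset w = c"
proof (induction w arbitrary: X c)
  case Nil
  have "c \<noteq> {#} \<Longrightarrow> Poly_Mapping.lookup X [] \<in> {0}"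
  proof (rule Fc_induct[OF _ complex_vector.subspace_single_0 _ Nil(1)])
    show "clinear (\<lambda>X::'n falg. Poly_Mapping.lookup X [])"
      by (rule clinearI) (simp_all add: lookup_add lookup_scaleC scaleC_cmul)
  qed (auto simp: lookup_single when_def)
  with Nil show ?case by auto
next
  case (Cons i w)
  then have "i \<in># c"
    using EE_Fc0[OF Cons(2), of i \<kappa>] by (cases "i \<in># c") (auto simp: clinear_zero[OF lin_ecoef])
  with Cons.IH[OF EE_Fc[OF Cons(2)]] Cons.prems show ?case by auto
qed

definition proj :: "'n multiset \<Rightarrow> 'n falg \<Rightarrow> 'n falg"
  where "proj c = ext (\<lambda>u. if mset u = c then wd u else 0)"

lemma proj_Fc: "proj c X \<in> Fc c"
  unfolding proj_def by (rule clinear_sub_singleI[OF clinear_ext Fc_subspace]) (auto intro: wd_Fc simp: complex_vector.subspace_0[OF Fc_subspace])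

lemma sum_proj: "X = (\<Sum>c\<in>mset ` Poly_Mapping.keys X. proj c X)"
proof -
  have "(\<Sum>c\<in>mset ` Poly_Mapping.keys X. proj c X)
      = (\<Sum>u\<in>Poly_Mapping.keys X. \<Sum>c\<in>mset ` Poly_Mapping.keys X. if mset u = c then Poly_Mapping.lookup X u *\<^sub>C wd u else 0)"
    unfolding proj_def ext_def by (subst sum.swap) (intro sum.cong HOL.refl, simp)
  also have "\<dots> = ext wd X"
    unfolding ext_def by (intro sum.cong HOL.refl) simp
  finally show ?thesis by (simp add: ext_id)
qed

text \<open>By induction on the degree all e_i X lie in \<open>Jk \<kappa>\<close>. If \<kappa> -
  \<beta> is not dominant, some sl_2 with its locally nilpotent f_i forces \<open>X\<close> into
  \<open>Jk \<kappa>\<close>; if it is dominant, the Casimir element does, because its eigenvalue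
  \<open>tcm\<close> is nonzero.\<close>

lemma Rad_homogeneous:
  assumes "X \<in> Fc \<beta>" "\<And>w. ecoef (ik \<kappa>) w X = 0"
  shows "X \<in> Jk \<kappa>"
  using assms
proof (induction "size \<beta>" arbitrary: \<beta> X rule: less_induct)
  case less
  have EJ: "EE (ik \<kappa>) i X \<in> Jk \<kappa>" for i
  proof (cases "i \<in># \<beta>")
    case True
    show ?thesis
    proof (rule less.hyps)
      show "size (\<beta> - {#i#}) < size \<beta>" using True by (simp add: size_Diff1_less)
      show "ecoef (ik \<kappa>) w (EE (ik \<kappa>) i X) = 0" for w using less.prems(2)[of "i # w"] by simp
    qed (rule EE_Fc[OF less.prems(1) True])
  next
    case False
    with EE_Fc0[OF less.prems(1)] show ?thesis by (simp add: complex_vector.subspace_0[OF Jk_subspace])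
  qed
  show ?case
  proof (cases "\<beta> = {#}")
    case True
    have "X - Poly_Mapping.lookup X [] *\<^sub>C wd [] \<in> {0}"
    proof (rule Fc_induct[OF _ complex_vector.subspace_single_0 _ less.prems(1)])
      show "clinear (\<lambda>x. x - Poly_Mapping.lookup x [] *\<^sub>C wd [])"
        by (rule clinearI) (simp_all add: lookup_add lookup_scaleC algebra_simps scaleC_add_left scaleC_scaleC scaleC_cmul
          complex_vector.scale_right_diff_distrib)
    qed (use True in auto)
    then show ?thesis
      using less.prems(2)[of "[]"] complex_vector.subspace_0[OF Jk_subspace] by simp
  next
    case nonempty: False
    show ?thesis
    proof (cases "\<exists>i. int (\<kappa> i) - pm i \<beta> < 0")
      case True
      then obtain i where i: "int (\<kappa> i) - pm i \<beta> < 0" by blast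
      let ?X = "\<lambda>n. wd (replicate n i) * X"
      have XF: "?X n \<in> Fc (replicate_mset n i + \<beta>)" for n
        by (intro Fc_mult wd_Fc less.prems(1)) simp
      have E: "EE (ik \<kappa>) i (?X n) - of_int (int n * (int (\<kappa> i) - pm i \<beta> - int n + 1)) *\<^sub>C ?X (n - 1) \<in> Jk \<kappa>" for n
      proof (induction n)
        case 0
        then show ?case using EJ by (simp add: wd_Nil)
      next
        case (Suc n)
        have S: "?X (Suc n) = wd [i] * ?X n"
          by (simp add: mult.assoc[symmetric] wd_mult)
        have "wd [i] * ?X (n - 1) = ?X n" if "n \<noteq> 0"
          using that by (cases n) (simp_all add: mult.assoc[symmetric] wd_mult)
        then have "wd [i] * (EE (ik \<kappa>) i (?X n) - of_int (int n * (int (\<kappa> i) - pm i \<beta> - int n + 1)) *\<^sub>C ?X (n - 1))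
           = wd [i] * EE (ik \<kappa>) i (?X n) - of_int (int n * (int (\<kappa> i) - pm i \<beta> - int n + 1)) *\<^sub>C ?X n"
          by (cases "n = 0") (auto simp: right_diff_distrib falg_scale_right)
        moreover have "wd [i] * (EE (ik \<kappa>) i (?X n) - of_int (int n * (int (\<kappa> i) - pm i \<beta> - int n + 1)) *\<^sub>C ?X (n - 1)) \<in> Jk \<kappa>"
          by (rule Jk_mult_left[OF Suc])
        moreover have "EE (ik \<kappa>) i (?X (Suc n)) = wd [i] * EE (ik \<kappa>) i (?X n) + of_int (int (\<kappa> i) - (int n * 2 + pm i \<beta>)) *\<^sub>C ?X n"
          unfolding S EE_f using Hp_Fc[OF XF, of "ik \<kappa>" i n] by (simp del: of_int_add of_int_diff)
        moreover have "a + u *\<^sub>C y - s *\<^sub>C y = a - t *\<^sub>C y" if "s = t + u" for a y :: "'n falg" and s t u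
          unfolding that scaleC_add_left by simp
        from this[of "of_int (int (Suc n) * (int (\<kappa> i) - pm i \<beta> - int (Suc n) + 1))"
            "of_int (int n * (int (\<kappa> i) - pm i \<beta> - int n + 1))" "of_int (int (\<kappa> i) - (int n * 2 + pm i \<beta>))"]
        have "wd [i] * EE (ik \<kappa>) i (?X n) + of_int (int (\<kappa> i) - (int n * 2 + pm i \<beta>)) *\<^sub>C ?X n
            - of_int (int (Suc n) * (int (\<kappa> i) - pm i \<beta> - int (Suc n) + 1)) *\<^sub>C ?X n
           = wd [i] * EE (ik \<kappa>) i (?X n) - of_int (int n * (int (\<kappa> i) - pm i \<beta> - int n + 1)) *\<^sub>C ?X n"
          unfolding of_int_add[symmetric] of_int_eq_iff by (simp add: algebra_simps)
        ultimately show ?case by (simp only: diff_Suc_1)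
      qed
      have step: "?X n \<in> Jk \<kappa>" if "?X (Suc n) \<in> Jk \<kappa>" for n
      proof -
        have "EE (ik \<kappa>) i (?X (Suc n)) \<in> Jk \<kappa>" by (rule EE_Jk[OF that])
        from complex_vector.subspace_diff[OF Jk_subspace this E[of "Suc n"]]
        have "of_int (int (Suc n) * (int (\<kappa> i) - pm i \<beta> - int n)) *\<^sub>C ?X n \<in> Jk \<kappa>"
          by (simp add: algebra_simps del: of_int_mult of_int_add of_int_diff)
        from complex_vector.subspace_scale[OF Jk_subspace this, of "1 / of_int (int (Suc n) * (int (\<kappa> i) - pm i \<beta> - int n))"]
        show ?thesis using i by (simp add: scaleC_scaleC del: of_int_mult of_int_add of_int_diff)
      qed
      obtain N where "?X N \<in> Jk \<kappa>" using pow_nilpotent by blast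
      from descend[of "\<lambda>n. ?X n \<in> Jk \<kappa>", OF step this] show ?thesis by (simp add: wd_Nil)
    next
      case False
      have main: "complex_of_real (tcm (ik \<kappa>) \<beta>) *\<^sub>C X \<in> Jk \<kappa>"
      proof (rule casimir[where Q="\<lambda>_. True", OF less.prems(1) Jk_subspace])
        show "x' \<in> radL c' \<Longrightarrow> x' * Y \<in> Jk \<kappa>" for c' x' Y
          by (intro J0_Jk J0_mult_right radL_J0)
        show "x' * YY (ik \<kappa>) w X \<in> Jk \<kappa>" for w x'
          by (intro Jk_mult_left YY_stable(2) Jk_subspace EE_Jk EJ)
      qed auto
      \<comment> \<open>The value is (\<beta>, 2 \<rho> + \<kappa> + (\<kappa> - \<beta>)), positive
        for dominant \<kappa> - \<beta> and nonempty \<beta>.\<close>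
      have "2 * tcm (ik \<kappa>) \<beta> = (\<Sum>i\<in>#\<beta>. d i * (of_int (int (\<kappa> i) + 2 + (int (\<kappa> i) - pm i \<beta>))))"
      proof -
        have sums: "(\<Sum>i\<in>#c. 2 * f i - g i) = 2 * (\<Sum>i\<in>#c. f i) - (\<Sum>i\<in>#c. g i)" for c :: "'n multiset" and f g :: "'n \<Rightarrow> real"
          by (induction c) auto
        have "(\<Sum>i\<in>#\<beta>. d i * (of_int (int (\<kappa> i) + 2 + (int (\<kappa> i) - pm i \<beta>))))
            = (\<Sum>i\<in>#\<beta>. 2 * (d i * of_int (int (\<kappa> i) + 1)) - d i * of_int (pm i \<beta>))"
          by (intro arg_cong[where f=sum_mset] image_mset_cong) (simp add: algebra_simps)
        then show ?thesis unfolding sums tcm_def by simp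
      qed
      also have "\<dots> > 0"
      proof -
        have pos: "d i * (of_int (int (\<kappa> i) + 2 + (int (\<kappa> i) - pm i \<beta>))) > 0" for i
        proof (rule mult_pos_pos[OF d_pos])
          have "int (\<kappa> i) - pm i \<beta> \<ge> 0" using False by (simp add: not_less)
          then show "(0::real) < of_int (int (\<kappa> i) + 2 + (int (\<kappa> i) - pm i \<beta>))" by linarith
        qed
        from nonempty show ?thesis by (rule sum_mset_pos_real) (rule pos)
      qed
      finally have "tcm (ik \<kappa>) \<beta> \<noteq> 0" by simp
      then show ?thesis
        using complex_vector.subspace_scale[OF Jk_subspace main, of "1 / complex_of_real (tcm (ik \<kappa>) \<beta>)"]
        by (simp add: scaleC_scaleC)
    qed
  qed
qed

theorem Rad_Jk:
  assumes "\<And>w. ecoef (ik \<kappa>) w X = 0"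
  shows "X \<in> Jk \<kappa>"
proof -
  have "ecoef (ik \<kappa>) w (proj c X) = 0" for w c
  proof (cases "mset w = c")
    case True
    have "ecoef (ik \<kappa>) w X - ecoef (ik \<kappa>) w (proj c X) = 0"
    proof (rule clinear_eq_singleI[where X=X])
      show "ecoef (ik \<kappa>) w (wd u) - ecoef (ik \<kappa>) w (proj c (wd u)) = 0" for u
        using ecoef_Fc[OF wd_Fc[OF HOL.refl], of "ik \<kappa>" w u] True
        by (cases "ecoef (ik \<kappa>) w (wd u) = 0") (auto simp: proj_def clinear_zero[OF lin_ecoef])
      show "clinear (\<lambda>X. ecoef (ik \<kappa>) w X - ecoef (ik \<kappa>) w (proj c X))"
        unfolding proj_def by (intro clinear_minus lin_ecoef clinear_comps[OF lin_ecoef] clinear_ext)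
    qed (rule clinear_zero_map)
    with assms show ?thesis by simp
  next
    case False
    with ecoef_Fc[OF proj_Fc, of "ik \<kappa>" w c X] show ?thesis by blast
  qed
  then have "proj c X \<in> Jk \<kappa>" for c
    by (rule Rad_homogeneous[OF proj_Fc])
  then have "(\<Sum>c\<in>mset ` Poly_Mapping.keys X. proj c X) \<in> Jk \<kappa>"
    by (intro subspace_intros Jk_subspace)
  then show ?thesis using sum_proj[of X] by simp
qed

lemma ecoef_Jk: "X \<in> Jk \<kappa> \<Longrightarrow> ecoef (ik \<kappa>) w X = 0"
proof (induction w arbitrary: X)
  case Nil
  have "Poly_Mapping.lookup X [] \<in> {0}"
  proof (rule Jk_induct[OF _ complex_vector.subspace_single_0 _ _ Nil])
    show "clinear (\<lambda>X::'n falg. Poly_Mapping.lookup X [])"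
      by (rule clinearI) (simp_all add: lookup_add lookup_scaleC scaleC_cmul)
    fix u v i j assume "(i::'n) \<noteq> j"
    have F: "wd u * serre i j * wd v \<in> Fc (mset u + (replicate_mset (nat (1 - A $ i $ j)) i + {#j#}) + mset v)"
      by (intro Fc_mult serre_Fc wd_Fc) auto
    show "Poly_Mapping.lookup (wd u * serre i j * wd v) [] \<in> {0}"
      using ecoef_Fc[OF F, of "\<lambda>_. 0" "[]"] by (cases "Poly_Mapping.lookup (wd u * serre i j * wd v) [] = 0") auto
  qed (auto simp: wd_mult lookup_single when_def)
  then show ?case by simp
qed (auto intro: EE_Jk)

end

section \<open>The contravariant form and its radical\<close>

lemma ext_plus_fun: "ext (\<lambda>w. a w + b w) Z = ext a Z + ext b Z"
  by (simp add: ext_def scaleC_add_right sum.distrib)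

lemma ext_smult_fun: "ext (\<lambda>w. c *\<^sub>C a w) Z = c *\<^sub>C ext a Z"
  unfolding ext_def complex_vector.scale_sum_right by (intro sum.cong HOL.refl) (simp add: scaleC_scaleC mult.commute)

lemma ext_cmul_fun: "ext (\<lambda>w. (c::complex) * a w) Z = c * ext a Z"
  using ext_smult_fun[of c a Z] by (simp add: scaleC_cmul)

lemma ext_zero_fun: "(\<And>w. a w = 0) \<Longrightarrow> ext a Z = 0"
  by (simp add: ext_def)

lemma ext_Cons: "ext \<phi> (wd [i] * X) = ext (\<lambda>u. \<phi> (i # u)) X"
  by (rule clinear_eq_singleI[where X=X]) (intro clinear_comps[OF clinear_ext] clinear_intros | simp add: wd_mult)+

text \<open>The operator (ad e)^n a, formed with composition of endomorphisms.\<close>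

primrec opad :: "('x \<Rightarrow> 'x::complex_vector) \<Rightarrow> ('x \<Rightarrow> 'x) \<Rightarrow> nat \<Rightarrow> 'x \<Rightarrow> 'x" where
  "opad e a 0 x = a x"
| "opad e a (Suc n) x = e (opad e a n x) - opad e a n (e x)"

text \<open>The antipode of the free algebra as a Hopf algebra with primitive letters; it carries a
  factor from the first argument of an invariant pairing to the second.\<close>

definition anti :: "'n falg \<Rightarrow> 'n falg"
  where "anti = ext (\<lambda>u. (- 1) ^ length u *\<^sub>C wd (rev u))"

lemma lin_anti: "clinear anti"
  by (simp add: anti_def clinear_ext)

lemma anti_wd: "anti (wd u) = (- 1) ^ length u *\<^sub>C wd (rev u)"
  by (simp add: anti_def)

lemma anti_mult: "anti (X * Y) = anti Y * anti X"
proof (rule clinear_eq_singleI[where X=X])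
  show "anti (wd u * Y) = anti Y * anti (wd u)" for u
    by (rule clinear_eq_singleI[where X=Y])
       (intro clinear_comps[OF lin_anti] clinear_intros lin_anti | simp add: wd_mult anti_wd falg_scale_left falg_scale_right scaleC_scaleC power_add mult.commute)+
qed (intro clinear_comps[OF lin_anti] clinear_intros lin_anti)+

context km
begin

lemma anti_ad: "anti (ad i X) = ad i (anti X)"
  by (simp add: ad_def clinear_diff[OF lin_anti] anti_mult anti_wd)

lemma anti_serre: "anti (serre i j) = - serre i j"
proof -
  have "anti ((ad i ^^ n) (wd [j])) = - (ad i ^^ n) (wd [j])" for n
    by (induction n) (simp_all add: anti_ad anti_wd clinear_neg[OF lin_ad])
  then show ?thesis by (simp add: serre_def)
qed

lemma ecoef_simps: "ecoef \<kappa> w (X + Y) = ecoef \<kappa> w X + ecoef \<kappa> w Y" "ecoef \<kappa> w (X - Y) = ecoef \<kappa> w X - ecoef \<kappa> w Y"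
  "ecoef \<kappa> w (c *\<^sub>C X) = c * ecoef \<kappa> w X" "ecoef \<kappa> w 0 = 0"
  using clinear_add[OF lin_ecoef] clinear_diff[OF lin_ecoef] clinear_scale[OF lin_ecoef] clinear_zero[OF lin_ecoef]
  by (simp_all add: scaleC_cmul)

lemma ecoef_Hp: "ecoef \<kappa> u (Hp \<kappa>' i X) = of_int (\<kappa>' i - pm i (mset u)) * ecoef \<kappa> u X"
proof -
  have "ecoef \<kappa> u (Hp \<kappa>' i X) = of_int (\<kappa>' i - pm i (mset u)) *\<^sub>C ecoef \<kappa> u X"
  proof (rule clinear_eq_singleI[where X=X])
    show "ecoef \<kappa> u (Hp \<kappa>' i (wd v)) = of_int (\<kappa>' i - pm i (mset u)) *\<^sub>C ecoef \<kappa> u (wd v)" for v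
      using ecoef_Fc[OF wd_Fc[OF HOL.refl], of \<kappa> u v]
      by (cases "ecoef \<kappa> u (wd v) = 0") (simp_all add: Hp_wd ecoef_simps scaleC_cmul)
  qed (intro clinear_comps[OF lin_ecoef] lin_Hp clinear_smult lin_ecoef)+
  then show ?thesis by (simp add: scaleC_cmul)
qed

lemma ecoef_f: "ecoef \<kappa> u (wd [i] * X) = ext (\<lambda>w. ecoef \<kappa> w X) (Ew \<kappa> i u)"
proof (induction u arbitrary: X)
  case Nil
  have "Poly_Mapping.lookup (wd [i] * X) [] = 0"
    by (rule clinear_eq_singleI[where X=X])
       (rule clinearI | simp add: wd_mult lookup_single when_def distrib_left lookup_add falg_scale_right lookup_scaleC)+
  then show ?case by (simp add: clinear_zero[OF clinear_ext])
next
  case (Cons j u)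
  show ?case
    by (simp add: EE_f Cons ecoef_simps ecoef_Hp ext_Cons clinear_add[OF clinear_ext] scaleC_single clinear_zero[OF clinear_ext] scaleC_cmul)
qed

lemma ecoef_sym: "ecoef \<kappa> u (wd w) = ecoef \<kappa> w (wd u)"
proof (induction w arbitrary: u)
  case Nil
  then show ?case by (cases u) (simp_all add: wd_Nil ecoef_simps lookup_single when_def)
next
  case (Cons i w)
  have "ecoef \<kappa> u (wd (i # w)) = ext (\<lambda>v. ecoef \<kappa> w (wd v)) (Ew \<kappa> i u)"
    unfolding wd_Cons[of i w] ecoef_f Cons ..
  also have "\<dots> = ecoef \<kappa> w (Ew \<kappa> i u)"
    by (rule clinear_ext_eq[OF lin_ecoef, symmetric])
  finally show ?case by (simp add: EE_wd)
qed

text \<open>The contravariant (Shapovalov) form of the Verma module: symmetric by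
  \<open>ecoef_sym\<close>, with e_i and f_i adjoint to each other. For dominant \<kappa> its
  radical is \<open>Jk \<kappa>\<close>.\<close>

definition SS :: "('n \<Rightarrow> int) \<Rightarrow> 'n falg \<Rightarrow> 'n falg \<Rightarrow> complex"
  where "SS \<kappa> X = ext (\<lambda>u. ecoef \<kappa> u X)"

lemma lin_SS: "clinear (SS \<kappa> X)"
  by (simp add: SS_def clinear_ext)

lemma SS_wd: "SS \<kappa> X (wd u) = ecoef \<kappa> u X"
  by (simp add: SS_def)

lemma SS_sym_wd: "SS \<kappa> (wd u) Y = ecoef \<kappa> u Y"
  unfolding SS_def by (subst ecoef_sym) (rule clinear_ext_eq[OF lin_ecoef, symmetric])

lemma lin_SS1: "clinear (\<lambda>X. SS \<kappa> X Y)"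
  by (rule clinearI) (simp_all add: SS_def ecoef_simps ext_plus_fun ext_cmul_fun scaleC_cmul)

lemma SS_sym: "SS \<kappa> X Y = SS \<kappa> Y X"
  by (rule clinear_eq_singleI[where X=X]) (simp_all add: lin_SS lin_SS1 SS_wd SS_sym_wd)

lemma SS_EE1: "SS \<kappa> (EE \<kappa> i X) Y = SS \<kappa> X (wd [i] * Y)"
  by (simp add: SS_def ext_Cons)

lemma SS_EE2: "SS \<kappa> X (EE \<kappa> i Y) = SS \<kappa> (wd [i] * X) Y"
  using SS_EE1 SS_sym by metis

lemma SS_Jk: "X \<in> Jk \<kappa> \<Longrightarrow> SS (ik \<kappa>) X Y = 0"
  by (simp add: SS_def ecoef_Jk ext_zero_fun)

lemma Jk_SS: "(\<And>Y. SS (ik \<kappa>) X Y = 0) \<Longrightarrow> X \<in> Jk \<kappa>"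
  by (rule Rad_Jk) (metis SS_wd)

lemma opad_form: "SS \<kappa> (opad (EE \<kappa> i) (EE \<kappa> j) n X) Y = (- 1) ^ n * SS \<kappa> X ((ad i ^^ n) (wd [j]) * Y)"
proof (induction n arbitrary: X Y)
  case (Suc n)
  show ?case
    by (simp add: clinear_diff[OF lin_SS1] SS_EE1 Suc ad_def left_diff_distrib mult.assoc clinear_diff[OF lin_SS] algebra_simps)
qed (simp add: SS_EE1)

text \<open>Serre relations for the raising operators, obtained from those for the f_i by taking
  adjoints for the contravariant form.\<close>

lemma opad_serre: "i \<noteq> j \<Longrightarrow> opad (EE (ik \<kappa>) i) (EE (ik \<kappa>) j) (nat (1 - A $ i $ j)) X \<in> Jk \<kappa>"
proof (rule Jk_SS)
  fix Y assume "i \<noteq> j"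
  then have "serre i j * Y \<in> Jk \<kappa>" by (intro J0_Jk J0_mult_right serre_J0)
  from SS_Jk[OF this, of X] show "SS (ik \<kappa>) (opad (EE (ik \<kappa>) i) (EE (ik \<kappa>) j) (nat (1 - A $ i $ j)) X) Y = 0"
    unfolding opad_form serre_def[symmetric] by (simp add: SS_sym[of _ X])
qed

text \<open>The contravariant form is nondegenerate on the finite-dimensional space of degree
  \<open>c\<close> modulo \<open>Jk \<kappa>\<close>. The words in \<open>J\<close> and the vectors
  \<open>x\<close> are dual for it, so \<phi> can be rebuilt from its values on the
  \<open>x j\<close>.\<close>

lemma represent_functional:
  assumes "\<And>u. \<phi> u \<noteq> 0 \<Longrightarrow> mset u = c" and "\<And>X. X \<in> Jk \<kappa> \<Longrightarrow> ext \<phi> X = 0"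
  shows "\<exists>X\<in>Fc c. \<forall>u. \<phi> u = ecoef (ik \<kappa>) u X"
proof -
  let ?I = "{w. mset w = c}"
  have fin: "finite ?I"
    by (rule finite_subset[OF _ finite_lists_length_eq[of UNIV "size c"]]) auto
  obtain J x where J: "J \<subseteq> ?I" "\<And>y w. y \<in> Fc c \<Longrightarrow> w \<in> ?I \<Longrightarrow> ecoef (ik \<kappa>) w (y - (\<Sum>j\<in>J. ecoef (ik \<kappa>) j y *\<^sub>C x j)) = 0"
    and x: "\<And>j. j \<in> J \<Longrightarrow> x j \<in> Fc c"
    using finite_dual_basis[where \<phi>="ecoef (ik \<kappa>)" and S="Fc c", OF fin lin_ecoef Fc_subspace] by blast
  let ?X = "\<Sum>j\<in>J. ext \<phi> (x j) *\<^sub>C wd j"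
  have "?X \<in> Fc c"
    using J(1) by (intro subspace_intros Fc_subspace wd_Fc) auto
  moreover have "\<phi> u = ecoef (ik \<kappa>) u ?X" for u
  proof (cases "mset u = c")
    case False
    then show ?thesis using assms(1)[of u] ecoef_Fc[OF \<open>?X \<in> Fc c\<close>, of "ik \<kappa>" u] by metis
  next
    case True
    let ?y = "wd u - (\<Sum>j\<in>J. ecoef (ik \<kappa>) j (wd u) *\<^sub>C x j)"
    have y: "?y \<in> Fc c" using True x by (intro subspace_intros Fc_subspace wd_Fc)
    have "?y \<in> Jk \<kappa>"
    proof (rule Rad_Jk)
      show "ecoef (ik \<kappa>) w ?y = 0" for w
        using J(2)[OF wd_Fc[OF True], of w] ecoef_Fc[OF y, of "ik \<kappa>" w] by blast
    qed
    from assms(2)[OF this] have "\<phi> u = (\<Sum>j\<in>J. ecoef (ik \<kappa>) j (wd u) *\<^sub>C ext \<phi> (x j))"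
      by (simp add: clinear_diff[OF clinear_ext] clinear_sum[OF clinear_ext] clinear_scale[OF clinear_ext])
    also have "\<dots> = ecoef (ik \<kappa>) u ?X"
      by (simp add: clinear_sum[OF lin_ecoef] ecoef_simps scaleC_cmul mult.commute ecoef_sym[of _ u])
    finally show ?thesis .
  qed
  ultimately show ?thesis by blast
qed

section \<open>Homomorphisms from tensor products\<close>

text \<open>\<open>tri \<kappa> m \<beta> \<nu> \<Phi>\<close>: \<open>\<Phi>\<close> induces a homomorphism from the tensor product of the irreducible modules
  \<open>L(\<kappa>)\<close> and \<open>L(m)\<close> to \<open>L(\<nu>)\<close>, each realized as the free algebra modulo \<open>Jk\<close>, where
  \<open>\<nu> = \<kappa> + m - \<beta>\<close>.\<close>

definition tri :: "('n \<Rightarrow> nat) \<Rightarrow> ('n \<Rightarrow> nat) \<Rightarrow> 'n multiset \<Rightarrow> ('n \<Rightarrow> nat) \<Rightarrow> ('n falg \<Rightarrow> 'n falg \<Rightarrow> 'n falg) \<Rightarrow> bool"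
  where "tri \<kappa> m \<beta> \<nu> \<Phi> \<longleftrightarrow> cbilinear \<Phi>
    \<and> (\<forall>i. int (\<nu> i) = int (\<kappa> i) + int (m i) - pm i \<beta>)
    \<and> (\<forall>c c' X Y. X \<in> Fc c \<longrightarrow> Y \<in> Fc c' \<longrightarrow> (if \<beta> \<subseteq># c + c' then \<Phi> X Y \<in> Fc (c + c' - \<beta>) else \<Phi> X Y = 0))
    \<and> (\<forall>X Y. X \<in> Jk \<kappa> \<or> Y \<in> Jk m \<longrightarrow> \<Phi> X Y \<in> Jk \<nu>)
    \<and> (\<forall>i X Y. EE (ik \<nu>) i (\<Phi> X Y) - (\<Phi> (EE (ik \<kappa>) i X) Y + \<Phi> X (EE (ik m) i Y)) \<in> Jk \<nu>)
    \<and> (\<forall>i X Y. wd [i] * \<Phi> X Y - (\<Phi> (wd [i] * X) Y + \<Phi> X (wd [i] * Y)) \<in> Jk \<nu>)"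

end

text \<open>\<eta> sends y to the coefficient of the highest weight vector in the image of
  v_\<kappa> \<otimes> y. That coefficient kills the images of all f_i, so \<eta> determines the
  homomorphism; \<open>R\<close> makes it well defined on the second factor and \<open>L\<close> on
  the first.\<close>

locale hom_data = km +
  fixes \<kappa> m \<nu> :: "'a \<Rightarrow> nat" and \<beta> :: "'a multiset" and \<eta> :: "'a list \<Rightarrow> complex"
  assumes supp: "\<eta> u \<noteq> 0 \<Longrightarrow> mset u = \<beta>"
    and R: "X \<in> Jk m \<Longrightarrow> ext \<eta> X = 0"
    and L: "ext \<eta> (wd (replicate (Suc (\<kappa> j)) j) * X) = 0"
    and nu: "int (\<nu> i) = int (\<kappa> i) + int (m i) - pm i \<beta>"
begin

definition BF :: "'a falg \<Rightarrow> 'a falg \<Rightarrow> complex" where "BF X Y = ext \<eta> (anti X * Y)"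

text \<open>The value of the invariant functional \<open>BF\<close> after the raising operators of
  \<open>w\<close> have acted on the tensor of \<open>X\<close> and \<open>Y\<close>, hence the
  coefficient \<open>ecoef\<close> of the image that is to be constructed.\<close>

primrec sh :: "'a list \<Rightarrow> 'a falg \<Rightarrow> 'a falg \<Rightarrow> complex" where
  "sh [] X Y = BF X Y"
| "sh (i # w) X Y = sh w (EE (ik \<kappa>) i X) Y + sh w X (EE (ik m) i Y)"

lemma lin_BF1: "clinear (\<lambda>X. BF X Y)" and lin_BF2: "clinear (BF X)"
  unfolding BF_def[abs_def] by (intro clinear_comps[OF clinear_ext] clinear_intros lin_anti)+

lemma lin_sh: "clinear (\<lambda>X. sh w X Y)" "clinear (\<lambda>Y. sh w X Y)"
proof (induction w arbitrary: X Y)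
  case (Cons i w)
  { case 1
    show ?case unfolding sh.simps by (intro clinear_plus clinear_comps[OF Cons(1)] lin_EE Cons) }
  { case 2
    show ?case unfolding sh.simps by (intro clinear_plus clinear_comps[OF Cons(2)] lin_EE Cons) }
next
  case Nil
  have "sh [] X = BF X" for X by (simp add: fun_eq_iff)
  { case 1
    show ?case by (simp add: lin_BF1) }
  { case 2
    show ?case by (simp add: lin_BF2 \<open>\<And>X. sh [] X = BF X\<close>) }
qed

lemmas sh_simps1 = clinear_add[OF lin_sh(1)] clinear_diff[OF lin_sh(1)] clinear_scale[OF lin_sh(1)] clinear_zero[OF lin_sh(1)]
lemmas sh_simps2 = clinear_add[OF lin_sh(2)] clinear_diff[OF lin_sh(2)] clinear_scale[OF lin_sh(2)] clinear_zero[OF lin_sh(2)]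

lemma BF_f: "BF (wd [i] * X) Y + BF X (wd [i] * Y) = 0"
proof -
  have "anti (wd [i] * X) * Y = - (anti X * (wd [i] * Y))"
    unfolding anti_mult by (simp add: anti_wd mult.assoc)
  then show ?thesis by (simp add: BF_def clinear_neg[OF clinear_ext])
qed

lemma BF_Jk1: "X \<in> Jk \<kappa> \<Longrightarrow> BF X Y = 0"
proof -
  assume "X \<in> Jk \<kappa>"
  then have "BF X Y \<in> {0}"
  proof (rule Jk_induct[OF lin_BF1 complex_vector.subspace_single_0, rotated -1])
    fix u v i j assume "(i::'a) \<noteq> j"
    then have "anti (wd v) * (serre i j * (anti (wd u) * Y)) \<in> Jk m"
      by (intro J0_Jk J0_mult_left J0_mult_right serre_J0)
    moreover have "anti (wd u * serre i j * wd v) * Y = - (anti (wd v) * (serre i j * (anti (wd u) * Y)))"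
      by (simp add: anti_mult anti_serre mult.assoc)
    ultimately show "BF (wd u * serre i j * wd v) Y \<in> {0}"
      by (simp add: BF_def clinear_neg[OF clinear_ext] R)
  next
    fix u j
    have "anti (wd u * wd (replicate (Suc (\<kappa> j)) j)) * Y
        = (- 1) ^ Suc (\<kappa> j) *\<^sub>C (wd (replicate (Suc (\<kappa> j)) j) * (anti (wd u) * Y))"
      unfolding anti_mult anti_wd[of "replicate _ _"] rev_replicate length_replicate falg_scale_left mult.assoc ..
    then show "BF (wd u * wd (replicate (Suc (\<kappa> j)) j)) Y \<in> {0}"
      unfolding BF_def by (simp only: clinear_scale[OF clinear_ext] L) simp
  qed
  then show ?thesis by simp
qed

lemma BF_Jk2: "Y \<in> Jk m \<Longrightarrow> BF X Y = 0"
  unfolding BF_def by (intro R Jk_mult_left)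

lemma sh_Jk: "X \<in> Jk \<kappa> \<Longrightarrow> sh w X Y = 0" "Y \<in> Jk m \<Longrightarrow> sh w X Y = 0"
proof (induction w arbitrary: X Y)
  case (Cons i w)
  { case 1
    then show ?case using Cons(1)[OF 1] Cons(1)[OF EE_Jk[OF 1]] by simp }
  { case 2
    then show ?case using Cons(2)[OF 2] Cons(2)[OF EE_Jk[OF 2]] by simp }
qed (simp_all add: BF_Jk1 BF_Jk2)

lemma BF_Fc: "X \<in> Fc c \<Longrightarrow> Y \<in> Fc c' \<Longrightarrow> BF X Y \<noteq> 0 \<Longrightarrow> c + c' = \<beta>"
proof (rule ccontr)
  assume X: "X \<in> Fc c" and Y: "Y \<in> Fc c'" and ne: "BF X Y \<noteq> 0" and "c + c' \<noteq> \<beta>"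
  then have "BF (wd u) (wd v) = 0" if "mset u = c" "mset v = c'" for u v
    using supp[of "rev u @ v"] that
    by (auto simp: BF_def anti_wd falg_scale_left wd_mult clinear_scale[OF clinear_ext])
  then have "BF (wd u) Y \<in> {0}" if "mset u = c" for u
    by (intro Fc_induct[OF lin_BF2 complex_vector.subspace_single_0 _ Y]) (use that in auto)
  then have "BF X Y \<in> {0}"
    by (intro Fc_induct[OF lin_BF1 complex_vector.subspace_single_0 _ X]) auto
  with ne show False by simp
qed

lemma sh_Fc: "X \<in> Fc c \<Longrightarrow> Y \<in> Fc c' \<Longrightarrow> sh w X Y \<noteq> 0 \<Longrightarrow> c + c' = \<beta> + mset w"
proof (induction w arbitrary: X Y c c')
  case Nil
  then show ?case using BF_Fc by simp
next
  case (Cons i w)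
  then have "sh w (EE (ik \<kappa>) i X) Y \<noteq> 0 \<or> sh w X (EE (ik m) i Y) \<noteq> 0" by auto
  then consider "sh w (EE (ik \<kappa>) i X) Y \<noteq> 0" | "sh w X (EE (ik m) i Y) \<noteq> 0" by blast
  then show ?case
  proof cases
    case 1
    then have i: "i \<in># c" using EE_Fc0[OF Cons.prems(1)] by (metis clinear_zero[OF lin_sh(1)])
    from Cons.IH[OF EE_Fc[OF Cons.prems(1) i] Cons.prems(2) 1] i
    show ?thesis by (metis add_mset_add_single insert_DiffM mset.simps(2) union_mset_add_mset_left union_mset_add_mset_right)
  next
    case 2
    then have i: "i \<in># c'" using EE_Fc0[OF Cons.prems(2)] by (metis clinear_zero[OF lin_sh(2)])
    from Cons.IH[OF Cons.prems(1) EE_Fc[OF Cons.prems(2) i] 2] i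
    show ?thesis by (metis add_mset_add_single insert_DiffM mset.simps(2) union_mset_add_mset_left union_mset_add_mset_right)
  qed
qed

lemma sh_Hp: "sh w (Hp (ik \<kappa>) i X) Y + sh w X (Hp (ik m) i Y) = of_int (int (\<nu> i) - pm i (mset w)) *\<^sub>C sh w X Y"
proof (rule clinear_eq_singleI[where X=X])
  fix u
  show "sh w (Hp (ik \<kappa>) i (wd u)) Y + sh w (wd u) (Hp (ik m) i Y) = of_int (int (\<nu> i) - pm i (mset w)) *\<^sub>C sh w (wd u) Y"
  proof (rule clinear_eq_singleI[where X=Y])
    fix v
    have "sh w (wd u) (wd v) \<noteq> 0 \<Longrightarrow> pm i (mset u) + pm i (mset v) = pm i \<beta> + pm i (mset w)"
      using sh_Fc[OF wd_Fc[OF HOL.refl] wd_Fc[OF HOL.refl], of w u v] by (metis pm_simps(3))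
    then have *: "sh w (wd u) (wd v) \<noteq> 0 \<Longrightarrow> (int (\<kappa> i) - pm i (mset u)) + (int (m i) - pm i (mset v)) = int (\<nu> i) - pm i (mset w)"
      unfolding nu by linarith
    show "sh w (Hp (ik \<kappa>) i (wd u)) (wd v) + sh w (wd u) (Hp (ik m) i (wd v)) = of_int (int (\<nu> i) - pm i (mset w)) *\<^sub>C sh w (wd u) (wd v)"
      unfolding Hp_wd sh_simps1 sh_simps2 scaleC_add_left[symmetric] of_int_add[symmetric]
    proof (cases "sh w (wd u) (wd v) = 0")
      case False
      show "of_int ((int (\<kappa> i) - pm i (mset u)) + (int (m i) - pm i (mset v))) *\<^sub>C sh w (wd u) (wd v) = of_int (int (\<nu> i) - pm i (mset w)) *\<^sub>C sh w (wd u) (wd v)"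
        unfolding *[OF False] ..
    qed (simp only: scaleC_zero)
  qed (intro clinear_plus clinear_smult lin_sh clinear_comps[OF lin_sh(2)] lin_Hp)+
qed (intro clinear_plus clinear_smult lin_sh clinear_comps[OF lin_sh(1)] lin_Hp)+

lemma sh_EE: "ext (\<lambda>w. sh w X Y) (wd [i] * Z) = ext (\<lambda>w. sh w (EE (ik \<kappa>) i X) Y) Z + ext (\<lambda>w. sh w X (EE (ik m) i Y)) Z"
  by (simp add: ext_Cons ext_plus_fun)

lemma sh_f: "ext (\<lambda>w. sh w X Y) (Ew (ik \<nu>) i u) = sh u (wd [i] * X) Y + sh u X (wd [i] * Y)"
proof (induction u arbitrary: X Y)
  case Nil
  then show ?case by (simp add: clinear_zero[OF clinear_ext] BF_f)
next
  case (Cons j u)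
  have "sh (j # u) (wd [i] * X) Y + sh (j # u) X (wd [i] * Y) =
      (sh u (wd [i] * EE (ik \<kappa>) j X) Y + sh u (EE (ik \<kappa>) j X) (wd [i] * Y)) + (sh u (wd [i] * X) (EE (ik m) j Y) + sh u X (wd [i] * EE (ik m) j Y))
      + (if i = j then sh u (Hp (ik \<kappa>) i X) Y + sh u X (Hp (ik m) i Y) else 0)"
    by (simp add: EE_f sh_simps1 sh_simps2)
  then show ?case
    unfolding sh_Hp by (simp add: clinear_add[OF clinear_ext] sh_EE Cons clinear_zero[OF clinear_ext] scaleC_single scaleC_cmul)
qed

lemma sh_opad: "ext (\<lambda>w. sh w X Y) ((ad i ^^ n) (wd [j]) * Z) = (- 1) ^ n *
    (ext (\<lambda>w. sh w (opad (EE (ik \<kappa>) i) (EE (ik \<kappa>) j) n X) Y) Z + ext (\<lambda>w. sh w X (opad (EE (ik m) i) (EE (ik m) j) n Y)) Z)"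
proof (induction n arbitrary: X Y Z)
  case 0
  then show ?case by (simp add: sh_EE)
next
  case (Suc n)
  have arith: "t * (a + b) + t * (c + d) - t * (e + f + (g + h)) = - 1 * t * (e - a + (h - d))"
    if "f = c" "g = b" for t a b c d e f g h :: complex
    unfolding that by (simp add: algebra_simps)
  have minus: "ext (\<lambda>w. a w - b w) Z = ext a Z - ext b Z" for a b :: "'a list \<Rightarrow> complex" and Z
    by (simp add: ext_def complex_vector.scale_right_diff_distrib sum_subtractf)
  have split: "(ad i ^^ Suc n) (wd [j]) * Z = wd [i] * ((ad i ^^ n) (wd [j]) * Z) - (ad i ^^ n) (wd [j]) * (wd [i] * Z)"
    by (simp add: ad_def[of i "(ad i ^^ n) (wd [j])"] left_diff_distrib mult.assoc)
  show ?case
    unfolding split clinear_diff[OF clinear_ext] sh_EE Suc opad.simps sh_simps1 sh_simps2 minus power_Suc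
    by (rule arith; rule HOL.refl)
qed

lemma sh_serre: "i \<noteq> j \<Longrightarrow> ext (\<lambda>w. sh w X Y) (serre i j * Z) = 0"
proof -
  assume ij: "i \<noteq> j"
  have "ext (\<lambda>w. sh w (opad (EE (ik \<kappa>) i) (EE (ik \<kappa>) j) (nat (1 - A $ i $ j)) X) Y) Z = 0"
    "ext (\<lambda>w. sh w X (opad (EE (ik m) i) (EE (ik m) j) (nat (1 - A $ i $ j)) Y)) Z = 0"
    by (intro ext_zero_fun sh_Jk opad_serre ij)+
  then show ?thesis unfolding serre_def sh_opad by (simp only: add_0 mult_zero_right)
qed

definition fop :: "'a \<Rightarrow> ('a list \<Rightarrow> complex) \<Rightarrow> 'a list \<Rightarrow> complex"
  where "fop i \<phi> = (\<lambda>u. ext \<phi> (Ew (ik \<nu>) i u))"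

lemma fop_descend: "\<nu> j < a \<Longrightarrow> (fop j ^^ n) \<phi> (replicate (a + n) j) = 0 \<Longrightarrow> \<phi> (replicate a j) = 0"
proof (induction n arbitrary: \<phi> a)
  case (Suc n)
  have "fop j \<phi> (replicate (Suc a) j) = 0"
  proof (rule Suc.IH)
    show "(fop j ^^ n) (fop j \<phi>) (replicate (Suc a + n) j) = 0"
      using Suc.prems(2) unfolding funpow_Suc_right o_apply add_Suc_right add_Suc .
  qed (use Suc.prems(1) in simp)
  moreover have "fop j \<phi> (replicate (Suc a) j) = (of_nat (Suc a) * of_int (int (\<nu> j) - int a)) * \<phi> (replicate a j)"
    unfolding fop_def EE_wd[symmetric] EE_replicate if_P[OF HOL.refl] by (simp add: clinear_scale[OF clinear_ext] scaleC_cmul)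
  moreover have "(of_int (int (\<nu> j) - int a) :: complex) \<noteq> 0"
    using Suc.prems(1) by (simp del: of_int_diff)
  ultimately show ?case by (metis mult_eq_0_iff of_nat_eq_0_iff nat.distinct(1))
qed simp

text \<open>A high power of f_j kills the tensor of \<open>X\<close> and \<open>Y\<close>, hence the
  functional given by \<open>sh\<close>. Beyond exponent \<open>\<nu> j\<close>, each application of
  \<open>fop\<close> multiplies the values on powers of f_j by nonzero numbers, so these values were
  zero from the start.\<close>

lemma sh_right: "sh (replicate (Suc (\<nu> j)) j) X Y = 0"
proof -
  obtain N where N: "\<And>n. n \<ge> N \<Longrightarrow> wd (replicate n j) * X \<in> Jk \<kappa>" using pow_nilpotent by blast
  obtain M where M: "\<And>n. n \<ge> M \<Longrightarrow> wd (replicate n j) * Y \<in> Jk m" using pow_nilpotent by blast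
  have lin: "clinear (fop j)"
    by (rule clinearI) (simp_all add: fop_def fun_eq_iff ext_plus_fun plus_fun_def scaleC_fun_def ext_smult_fun)
  have step: "fop j (\<lambda>w. sh w X Y) = (\<lambda>w. sh w (wd [j] * X) Y) + (\<lambda>w. sh w X (wd [j] * Y))" for X Y
    by (simp add: fop_def sh_f fun_eq_iff)
  have "(fop j ^^ (N + M)) (\<lambda>w. sh w X Y) = (\<Sum>k\<le>N + M. of_nat (N + M choose k) *\<^sub>C (\<lambda>w. sh w (wd (replicate k j) * X) (wd (replicate (N + M - k) j) * Y)))"
    using leibniz[of "fop j" "\<lambda>X Y w. sh w X Y" "\<lambda>X. wd [j] * X" "\<lambda>X. wd [j] * X", OF lin step, of "N + M" X Y]
    unfolding wd_pow .
  also have "\<dots> = 0"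
  proof (rule sum.neutral, rule ballI)
    fix k assume "k \<in> {..N + M}"
    then have "N \<le> k \<or> M \<le> N + M - k" by auto
    then show "of_nat (N + M choose k) *\<^sub>C (\<lambda>w. sh w (wd (replicate k j) * X) (wd (replicate (N + M - k) j) * Y)) = 0"
      using N M by (auto simp: fun_eq_iff sh_Jk)
  qed
  finally have "(fop j ^^ (N + M)) (\<lambda>w. sh w X Y) (replicate (Suc (\<nu> j) + (N + M)) j) = 0" by simp
  from fop_descend[OF lessI this] show ?thesis .
qed

lemma sh_Jk_nu: "Z \<in> Jk \<nu> \<Longrightarrow> ext (\<lambda>w. sh w X Y) Z = 0"
proof -
  assume Z: "Z \<in> Jk \<nu>"
  have left: "ext (\<lambda>w. sh w X Y) (wd u * Z) = 0" if "\<And>X Y. ext (\<lambda>w. sh w X Y) Z = 0" for u Z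
  proof (induction u arbitrary: X Y)
    case (Cons i u)
    then show ?case unfolding wd_Cons[of i u] mult.assoc sh_EE by simp
  qed (simp add: wd_Nil that)
  have "ext (\<lambda>w. sh w X Y) Z \<in> {0}"
  proof (rule Jk_induct[OF clinear_ext complex_vector.subspace_single_0 _ _ Z])
    show "ext (\<lambda>w. sh w X Y) (wd u * serre i j * wd v) \<in> {0}" if "i \<noteq> j" for u v i j
      unfolding mult.assoc singleton_iff by (rule left, rule sh_serre[OF that])
    show "ext (\<lambda>w. sh w X Y) (wd u * wd (replicate (Suc (\<nu> j)) j)) \<in> {0}" for u j
    proof -
      have "ext (\<lambda>w. sh w X Y) (wd (replicate (Suc (\<nu> j)) j)) = 0" for X Y
        unfolding ext_single scaleC_one' by (rule sh_right)
      from left[OF this] show ?thesis unfolding singleton_iff .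
    qed
  qed
  then show ?thesis by simp
qed

text \<open>For fixed arguments \<open>sh\<close> vanishes on \<open>Jk \<nu>\<close>, and the
  contravariant form represents it by a vector. The identities of \<open>tri\<close> hold after
  applying \<open>ecoef\<close>, and \<open>Rad_Jk\<close> turns this into membership in
  \<open>Jk \<nu>\<close>.\<close>

theorem tri_exists:
  "\<exists>\<Phi>. tri \<kappa> m \<beta> \<nu> \<Phi> \<and> (\<forall>X Y. Poly_Mapping.lookup (\<Phi> X Y) [] = ext \<eta> (anti X * Y))"
proof -
  have "\<exists>Z. (if \<beta> \<subseteq># mset u + mset v then Z \<in> Fc (mset u + mset v - \<beta>) else Z = 0) \<and> (\<forall>w. sh w (wd u) (wd v) = ecoef (ik \<nu>) w Z)" for u v
  proof (cases "\<beta> \<subseteq># mset u + mset v")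
    case True
    have "\<exists>X\<in>Fc (mset u + mset v - \<beta>). \<forall>w. sh w (wd u) (wd v) = ecoef (ik \<nu>) w X"
    proof (rule represent_functional)
      show "sh w (wd u) (wd v) \<noteq> 0 \<Longrightarrow> mset w = mset u + mset v - \<beta>" for w
        using sh_Fc[OF wd_Fc[OF HOL.refl] wd_Fc[OF HOL.refl], of w u v] by simp
    qed (rule sh_Jk_nu)
    then show ?thesis using True by auto
  next
    case False
    have "sh w (wd u) (wd v) = 0" for w
      using False sh_Fc[OF wd_Fc[OF HOL.refl] wd_Fc[OF HOL.refl], of w u v]
      by (metis mset_subset_eq_add_left)
    then show ?thesis using False by (auto simp: ecoef_simps)
  qed
  then have "\<forall>u. \<exists>Z. \<forall>v. (if \<beta> \<subseteq># mset u + mset v then Z v \<in> Fc (mset u + mset v - \<beta>) else Z v = 0) \<and> (\<forall>w. sh w (wd u) (wd v) = ecoef (ik \<nu>) w (Z v))"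
    by (intro allI choice) blast
  from choice[OF this] obtain Z where
    Z: "\<And>u v. if \<beta> \<subseteq># mset u + mset v then Z u v \<in> Fc (mset u + mset v - \<beta>) else Z u v = 0"
      "\<And>u v w. sh w (wd u) (wd v) = ecoef (ik \<nu>) w (Z u v)" by blast
  define \<Phi> where "\<Phi> X Y = ext (\<lambda>u. ext (Z u) Y) X" for X Y
  have lin1: "clinear (\<lambda>X. \<Phi> X Y)" for Y unfolding \<Phi>_def by (rule clinear_ext)
  have lin2: "clinear (\<Phi> X)" for X
    by (rule clinearI) (simp_all add: \<Phi>_def ext_plus_fun ext_smult_fun clinear_add[OF clinear_ext] clinear_scale[OF clinear_ext])
  have ec: "ecoef (ik \<nu>) w (\<Phi> X Y) = sh w X Y" for w X Y
  proof (rule clinear_eq_singleI[where X=X])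
    fix u
    show "ecoef (ik \<nu>) w (\<Phi> (wd u) Y) = sh w (wd u) Y"
      by (rule clinear_eq_singleI[where X=Y])
         (intro clinear_comps[OF lin_ecoef] lin2 lin_sh | simp add: \<Phi>_def Z(2))+
  qed (intro clinear_comps[OF lin_ecoef] lin1 lin_sh)+
  have "tri \<kappa> m \<beta> \<nu> \<Phi>"
    unfolding tri_def
  proof (intro conjI allI impI)
    show "cbilinear \<Phi>" using lin1 lin2 by (simp add: cbilinear_def)
    show "int (\<nu> i) = int (\<kappa> i) + int (m i) - pm i \<beta>" for i by (rule nu)
    fix c c' X Y assume X: "X \<in> Fc c" and Y: "Y \<in> Fc c'"
    define S where "S = (if \<beta> \<subseteq># c + c' then Fc (c + c' - \<beta>) else {0})"
    have S: "csubspace S" by (simp add: S_def Fc_subspace)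
    have w: "\<Phi> (wd u) (wd v) \<in> S" if "mset u = c" "mset v = c'" for u v
      using Z(1)[of u v] that by (auto simp: S_def \<Phi>_def split: if_splits)
    have "\<Phi> (wd u) Y \<in> S" if "mset u = c" for u
      by (rule Fc_induct[OF lin2 S w[OF that] Y])
    then have "\<Phi> X Y \<in> S"
      by (rule Fc_induct[OF lin1 S _ X])
    then show "if \<beta> \<subseteq># c + c' then \<Phi> X Y \<in> Fc (c + c' - \<beta>) else \<Phi> X Y = 0"
      by (simp add: S_def split: if_splits)
  next
    fix X Y assume "X \<in> Jk \<kappa> \<or> Y \<in> Jk m"
    then show "\<Phi> X Y \<in> Jk \<nu>" by (intro Rad_Jk) (auto simp: ec sh_Jk)
  next
    fix i X Y
    show "EE (ik \<nu>) i (\<Phi> X Y) - (\<Phi> (EE (ik \<kappa>) i X) Y + \<Phi> X (EE (ik m) i Y)) \<in> Jk \<nu>"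
    proof (rule Rad_Jk)
      fix w
      have "ecoef (ik \<nu>) w (EE (ik \<nu>) i (\<Phi> X Y)) = ecoef (ik \<nu>) (i # w) (\<Phi> X Y)" by simp
      then show "ecoef (ik \<nu>) w (EE (ik \<nu>) i (\<Phi> X Y) - (\<Phi> (EE (ik \<kappa>) i X) Y + \<Phi> X (EE (ik m) i Y))) = 0"
        unfolding ec ecoef_simps by simp
    qed
    show "wd [i] * \<Phi> X Y - (\<Phi> (wd [i] * X) Y + \<Phi> X (wd [i] * Y)) \<in> Jk \<nu>"
      by (rule Rad_Jk) (simp add: ecoef_simps ecoef_f ec sh_f)
  qed
  moreover have "Poly_Mapping.lookup (\<Phi> X Y) [] = ext \<eta> (anti X * Y)" for X Y
    using ec[of "[]" X Y] by (simp add: BF_def)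
  ultimately show ?thesis by blast
qed

end

section \<open>Extremal weight vectors\<close>

text \<open>An sl_2 action on the quotient by \<open>M\<close>, with \<open>W p\<close> the vectors
  of weight \<open>p\<close>. It is used for both orders of raising and lowering;
  \<open>sl2_FE\<close> exchanges them by negating the weights.\<close>

locale sl2_mod =
  fixes e f :: "'v::complex_vector \<Rightarrow> 'v" and W :: "int \<Rightarrow> 'v set" and M :: "'v set"
  assumes lin_e: "clinear e" and lin_f: "clinear f" and M: "csubspace M" and W: "csubspace (W p)"
    and e_M: "X \<in> M \<Longrightarrow> e X \<in> M" and f_M: "X \<in> M \<Longrightarrow> f X \<in> M"
    and e_W: "X \<in> W p \<Longrightarrow> e X \<in> W (p + 2)" and f_W: "X \<in> W p \<Longrightarrow> f X \<in> W (p - 2)"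
    and comm: "X \<in> W p \<Longrightarrow> e (f X) - f (e X) - of_int p *\<^sub>C X \<in> M"
begin

lemma pow_M: "X \<in> M \<Longrightarrow> (e ^^ n) X \<in> M" "X \<in> M \<Longrightarrow> (f ^^ n) X \<in> M"
  by (induction n) (auto simp: e_M f_M)

lemma pow_W: "X \<in> W p \<Longrightarrow> (e ^^ n) X \<in> W (p + 2 * int n)" "X \<in> W p \<Longrightarrow> (f ^^ n) X \<in> W (p - 2 * int n)"
proof (induction n)
  case (Suc n)
  { case 1
    with Suc(1) e_W[of "(e ^^ n) X" "p + 2 * int n"] show ?case by (simp add: algebra_simps) }
  { case 2
    with Suc(2) f_W[of "(f ^^ n) X" "p - 2 * int n"] show ?case by (simp add: algebra_simps) }
qed auto

lemma telescope: "a - b - s *\<^sub>C Y \<in> M \<Longrightarrow> b - c - t *\<^sub>C Y \<in> M \<Longrightarrow> r = s + t \<Longrightarrow> a - c - r *\<^sub>C Y \<in> M"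
  using complex_vector.subspace_add[OF M, of "a - b - s *\<^sub>C Y" "b - c - t *\<^sub>C Y"] by (simp add: scaleC_add_left algebra_simps)

lemma drop_middle: "a - b - c \<in> M \<Longrightarrow> b \<in> M \<Longrightarrow> a - c \<in> M"
  using complex_vector.subspace_add[OF M, of "a - b - c" b] by (simp add: algebra_simps)

lemma e_f_pow:
  assumes "X \<in> W p"
  shows "e ((f ^^ n) X) - (f ^^ n) (e X) - of_int (int n * (p - int n + 1)) *\<^sub>C (f ^^ (n - 1)) X \<in> M"
proof (induction n)
  case 0
  then show ?case by (simp add: complex_vector.subspace_0[OF M])
next
  case (Suc n)
  have "f ((f ^^ (n - 1)) X) = (f ^^ n) X" if "n \<noteq> 0" using that by (cases n) auto
  then have "f (e ((f ^^ n) X) - (f ^^ n) (e X) - of_int (int n * (p - int n + 1)) *\<^sub>C (f ^^ (n - 1)) X)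
      = f (e ((f ^^ n) X)) - (f ^^ Suc n) (e X) - of_int (int n * (p - int n + 1)) *\<^sub>C (f ^^ n) X"
    by (cases "n = 0") (simp_all add: clinear_diff[OF lin_f] clinear_scale[OF lin_f] clinear_zero[OF lin_f])
  with f_M[OF Suc] have 1: "f (e ((f ^^ n) X)) - (f ^^ Suc n) (e X) - of_int (int n * (p - int n + 1)) *\<^sub>C (f ^^ n) X \<in> M"
    by simp
  have 2: "e (f ((f ^^ n) X)) - f (e ((f ^^ n) X)) - of_int (p - 2 * int n) *\<^sub>C (f ^^ n) X \<in> M"
    by (rule comm[OF pow_W(2)[OF assms]])
  have "e (f ((f ^^ n) X)) - (f ^^ Suc n) (e X) - of_int (int (Suc n) * (p - int (Suc n) + 1)) *\<^sub>C (f ^^ n) X \<in> M"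
    by (rule telescope[OF 2 1]) (simp add: algebra_simps)
  then show ?case by simp
qed

lemma e_pow_f:
  assumes "X \<in> W p"
  shows "(e ^^ n) (f X) - f ((e ^^ n) X) - of_int (int n * (p + int n - 1)) *\<^sub>C (e ^^ (n - 1)) X \<in> M"
proof (induction n)
  case 0
  then show ?case by (simp add: complex_vector.subspace_0[OF M])
next
  case (Suc n)
  have "e ((e ^^ (n - 1)) X) = (e ^^ n) X" if "n \<noteq> 0" using that by (cases n) auto
  then have "e ((e ^^ n) (f X) - f ((e ^^ n) X) - of_int (int n * (p + int n - 1)) *\<^sub>C (e ^^ (n - 1)) X)
      = (e ^^ Suc n) (f X) - e (f ((e ^^ n) X)) - of_int (int n * (p + int n - 1)) *\<^sub>C (e ^^ n) X"
    by (cases "n = 0") (simp_all add: clinear_diff[OF lin_e] clinear_scale[OF lin_e] clinear_zero[OF lin_e])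
  with e_M[OF Suc] have 1: "(e ^^ Suc n) (f X) - e (f ((e ^^ n) X)) - of_int (int n * (p + int n - 1)) *\<^sub>C (e ^^ n) X \<in> M"
    by simp
  have 2: "e (f ((e ^^ n) X)) - f (e ((e ^^ n) X)) - of_int (p + 2 * int n) *\<^sub>C (e ^^ n) X \<in> M"
    by (rule comm[OF pow_W(1)[OF assms]])
  have "(e ^^ Suc n) (f X) - f (e ((e ^^ n) X)) - of_int (int (Suc n) * (p + int (Suc n) - 1)) *\<^sub>C (e ^^ n) X \<in> M"
    by (rule telescope[OF 1 2]) (simp add: algebra_simps)
  then show ?case by simp
qed

text \<open>By induction, f e X agrees with a fixed multiple of X modulo \<open>M\<close>. Then e
  maps f^(n+1) X to a strictly negative multiple of f^n X modulo \<open>M\<close>, so that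
  nilpotency of f descends to X itself.\<close>

lemma pow_injective:
  assumes "\<exists>n. (f ^^ n) X \<in> M" "X \<in> W p" "(e ^^ r) X \<in> M" "p + int r \<le> 0"
    and nil: "\<And>X p. X \<in> W p \<Longrightarrow> \<exists>n. (f ^^ n) X \<in> M"
  shows "X \<in> M"
  using assms(2-4)
proof (induction r arbitrary: X)
  case (Suc r)
  \<comment> \<open>The scalar c for which e^r (f e X - c X) reduces to f e^(r+1) X, which lies in
    \<open>M\<close>.\<close>
  let ?c = "of_int (int r * (p + int r + 1)) :: complex"
  let ?Z = "f (e X) - ?c *\<^sub>C X"
  have Z: "?Z \<in> W p"
    using f_W[OF e_W[OF Suc.prems(1)]] Suc.prems(1) by (auto intro!: subspace_intros W)
  have "(e ^^ r) (f (e X)) - f ((e ^^ Suc r) X) - of_int (int r * (p + 2 + int r - 1)) *\<^sub>C (e ^^ (r - 1)) (e X) \<in> M"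
    using e_pow_f[OF e_W[OF Suc.prems(1)], of r] by (simp add: funpow_swap1)
  from complex_vector.subspace_add[OF M this f_M[OF Suc.prems(2)]]
  have "(e ^^ r) (f (e X)) - of_int (int r * (p + 2 + int r - 1)) *\<^sub>C (e ^^ (r - 1)) (e X) \<in> M"
    by simp
  moreover have "(e ^^ (r - 1)) (e X) = (e ^^ r) X" if "r \<noteq> 0"
    using that by (cases r) (auto simp: funpow_swap1)
  then have "of_int (int r * (p + 2 + int r - 1)) *\<^sub>C (e ^^ (r - 1)) (e X) = ?c *\<^sub>C (e ^^ r) X"
    by (cases "r = 0") (simp_all add: algebra_simps)
  ultimately have "(e ^^ r) ?Z \<in> M"
    by (simp only: clinear_diff[OF clinear_pow[OF lin_e]] clinear_scale[OF clinear_pow[OF lin_e]])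
  from Suc.IH[OF Z this] Suc.prems(3) have Z0: "?Z \<in> M" by simp
  have step: "(f ^^ n) X \<in> M" if n: "(f ^^ Suc n) X \<in> M" for n
  proof -
    have "(f ^^ n) ?Z \<in> M" by (rule pow_M(2)[OF Z0])
    then have 1: "(f ^^ Suc n) (e X) - 0 - ?c *\<^sub>C (f ^^ n) X \<in> M"
      by (simp only: clinear_diff[OF clinear_pow[OF lin_f]] clinear_scale[OF clinear_pow[OF lin_f]] diff_0_right funpow_Suc_right o_apply)
    have 2: "e ((f ^^ Suc n) X) - (f ^^ Suc n) (e X) - of_int (int (Suc n) * (p - int (Suc n) + 1)) *\<^sub>C (f ^^ n) X \<in> M"
      using e_f_pow[OF Suc.prems(1), of "Suc n"] by (simp del: funpow.simps)
    let ?r = "int (Suc n) * (p - int (Suc n) + 1) + int r * (p + int r + 1)"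
    have "e ((f ^^ Suc n) X) - 0 - of_int ?r *\<^sub>C (f ^^ n) X \<in> M"
      by (rule telescope[OF 2 1]) simp
    from complex_vector.subspace_diff[OF M e_M[OF n] this]
    have "of_int ?r *\<^sub>C (f ^^ n) X \<in> M" by simp
    moreover have "?r < 0"
    proof -
      have "int (Suc n) * (p - int (Suc n) + 1) < 0" using Suc.prems(3) by (intro mult_pos_neg) auto
      moreover have "int r * (p + int r + 1) \<le> 0" using Suc.prems(3) by (intro mult_nonneg_nonpos) auto
      ultimately show ?thesis by simp
    qed
    then have "(of_int ?r :: complex) \<noteq> 0" by (metis less_irrefl of_int_eq_0_iff)
    ultimately show ?thesis
      using complex_vector.subspace_scale[OF M, of "of_int ?r *\<^sub>C (f ^^ n) X" "1 / of_int ?r"] by (simp only: scaleC_scaleC) simp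
  qed
  obtain N where "(f ^^ N) X \<in> M" using nil[OF Suc.prems(1)] by blast
  from descend[of "\<lambda>n. (f ^^ n) X \<in> M", OF step this] show ?case by simp
qed simp

lemma e_pow_f_pow:
  assumes "X \<in> W p" "e X \<in> M"
  shows "(e ^^ n) ((f ^^ n) X) - of_int (\<Prod>k<n. int (Suc k) * (p - int k)) *\<^sub>C X \<in> M"
proof (induction n)
  case 0
  then show ?case by (simp add: complex_vector.subspace_0[OF M])
next
  case (Suc n)
  let ?k = "int (Suc n) * (p - int n)"
  have "e ((f ^^ Suc n) X) - (f ^^ Suc n) (e X) - of_int ?k *\<^sub>C (f ^^ n) X \<in> M"
    using e_f_pow[OF assms(1), of "Suc n"] by (simp del: funpow.simps)
  from drop_middle[OF this pow_M(2)[OF assms(2)]]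
  have "e ((f ^^ Suc n) X) - of_int ?k *\<^sub>C (f ^^ n) X \<in> M" .
  from pow_M(1)[OF this, of n]
  have 1: "(e ^^ Suc n) ((f ^^ Suc n) X) - of_int ?k *\<^sub>C (e ^^ n) ((f ^^ n) X) \<in> M"
    by (simp only: clinear_diff[OF clinear_pow[OF lin_e]] clinear_scale[OF clinear_pow[OF lin_e]] funpow_Suc_right o_apply)
  have "of_int ?k *\<^sub>C ((e ^^ n) ((f ^^ n) X) - of_int (\<Prod>k<n. int (Suc k) * (p - int k)) *\<^sub>C X) \<in> M"
    by (rule complex_vector.subspace_scale[OF M Suc])
  from complex_vector.subspace_add[OF M 1 this]
  have "(e ^^ Suc n) ((f ^^ Suc n) X) - (of_int ?k * of_int (\<Prod>k<n. int (Suc k) * (p - int k))) *\<^sub>C X \<in> M"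
    by (simp only: complex_vector.scale_right_diff_distrib scaleC_scaleC) simp
  then show ?case by (simp only: prod.lessThan_Suc of_int_mult mult.commute)
qed

end

context km
begin

lemma EE_pow_Fc:
  assumes "X \<in> Fc c"
  shows "n \<le> count c i \<Longrightarrow> (EE \<kappa> i ^^ n) X \<in> Fc (c - replicate_mset n i)"
    and "n > count c i \<Longrightarrow> (EE \<kappa> i ^^ n) X = 0"
proof -
  show *: "n \<le> count c i \<Longrightarrow> (EE \<kappa> i ^^ n) X \<in> Fc (c - replicate_mset n i)" for n
  proof (induction n)
    case (Suc n)
    then have "i \<in># c - replicate_mset n i" by (simp add: in_diff_count)
    from EE_Fc[OF Suc.IH this] Suc.prems show ?case by (simp add: diff_diff_add_mset add.commute)
  qed (simp add: assms)
  have "(EE \<kappa> i ^^ (Suc (count c i) + k)) X = 0" for k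
  proof (induction k)
    case 0
    have "i \<notin># c - replicate_mset (count c i) i" by (simp add: in_diff_count)
    with EE_Fc0[OF *[of "count c i"]] show ?case by simp
  qed (simp add: EE_simps)
  then show "n > count c i \<Longrightarrow> (EE \<kappa> i ^^ n) X = 0"
    by (metis Suc_leI le_add_diff_inverse)
qed

lemma EE_nilpotent: "\<exists>n. (EE \<kappa> i ^^ n) X \<in> {0}"
proof -
  have sub: "csubspace {X. \<exists>N. \<forall>n\<ge>N. (EE \<kappa> i ^^ n) X \<in> {0}}"
    by (intro eventually_subspace complex_vector.subspace_single_0 clinear_pow lin_EE)
  have "wd u \<in> {X. \<exists>N. \<forall>n\<ge>N. (EE \<kappa> i ^^ n) X \<in> {0}}" for u
    using EE_pow_Fc(2)[OF wd_Fc[OF HOL.refl, of u], of i _ \<kappa>] by (auto intro!: exI[of _ "Suc (count (mset u) i)"])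
  from clinear_sub_singleI[OF clinear_id sub this, of X] show ?thesis by blast
qed

lemma sl2_EF: "sl2_mod (EE (ik \<kappa>) i) (\<lambda>X. wd [i] * X) (\<lambda>p. {X. Hp (ik \<kappa>) i X = of_int p *\<^sub>C X}) (Jk \<kappa>)"
  and sl2_FE: "sl2_mod (\<lambda>X. wd [i] * X) (EE (ik \<kappa>) i) (\<lambda>p. {X. Hp (ik \<kappa>) i X = of_int (- p) *\<^sub>C X}) (Jk \<kappa>)"
proof -
  have W: "csubspace {X. Hp (ik \<kappa>) i X = of_int p *\<^sub>C X}" for p
    using clinear_ker_subspace[OF clinear_minus[OF lin_Hp clinear_smult[OF clinear_id]], of "ik \<kappa>" i "of_int p"] by simp
  have e: "Hp (ik \<kappa>) i (EE (ik \<kappa>) i X) = of_int (p + 2) *\<^sub>C EE (ik \<kappa>) i X"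
    and f: "Hp (ik \<kappa>) i (wd [i] * X) = of_int (p - 2) *\<^sub>C (wd [i] * X)"
    and c: "EE (ik \<kappa>) i (wd [i] * X) = wd [i] * EE (ik \<kappa>) i X + of_int p *\<^sub>C X"
    if "Hp (ik \<kappa>) i X = of_int p *\<^sub>C X" for X p
    using that by (simp_all add: Hp_commute EE_simps scaleC_add_left Hp_f falg_scale_right complex_vector.scale_left_diff_distrib EE_f)
  show "sl2_mod (EE (ik \<kappa>) i) (\<lambda>X. wd [i] * X) (\<lambda>p. {X. Hp (ik \<kappa>) i X = of_int p *\<^sub>C X}) (Jk \<kappa>)"
  proof (rule sl2_mod.intro)
    fix X p assume "X \<in> {X. Hp (ik \<kappa>) i X = of_int p *\<^sub>C X}"
    then have X: "Hp (ik \<kappa>) i X = of_int p *\<^sub>C X" by simp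
    show "EE (ik \<kappa>) i X \<in> {X. Hp (ik \<kappa>) i X = of_int (p + 2) *\<^sub>C X}"
      using e[OF X] by simp
    show "wd [i] * X \<in> {X. Hp (ik \<kappa>) i X = of_int (p - 2) *\<^sub>C X}"
      using f[OF X] by simp
    show "EE (ik \<kappa>) i (wd [i] * X) - wd [i] * EE (ik \<kappa>) i X - of_int p *\<^sub>C X \<in> Jk \<kappa>"
      unfolding c[OF X] by (simp add: complex_vector.subspace_0[OF Jk_subspace])
  qed (intro lin_EE clinear_intros Jk_subspace W EE_Jk Jk_mult_left | assumption)+
  show "sl2_mod (\<lambda>X. wd [i] * X) (EE (ik \<kappa>) i) (\<lambda>p. {X. Hp (ik \<kappa>) i X = of_int (- p) *\<^sub>C X}) (Jk \<kappa>)"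
  proof (rule sl2_mod.intro)
    fix X p assume "X \<in> {X. Hp (ik \<kappa>) i X = of_int (- p) *\<^sub>C X}"
    then have X: "Hp (ik \<kappa>) i X = of_int (- p) *\<^sub>C X" by simp
    show "wd [i] * X \<in> {X. Hp (ik \<kappa>) i X = of_int (- (p + 2)) *\<^sub>C X}"
      using f[OF X] by simp
    show "EE (ik \<kappa>) i X \<in> {X. Hp (ik \<kappa>) i X = of_int (- (p - 2)) *\<^sub>C X}"
      using e[OF X] by (simp add: algebra_simps)
    show "wd [i] * EE (ik \<kappa>) i X - EE (ik \<kappa>) i (wd [i] * X) - of_int p *\<^sub>C X \<in> Jk \<kappa>"
      unfolding c[OF X] by (simp add: complex_vector.scale_minus_left complex_vector.subspace_0[OF Jk_subspace])
  qed (intro lin_EE clinear_intros Jk_subspace W EE_Jk Jk_mult_left | assumption)+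
qed

lemma E_inj:
  assumes "X \<in> Fc c" "(EE (ik \<kappa>) i ^^ n) X \<in> Jk \<kappa>" "int (\<kappa> i) - pm i c + int n \<le> 0"
  shows "X \<in> Jk \<kappa>"
proof (rule sl2_mod.pow_injective[OF sl2_EF])
  show nil: "\<exists>n. ((\<lambda>X. wd [i] * X) ^^ n) X \<in> Jk \<kappa>" for X
    unfolding wd_pow using pow_nilpotent by blast
  show "\<exists>n. ((\<lambda>X. wd [i] * X) ^^ n) X \<in> Jk \<kappa>" for X by (rule nil)
qed (use assms in \<open>auto simp: Hp_Fc\<close>)

lemma F_inj:
  assumes "X \<in> Fc c" "wd (replicate n i) * X \<in> Jk \<kappa>" "int n \<le> int (\<kappa> i) - pm i c"
  shows "X \<in> Jk \<kappa>"
proof (rule sl2_mod.pow_injective[OF sl2_FE])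
  show nil: "\<exists>n. (EE (ik \<kappa>) i ^^ n) X \<in> Jk \<kappa>" for X
    using EE_nilpotent[of "ik \<kappa>" i X] complex_vector.subspace_0[OF Jk_subspace[of \<kappa>]] by (metis singletonD)
  show "\<exists>n. (EE (ik \<kappa>) i ^^ n) X \<in> Jk \<kappa>" for X by (rule nil)
  show "((\<lambda>X. wd [i] * X) ^^ n) X \<in> Jk \<kappa>" unfolding wd_pow by (rule assms)
  show "X \<in> {X. Hp (ik \<kappa>) i X = of_int (- (pm i c - int (\<kappa> i))) *\<^sub>C X}" using assms by (simp add: Hp_Fc)
qed (use assms in simp)

text \<open>\<open>qq m c\<close> is the difference of the squared norms of \<open>m - c\<close> and \<open>m\<close>.\<close>

definition qq :: "('n \<Rightarrow> int) \<Rightarrow> 'n multiset \<Rightarrow> real"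
  where "qq m c = (\<Sum>i\<in>#c. d i * of_int (pm i c - 2 * m i))"

lemma qq_add_mset: "qq m (add_mset i c) = qq m c + 2 * d i * of_int (1 - (m i - pm i c))"
proof -
  have "qq m (add_mset i c) = d i * of_int (2 + pm i c - 2 * m i) + (\<Sum>k\<in>#c. d k * of_int (A $ k $ i) + d k * of_int (pm k c - 2 * m k))"
    by (simp add: qq_def algebra_simps)
  also have "\<dots> = d i * of_int (2 + pm i c - 2 * m i) + (d i * of_int (pm i c) + qq m c)"
    unfolding sum_mset.distrib bb_sym qq_def ..
  finally show ?thesis by (simp add: algebra_simps)
qed

lemma qq_add_replicate: "qq m (replicate_mset n i + c) = qq m c + 2 * d i * real n * of_int (int n - (m i - pm i c))"
  by (induction n) (simp_all add: qq_add_mset algebra_simps)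

lemma qq_empty [simp]: "qq m {#} = 0"
  by (simp add: qq_def)

text \<open>With \<gamma> the sum of \<open>c\<close>, the negative of \<open>qq\<close> is (m,
  \<gamma>) + (m - \<gamma>, \<gamma>), and both terms are nonnegative when m and m - \<gamma> are
  dominant.\<close>

lemma qq_dominant:
  assumes "\<And>i. pm i c \<le> int (m i)"
  shows "qq (ik m) c \<le> 0" and "qq (ik m) c = 0 \<Longrightarrow> i \<in># c \<Longrightarrow> m i = 0"
proof -
  have neg: "d i * of_int (pm i c - 2 * int (m i)) \<le> - (d i * real (m i))" for i
  proof -
    have "(of_int (pm i c - 2 * int (m i)) :: real) \<le> - real (m i)" using assms[of i] by linarith
    from mult_left_mono[OF this less_imp_le[OF d_pos[of i]]] show ?thesis by simp
  qed
  have le: "(\<Sum>i\<in>#c. d i * of_int (pm i c - 2 * int (m i))) \<le> (\<Sum>i\<in>#c. - (d i * real (m i)))"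
    by (intro sum_mset_mono) (use neg in blast)
  also have "\<dots> = - (\<Sum>i\<in>#c. d i * real (m i))" by (induction c) auto
  finally have *: "qq (ik m) c \<le> - (\<Sum>i\<in>#c. d i * real (m i))" by (simp add: qq_def)
  have pos: "0 \<le> (\<Sum>i\<in>#c. d i * real (m i))" for c
    using d_pos by (intro sum_mset_nonneg_real) (simp add: less_imp_le)
  with * show "qq (ik m) c \<le> 0" by (smt (verit))
  assume "qq (ik m) c = 0" "i \<in># c"
  then obtain c' where "c = add_mset i c'" by (metis multi_member_split)
  with * \<open>qq (ik m) c = 0\<close> pos[of c'] have "d i * real (m i) \<le> 0" by simp
  then show "m i = 0" using d_pos[of i] by (simp add: mult_le_0_iff)
qed

text \<open>The reflection s_i realized by a power of e_i: sl_2 theory keeps the vector nonzero, and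
  the invariant norm does not change.\<close>

lemma reflect_up:
  assumes X: "X \<in> Fc c" "X \<notin> Jk \<kappa>" and n: "int n = - (int (\<kappa> i) - pm i c)"
  obtains c' where "c = replicate_mset n i + c'" "(EE (ik \<kappa>) i ^^ n) X \<in> Fc c'" "(EE (ik \<kappa>) i ^^ n) X \<notin> Jk \<kappa>"
    "int n = int (\<kappa> i) - pm i c'" "qq (ik \<kappa>) c' = qq (ik \<kappa>) c"
proof -
  have nJ: "(EE (ik \<kappa>) i ^^ n) X \<notin> Jk \<kappa>" using E_inj[OF X(1)] X(2) n by auto
  then have "n \<le> count c i"
    using EE_pow_Fc(2)[OF X(1), of i n "ik \<kappa>"] complex_vector.subspace_0[OF Jk_subspace] by (metis not_le)
  then have c: "c = replicate_mset n i + (c - replicate_mset n i)"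
    by (metis count_le_replicate_mset_subset_eq subset_mset.add_diff_inverse)
  let ?c = "c - replicate_mset n i"
  have "pm i c = pm i (replicate_mset n i) + pm i ?c" by (subst c) simp
  then have p: "int n = int (\<kappa> i) - pm i ?c" using n by simp
  have "qq (ik \<kappa>) c = qq (ik \<kappa>) ?c"
    by (subst c, subst qq_add_replicate) (simp add: p[symmetric] del: of_int_diff)
  from that[OF c EE_pow_Fc(1)[OF X(1) \<open>n \<le> count c i\<close>] nJ p this[symmetric]] show ?thesis .
qed

text \<open>No weight of V(\<kappa>) is longer than \<kappa>: reflections preserve the norm and lead
  to a dominant weight, where \<open>qq_dominant\<close> applies.\<close>

lemma qq_le_0: "X \<in> Fc c \<Longrightarrow> X \<notin> Jk \<kappa> \<Longrightarrow> qq (ik \<kappa>) c \<le> 0"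
proof (induction "size c" arbitrary: c X rule: less_induct)
  case less
  show ?case
  proof (cases "\<forall>i. pm i c \<le> int (\<kappa> i)")
    case True
    then show ?thesis by (intro qq_dominant) blast
  next
    case False
    then obtain i where i: "int (\<kappa> i) - pm i c < 0" by (auto simp: not_le)
    have "int (nat (pm i c - int (\<kappa> i))) = - (int (\<kappa> i) - pm i c)" using i by simp
    from reflect_up[OF less.prems this] obtain c' where
      c': "c = replicate_mset (nat (pm i c - int (\<kappa> i))) i + c'" "(EE (ik \<kappa>) i ^^ nat (pm i c - int (\<kappa> i))) X \<in> Fc c'"
        "(EE (ik \<kappa>) i ^^ nat (pm i c - int (\<kappa> i))) X \<notin> Jk \<kappa>" "qq (ik \<kappa>) c' = qq (ik \<kappa>) c" by metis
    have "size c = nat (pm i c - int (\<kappa> i)) + size c'" by (subst c'(1)) simp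
    with i have "size c' < size c" by simp
    from less.hyps[OF this c'(2,3)] show ?thesis using c'(4) by simp
  qed
qed

lemma one_notin_Jk: "(1 :: 'n falg) \<notin> Jk \<kappa>"
  using ecoef_Jk[of 1 \<kappa> "[]"] by (auto simp: wd_Nil[symmetric])

lemma Fc_empty: "X \<in> Fc {#} \<Longrightarrow> X = Poly_Mapping.lookup X [] *\<^sub>C 1"
proof -
  assume X: "X \<in> Fc {#}"
  have "X - Poly_Mapping.lookup X [] *\<^sub>C wd [] \<in> {0}"
  proof (rule Fc_induct[OF _ complex_vector.subspace_single_0 _ X])
    show "clinear (\<lambda>x. x - Poly_Mapping.lookup x [] *\<^sub>C wd [])"
      by (rule clinearI) (simp_all add: lookup_add lookup_scaleC algebra_simps scaleC_add_left scaleC_scaleC scaleC_cmul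
          complex_vector.scale_right_diff_distrib)
  qed auto
  then show ?thesis by (simp add: wd_Nil)
qed

text \<open>Equality of norms forces \<open>\<kappa> j = 0\<close> for every letter of
  \<open>c\<close>; the rightmost letter of each word then already kills the highest weight
  vector.\<close>

lemma dominant_qq_0:
  assumes X: "X \<in> Fc c" "X \<notin> Jk \<kappa>" and c: "\<And>i. pm i c \<le> int (\<kappa> i)" and q: "qq (ik \<kappa>) c = 0"
  shows "c = {#}"
proof (rule ccontr)
  assume ne: "c \<noteq> {#}"
  have "X \<in> Jk \<kappa>"
  proof (rule Fc_induct[OF clinear_id Jk_subspace _ X(1)])
    fix u assume u: "mset u = c"
    with ne have "u \<noteq> []" by auto
    then obtain u' j where u': "u = u' @ [j]" by (metis rev_exhaust)
    then have "\<kappa> j = 0" using qq_dominant(2)[OF c q, of j] u by auto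
    then show "wd u \<in> Jk \<kappa>" using Jk_base[of u' \<kappa> j] by (simp add: u' wd_mult)
  qed
  with X(2) show False ..
qed

primrec cont :: "('n \<times> nat) list \<Rightarrow> 'n multiset" where
  "cont [] = {#}"
| "cont (ia # x) = replicate_mset (snd ia) (fst ia) + cont x"

primrec wrd :: "('n \<times> nat) list \<Rightarrow> 'n list" where
  "wrd [] = []"
| "wrd (ia # x) = replicate (snd ia) (fst ia) @ wrd x"

text \<open>A chain records reflections lowering the highest weight \<open>\<kappa>\<close> to the weight \<open>\<kappa> - cont x\<close> of its
  Weyl group orbit; \<open>zz x\<close> is the corresponding extremal vector.\<close>

primrec chain :: "('n \<Rightarrow> nat) \<Rightarrow> ('n \<times> nat) list \<Rightarrow> bool" where
  "chain \<kappa> [] = True"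
| "chain \<kappa> (ia # x) \<longleftrightarrow> chain \<kappa> x \<and> int (snd ia) = int (\<kappa> (fst ia)) - pm (fst ia) (cont x)"

abbreviation zz :: "('n \<times> nat) list \<Rightarrow> 'n falg" where "zz x \<equiv> wd (wrd x)"

lemma mset_wrd [simp]: "mset (wrd x) = cont x"
  by (induction x) auto

lemma zz_Fc: "zz x \<in> Fc (cont x)"
  by (rule wd_Fc) simp

lemma zz_Cons: "zz ((i, a) # x) = wd (replicate a i) * zz x"
  by (simp add: wd_mult)

lemma chain_extremal: "chain \<kappa> x \<Longrightarrow> qq (ik \<kappa>) (cont x) = 0" "chain \<kappa> x \<Longrightarrow> zz x \<notin> Jk \<kappa>"
proof (induction x)
  case (Cons ia x)
  { case 1
    with Cons(1) show ?case by (simp add: qq_add_replicate del: of_int_diff) }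
  { case 2
    then have "wd (replicate (snd ia) (fst ia)) * zz x \<in> Jk \<kappa> \<Longrightarrow> zz x \<in> Jk \<kappa>"
      by (intro F_inj[OF zz_Fc]) auto
    with Cons(2) 2 show ?case by (auto simp: wd_mult) }
qed (use one_notin_Jk in \<open>auto simp: wd_Nil\<close>)

text \<open>Maximal norm characterizes the Weyl orbit of \<kappa> among the weights of V(\<kappa>);
  later arguments test extremality through the number \<open>qq\<close> alone.\<close>

lemma chain_exists: "X \<in> Fc c \<Longrightarrow> X \<notin> Jk \<kappa> \<Longrightarrow> qq (ik \<kappa>) c = 0 \<Longrightarrow> \<exists>x. chain \<kappa> x \<and> cont x = c"
proof (induction "size c" arbitrary: c X rule: less_induct)
  case less
  show ?case
  proof (cases "\<forall>i. pm i c \<le> int (\<kappa> i)")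
    case True
    with dominant_qq_0[OF less.prems(1,2) _ less.prems(3)] have "c = {#}" by blast
    then show ?thesis by (intro exI[of _ "[]"]) simp
  next
    case False
    then obtain i where i: "int (\<kappa> i) - pm i c < 0" by (auto simp: not_le)
    define n where "n = nat (pm i c - int (\<kappa> i))"
    have "int n = - (int (\<kappa> i) - pm i c)" using i by (simp add: n_def)
    from reflect_up[OF less.prems(1,2) this] obtain c' where
      c': "c = replicate_mset n i + c'" "(EE (ik \<kappa>) i ^^ n) X \<in> Fc c'"
        "(EE (ik \<kappa>) i ^^ n) X \<notin> Jk \<kappa>" "int n = int (\<kappa> i) - pm i c'" "qq (ik \<kappa>) c' = qq (ik \<kappa>) c" by metis
    have "size c = n + size c'" by (subst c'(1)) simp
    then have "size c' < size c" using i by (simp add: n_def)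
    from less.hyps[OF this c'(2,3)] c'(5) less.prems(3) obtain x where "chain \<kappa> x" "cont x = c'" by auto
    then show ?thesis using c'(1,4) by (intro exI[of _ "(i, n) # x"]) simp
  qed
qed

text \<open>A nonzero result would have a weight of norm larger than that of \<kappa>, against
  \<open>qq_le_0\<close>.\<close>

lemma extremal_E:
  assumes X: "X \<in> Fc c" and q: "qq (ik \<kappa>) c = 0" and n: "n \<noteq> 0" "int (\<kappa> i) - pm i c + int n > 0"
  shows "(EE (ik \<kappa>) i ^^ n) X \<in> Jk \<kappa>"
proof (cases "n \<le> count c i")
  case False
  then show ?thesis using EE_pow_Fc(2)[OF X, of i n "ik \<kappa>"] by (simp add: complex_vector.subspace_0[OF Jk_subspace])
next
  case True
  let ?c = "c - replicate_mset n i"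
  have c: "c = replicate_mset n i + ?c"
    using True by (metis count_le_replicate_mset_subset_eq subset_mset.add_diff_inverse)
  have "pm i c = pm i (replicate_mset n i) + pm i ?c" by (subst c) simp
  then have "int n - (int (\<kappa> i) - pm i ?c) < 0" using n by simp
  then have "2 * d i * real n * of_int (int n - (int (\<kappa> i) - pm i ?c)) < 0"
    using n d_pos[of i] by (intro mult_pos_neg) auto
  moreover have "qq (ik \<kappa>) c = qq (ik \<kappa>) ?c + 2 * d i * real n * of_int (int n - (int (\<kappa> i) - pm i ?c))"
    by (subst c) (rule qq_add_replicate)
  ultimately have "\<not> qq (ik \<kappa>) ?c \<le> 0" using q by linarith
  with qq_le_0[OF EE_pow_Fc(1)[OF X True], of "ik \<kappa>" \<kappa>] show ?thesis by blast
qed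

lemma extremal_F:
  assumes X: "X \<in> Fc c" and q: "qq (ik \<kappa>) c = 0" and n: "n \<noteq> 0" "int n > int (\<kappa> i) - pm i c"
  shows "wd (replicate n i) * X \<in> Jk \<kappa>"
proof -
  have "2 * d i * real n * of_int (int n - (int (\<kappa> i) - pm i c)) > 0"
    using n d_pos[of i] by (intro mult_pos_pos) auto
  then have "\<not> qq (ik \<kappa>) (replicate_mset n i + c) \<le> 0"
    unfolding qq_add_replicate using q by linarith
  moreover have "wd (replicate n i) * X \<in> Fc (replicate_mset n i + c)"
    using X by (intro Fc_mult wd_Fc) auto
  ultimately show ?thesis using qq_le_0 by blast
qed

lemma EF_coeff: "int n \<le> p \<Longrightarrow> (of_int (\<Prod>k<n. int (Suc k) * (p - int k)) :: complex) \<noteq> 0"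
  unfolding of_int_eq_0_iff by (auto simp: prod_zero_iff)

lemma EF_extremal:
  assumes X: "X \<in> Fc c" and q: "qq (ik \<kappa>) c = 0" and n: "int n \<le> int (\<kappa> i) - pm i c"
  shows "\<exists>s. s \<noteq> 0 \<and> (EE (ik \<kappa>) i ^^ n) (wd (replicate n i) * X) - s *\<^sub>C X \<in> Jk \<kappa>"
proof -
  interpret sl2_mod "EE (ik \<kappa>) i" "\<lambda>X. wd [i] * X" "\<lambda>p. {X. Hp (ik \<kappa>) i X = of_int p *\<^sub>C X}" "Jk \<kappa>"
    by (rule sl2_EF)
  have "EE (ik \<kappa>) i X \<in> Jk \<kappa>" using extremal_E[OF X q, of 1 i] n by simp
  from e_pow_f_pow[OF _ this, of "int (\<kappa> i) - pm i c" n] Hp_Fc[OF X] EF_coeff[OF n] show ?thesis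
    unfolding wd_pow mem_Collect_eq by blast
qed

lemma FE_extremal:
  assumes X: "X \<in> Fc c" and q: "qq (ik \<kappa>) c = 0" and n: "int n \<le> - (int (\<kappa> i) - pm i c)"
  shows "\<exists>s. s \<noteq> 0 \<and> wd (replicate n i) * (EE (ik \<kappa>) i ^^ n) X - s *\<^sub>C X \<in> Jk \<kappa>"
proof -
  interpret sl2_mod "\<lambda>X. wd [i] * X" "EE (ik \<kappa>) i" "\<lambda>p. {X. Hp (ik \<kappa>) i X = of_int (- p) *\<^sub>C X}" "Jk \<kappa>"
    by (rule sl2_FE)
  have "wd [i] * X \<in> Jk \<kappa>" using extremal_F[OF X q, of 1 i] n by simp
  from e_pow_f_pow[OF _ this, of "- (int (\<kappa> i) - pm i c)" n] Hp_Fc[OF X] EF_coeff[OF n] show ?thesis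
    unfolding wd_pow mem_Collect_eq minus_minus by blast
qed

lemma Jk_trans: "X - s *\<^sub>C Y \<in> Jk \<kappa> \<Longrightarrow> Y - t *\<^sub>C Z \<in> Jk \<kappa> \<Longrightarrow> X - (s * t) *\<^sub>C Z \<in> Jk \<kappa>"
  using complex_vector.subspace_add[OF Jk_subspace _ complex_vector.subspace_scale[OF Jk_subspace], of "X - s *\<^sub>C Y" \<kappa> "Y - t *\<^sub>C Z" s]
  by (simp add: complex_vector.scale_right_diff_distrib scaleC_scaleC)

lemma Jk_cancel: "X - s *\<^sub>C Y \<in> Jk \<kappa> \<Longrightarrow> s \<noteq> 0 \<Longrightarrow> X \<in> Jk \<kappa> \<longleftrightarrow> Y \<in> Jk \<kappa>"
proof
  assume *: "X - s *\<^sub>C Y \<in> Jk \<kappa>" "s \<noteq> 0"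
  show "X \<in> Jk \<kappa>" if "Y \<in> Jk \<kappa>"
    using complex_vector.subspace_add[OF Jk_subspace *(1) complex_vector.subspace_scale[OF Jk_subspace that, of s]] by simp
  show "Y \<in> Jk \<kappa>" if "X \<in> Jk \<kappa>"
    using complex_vector.subspace_scale[OF Jk_subspace complex_vector.subspace_diff[OF Jk_subspace that *(1)], of "1 / s"] *(2)
    by (simp add: scaleC_scaleC)
qed

text \<open>Extremal weight spaces are lines: the power of e_i that undoes the outermost reflection
  is injective and leads to the line of the shorter chain.\<close>

lemma extremal_unique: "chain \<kappa> x \<Longrightarrow> X \<in> Fc (cont x) \<Longrightarrow> \<exists>t. X - t *\<^sub>C zz x \<in> Jk \<kappa>"
proof (induction x arbitrary: X)
  case Nil
  then show ?case
    using Fc_empty[of X] complex_vector.subspace_0[OF Jk_subspace] by (metis cont.simps(1) diff_self wd_Nil wrd.simps(1))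
next
  case (Cons ia x)
  obtain i a where ia: "ia = (i, a)" by (cases ia)
  with Cons.prems have a: "int a = int (\<kappa> i) - pm i (cont x)" and ch: "chain \<kappa> x" and X: "X \<in> Fc (replicate_mset a i + cont x)" by auto
  have "(EE (ik \<kappa>) i ^^ a) X \<in> Fc (cont x)"
    using EE_pow_Fc(1)[OF X, of a i "ik \<kappa>"] by simp
  from Cons.IH[OF ch this] obtain t where t: "(EE (ik \<kappa>) i ^^ a) X - t *\<^sub>C zz x \<in> Jk \<kappa>" by blast
  obtain s where s: "s \<noteq> 0" "(EE (ik \<kappa>) i ^^ a) (wd (replicate a i) * zz x) - s *\<^sub>C zz x \<in> Jk \<kappa>"
    using EF_extremal[OF zz_Fc chain_extremal(1)[OF ch], of a i] a by auto
  let ?Y = "X - (t / s) *\<^sub>C zz ((i, a) # x)"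
  have "?Y \<in> Fc (replicate_mset a i + cont x)"
    using X zz_Fc[of "(i, a) # x"] by (auto intro!: subspace_intros Fc_subspace)
  moreover have "(EE (ik \<kappa>) i ^^ a) ?Y \<in> Jk \<kappa>"
  proof -
    have "(EE (ik \<kappa>) i ^^ a) ?Y = ((EE (ik \<kappa>) i ^^ a) X - t *\<^sub>C zz x) - (t / s) *\<^sub>C ((EE (ik \<kappa>) i ^^ a) (wd (replicate a i) * zz x) - s *\<^sub>C zz x)"
      unfolding zz_Cons clinear_diff[OF clinear_pow[OF lin_EE]] clinear_scale[OF clinear_pow[OF lin_EE]]
      using s(1) by (simp add: complex_vector.scale_right_diff_distrib scaleC_scaleC)
    also have "\<dots> \<in> Jk \<kappa>" by (intro subspace_intros Jk_subspace t s)
    finally show ?thesis .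
  qed
  ultimately have "?Y \<in> Jk \<kappa>" by (rule E_inj) (use a in simp)
  then show ?case unfolding ia by blast
qed

definition scale :: "nat \<Rightarrow> ('n \<times> nat) list \<Rightarrow> ('n \<times> nat) list"
  where "scale N x = map (\<lambda>(i, a). (i, N * a)) x"

lemma scale_simps [simp]: "scale N [] = []" "scale N (ia # x) = (fst ia, N * snd ia) # scale N x"
  by (simp_all add: scale_def case_prod_unfold)

lemma pm_repeat [simp]: "pm i (repeat_mset N c) = int N * pm i c"
  by (induction N) (simp_all add: algebra_simps)

lemma cont_scale [simp]: "cont (scale N x) = repeat_mset N (cont x)"
proof -
  have r: "repeat_mset N (replicate_mset a i) = replicate_mset (N * a) i" for a i
    by (rule multiset_eqI) simp
  show ?thesis by (induction x) (simp_all add: repeat_mset_distrib2 r)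
qed

lemma chain_scale: "chain \<kappa> x \<Longrightarrow> chain (\<lambda>i. N * \<kappa> i) (scale N x)"
  by (induction x) (auto simp: right_diff_distrib)

end

section \<open>Coproduct and composition of homomorphisms\<close>

lemma tensor_span: "(t :: ('v::complex_vector, 'w::complex_vector) tensor) \<in> cspan {x \<otimes>\<^sub>C y | x y. True}"
proof -
  obtain p where t: "t = abs_tensor p" by (metis Quotient3_abs_rep[OF Quotient3_tensor])
  have lin: "clinear (abs_tensor :: _ \<Rightarrow> ('v, 'w) tensor)"
    by (rule clinearI) (simp_all add: plus_tensor.abs_eq scaleC_tensor.abs_eq)
  have "abs_tensor p \<in> cspan {x \<otimes>\<^sub>C y | (x::'v) (y::'w). True}"
  proof (rule clinear_sub_singleI[OF lin complex_vector.subspace_span])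
    fix u :: "'v \<times> 'w"
    have "abs_tensor (Poly_Mapping.single u 1) = fst u \<otimes>\<^sub>C snd u" by (simp add: tens.abs_eq)
    then show "abs_tensor (Poly_Mapping.single u 1) \<in> cspan {x \<otimes>\<^sub>C y | (x::'v) (y::'w). True}"
      by (auto intro: complex_vector.span_base)
  qed
  with t show ?thesis by simp
qed

lemma tensor_subI:
  assumes "clinear f" "csubspace S" "\<And>x y. f (x \<otimes>\<^sub>C y) \<in> S"
  shows "f t \<in> S"
  by (rule span_image_sub[OF assms(1,2) _ tensor_span]) (use assms(3) in auto)

lemma tensor_eqI:
  assumes "clinear f" "clinear g" "\<And>x y. f (x \<otimes>\<^sub>C y) = g (x \<otimes>\<^sub>C y)"
  shows "f t = g t"
  by (rule span_eqI[OF assms(1,2) _ tensor_span]) (use assms(3) in auto)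

definition dT :: "('v \<Rightarrow> 'v) \<Rightarrow> ('w \<Rightarrow> 'w) \<Rightarrow> ('v::complex_vector, 'w::complex_vector) tensor \<Rightarrow> ('v, 'w) tensor"
  where "dT a b = tensor_lift (\<lambda>x y. a x \<otimes>\<^sub>C y + x \<otimes>\<^sub>C b y)"

lemma
  assumes "clinear a" "clinear b"
  shows lin_dT: "clinear (dT a b)" and dT_tens: "dT a b (x \<otimes>\<^sub>C y) = a x \<otimes>\<^sub>C y + x \<otimes>\<^sub>C b y"
proof -
  have "cbilinear (\<lambda>x y. a x \<otimes>\<^sub>C y + x \<otimes>\<^sub>C b y)"
    using assms by (intro cbilinearI clinear_plus clinear_tens1 clinear_tens2 clinear_id)
  then show "clinear (dT a b)" "dT a b (x \<otimes>\<^sub>C y) = a x \<otimes>\<^sub>C y + x \<otimes>\<^sub>C b y"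
    by (simp_all add: dT_def clinear_tensor_lift tensor_lift_tens)
qed

context km
begin

lemma triI:
  assumes "\<And>X. clinear (\<Phi> X)" "\<And>Y. clinear (\<lambda>X. \<Phi> X Y)"
    and "\<And>i. int (\<nu> i) = int (\<kappa> i) + int (m i) - pm i \<beta>"
    and "\<And>c c' X Y. X \<in> Fc c \<Longrightarrow> Y \<in> Fc c' \<Longrightarrow> \<beta> \<subseteq># c + c' \<Longrightarrow> \<Phi> X Y \<in> Fc (c + c' - \<beta>)"
    and "\<And>c c' X Y. X \<in> Fc c \<Longrightarrow> Y \<in> Fc c' \<Longrightarrow> \<not> \<beta> \<subseteq># c + c' \<Longrightarrow> \<Phi> X Y = 0"
    and "\<And>X Y. X \<in> Jk \<kappa> \<Longrightarrow> \<Phi> X Y \<in> Jk \<nu>" "\<And>X Y. Y \<in> Jk m \<Longrightarrow> \<Phi> X Y \<in> Jk \<nu>"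
    and "\<And>i X Y. EE (ik \<nu>) i (\<Phi> X Y) - (\<Phi> (EE (ik \<kappa>) i X) Y + \<Phi> X (EE (ik m) i Y)) \<in> Jk \<nu>"
    and "\<And>i X Y. wd [i] * \<Phi> X Y - (\<Phi> (wd [i] * X) Y + \<Phi> X (wd [i] * Y)) \<in> Jk \<nu>"
  shows "tri \<kappa> m \<beta> \<nu> \<Phi>"
  unfolding tri_def cbilinear_def using assms by auto

lemma triD:
  assumes "tri \<kappa> m \<beta> \<nu> \<Phi>"
  shows tri_lin2: "clinear (\<Phi> X)" and tri_lin1: "clinear (\<lambda>X. \<Phi> X Y)"
    and tri_nu: "int (\<nu> i) = int (\<kappa> i) + int (m i) - pm i \<beta>"
    and tri_Fc: "X \<in> Fc c \<Longrightarrow> Y \<in> Fc c' \<Longrightarrow> \<beta> \<subseteq># c + c' \<Longrightarrow> \<Phi> X Y \<in> Fc (c + c' - \<beta>)"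
    and tri_Fc0: "X \<in> Fc c \<Longrightarrow> Y \<in> Fc c' \<Longrightarrow> \<not> \<beta> \<subseteq># c + c' \<Longrightarrow> \<Phi> X Y = 0"
    and tri_Jk1: "X \<in> Jk \<kappa> \<Longrightarrow> \<Phi> X Y \<in> Jk \<nu>" and tri_Jk2: "Y \<in> Jk m \<Longrightarrow> \<Phi> X Y \<in> Jk \<nu>"
    and tri_EE: "EE (ik \<nu>) i (\<Phi> X Y) - (\<Phi> (EE (ik \<kappa>) i X) Y + \<Phi> X (EE (ik m) i Y)) \<in> Jk \<nu>"
    and tri_f: "wd [i] * \<Phi> X Y - (\<Phi> (wd [i] * X) Y + \<Phi> X (wd [i] * Y)) \<in> Jk \<nu>"
proof -
  note a = assms[unfolded tri_def cbilinear_def]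
  show "clinear (\<Phi> X)" "clinear (\<lambda>X. \<Phi> X Y)" "int (\<nu> i) = int (\<kappa> i) + int (m i) - pm i \<beta>"
    "X \<in> Jk \<kappa> \<Longrightarrow> \<Phi> X Y \<in> Jk \<nu>" "Y \<in> Jk m \<Longrightarrow> \<Phi> X Y \<in> Jk \<nu>"
    "EE (ik \<nu>) i (\<Phi> X Y) - (\<Phi> (EE (ik \<kappa>) i X) Y + \<Phi> X (EE (ik m) i Y)) \<in> Jk \<nu>"
    "wd [i] * \<Phi> X Y - (\<Phi> (wd [i] * X) Y + \<Phi> X (wd [i] * Y)) \<in> Jk \<nu>"
    using a by blast+
  have *: "X \<in> Fc c \<Longrightarrow> Y \<in> Fc c' \<Longrightarrow> (if \<beta> \<subseteq># c + c' then \<Phi> X Y \<in> Fc (c + c' - \<beta>) else \<Phi> X Y = 0)"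
    using a by blast
  show "X \<in> Fc c \<Longrightarrow> Y \<in> Fc c' \<Longrightarrow> \<beta> \<subseteq># c + c' \<Longrightarrow> \<Phi> X Y \<in> Fc (c + c' - \<beta>)" using * by simp
  show "X \<in> Fc c \<Longrightarrow> Y \<in> Fc c' \<Longrightarrow> \<not> \<beta> \<subseteq># c + c' \<Longrightarrow> \<Phi> X Y = 0" using * by simp
qed

lemma tri_flip:
  assumes t: "tri \<kappa> m \<beta> \<nu> \<Phi>"
  shows "tri m \<kappa> \<beta> \<nu> (\<lambda>X Y. \<Phi> Y X)"
proof (rule triI)
  show "int (\<nu> i) = int (m i) + int (\<kappa> i) - pm i \<beta>" for i using tri_nu[OF t, of i] by simp
  fix c c' X Y assume *: "X \<in> Fc c" "Y \<in> Fc c'"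
  show "\<beta> \<subseteq># c + c' \<Longrightarrow> \<Phi> Y X \<in> Fc (c + c' - \<beta>)" using tri_Fc[OF t *(2,1)] by (simp add: add.commute)
  show "\<not> \<beta> \<subseteq># c + c' \<Longrightarrow> \<Phi> Y X = 0" using tri_Fc0[OF t *(2,1)] by (simp add: add.commute)
next
  fix i X Y
  show "EE (ik \<nu>) i (\<Phi> Y X) - (\<Phi> Y (EE (ik m) i X) + \<Phi> (EE (ik \<kappa>) i Y) X) \<in> Jk \<nu>"
    using tri_EE[OF t, of i Y X] by (simp only: add.commute)
  show "wd [i] * \<Phi> Y X - (\<Phi> Y (wd [i] * X) + \<Phi> (wd [i] * Y) X) \<in> Jk \<nu>"
    using tri_f[OF t, of i Y X] by (simp only: add.commute)
qed (use t in \<open>auto intro: tri_lin1 tri_lin2 tri_Jk1 tri_Jk2\<close>)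

lemma tri_cong_Jk1: "tri \<kappa> m \<beta> \<nu> \<Phi> \<Longrightarrow> X - s *\<^sub>C X' \<in> Jk \<kappa> \<Longrightarrow> \<Phi> X Y - s *\<^sub>C \<Phi> X' Y \<in> Jk \<nu>"
  using tri_Jk1[of \<kappa> m \<beta> \<nu> \<Phi> "X - s *\<^sub>C X'" Y]
  by (simp add: clinear_diff[OF tri_lin1] clinear_scale[OF tri_lin1])

lemma tri_cong_Jk2: "tri \<kappa> m \<beta> \<nu> \<Phi> \<Longrightarrow> Y - s *\<^sub>C Y' \<in> Jk m \<Longrightarrow> \<Phi> X Y - s *\<^sub>C \<Phi> X Y' \<in> Jk \<nu>"
  using tri_Jk2[of \<kappa> m \<beta> \<nu> \<Phi> "Y - s *\<^sub>C Y'" X]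
  by (simp add: clinear_diff[OF tri_lin2] clinear_scale[OF tri_lin2])

lemma SS_EE_pow: "SS \<kappa> ((EE \<kappa> i ^^ n) X) Y = SS \<kappa> X (wd (replicate n i) * Y)"
proof (induction n arbitrary: Y)
  case (Suc n)
  have "wd (replicate n i) * (wd [i] * Y) = wd (replicate (Suc n) i) * Y"
    by (simp add: mult.assoc[symmetric] wd_mult replicate_append_same)
  then show ?case by (simp add: SS_EE1 Suc)
qed (simp add: wd_Nil)

lemma SS_extremal: "chain \<kappa> x \<Longrightarrow> SS (ik \<kappa>) (zz x) (zz x) \<noteq> 0"
proof (induction x)
  case Nil
  then show ?case by (simp add: SS_wd)
next
  case (Cons ia x)
  obtain i a where ia: "ia = (i, a)" by (cases ia)
  with Cons.prems have a: "int a = int (\<kappa> i) - pm i (cont x)" and ch: "chain \<kappa> x" by auto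
  obtain s where s: "s \<noteq> 0" "(EE (ik \<kappa>) i ^^ a) (wd (replicate a i) * zz x) - s *\<^sub>C zz x \<in> Jk \<kappa>"
    using EF_extremal[OF zz_Fc chain_extremal(1)[OF ch], of a i] a by auto
  have "SS (ik \<kappa>) (zz (ia # x)) (zz (ia # x)) = SS (ik \<kappa>) ((EE (ik \<kappa>) i ^^ a) (wd (replicate a i) * zz x)) (zz x)"
    unfolding ia zz_Cons SS_EE_pow ..
  also have "\<dots> = SS (ik \<kappa>) (s *\<^sub>C zz x) (zz x)"
    using SS_Jk[OF s(2), of "zz x"] by (simp add: clinear_diff[OF lin_SS1])
  finally show ?case using s(1) Cons.IH[OF ch] by (simp add: clinear_scale[OF lin_SS1] scaleC_cmul)
qed

lemma lookup_notin_Jk: "Poly_Mapping.lookup X [] \<noteq> 0 \<Longrightarrow> X \<notin> Jk \<kappa>"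
  using ecoef_Jk[of X \<kappa> "[]"] by auto

text \<open>The projection of \<open>L(\<kappa>) \<otimes> L(m)\<close> to \<open>L(\<nu>)\<close> for \<open>\<nu> = \<kappa> + (m - cont x)\<close> dominant, i.e. the case of the
  Parthasarathy--Ranga Rao--Varadarajan theorem where no reflection is needed.\<close>

lemma tri_dominant:
  assumes ch: "chain m x" and nu: "\<And>i. int (\<nu> i) = int (\<kappa> i) + int (m i) - pm i (cont x)"
  shows "\<exists>\<Phi>. tri \<kappa> m (cont x) \<nu> \<Phi> \<and> \<Phi> 1 (zz x) \<notin> Jk \<nu>"
proof -
  have eta: "ext (\<lambda>u. ecoef (ik m) u (zz x)) = SS (ik m) (zz x)" by (simp add: SS_def)
  interpret hom_data A d \<kappa> m \<nu> "cont x" "\<lambda>u. ecoef (ik m) u (zz x)"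
  proof
    show "ecoef (ik m) u (zz x) \<noteq> 0 \<Longrightarrow> mset u = cont x" for u by (rule ecoef_Fc[OF zz_Fc])
    show "X \<in> Jk m \<Longrightarrow> ext (\<lambda>u. ecoef (ik m) u (zz x)) X = 0" for X
      unfolding eta using SS_Jk[of X m "zz x"] SS_sym[of "ik m" X "zz x"] by simp
    show "int (\<nu> i) = int (\<kappa> i) + int (m i) - pm i (cont x)" for i by (rule nu)
    fix j X
    \<comment> \<open>Dominance of \<nu> at \<open>j\<close> says that this power passes the end of
      the string through the extremal weight.\<close>
    have "(EE (ik m) j ^^ Suc (\<kappa> j)) (zz x) \<in> Jk m"
      using nu[of j] by (intro extremal_E[OF zz_Fc chain_extremal(1)[OF ch]]) auto
    from SS_Jk[OF this, of X] show "ext (\<lambda>u. ecoef (ik m) u (zz x)) (wd (replicate (Suc (\<kappa> j)) j) * X) = 0"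
      unfolding eta SS_EE_pow .
  qed
  obtain \<Phi> where "tri \<kappa> m (cont x) \<nu> \<Phi>" "\<And>X Y. Poly_Mapping.lookup (\<Phi> X Y) [] = SS (ik m) (zz x) (anti X * Y)"
    using tri_exists unfolding eta by blast
  moreover have "anti 1 = (1 :: 'n falg)" using anti_wd[of "[]"] by (simp add: wd_Nil)
  ultimately show ?thesis using SS_extremal[OF ch] lookup_notin_Jk[of "\<Phi> 1 (zz x)" \<nu>] by auto
qed

abbreviation dF :: "'n \<Rightarrow> ('n falg, 'n falg) tensor \<Rightarrow> ('n falg, 'n falg) tensor"
  where "dF i \<equiv> dT (\<lambda>X. wd [i] * X) (\<lambda>X. wd [i] * X)"

text \<open>The diagonal action on a tensor product of Verma modules; applied to the tensor of the
  two generators it yields the coproduct \<open>cop\<close>.\<close>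

definition DD :: "'n falg \<Rightarrow> ('n falg, 'n falg) tensor \<Rightarrow> ('n falg, 'n falg) tensor"
  where "DD X t = ext (\<lambda>u. foldr dF u t) X"

definition cop :: "'n falg \<Rightarrow> ('n falg, 'n falg) tensor"
  where "cop X = DD X (1 \<otimes>\<^sub>C 1)"

lemma lin_dF: "clinear (dF i)" and dF_tens: "dF i (X \<otimes>\<^sub>C Y) = (wd [i] * X) \<otimes>\<^sub>C Y + X \<otimes>\<^sub>C (wd [i] * Y)"
  by (intro lin_dT clinear_intros, rule dT_tens) (intro clinear_intros)+

lemma lin_DD: "clinear (\<lambda>X. DD X t)" "clinear (DD X)"
proof -
  have lin: "clinear (foldr dF u)" for u
  proof (induction u)
    case Nil
    then show ?case using clinear_id by (simp add: id_def)
  next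
    case (Cons i u)
    then show ?case using clinear_compose[OF lin_dF Cons] by (simp add: o_def)
  qed
  show "clinear (\<lambda>X. DD X t)" unfolding DD_def by (rule clinear_ext)
  show "clinear (DD X)"
    by (rule clinearI) (simp_all add: DD_def clinear_add[OF lin] clinear_scale[OF lin] ext_plus_fun ext_smult_fun)
qed

lemma DD_wd: "DD (wd u) t = foldr dF u t"
  by (simp add: DD_def)

lemma DD_mult: "DD (X * Y) t = DD X (DD Y t)"
proof (rule clinear_eq_singleI[where X=X])
  show "DD (wd u * Y) t = DD (wd u) (DD Y t)" for u
    by (rule clinear_eq_singleI[where X=Y])
       (intro clinear_comps[OF lin_DD(1)] clinear_comps[OF lin_DD(2)] clinear_intros lin_DD | simp add: wd_mult DD_wd)+
qed (intro clinear_comps[OF lin_DD(1)] clinear_intros lin_DD)+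

lemma lin_cop: "clinear cop"
  unfolding cop_def[abs_def] by (rule lin_DD)

lemma cop_mult: "cop (X * Y) = DD X (cop Y)"
  by (simp add: cop_def DD_mult)

definition TM :: "('n \<Rightarrow> nat) \<Rightarrow> ('n \<Rightarrow> nat) \<Rightarrow> ('n falg, 'n falg) tensor set"
  where "TM \<kappa> m = cspan {X \<otimes>\<^sub>C Y | X Y. X \<in> Jk \<kappa> \<or> Y \<in> Jk m}"

lemma TM_subspace: "csubspace (TM \<kappa> m)"
  by (simp add: TM_def complex_vector.subspace_span)

lemma TM_base: "X \<in> Jk \<kappa> \<or> Y \<in> Jk m \<Longrightarrow> X \<otimes>\<^sub>C Y \<in> TM \<kappa> m"
  unfolding TM_def by (intro complex_vector.span_base) blast

lemma TM_induct:
  assumes "clinear g" "csubspace S" "\<And>X Y. X \<in> Jk \<kappa> \<or> Y \<in> Jk m \<Longrightarrow> g (X \<otimes>\<^sub>C Y) \<in> S" "t \<in> TM \<kappa> m"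
  shows "g t \<in> S"
  by (rule span_image_sub[OF assms(1,2) _ assms(4)[unfolded TM_def]]) (use assms(3) in auto)

lemma dF_TM: "t \<in> TM \<kappa> m \<Longrightarrow> dF i t \<in> TM \<kappa> m"
proof (erule TM_induct[rotated -1])
  show "X \<in> Jk \<kappa> \<or> Y \<in> Jk m \<Longrightarrow> dF i (X \<otimes>\<^sub>C Y) \<in> TM \<kappa> m" for X Y
    unfolding dF_tens by (intro complex_vector.subspace_add[OF TM_subspace] TM_base) (auto intro: Jk_mult_left)
qed (intro lin_dF TM_subspace)+

lemma DD_TM: "t \<in> TM \<kappa> m \<Longrightarrow> DD X t \<in> TM \<kappa> m"
proof (rule clinear_sub_singleI[where X=X])
  show "t \<in> TM \<kappa> m \<Longrightarrow> DD (wd u) t \<in> TM \<kappa> m" for u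
    unfolding DD_wd by (induction u) (auto intro: dF_TM)
qed (intro lin_DD TM_subspace)+

text \<open>Commutators of primitive elements are primitive, so a Serre element acts on one factor
  at a time, where its values lie in \<open>Jk\<close>.\<close>

lemma DD_serre: "i \<noteq> j \<Longrightarrow> DD (serre i j) t \<in> TM \<kappa> m"
proof -
  assume ij: "i \<noteq> j"
  have prim: "DD ((ad i ^^ n) (wd [j])) (X \<otimes>\<^sub>C Y) = ((ad i ^^ n) (wd [j]) * X) \<otimes>\<^sub>C Y + X \<otimes>\<^sub>C ((ad i ^^ n) (wd [j]) * Y)" for n X Y
  proof (induction n arbitrary: X Y)
    case 0
    then show ?case by (simp add: DD_wd dF_tens)
  next
    case (Suc n)
    let ?P = "(ad i ^^ n) (wd [j])"
    have m1: "(U - V) \<otimes>\<^sub>C Z = U \<otimes>\<^sub>C Z - V \<otimes>\<^sub>C Z" and m2: "Z \<otimes>\<^sub>C (U - V) = Z \<otimes>\<^sub>C U - Z \<otimes>\<^sub>C V" for U V Z :: "'n falg"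
      using clinear_diff[OF clinear_tens1[OF clinear_id]] clinear_diff[OF clinear_tens2[OF clinear_id]] by blast+
    have "DD (ad i ?P) (X \<otimes>\<^sub>C Y) = DD (wd [i]) (DD ?P (X \<otimes>\<^sub>C Y)) - DD ?P (DD (wd [i]) (X \<otimes>\<^sub>C Y))"
      unfolding ad_def clinear_diff[OF lin_DD(1)] DD_mult ..
    also have "\<dots> = (ad i ?P * X) \<otimes>\<^sub>C Y + X \<otimes>\<^sub>C (ad i ?P * Y)"
      unfolding DD_wd foldr.simps o_apply id_apply dF_tens Suc clinear_add[OF lin_DD(2)] clinear_add[OF lin_dF] ad_def left_diff_distrib m1 m2
      by (simp add: mult.assoc)
    finally show ?case by simp
  qed
  show ?thesis
  proof (rule tensor_subI[OF lin_DD(2) TM_subspace])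
    show "DD (serre i j) (X \<otimes>\<^sub>C Y) \<in> TM \<kappa> m" for X Y
      unfolding serre_def prim unfolding serre_def[symmetric]
      using J0_Jk[OF J0_mult_right[OF serre_J0[OF ij]]]
      by (intro complex_vector.subspace_add[OF TM_subspace] TM_base) blast+
  qed
qed

lemma DD_pow: "DD (wd (replicate n i)) (X \<otimes>\<^sub>C Y) =
    (\<Sum>k\<le>n. of_nat (n choose k) *\<^sub>C ((wd (replicate k i) * X) \<otimes>\<^sub>C (wd (replicate (n - k) i) * Y)))"
proof -
  have "foldr dF (replicate n i) t = (dF i ^^ n) t" for t by (induction n) auto
  then show ?thesis
    using leibniz[of "dF i" "(\<otimes>\<^sub>C)" "\<lambda>X. wd [i] * X" "\<lambda>X. wd [i] * X" n X Y, OF lin_dF dF_tens] by (simp only: DD_wd wd_pow)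
qed

text \<open>The coproduct induces a map from V(\<kappa> + m) to V(\<kappa>) \<otimes> V(m): in the
  expansion of the power \<open>Suc (\<kappa> j + m j)\<close> of f_j every term has too large an
  exponent in one factor.\<close>

lemma cop_Jk: "X \<in> Jk (\<lambda>i. \<kappa> i + m i) \<Longrightarrow> cop X \<in> TM \<kappa> m"
proof (erule Jk_induct[rotated -1])
  show "i \<noteq> j \<Longrightarrow> cop (wd u * serre i j * wd v) \<in> TM \<kappa> m" for u v i j
    unfolding mult.assoc cop_mult by (intro DD_TM DD_serre)
  show "cop (wd u * wd (replicate (Suc (\<kappa> j + m j)) j)) \<in> TM \<kappa> m" for u j
    unfolding cop_mult
  proof (intro DD_TM)
    have "k \<ge> Suc a \<Longrightarrow> wd (replicate k j) \<in> Jk \<kappa>'" if "a = \<kappa>' j" for k a \<kappa>'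
      using Jk_base[of "replicate (k - Suc (\<kappa>' j)) j" \<kappa>' j] that
      by (simp add: wd_mult replicate_add[symmetric] del: replicate_Suc)
    then have "Suc (\<kappa> j) \<le> k \<Longrightarrow> wd (replicate k j) \<in> Jk \<kappa>" "Suc (m j) \<le> k \<Longrightarrow> wd (replicate k j) \<in> Jk m" for k by blast+
    then have "wd (replicate k j) \<in> Jk \<kappa> \<or> wd (replicate (Suc (\<kappa> j + m j) - k) j) \<in> Jk m" for k
      by (cases "Suc (\<kappa> j) \<le> k") auto
    then show "cop (wd (replicate (Suc (\<kappa> j + m j)) j)) \<in> TM \<kappa> m"
      unfolding cop_def DD_pow mult_1_right by (intro subspace_intros TM_subspace TM_base)
  qed
qed (intro lin_cop TM_subspace)+

definition TF :: "'n multiset \<Rightarrow> ('n falg, 'n falg) tensor set"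
  where "TF c = cspan {X \<otimes>\<^sub>C Y | X Y c1 c2. X \<in> Fc c1 \<and> Y \<in> Fc c2 \<and> c1 + c2 = c}"

lemma TF_subspace: "csubspace (TF c)"
  by (simp add: TF_def complex_vector.subspace_span)

lemma TF_base: "X \<in> Fc c1 \<Longrightarrow> Y \<in> Fc c2 \<Longrightarrow> c1 + c2 = c \<Longrightarrow> X \<otimes>\<^sub>C Y \<in> TF c"
  unfolding TF_def by (intro complex_vector.span_base) blast

lemma TF_induct:
  assumes "clinear g" "csubspace S" "\<And>X Y c1 c2. X \<in> Fc c1 \<Longrightarrow> Y \<in> Fc c2 \<Longrightarrow> c1 + c2 = c \<Longrightarrow> g (X \<otimes>\<^sub>C Y) \<in> S" "t \<in> TF c"
  shows "g t \<in> S"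
  by (rule span_image_sub[OF assms(1,2) _ assms(4)[unfolded TF_def]]) (use assms(3) in auto)

lemma cop_wd_TF: "cop (wd u) \<in> TF (mset u)"
proof (induction u)
  case Nil
  have "(1 :: 'n falg) \<in> Fc {#}" using wd_Fc[of "[]"] by (simp add: wd_Nil)
  then show ?case by (simp add: cop_def DD_wd) (rule TF_base; simp)
next
  case (Cons i u)
  have "dF i (cop (wd u)) \<in> TF (mset (i # u))"
  proof (rule TF_induct[OF lin_dF TF_subspace _ Cons])
    fix X Y c1 c2 assume *: "X \<in> Fc c1" "Y \<in> Fc c2" "c1 + c2 = mset u"
    have "wd [i] * X \<in> Fc ({#i#} + c1)" "wd [i] * Y \<in> Fc ({#i#} + c2)"
      by (intro Fc_mult wd_Fc *; simp)+
    with * show "dF i (X \<otimes>\<^sub>C Y) \<in> TF (mset (i # u))"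
      unfolding dF_tens by (intro complex_vector.subspace_add[OF TF_subspace]) (auto intro: TF_base)
  qed
  then show ?case by (simp add: cop_def DD_wd)
qed

lemma cop_TF: "X \<in> Fc c \<Longrightarrow> cop X \<in> TF c"
  by (erule Fc_induct[rotated -1]) (use cop_wd_TF in \<open>auto intro: lin_cop TF_subspace\<close>)

lemma cop_EE: "cop (EE (\<lambda>i. \<kappa> i + m i) i X) = dT (EE \<kappa> i) (EE m i) (cop X)"
proof (rule clinear_eq_singleI[where X=X])
  fix u
  let ?D = "dT (EE \<kappa> i) (EE m i)" and ?H = "dT (Hp \<kappa> i) (Hp m i)"
  note linD = lin_dT[OF lin_EE lin_EE, of \<kappa> i m i] and linH = lin_dT[OF lin_Hp lin_Hp, of \<kappa> i m i]
  note D = dT_tens[OF lin_EE lin_EE, of \<kappa> i m i] and H = dT_tens[OF lin_Hp lin_Hp, of \<kappa> i m i]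
  have comm: "?D (dF j t) = dF j (?D t) + (if i = j then ?H t else 0)" for j t
  proof (rule tensor_eqI[where t=t])
    have pl: "(U + V) \<otimes>\<^sub>C Z = U \<otimes>\<^sub>C Z + V \<otimes>\<^sub>C Z" "Z \<otimes>\<^sub>C (U + V) = Z \<otimes>\<^sub>C U + Z \<otimes>\<^sub>C V" for U V Z :: "'n falg"
      using clinear_add[OF clinear_tens1[OF clinear_id]] clinear_add[OF clinear_tens2[OF clinear_id]] by blast+
    show "?D (dF j (X \<otimes>\<^sub>C Y)) = dF j (?D (X \<otimes>\<^sub>C Y)) + (if i = j then ?H (X \<otimes>\<^sub>C Y) else 0)" for X Y
      by (cases "j = i") (simp_all add: dF_tens D H clinear_add[OF linD] clinear_add[OF lin_dF] EE_f pl)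
    show "clinear (\<lambda>t. dF j (?D t) + (if i = j then ?H t else 0))"
      by (cases "j = i") (simp_all add: clinear_plus clinear_compose[OF lin_dF linD] linH)
  qed (rule clinear_compose[OF linD lin_dF])
  have HH: "?H (cop (wd u)) = of_int (\<kappa> i + m i - pm i (mset u)) *\<^sub>C cop (wd u)" for u
  proof -
    have "?H (cop (wd u)) - of_int (\<kappa> i + m i - pm i (mset u)) *\<^sub>C cop (wd u) \<in> {0}"
    proof (rule TF_induct[OF _ complex_vector.subspace_single_0 _ cop_wd_TF])
      show "clinear (\<lambda>t. ?H t - of_int (\<kappa> i + m i - pm i (mset u)) *\<^sub>C t)"
        by (intro clinear_minus linH clinear_smult clinear_id)
      fix X Y c1 c2 assume *: "X \<in> Fc c1" "Y \<in> Fc c2" "c1 + c2 = mset u"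
      have c: "\<kappa> i + m i - pm i (mset u) = (\<kappa> i - pm i c1) + (m i - pm i c2)"
        by (simp add: *(3)[symmetric])
      have sc: "(r *\<^sub>C U) \<otimes>\<^sub>C V = r *\<^sub>C (U \<otimes>\<^sub>C V)" "U \<otimes>\<^sub>C (r *\<^sub>C V) = r *\<^sub>C (U \<otimes>\<^sub>C V)" for r and U V :: "'n falg"
        using clinear_scale[OF clinear_tens1[OF clinear_id]] clinear_scale[OF clinear_tens2[OF clinear_id]] by blast+
      show "?H (X \<otimes>\<^sub>C Y) - of_int (\<kappa> i + m i - pm i (mset u)) *\<^sub>C (X \<otimes>\<^sub>C Y) \<in> {0}"
        unfolding H Hp_Fc[OF *(1)] Hp_Fc[OF *(2)] sc c of_int_add scaleC_add_left by simp
    qed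
    then show ?thesis by simp
  qed
  show "cop (EE (\<lambda>i. \<kappa> i + m i) i (wd u)) = ?D (cop (wd u))"
  proof (induction u)
    case Nil
    have z: "0 \<otimes>\<^sub>C Z = 0" "Z \<otimes>\<^sub>C 0 = 0" for Z :: "'n falg"
      using clinear_zero[OF clinear_tens1[OF clinear_id]] clinear_zero[OF clinear_tens2[OF clinear_id]] by blast+
    show ?case by (simp add: wd_Nil clinear_zero[OF lin_cop]) (simp add: cop_def DD_wd D z EE_wd flip: wd_Nil)
  next
    case (Cons j u)
    have 1: "cop (wd [j] * Z) = dF j (cop Z)" for Z by (simp add: cop_mult DD_wd)
    show ?case
      unfolding wd_Cons[of j u] EE_f clinear_add[OF lin_cop] 1 comm Cons[symmetric] HH
      by (auto simp: Hp_wd clinear_scale[OF lin_cop] clinear_zero[OF lin_cop])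
  qed
qed (intro clinear_comps[OF lin_cop] clinear_compose[OF lin_dT] lin_EE lin_cop)+

text \<open>The composite V(\<kappa>) \<otimes> V(m1 + m2) \<rightarrow> V(\<kappa>) \<otimes> V(m1)
  \<otimes> V(m2) \<rightarrow> V(\<nu>1) \<otimes> V(m2) \<rightarrow> V(\<nu>), whose first arrow
  is the coproduct.\<close>

lemma tri_comp:
  assumes t1: "tri \<kappa> m1 \<beta>1 \<nu>1 \<Phi>1" and t2: "tri \<nu>1 m2 \<beta>2 \<nu> \<Phi>2"
  defines "G \<equiv> \<lambda>X. tensor_lift (\<lambda>Y1 Y2. \<Phi>2 (\<Phi>1 X Y1) Y2)"
  shows "tri \<kappa> (\<lambda>i. m1 i + m2 i) (\<beta>1 + \<beta>2) \<nu> (\<lambda>X Y. G X (cop Y))"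
    and "cop Y - s *\<^sub>C (Y1 \<otimes>\<^sub>C Y2) \<in> TM m1 m2 \<Longrightarrow> G X (cop Y) - s *\<^sub>C \<Phi>2 (\<Phi>1 X Y1) Y2 \<in> Jk \<nu>"
proof -
  have bil: "cbilinear (\<lambda>Y1 Y2. \<Phi>2 (\<Phi>1 X Y1) Y2)" for X
    by (intro cbilinearI tri_lin2[OF t2] clinear_compose[OF tri_lin1[OF t2] tri_lin2[OF t1]])
  have linG: "clinear (G X)" and G: "G X (Y1 \<otimes>\<^sub>C Y2) = \<Phi>2 (\<Phi>1 X Y1) Y2" for X Y1 Y2
    unfolding G_def by (simp_all add: clinear_tensor_lift tensor_lift_tens bil)
  have linG1: "clinear (\<lambda>X. G X t)" for t
  proof (rule clinearI)
    fix x y c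
    show "G (x + y) t = G x t + G y t"
      by (rule tensor_eqI[where t=t], rule linG, intro clinear_plus linG)
         (simp add: G clinear_add[OF tri_lin1[OF t1]] clinear_add[OF tri_lin1[OF t2]])
    show "G (c *\<^sub>C x) t = c *\<^sub>C G x t"
      by (rule tensor_eqI[where t=t], rule linG, intro clinear_smult linG)
         (simp add: G clinear_scale[OF tri_lin1[OF t1]] clinear_scale[OF tri_lin1[OF t2]])
  qed
  have GTM: "G X t \<in> Jk \<nu>" if "t \<in> TM m1 m2" for X t
    by (rule TM_induct[OF linG Jk_subspace _ that]) (auto simp: G intro: tri_Jk1[OF t2] tri_Jk2[OF t2] tri_Jk2[OF t1])
  show "cop Y - s *\<^sub>C (Y1 \<otimes>\<^sub>C Y2) \<in> TM m1 m2 \<Longrightarrow> G X (cop Y) - s *\<^sub>C \<Phi>2 (\<Phi>1 X Y1) Y2 \<in> Jk \<nu>"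
    using GTM[of "cop Y - s *\<^sub>C (Y1 \<otimes>\<^sub>C Y2)" X] by (simp add: clinear_diff[OF linG] clinear_scale[OF linG] G)
  have deriv: "o2 (G X t) - (G (a X) t + G X (dT b c t)) \<in> Jk \<nu>"
    if "clinear o2" "clinear b" "clinear c"
      "\<And>X Y. o1 (\<Phi>1 X Y) - (\<Phi>1 (a X) Y + \<Phi>1 X (b Y)) \<in> Jk \<nu>1"
      "\<And>X Y. o2 (\<Phi>2 X Y) - (\<Phi>2 (o1 X) Y + \<Phi>2 X (c Y)) \<in> Jk \<nu>" for o1 o2 a b c X t
  proof (rule tensor_subI[OF _ Jk_subspace, where t=t])
    show "clinear (\<lambda>t. o2 (G X t) - (G (a X) t + G X (dT b c t)))"
      by (intro clinear_minus clinear_plus linG clinear_compose[OF that(1) linG] clinear_compose[OF linG lin_dT] that)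
    fix Y1 Y2
    have "\<Phi>2 (o1 (\<Phi>1 X Y1) - (\<Phi>1 (a X) Y1 + \<Phi>1 X (b Y1))) Y2 \<in> Jk \<nu>"
      by (rule tri_Jk1[OF t2 that(4)])
    from complex_vector.subspace_add[OF Jk_subspace that(5)[of "\<Phi>1 X Y1" Y2] this]
    show "o2 (G X (Y1 \<otimes>\<^sub>C Y2)) - (G (a X) (Y1 \<otimes>\<^sub>C Y2) + G X (dT b c (Y1 \<otimes>\<^sub>C Y2))) \<in> Jk \<nu>"
      by (simp add: dT_tens[OF that(2,3)] G clinear_add[OF linG] clinear_diff[OF tri_lin1[OF t2]] clinear_add[OF tri_lin1[OF t2]] algebra_simps)
  qed
  show "tri \<kappa> (\<lambda>i. m1 i + m2 i) (\<beta>1 + \<beta>2) \<nu> (\<lambda>X Y. G X (cop Y))"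
  proof (rule triI)
    show "clinear (\<lambda>Y. G X (cop Y))" for X by (rule clinear_compose[OF linG lin_cop])
    show "clinear (\<lambda>X. G X (cop Y))" for Y by (rule linG1)
    show "int (\<nu> i) = int (\<kappa> i) + int (m1 i + m2 i) - pm i (\<beta>1 + \<beta>2)" for i
      using tri_nu[OF t1, of i] tri_nu[OF t2, of i] by simp
    show "X \<in> Jk \<kappa> \<Longrightarrow> G X (cop Y) \<in> Jk \<nu>" for X Y
      by (rule tensor_subI[OF linG Jk_subspace]) (auto simp: G intro: tri_Jk1[OF t1] tri_Jk1[OF t2])
    show "Y \<in> Jk (\<lambda>i. m1 i + m2 i) \<Longrightarrow> G X (cop Y) \<in> Jk \<nu>" for X Y
      by (intro GTM cop_Jk)
    show "EE (ik \<nu>) i (G X (cop Y)) - (G (EE (ik \<kappa>) i X) (cop Y) + G X (cop (EE (ik (\<lambda>i. m1 i + m2 i)) i Y))) \<in> Jk \<nu>" for i X Y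
      unfolding of_nat_add cop_EE by (rule deriv[OF lin_EE lin_EE lin_EE tri_EE[OF t1] tri_EE[OF t2]])
    show "wd [i] * G X (cop Y) - (G (wd [i] * X) (cop Y) + G X (cop (wd [i] * Y))) \<in> Jk \<nu>" for i X Y
    proof -
      have "cop (wd [i] * Y) = dF i (cop Y)" by (simp add: cop_mult DD_wd)
      then show ?thesis
        using deriv[OF _ _ _ tri_f[OF t1] tri_f[OF t2], of i X "cop Y"] by (simp add: clinear_intros)
    qed
    fix c c' X Y assume X: "X \<in> Fc c" and Y: "Y \<in> Fc c'"
    define S where "S = (if \<beta>1 + \<beta>2 \<subseteq># c + c' then Fc (c + c' - (\<beta>1 + \<beta>2)) else {0})"
    have S: "csubspace S" by (simp add: S_def Fc_subspace)
    have "G X (cop Y) \<in> S"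
    proof (rule TF_induct[OF linG S _ cop_TF[OF Y]])
      fix Y1 Y2 c1 c2 assume *: "Y1 \<in> Fc c1" "Y2 \<in> Fc c2" "c1 + c2 = c'"
      show "G X (Y1 \<otimes>\<^sub>C Y2) \<in> S"
      proof (cases "\<beta>1 \<subseteq># c + c1 \<and> \<beta>2 \<subseteq># (c + c1 - \<beta>1) + c2")
        case True
        then have "\<Phi>2 (\<Phi>1 X Y1) Y2 \<in> Fc ((c + c1 - \<beta>1) + c2 - \<beta>2)"
          by (intro tri_Fc[OF t2] tri_Fc[OF t1] X *) auto
        moreover obtain e1 where e1: "c + c1 = \<beta>1 + e1" using True by (auto simp: mset_subset_eq_exists_conv)
        moreover obtain e2 where e2: "e1 + c2 = \<beta>2 + e2" using True e1 by (auto simp: mset_subset_eq_exists_conv)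
        moreover have "c + c' = \<beta>1 + \<beta>2 + e2"
        proof -
          have "c + c' = (c + c1) + c2" by (simp add: *(3)[symmetric] add.assoc)
          also have "\<dots> = \<beta>1 + (e1 + c2)" by (simp add: e1 add.assoc)
          finally show ?thesis by (simp add: e2 add.assoc)
        qed
        ultimately show ?thesis by (simp add: S_def G)
      next
        case False
        then consider "\<not> \<beta>1 \<subseteq># c + c1" | "\<beta>1 \<subseteq># c + c1" "\<not> \<beta>2 \<subseteq># (c + c1 - \<beta>1) + c2" by blast
        then have "\<Phi>2 (\<Phi>1 X Y1) Y2 = 0"
        proof cases
          case 1
          then show ?thesis using tri_Fc0[OF t1 X *(1)] by (simp add: clinear_zero[OF tri_lin1[OF t2]])
        next
          case 2
          then show ?thesis using tri_Fc0[OF t2 tri_Fc[OF t1 X *(1)] *(2)] by blast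
        qed
        then show ?thesis using complex_vector.subspace_0[OF S] by (simp add: G)
      qed
    qed
    then show "\<beta>1 + \<beta>2 \<subseteq># c + c' \<Longrightarrow> G X (cop Y) \<in> Fc (c + c' - (\<beta>1 + \<beta>2))"
      "\<not> \<beta>1 + \<beta>2 \<subseteq># c + c' \<Longrightarrow> G X (cop Y) = 0" by (simp_all add: S_def)
  qed
qed

text \<open>The coproduct sends an extremal vector to the tensor of the extremal vectors of the same
  direction: at each reflection every splitting of the exponent but the proportional one passes the
  end of a string.\<close>

lemma cop_zz:
  assumes "chain m x"
  shows "\<exists>s. s \<noteq> 0 \<and> cop (zz (scale (N1 + N2) x)) - s *\<^sub>C (zz (scale N1 x) \<otimes>\<^sub>C zz (scale N2 x)) \<in> TM (\<lambda>i. N1 * m i) (\<lambda>i. N2 * m i)"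
  using assms
proof (induction x)
  case Nil
  show ?case by (intro exI[of _ 1]) (simp add: cop_def DD_wd complex_vector.subspace_0[OF TM_subspace] wd_Nil[symmetric])
next
  case (Cons ia x)
  obtain i a where ia: "ia = (i, a)" by (cases ia)
  let ?M = "TM (\<lambda>i. N1 * m i) (\<lambda>i. N2 * m i)"
  from Cons obtain s where s: "s \<noteq> 0" "cop (zz (scale (N1 + N2) x)) - s *\<^sub>C (zz (scale N1 x) \<otimes>\<^sub>C zz (scale N2 x)) \<in> ?M" by auto
  have ch: "chain m x" and a: "int a = int (m i) - pm i (cont x)" using Cons.prems ia by auto
  let ?Z1 = "zz (scale N1 x)" and ?Z2 = "zz (scale N2 x)" and ?n = "(N1 + N2) * a"
  let ?t = "\<lambda>k. (wd (replicate k i) * ?Z1) \<otimes>\<^sub>C (wd (replicate (?n - k) i) * ?Z2)"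
  have kill: "wd (replicate k i) * zz (scale N x) \<in> Jk (\<lambda>i. N * m i)" if "k > N * a" for k N
  proof (rule extremal_F[OF zz_Fc chain_extremal(1)[OF chain_scale[OF ch]]])
    have "int (N * m i) - pm i (cont (scale N x)) = int (N * a)" using a by (simp add: right_diff_distrib)
    then show "int k > int (N * m i) - pm i (cont (scale N x))" using that by linarith
  qed (use that in simp)
  have rest: "?t k \<in> ?M" if "k \<le> ?n" "k \<noteq> N1 * a" for k
  proof (rule TM_base)
    from that have "k > N1 * a \<or> ?n - k > N2 * a" by (auto simp: distrib_right)
    then consider "k > N1 * a" | "?n - k > N2 * a" by blast
    then show "wd (replicate k i) * ?Z1 \<in> Jk (\<lambda>i. N1 * m i) \<or> wd (replicate (?n - k) i) * ?Z2 \<in> Jk (\<lambda>i. N2 * m i)"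
      by cases (auto intro: kill)
  qed
  have "DD (wd (replicate ?n i)) (?Z1 \<otimes>\<^sub>C ?Z2) = (\<Sum>k\<le>?n. of_nat (?n choose k) *\<^sub>C ?t k)" by (rule DD_pow)
  also have "\<dots> = of_nat (?n choose (N1 * a)) *\<^sub>C ?t (N1 * a) + (\<Sum>k\<in>{..?n} - {N1 * a}. of_nat (?n choose k) *\<^sub>C ?t k)"
    by (rule sum.remove) (auto simp: distrib_right)
  finally have "DD (wd (replicate ?n i)) (?Z1 \<otimes>\<^sub>C ?Z2) - of_nat (?n choose (N1 * a)) *\<^sub>C ?t (N1 * a)
      = (\<Sum>k\<in>{..?n} - {N1 * a}. of_nat (?n choose k) *\<^sub>C ?t k)" by simp
  also have "\<dots> \<in> ?M" by (intro subspace_intros TM_subspace rest) auto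
  finally have 1: "DD (wd (replicate ?n i)) (?Z1 \<otimes>\<^sub>C ?Z2) - of_nat (?n choose (N1 * a)) *\<^sub>C ?t (N1 * a) \<in> ?M" .
  have t: "?t (N1 * a) = zz (scale N1 (ia # x)) \<otimes>\<^sub>C zz (scale N2 (ia # x))"
    by (simp add: ia distrib_right wd_mult)
  have z: "zz (scale (N1 + N2) (ia # x)) = wd (replicate ?n i) * zz (scale (N1 + N2) x)"
    by (simp add: ia wd_mult)
  have "DD (wd (replicate ?n i)) (cop (zz (scale (N1 + N2) x)) - s *\<^sub>C (?Z1 \<otimes>\<^sub>C ?Z2)) \<in> ?M"
    by (rule DD_TM[OF s(2)])
  from complex_vector.subspace_add[OF TM_subspace this complex_vector.subspace_scale[OF TM_subspace 1, of s]]
  have "cop (zz (scale (N1 + N2) (ia # x))) - (s * of_nat (?n choose (N1 * a))) *\<^sub>C (zz (scale N1 (ia # x)) \<otimes>\<^sub>C zz (scale N2 (ia # x))) \<in> ?M"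
    unfolding t z cop_mult clinear_diff[OF lin_DD(2)] clinear_scale[OF lin_DD(2)]
    by (simp add: complex_vector.scale_right_diff_distrib scaleC_scaleC)
  moreover have "?n choose (N1 * a) > 0" by (simp add: distrib_right)
  ultimately show ?case using s(1) by (intro exI[of _ "s * of_nat (?n choose (N1 * a))"]) auto
qed

end

section \<open>Divided powers and products of functionals\<close>

primrec cv :: "('n \<times> nat) list \<Rightarrow> (('n \<times> nat) list \<Rightarrow> complex) \<Rightarrow> (('n \<times> nat) list \<Rightarrow> complex) \<Rightarrow> complex" where
  "cv [] h h' = h [] * h' []"
| "cv (ia # x) h h' = (\<Sum>b\<le>snd ia. cv x (\<lambda>w. h ((fst ia, b) # w)) (\<lambda>w. h' ((fst ia, snd ia - b) # w)))"

lemma cv_zero: "(\<forall>w. h w = 0) \<or> (\<forall>w. h' w = 0) \<Longrightarrow> cv x h h' = 0"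
  by (induction x arbitrary: h h') auto

lemma cv_scale: "cv x (\<lambda>w. s * h w) (\<lambda>w. t * h' w) = s * t * cv x h h'"
  by (induction x arbitrary: h h') (simp_all add: sum_distrib_left)

lemma cv_Ints: "(\<And>w. h w \<in> \<int>) \<Longrightarrow> (\<And>w. h' w \<in> \<int>) \<Longrightarrow> cv x h h' \<in> \<int>"
  by (induction x arbitrary: h h') auto

lemma cv_snoc: "cv (x @ [(i, a)]) h h' = (\<Sum>b\<le>a. cv x (\<lambda>w. h (w @ [(i, b)])) (\<lambda>w. h' (w @ [(i, a - b)])))"
proof (induction x arbitrary: h h')
  case (Cons ia x)
  show ?case by (simp add: Cons) (rule sum.swap)
qed simp

definition TT :: "('v::complex_vector \<Rightarrow> complex) \<Rightarrow> ('w::complex_vector \<Rightarrow> complex) \<Rightarrow> ('v, 'w) tensor \<Rightarrow> complex"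
  where "TT \<phi> \<psi> = tensor_lift (\<lambda>x y. \<phi> x * \<psi> y)"

lemma
  assumes "clinear \<phi>" "clinear \<psi>"
  shows lin_TT: "clinear (TT \<phi> \<psi>)" and TT_tens: "TT \<phi> \<psi> (x \<otimes>\<^sub>C y) = \<phi> x * \<psi> y"
proof -
  have "cbilinear (\<lambda>x y. \<phi> x * \<psi> y)"
    by (intro cbilinearI clinearI)
       (simp_all add: clinear_add[OF assms(1)] clinear_add[OF assms(2)] clinear_scale[OF assms(1)] clinear_scale[OF assms(2)]
         scaleC_cmul algebra_simps)
  then show "clinear (TT \<phi> \<psi>)" "TT \<phi> \<psi> (x \<otimes>\<^sub>C y) = \<phi> x * \<psi> y"
    by (simp_all add: TT_def clinear_tensor_lift tensor_lift_tens)
qed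

context km
begin

primrec dv :: "('n \<times> nat) list \<Rightarrow> 'n falg" where
  "dv [] = 1"
| "dv (ia # x) = (1 / fact (snd ia)) *\<^sub>C (wd (replicate (snd ia) (fst ia)) * dv x)"

definition fc :: "('n \<times> nat) list \<Rightarrow> nat" where "fc x = prod_list (map (\<lambda>ia. fact (snd ia)) x)"

lemma fc_pos: "fc x > 0"
  by (induction x) (simp_all add: fc_def)

lemma dv_zz: "dv x = (1 / of_nat (fc x)) *\<^sub>C zz x"
proof (induction x)
  case (Cons ia x)
  then show ?case by (simp add: fc_def falg_scale_right wd_mult scaleC_scaleC)
qed (simp add: fc_def wd_Nil)

lemma fc_append: "fc (x @ y) = fc x * fc y"
  by (simp add: fc_def)

lemma wrd_append: "wrd (x @ y) = wrd x @ wrd y"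
  by (induction x) auto

lemma wrd_rev: "wrd (rev x) = rev (wrd x)"
  by (induction x) (auto simp: wrd_append)

lemma dv_append: "dv (x @ y) = dv x * dv y"
  by (simp add: dv_zz fc_append wrd_append falg_scale_left falg_scale_right wd_mult scaleC_scaleC)

text \<open>The coproduct of f^a/a! is the sum of the tensors of f^b/b! and f^(a-b)/(a-b)!, without
  binomial coefficients. Products of functionals that are integral on divided powers are therefore
  integral again.\<close>

lemma TT_cop_dv:
  assumes "clinear \<phi>" "clinear \<psi>"
  shows "TT \<phi> \<psi> (cop (dv x)) = cv x (\<lambda>w. \<phi> (dv w)) (\<lambda>w. \<psi> (dv w))"
  using assms
proof (induction x arbitrary: \<phi> \<psi>)
  case Nil
  have "cop 1 = 1 \<otimes>\<^sub>C 1" by (simp add: cop_def DD_wd flip: wd_Nil)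
  then show ?case by (simp add: TT_tens Nil)
next
  case (Cons ia x)
  obtain i a where ia: "ia = (i, a)" by (cases ia)
  let ?L = "\<lambda>k X. wd (replicate k i) * X :: 'n falg"
  have lin: "clinear (\<lambda>X. \<phi> (?L k X))" "clinear (\<lambda>X. \<psi> (?L k X))" for k
    by (intro clinear_comps[OF Cons.prems(1)] clinear_comps[OF Cons.prems(2)] clinear_intros)+
  have shift: "TT \<phi> \<psi> (DD (wd (replicate a i)) t) = (\<Sum>k\<le>a. of_nat (a choose k) *\<^sub>C TT (\<lambda>X. \<phi> (?L k X)) (\<lambda>X. \<psi> (?L (a - k) X)) t)" for t
  proof (rule tensor_eqI[where t=t])
    show "clinear (\<lambda>t. TT \<phi> \<psi> (DD (wd (replicate a i)) t))"
      by (intro clinear_comps[OF lin_TT[OF Cons.prems]] lin_DD)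
    show "clinear (\<lambda>t. \<Sum>k\<le>a. of_nat (a choose k) *\<^sub>C TT (\<lambda>X. \<phi> (?L k X)) (\<lambda>X. \<psi> (?L (a - k) X)) t)"
      by (intro clinear_sum_map clinear_smult lin_TT lin)
    show "TT \<phi> \<psi> (DD (wd (replicate a i)) (X \<otimes>\<^sub>C Y)) = (\<Sum>k\<le>a. of_nat (a choose k) *\<^sub>C TT (\<lambda>X. \<phi> (?L k X)) (\<lambda>X. \<psi> (?L (a - k) X)) (X \<otimes>\<^sub>C Y))" for X Y
      by (simp add: DD_pow clinear_sum[OF lin_TT[OF Cons.prems]] clinear_scale[OF lin_TT[OF Cons.prems]] TT_tens[OF Cons.prems] TT_tens[OF lin])
  qed
  have "TT \<phi> \<psi> (cop (dv (ia # x))) = (1 / fact a) * (\<Sum>k\<le>a. of_nat (a choose k) * TT (\<lambda>X. \<phi> (?L k X)) (\<lambda>X. \<psi> (?L (a - k) X)) (cop (dv x)))"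
    by (simp add: ia clinear_scale[OF lin_cop] cop_mult clinear_scale[OF lin_TT[OF Cons.prems]] shift scaleC_cmul)
  also have "\<dots> = (\<Sum>k\<le>a. (1 / fact a * of_nat (a choose k)) * cv x (\<lambda>w. \<phi> (?L k (dv w))) (\<lambda>w. \<psi> (?L (a - k) (dv w))))"
    by (simp add: Cons.IH[OF lin] sum_distrib_left mult.assoc)
  also have "\<dots> = (\<Sum>k\<le>a. cv x (\<lambda>w. \<phi> (dv ((i, k) # w))) (\<lambda>w. \<psi> (dv ((i, a - k) # w))))"
  proof (intro sum.cong HOL.refl)
    fix k assume "k \<in> {..a}"
    then have "1 / fact a * of_nat (a choose k) = 1 / fact k * (1 / fact (a - k) :: complex)"
      by (simp add: binomial_fact field_simps)
    then show "(1 / fact a * of_nat (a choose k)) * cv x (\<lambda>w. \<phi> (?L k (dv w))) (\<lambda>w. \<psi> (?L (a - k) (dv w)))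
        = cv x (\<lambda>w. \<phi> (dv ((i, k) # w))) (\<lambda>w. \<psi> (dv ((i, a - k) # w)))"
      by (simp only: cv_scale[symmetric] dv.simps fst_conv snd_conv clinear_scale[OF Cons.prems(1)] clinear_scale[OF Cons.prems(2)] scaleC_cmul)
  qed
  finally show ?case by (simp add: ia)
qed

definition conv :: "('n list \<Rightarrow> complex) \<Rightarrow> ('n list \<Rightarrow> complex) \<Rightarrow> 'n list \<Rightarrow> complex"
  where "conv \<eta> \<eta>' u = TT (ext \<eta>) (ext \<eta>') (cop (wd u))"

lemma ext_conv: "ext (conv \<eta> \<eta>') X = TT (ext \<eta>) (ext \<eta>') (cop X)"
  by (rule clinear_eq_singleI[where X=X])
     (intro clinear_ext clinear_comps[OF lin_TT[OF clinear_ext clinear_ext]] lin_cop | simp add: conv_def)+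

text \<open>\<open>conv\<close> is the product of functionals dual to the coproduct, and highest
  weights add. For the condition \<open>L\<close>, a power of f_j beyond the sum of the two bounds
  exceeds one of them in every term of its coproduct.\<close>

lemma hom_data_conv:
  assumes "hom_data A d \<kappa> m \<nu> \<beta> \<eta>" "hom_data A d \<kappa>' m' \<nu>' \<beta>' \<eta>'"
  shows "hom_data A d (\<lambda>i. \<kappa> i + \<kappa>' i) (\<lambda>i. m i + m' i) (\<lambda>i. \<nu> i + \<nu>' i) (\<beta> + \<beta>') (conv \<eta> \<eta>')"
proof -
  interpret a: hom_data A d \<kappa> m \<nu> \<beta> \<eta> by fact
  interpret b: hom_data A d \<kappa>' m' \<nu>' \<beta>' \<eta>' by fact
  note lin = lin_TT[OF clinear_ext[of \<eta>] clinear_ext[of \<eta>']]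
  note TT = TT_tens[OF clinear_ext[of \<eta>] clinear_ext[of \<eta>']]
  have supp: "ext \<eta> X \<noteq> 0 \<Longrightarrow> c = \<beta>" "ext \<eta>' X \<noteq> 0 \<Longrightarrow> c = \<beta>'" if X: "X \<in> Fc c" for X c
  proof -
    show "c = \<beta>" if "ext \<eta> X \<noteq> 0"
    proof (rule ccontr)
      assume "c \<noteq> \<beta>"
      then have "ext \<eta> X \<in> {0}"
        using a.supp by (intro Fc_induct[OF clinear_ext complex_vector.subspace_single_0 _ X]) auto
      with that show False by simp
    qed
    show "c = \<beta>'" if "ext \<eta>' X \<noteq> 0"
    proof (rule ccontr)
      assume "c \<noteq> \<beta>'"
      then have "ext \<eta>' X \<in> {0}"
        using b.supp by (intro Fc_induct[OF clinear_ext complex_vector.subspace_single_0 _ X]) auto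
      with that show False by simp
    qed
  qed
  show ?thesis
  proof
    show "mset u = \<beta> + \<beta>'" if "conv \<eta> \<eta>' u \<noteq> 0" for u
    proof (rule ccontr)
      assume ne: "mset u \<noteq> \<beta> + \<beta>'"
      have "TT (ext \<eta>) (ext \<eta>') (cop (wd u)) \<in> {0}"
      proof (rule TF_induct[OF lin complex_vector.subspace_single_0 _ cop_wd_TF])
        fix X Y c1 c2 assume *: "X \<in> Fc c1" "Y \<in> Fc c2" "c1 + c2 = mset u"
        have "ext \<eta> X = 0 \<or> ext \<eta>' Y = 0"
          using supp(1)[OF *(1)] supp(2)[OF *(2)] ne *(3) by metis
        then show "TT (ext \<eta>) (ext \<eta>') (X \<otimes>\<^sub>C Y) \<in> {0}" by (auto simp: TT)
      qed
      with that show False by (simp add: conv_def)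
    qed
    show "ext (conv \<eta> \<eta>') X = 0" if "X \<in> Jk (\<lambda>i. m i + m' i)" for X
    proof -
      have "TT (ext \<eta>) (ext \<eta>') (cop X) \<in> {0}"
        by (rule TM_induct[OF lin complex_vector.subspace_single_0 _ cop_Jk[OF that]]) (auto simp: TT a.R b.R)
      then show ?thesis by (simp add: ext_conv)
    qed
    have kill: "ext \<eta> (wd (replicate k j) * X) = 0" if "Suc (\<kappa> j) \<le> k" for k j X
      using a.L[of j "wd (replicate (k - Suc (\<kappa> j)) j) * X"] that
      by (simp add: mult.assoc[symmetric] wd_mult replicate_add[symmetric] del: replicate_Suc)
    have kill': "ext \<eta>' (wd (replicate k j) * X) = 0" if "Suc (\<kappa>' j) \<le> k" for k j X
      using b.L[of j "wd (replicate (k - Suc (\<kappa>' j)) j) * X"] that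
      by (simp add: mult.assoc[symmetric] wd_mult replicate_add[symmetric] del: replicate_Suc)
    show "ext (conv \<eta> \<eta>') (wd (replicate (Suc (\<kappa> j + \<kappa>' j)) j) * X) = 0" for j X
      unfolding ext_conv cop_mult
    proof (rule tensor_eqI[where t="cop X"])
      show "clinear (\<lambda>t. TT (ext \<eta>) (ext \<eta>') (DD (wd (replicate (Suc (\<kappa> j + \<kappa>' j)) j)) t))"
        by (intro clinear_comps[OF lin] lin_DD)
      fix X Y
      have "Suc (\<kappa> j) \<le> k \<or> Suc (\<kappa>' j) \<le> Suc (\<kappa> j + \<kappa>' j) - k" for k by auto
      then show "TT (ext \<eta>) (ext \<eta>') (DD (wd (replicate (Suc (\<kappa> j + \<kappa>' j)) j)) (X \<otimes>\<^sub>C Y)) = 0"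
        unfolding DD_pow clinear_sum[OF lin] clinear_scale[OF lin] TT
        by (intro sum.neutral ballI) (metis kill kill' mult_zero_left mult_zero_right scaleC_zero(1))
    qed (rule clinear_zero_map)
    show "int (\<nu> i + \<nu>' i) = int (\<kappa> i + \<kappa>' i) + int (m i + m' i) - pm i (\<beta> + \<beta>')" for i
      using a.nu[of i] b.nu[of i] by simp
  qed
qed

definition dval :: "('n list \<Rightarrow> complex) \<Rightarrow> ('n \<times> nat) list \<Rightarrow> complex"
  where "dval \<eta> x = ext \<eta> (dv x)"

lemma dval_conv: "dval (conv \<eta> \<eta>') x = cv x (dval \<eta>) (dval \<eta>')"
  using TT_cop_dv[OF clinear_ext[of \<eta>] clinear_ext[of \<eta>'], of x] by (simp add: dval_def[abs_def] ext_conv)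

lemma dval_wrd: "dval \<eta> x = \<eta> (wrd x) / of_nat (fc x)"
  by (simp add: dval_def dv_zz clinear_scale[OF clinear_ext] scaleC_cmul)

end

context hom_data
begin

text \<open>Through \<open>anti\<close> the reversed prefix becomes a vector of V(\<kappa>), and the
  exponent \<open>b\<close> puts it beyond the end of an extremal string.\<close>

lemma dval_left:
  assumes "chain \<kappa> ((i, a) # y)" "a < b"
  shows "dval \<eta> (rev y @ (i, b) # v) = 0"
proof -
  have "wd (replicate b i) * zz y \<in> Jk \<kappa>"
    using assms chain_extremal(1)[of \<kappa> y] by (intro extremal_F[OF zz_Fc]) auto
  then have "BF (wd (wrd ((i, b) # y))) Z = 0" for Z
    by (intro BF_Jk1) (simp add: wd_mult)
  then have "ext \<eta> (wd (rev (wrd ((i, b) # y))) * Z) = 0" for Z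
    unfolding BF_def anti_wd falg_scale_left clinear_scale[OF clinear_ext] by (simp add: scaleC_cmul)
  moreover have "dv (rev y @ (i, b) # v) = (1 / of_nat (fc (rev y @ [(i, b)]))) *\<^sub>C (wd (rev (wrd ((i, b) # y))) * dv v)"
    using dv_append[of "rev y @ [(i, b)]" v] by (simp add: dv_zz[of "rev y @ [(i, b)]"] falg_scale_left wrd_append wrd_rev)
  ultimately show ?thesis by (simp add: dval_def clinear_scale[OF clinear_ext])
qed

lemma dval_right:
  assumes "chain m ((i, a) # z)" "a < b"
  shows "dval \<eta> (v @ (i, b) # z) = 0"
proof -
  have "wd (replicate b i) * zz z \<in> Jk m"
    using assms chain_extremal(1)[of m z] by (intro extremal_F[OF zz_Fc]) auto
  then have "ext \<eta> (dv v * (wd (replicate b i) * zz z)) = 0" by (intro R) (rule Jk_mult_left)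
  moreover have "dv (v @ (i, b) # z) = (1 / of_nat (fc ((i, b) # z))) *\<^sub>C (dv v * (wd (replicate b i) * zz z))"
    unfolding dv_append dv_zz[of "_ # _"] falg_scale_right by (simp add: wd_mult)
  ultimately show ?thesis by (simp add: dval_def clinear_scale[OF clinear_ext])
qed

end

context km
begin

text \<open>Of all ways to split the exponents of the extremal word, \<open>dval_left\<close> and
  \<open>dval_right\<close> leave only the one proportional to the two levels. The value being
  multiplicative, its prime divisors can be controlled at arbitrarily high level.\<close>

lemma dval_conv_value:
  assumes h: "hom_data A d (\<lambda>i. N * \<kappa> i) (\<lambda>i. N * m i) \<nu> \<beta> \<eta>"
    and h': "hom_data A d (\<lambda>i. N' * \<kappa> i) (\<lambda>i. N' * m i) \<nu>' \<beta>' \<eta>'"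
    and y: "chain \<kappa> y" and z: "chain m z"
  shows "dval (conv \<eta> \<eta>') (rev (scale (N + N') y) @ scale (N + N') z)
      = dval \<eta> (rev (scale N y) @ scale N z) * dval \<eta>' (rev (scale N' y) @ scale N' z)"
proof -
  interpret a: hom_data A d "\<lambda>i. N * \<kappa> i" "\<lambda>i. N * m i" \<nu> \<beta> \<eta> by fact
  interpret b: hom_data A d "\<lambda>i. N' * \<kappa> i" "\<lambda>i. N' * m i" \<nu>' \<beta>' \<eta>' by fact
  have left: "cv (rev (scale (N + N') y) @ w) (dval \<eta>) (dval \<eta>')
      = cv w (\<lambda>v. dval \<eta> (rev (scale N y) @ v)) (\<lambda>v. dval \<eta>' (rev (scale N' y) @ v))" for w
    using y
  proof (induction y arbitrary: w)
    case (Cons ia y)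
    obtain i a where ia: "ia = (i, a)" by (cases ia)
    have c: "chain (\<lambda>i. N * \<kappa> i) ((i, N * a) # scale N y)" "chain (\<lambda>i. N' * \<kappa> i) ((i, N' * a) # scale N' y)"
      using chain_scale[OF Cons.prems] ia by (metis fst_conv scale_simps(2) snd_conv)+
    let ?t = "\<lambda>b. cv w (\<lambda>v. dval \<eta> (rev (scale N y) @ (i, b) # v)) (\<lambda>v. dval \<eta>' (rev (scale N' y) @ (i, (N + N') * a - b) # v))"
    have "cv (rev (scale (N + N') (ia # y)) @ w) (dval \<eta>) (dval \<eta>') = (\<Sum>b\<le>(N + N') * a. ?t b)"
      using Cons by (simp add: ia)
    also have "\<dots> = ?t (N * a) + (\<Sum>b\<in>{..(N + N') * a} - {N * a}. ?t b)"
      by (rule sum.remove) (auto simp: distrib_right)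
    also have "(\<Sum>b\<in>{..(N + N') * a} - {N * a}. ?t b) = 0"
    proof (rule sum.neutral, rule ballI)
      fix b assume "b \<in> {..(N + N') * a} - {N * a}"
      then have "N * a < b \<or> N' * a < (N + N') * a - b" by (auto simp: distrib_right)
      then show "?t b = 0" by (intro cv_zero) (auto simp: a.dval_left[OF c(1)] b.dval_left[OF c(2)])
    qed
    finally show ?case by (simp add: ia distrib_right)
  qed simp
  have right: "cv (w @ scale (N + N') z) (\<lambda>v. dval \<eta> (u @ v)) (\<lambda>v. dval \<eta>' (u' @ v))
      = cv w (\<lambda>v. dval \<eta> (u @ v @ scale N z)) (\<lambda>v. dval \<eta>' (u' @ v @ scale N' z))" for u u' w
    using z
  proof (induction z arbitrary: w)
    case (Cons ia z)
    obtain i a where ia: "ia = (i, a)" by (cases ia)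
    have c: "chain (\<lambda>i. N * m i) ((i, N * a) # scale N z)" "chain (\<lambda>i. N' * m i) ((i, N' * a) # scale N' z)"
      using chain_scale[OF Cons.prems] ia by (metis fst_conv scale_simps(2) snd_conv)+
    let ?t = "\<lambda>b. cv w (\<lambda>v. dval \<eta> (u @ v @ (i, b) # scale N z)) (\<lambda>v. dval \<eta>' (u' @ v @ (i, (N + N') * a - b) # scale N' z))"
    have "cv (w @ scale (N + N') (ia # z)) (\<lambda>v. dval \<eta> (u @ v)) (\<lambda>v. dval \<eta>' (u' @ v))
        = cv (w @ [(i, (N + N') * a)]) (\<lambda>v. dval \<eta> (u @ v @ scale N z)) (\<lambda>v. dval \<eta>' (u' @ v @ scale N' z))"
      using Cons.IH[of "w @ [(i, (N + N') * a)]"] Cons.prems by (simp add: ia)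
    also have "\<dots> = (\<Sum>b\<le>(N + N') * a. ?t b)"
      by (simp only: cv_snoc append_assoc append_Cons append_Nil)
    also have "\<dots> = ?t (N * a) + (\<Sum>b\<in>{..(N + N') * a} - {N * a}. ?t b)"
      by (rule sum.remove) (auto simp: distrib_right)
    also have "(\<Sum>b\<in>{..(N + N') * a} - {N * a}. ?t b) = 0"
    proof (rule sum.neutral, rule ballI)
      fix b assume "b \<in> {..(N + N') * a} - {N * a}"
      then have "N * a < b \<or> N' * a < (N + N') * a - b" by (auto simp: distrib_right)
      then show "?t b = 0"
        using a.dval_right[OF c(1), of b "u @ _"] b.dval_right[OF c(2), of "(N + N') * a - b" "u' @ _"] by (intro cv_zero) auto
    qed
    finally show ?case by (simp add: ia distrib_right)
  qed simp
  have "dval (conv \<eta> \<eta>') (rev (scale (N + N') y) @ scale (N + N') z)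
      = cv (scale (N + N') z) (\<lambda>v. dval \<eta> (rev (scale N y) @ v)) (\<lambda>v. dval \<eta>' (rev (scale N' y) @ v))"
    unfolding dval_conv left ..
  also have "\<dots> = dval \<eta> (rev (scale N y) @ scale N z) * dval \<eta>' (rev (scale N' y) @ scale N' z)"
    using right[of "[]"] by simp
  finally show ?thesis .
qed

end

section \<open>Binomial congruences modulo a prime\<close>

lemma prime_dvd_binomial:
  assumes "prime p" "0 < k" "k < p"
  shows "p dvd (p choose k)"
proof -
  have "p dvd k * (p choose k)"
    using times_binomial_minus1_eq[of k p] assms(2) by simp
  moreover have "\<not> p dvd k" using assms(2,3) by (simp add: nat_dvd_not_less)
  ultimately show ?thesis using assms(1) by (metis prime_dvd_mult_iff)
qed

text \<open>The coefficient of x^j in (1 + x)^(Q + p), which modulo p equals (1 + x)^Q (1 +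
  x^p).\<close>

lemma prime_choose_add:
  assumes "prime p"
  shows "int p dvd int ((Q + p) choose j) - (int (Q choose j) + (if p \<le> j then int (Q choose (j - p)) else 0))"
proof -
  let ?f = "\<lambda>k. int (p choose k) * int (Q choose (j - k))"
  have "int ((Q + p) choose j) = (\<Sum>k\<le>j. ?f k)"
    using vandermonde[of p Q j] by (simp add: add.commute[of p Q] flip: of_nat_mult of_nat_sum)
  also have "\<dots> = (\<Sum>k\<in>{..j} \<inter> {0, p}. ?f k) + (\<Sum>k\<in>{..j} - {0, p}. ?f k)"
    by (subst sum.union_disjoint[symmetric]) (auto intro!: sum.cong)
  also have "(\<Sum>k\<in>{..j} \<inter> {0, p}. ?f k) = int (Q choose j) + (if p \<le> j then int (Q choose (j - p)) else 0)"
  proof (cases "p \<le> j")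
    case True
    then have "{..j} \<inter> {0, p} = {0, p}" by auto
    then show ?thesis using True assms prime_gt_0_nat[OF assms] by simp
  next
    case False
    then have "{..j} \<inter> {0, p} = {0}" by auto
    then show ?thesis using False by simp
  qed
  finally have "int ((Q + p) choose j) - (int (Q choose j) + (if p \<le> j then int (Q choose (j - p)) else 0))
      = (\<Sum>k\<in>{..j} - {0, p}. ?f k)" by simp
  also have "int p dvd \<dots>"
  proof (rule dvd_sum)
    fix k assume k: "k \<in> {..j} - {0, p}"
    have "int p dvd int (p choose k)"
    proof (cases "k < p")
      case True
      then show ?thesis using prime_dvd_binomial[OF assms, of k] k by (auto simp: int_dvd_int_iff)
    qed (use k in \<open>auto simp: binomial_eq_0\<close>)
    then show "int p dvd ?f k" by simp
  qed
  finally show ?thesis .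
qed

text \<open>With Q = Q' + p, \<open>prime_choose_add\<close> splits each binomial coefficient in two
  and the alternating sum telescopes modulo p; the upper bound on \<open>Q\<close> removes the
  boundary term.\<close>

lemma prime_alternating_sum:
  assumes p: "prime p" and Q: "p \<le> Q" "Q \<le> p * n"
  shows "int p dvd (\<Sum>r\<le>n. (- 1) ^ r * int (Q choose (p * r)))"
proof -
  obtain Q' where Q': "Q = Q' + p" using Q(1) by (metis le_add_diff_inverse2)
  have p0: "0 < p" using p by (rule prime_gt_0_nat)
  with Q Q' obtain n' where n: "n = Suc n'" by (cases n) auto
  have b: "int p dvd (- 1) ^ r * int ((Q' + p) choose (p * r)) - (- 1) ^ r * (int (Q' choose (p * r)) + (if p \<le> p * r then int (Q' choose (p * r - p)) else 0))" for r
    unfolding right_diff_distrib[symmetric] using prime_choose_add[OF p] by (rule dvd_mult)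
  have "(\<Sum>r\<le>n. (- 1) ^ r * (int (Q' choose (p * r)) + (if p \<le> p * r then int (Q' choose (p * r - p)) else 0)))
     = (\<Sum>r\<le>n. (- 1) ^ r * int (Q' choose (p * r))) + (\<Sum>r\<le>n. (- 1) ^ r * (if p \<le> p * r then int (Q' choose (p * r - p)) else 0))"
    by (simp add: distrib_left sum.distrib)
  also have "(\<Sum>r\<le>n. (- 1) ^ r * (if p \<le> p * r then int (Q' choose (p * r - p)) else 0)) = (\<Sum>r\<le>n'. - ((- 1) ^ r * int (Q' choose (p * r))))"
    unfolding n by (subst sum.atMost_Suc_shift) (use p0 in simp)
  also have "(\<Sum>r\<le>n. (- 1) ^ r * int (Q' choose (p * r))) = (\<Sum>r\<le>n'. (- 1) ^ r * int (Q' choose (p * r)))"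
    using Q(2) Q' p0 by (simp add: n binomial_eq_0)
  finally have "(\<Sum>r\<le>n. (- 1) ^ r * (int (Q' choose (p * r)) + (if p \<le> p * r then int (Q' choose (p * r - p)) else 0))) = 0"
    by (simp add: sum_negf)
  moreover have "int p dvd (\<Sum>r\<le>n. (- 1) ^ r * int (Q choose (p * r)) - (- 1) ^ r * (int (Q' choose (p * r)) + (if p \<le> p * r then int (Q' choose (p * r - p)) else 0)))"
    unfolding Q' using b by (intro dvd_sum)
  ultimately show ?thesis by (simp add: sum_subtractf)
qed

text \<open>The number (p q)! / (p!)^q, by which the q-th power of f^p/p! exceeds
  f^(pq)/(pq)!.\<close>

definition mult_p :: "nat \<Rightarrow> nat \<Rightarrow> int" where "mult_p p q = (\<Prod>k<q. int ((p * Suc k) choose p))"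

text \<open>Each factor \<open>(p * Suc k) choose p\<close> is congruent to \<open>Suc k\<close>.
  Modulo p, the powers of f^p/p! are thus related to the divided powers f^(pq)/(pq)! by the same q!
  that relates f^q to f^q/q!.\<close>

lemma mult_p_cong:
  assumes p: "prime p"
  shows "int p dvd mult_p p q - fact q"
proof (induction q)
  case (Suc q)
  have "int p dvd int ((p * Suc k) choose p) - int (Suc k)" for k
  proof (induction k)
    case (Suc k)
    have e: "p * Suc (Suc k) = p * Suc k + p" by simp
    have "int ((p * Suc (Suc k)) choose p) - int (Suc (Suc k)) = (int ((p * Suc (Suc k)) choose p) - (int ((p * Suc k) choose p) + 1))
        + (int ((p * Suc k) choose p) - int (Suc k))" by simp
    also have "int p dvd \<dots>"
    proof (rule dvd_add[OF _ Suc.IH])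
      show "int p dvd int ((p * Suc (Suc k)) choose p) - (int ((p * Suc k) choose p) + 1)"
        unfolding e using prime_choose_add[OF p, of "p * Suc k" p]
        by (simp only: order_refl if_True diff_self_eq_0 binomial_n_0 of_nat_1)
    qed
    finally show ?case .
  qed simp
  then have "int p dvd mult_p p q * (int ((p * Suc q) choose p) - int (Suc q)) + (mult_p p q - fact q) * int (Suc q)"
    using Suc by (intro dvd_add dvd_mult dvd_mult2) auto
  then show ?case by (simp add: mult_p_def algebra_simps)
qed (simp add: mult_p_def)

lemma mult_p_not_dvd: "prime p \<Longrightarrow> q < p \<Longrightarrow> \<not> int p dvd mult_p p q"
proof
  assume p: "prime p" "q < p" and "int p dvd mult_p p q"
  from dvd_diff[OF this(3) mult_p_cong[OF p(1), of q]] have "int p dvd fact q" by simp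
  then have "p dvd fact q" by (metis int_dvd_int_iff of_nat_fact)
  with p show False by (simp add: prime_dvd_fact_iff)
qed

text \<open>The values of a linear functional on products of divided powers \<open>f\<^bsub>i\<^esub>\<^sup>a/a!\<close>, together with the
  relations among such products that do not involve denominators.\<close>

locale divided_functional =
  fixes A :: "int ^ 'n ^ 'n" and h :: "('n \<times> nat) list \<Rightarrow> int"
  assumes D0: "h (u @ (i, 0) # v) = h (u @ v)"
    and D1: "h (u @ (i, a) # (i, b) # v) = int ((a + b) choose a) * h (u @ (i, a + b) # v)"
    and S: "i \<noteq> j \<Longrightarrow> int n > int b * (- (A $ i $ j)) \<Longrightarrow> (\<Sum>r\<le>n. (- 1) ^ r * h (u @ (i, n - r) # (j, b) # (i, r) # v)) = 0"
begin

lemma replicate_p: "h (u @ replicate q (i, p) @ v) = mult_p p q * h (u @ (i, p * q) # v)"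
proof (induction q arbitrary: u)
  case (Suc q)
  have "h (u @ replicate (Suc q) (i, p) @ v) = mult_p p q * h (u @ (i, p) # (i, p * q) # v)"
    using Suc[of "u @ [(i, p)]"] by simp
  then show ?case by (simp add: D1 mult_p_def)
qed (simp add: D0 mult_p_def)

text \<open>The value at (ad f_i)^n/n! applied to f_j^b/b!, between \<open>u\<close> and
  \<open>v\<close>; assumption \<open>S\<close> says that it vanishes once \<open>n\<close> exceeds
  -\<open>b * A $ i $ j\<close>.\<close>

definition Y :: "('n \<times> nat) list \<Rightarrow> 'n \<Rightarrow> 'n \<Rightarrow> nat \<Rightarrow> nat \<Rightarrow> ('n \<times> nat) list \<Rightarrow> int"
  where "Y u i j b n v = (\<Sum>r\<le>n. (- 1) ^ r * h (u @ (i, n - r) # (j, b) # (i, r) # v))"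

lemma Y_D1: "Y u i j b n ((i, x) # (i, y) # v) = int ((x + y) choose y) * Y u i j b n ((i, x + y) # v)"
proof -
  have "h (u @ (i, n - r) # (j, b) # (i, r) # (i, x) # (i, y) # v)
      = int ((x + y) choose x) * h (u @ (i, n - r) # (j, b) # (i, r) # (i, x + y) # v)" for r
    using D1[of "u @ [(i, n - r), (j, b), (i, r)]" i x y v] by simp
  moreover have "(x + y) choose x = (x + y) choose y" using binomial_symmetric[of x "x + y"] by simp
  ultimately show ?thesis by (simp add: Y_def sum_distrib_left mult.left_commute)
qed

text \<open>The rule for commuting f_i^B/B! to the right past f_j^b/b!, free of
  denominators.\<close>

lemma Y_expand: "h (u @ (i, B) # (j, b) # w) = (\<Sum>n\<le>B. Y u i j b n ((i, B - n) # w))"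
proof -
  let ?g = "\<lambda>s r. (- 1) ^ r * int ((B - s) choose r) * h (u @ (i, s) # (j, b) # (i, B - s) # w)"
  have "h (u @ (i, n - r) # (j, b) # (i, r) # (i, B - n) # w)
      = int ((B - (n - r)) choose r) * h (u @ (i, n - r) # (j, b) # (i, B - (n - r)) # w)" if "r \<le> n" "n \<le> B" for n r
  proof -
    have "r + (B - n) = B - (n - r)" using that by simp
    then show ?thesis using D1[of "u @ [(i, n - r), (j, b)]" i r "B - n" w] by simp
  qed
  then have "(\<Sum>n\<le>B. Y u i j b n ((i, B - n) # w)) = (\<Sum>n\<le>B. \<Sum>r\<le>n. ?g (n - r) r)"
    unfolding Y_def by (intro sum.cong HOL.refl) (simp add: mult.assoc)
  also have "\<dots> = (\<Sum>(r, s)\<in>{(r, s). r + s \<le> B}. ?g s r)"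
    by (rule sum.triangle_reindex_eq[symmetric])
  also have "{(r, s). r + s \<le> B} = prod.swap ` (SIGMA s:{..B}. {..B - s})"
    by (auto simp: image_iff)
  also have "(\<Sum>(r, s)\<in>prod.swap ` (SIGMA s:{..B}. {..B - s}). ?g s r) = (\<Sum>(s, r)\<in>(SIGMA s:{..B}. {..B - s}). ?g s r)"
    by (subst sum.reindex) (auto simp: case_prod_unfold)
  also have "\<dots> = (\<Sum>s\<le>B. \<Sum>r\<le>B - s. ?g s r)"
    by (rule sum.Sigma[symmetric]) auto
  \<comment> \<open>Collected by the exponent s that stays on the left, the inner sum is an
    alternating sum of binomial coefficients, zero unless s = B.\<close>
  also have "\<dots> = (\<Sum>s\<le>B. if s = B then h (u @ (i, B) # (j, b) # (i, 0) # w) else 0)"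
  proof (intro sum.cong HOL.refl)
    fix s assume "s \<in> {..B}"
    show "(\<Sum>r\<le>B - s. ?g s r) = (if s = B then h (u @ (i, B) # (j, b) # (i, 0) # w) else 0)"
    proof (cases "s = B")
      case False
      with \<open>s \<in> {..B}\<close> have "(\<Sum>r\<le>B - s. (- 1) ^ r * of_nat ((B - s) choose r)) = (0 :: int)"
        by (intro choose_alternating_sum) simp
      then show ?thesis using False by (simp add: sum_distrib_right[symmetric])
    qed simp
  qed
  also have "\<dots> = h (u @ (i, B) # (j, b) # (i, 0) # w)" by simp
  also have "\<dots> = h (u @ (i, B) # (j, b) # w)" using D0[of "u @ [(i, B), (j, b)]" i w] by simp
  finally show ?thesis ..
qed

text \<open>After \<open>Y_expand\<close>, the commutators of order m > p M vanish by the Serre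
  relations for divided powers; the others carry alternating binomial sums, divisible by p by
  \<open>prime_alternating_sum\<close>.\<close>

lemma serre_divided:
  assumes p: "prime p" and ij: "i \<noteq> j" and M: "A $ i $ j = - int M"
  shows "int p dvd (\<Sum>r\<le>Suc M. (- 1) ^ r * h (u @ (i, p * (Suc M - r)) # (j, p) # (i, p * r) # v))"
proof -
  let ?n = "Suc M"
  let ?Y = "\<lambda>m. Y u i j p m ((i, p * ?n - m) # v)"
  have "h (u @ (i, p * (?n - r)) # (j, p) # (i, p * r) # v) = (\<Sum>m\<le>p * ?n. int ((p * ?n - m) choose (p * r)) * ?Y m)" if r: "r \<le> ?n" for r
  proof -
    have split: "p * ?n = p * (?n - r) + p * r" using r by (metis add_mult_distrib2 le_add_diff_inverse2)
    have "h (u @ (i, p * (?n - r)) # (j, p) # (i, p * r) # v) = (\<Sum>m\<le>p * (?n - r). Y u i j p m ((i, p * (?n - r) - m) # (i, p * r) # v))"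
      by (rule Y_expand)
    also have "\<dots> = (\<Sum>m\<le>p * (?n - r). int ((p * ?n - m) choose (p * r)) * ?Y m)"
    proof (intro sum.cong HOL.refl)
      fix m assume "m \<in> {..p * (?n - r)}"
      then have "p * (?n - r) - m + p * r = p * ?n - m" using split by simp
      then show "Y u i j p m ((i, p * (?n - r) - m) # (i, p * r) # v) = int ((p * ?n - m) choose (p * r)) * ?Y m"
        using Y_D1[of u i j p m "p * (?n - r) - m" "p * r" v] by simp
    qed
    also have "\<dots> = (\<Sum>m\<le>p * ?n. int ((p * ?n - m) choose (p * r)) * ?Y m)"
    proof (rule sum.mono_neutral_left)
      show "{..p * (?n - r)} \<subseteq> {..p * ?n}" using split by auto
      show "\<forall>m\<in>{..p * ?n} - {..p * (?n - r)}. int ((p * ?n - m) choose (p * r)) * ?Y m = 0"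
      proof
        fix m assume "m \<in> {..p * ?n} - {..p * (?n - r)}"
        then have "p * ?n - m < p * r" using split by auto
        then show "int ((p * ?n - m) choose (p * r)) * ?Y m = 0" by (simp add: binomial_eq_0)
      qed
    qed simp
    finally show ?thesis .
  qed
  then have "(\<Sum>r\<le>?n. (- 1) ^ r * h (u @ (i, p * (?n - r)) # (j, p) # (i, p * r) # v))
      = (\<Sum>r\<le>?n. \<Sum>m\<le>p * ?n. ((- 1) ^ r * int ((p * ?n - m) choose (p * r))) * ?Y m)"
    by (intro sum.cong HOL.refl) (simp add: sum_distrib_left mult.assoc del: mult_Suc_right)
  also have "\<dots> = (\<Sum>m\<le>p * ?n. (\<Sum>r\<le>?n. (- 1) ^ r * int ((p * ?n - m) choose (p * r))) * ?Y m)"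
    by (subst sum.swap) (simp only: sum_distrib_right)
  also have "int p dvd \<dots>"
  proof (rule dvd_sum)
    fix m
    show "int p dvd (\<Sum>r\<le>?n. (- 1) ^ r * int ((p * ?n - m) choose (p * r))) * ?Y m"
    proof (cases "m > p * M")
      case True
      then have "int m > int p * (- (A $ i $ j))" by (simp add: M flip: of_nat_mult)
      from S[OF ij this] have "?Y m = 0" by (simp add: Y_def)
      then show ?thesis by simp
    next
      case False
      then have "p \<le> p * ?n - m" by simp
      from prime_alternating_sum[OF p this, of ?n] show ?thesis by (intro dvd_mult2) simp
    qed
  qed
  finally show ?thesis .
qed

text \<open>With n = \<open>Suc M\<close>, passing to powers of f_i^p/p! multiplies the r-th term by
  a number congruent to (n - r)! r!; together with the binomial coefficient this is the constant
  n!.\<close>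

lemma serre_mod_p:
  assumes p: "prime p" and ij: "i \<noteq> j" and M: "A $ i $ j = - int M"
  shows "int p dvd (\<Sum>r\<le>Suc M. (- 1) ^ r * int (Suc M choose r) *
    h (u @ replicate (Suc M - r) (i, p) @ (j, p) # replicate r (i, p) @ v))"
proof -
  let ?n = "Suc M"
  let ?H = "\<lambda>r. h (u @ (i, p * (?n - r)) # (j, p) # (i, p * r) # v)"
  let ?c = "\<lambda>r. int (?n choose r) * (mult_p p (?n - r) * mult_p p r)"
  have "h (u @ replicate (?n - r) (i, p) @ (j, p) # replicate r (i, p) @ v) = mult_p p (?n - r) * mult_p p r * ?H r" for r
    using replicate_p[of u "?n - r" i p "(j, p) # replicate r (i, p) @ v"] replicate_p[of "u @ [(i, p * (?n - r)), (j, p)]" r i p v]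
    by simp
  then have "(\<Sum>r\<le>?n. (- 1) ^ r * int (?n choose r) * h (u @ replicate (?n - r) (i, p) @ (j, p) # replicate r (i, p) @ v))
      = (\<Sum>r\<le>?n. (?c r - fact ?n) * ((- 1) ^ r * ?H r)) + fact ?n * (\<Sum>r\<le>?n. (- 1) ^ r * ?H r)"
    by (simp only: left_diff_distrib sum_subtractf sum_distrib_left) (simp add: mult_ac)
  also have "int p dvd \<dots>"
  proof (rule dvd_add)
    show "int p dvd fact ?n * (\<Sum>r\<le>?n. (- 1) ^ r * ?H r)"
      by (rule dvd_mult[OF serre_divided[OF p ij M]])
    show "int p dvd (\<Sum>r\<le>?n. (?c r - fact ?n) * ((- 1) ^ r * ?H r))"
    proof (intro dvd_sum dvd_mult2)
      fix r assume "r \<in> {..?n}"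
      then have "r \<le> ?n" by simp
      have "int (fact ?n) = int (fact r * fact (?n - r) * (?n choose r))"
        unfolding binomial_fact_lemma[OF \<open>r \<le> ?n\<close>] ..
      then have f: "(fact ?n :: int) = int (?n choose r) * (fact (?n - r) * fact r)"
        by (simp only: of_nat_mult of_nat_fact mult_ac)
      have "mult_p p (?n - r) * mult_p p r - fact (?n - r) * fact r
          = mult_p p (?n - r) * (mult_p p r - fact r) + (mult_p p (?n - r) - fact (?n - r)) * fact r"
        by (simp add: algebra_simps)
      also have "int p dvd \<dots>"
        by (intro dvd_add dvd_mult dvd_mult2 mult_p_cong p)
      finally show "int p dvd ?c r - fact ?n"
        unfolding f right_diff_distrib[symmetric] by (rule dvd_mult)
    qed
  qed
  finally show ?thesis .
qed

end

context km
begin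

lemma map_wrd_p:
  assumes "divided_functional A h"
  shows "h (u @ map (\<lambda>j. (j, p)) (wrd x) @ v) = prod_list (map (\<lambda>ia. mult_p p (snd ia)) x) * h (u @ scale p x @ v)"
proof (induction x arbitrary: u)
  case (Cons ia x)
  interpret divided_functional A h by fact
  have "h (u @ map (\<lambda>j. (j, p)) (wrd (ia # x)) @ v)
      = h (u @ replicate (snd ia) (fst ia, p) @ map (\<lambda>j. (j, p)) (wrd x) @ v)" by simp
  also have "\<dots> = mult_p p (snd ia) * h ((u @ [(fst ia, p * snd ia)]) @ map (\<lambda>j. (j, p)) (wrd x) @ v)"
    unfolding replicate_p by simp
  finally show ?case unfolding Cons by simp
qed simp

lemma ad_pow_expand: "(ad i ^^ n) X = (\<Sum>r\<le>n. of_int ((- 1) ^ r * int (n choose r)) *\<^sub>C (wd (replicate (n - r) i) * X * wd (replicate r i)))"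
proof -
  have pow: "((\<lambda>V. - (V * wd [i])) ^^ r) V = of_int ((- 1) ^ r) *\<^sub>C (V * wd (replicate r i))" for r and V :: "'n falg"
  proof (induction r)
    case (Suc r)
    have "wd (replicate r i) * wd [i] = wd (replicate (Suc r) i)" by (simp add: wd_mult replicate_append_same)
    then show ?case by (simp add: Suc falg_scale_left mult.assoc complex_vector.scale_minus_left)
  qed (simp add: wd_Nil)
  have "(ad i ^^ n) (1 * (X * 1)) = (\<Sum>k\<le>n. of_nat (n choose k) *\<^sub>C (((\<lambda>V. - (V * wd [i])) ^^ k) 1 * 1 * 0 + (wd (replicate (n - k) i) * 1) * (X * ((\<lambda>V. - (V * wd [i])) ^^ k) 1)))"
    using leibniz[of "ad i" "\<lambda>V U. U * (X * V)" "\<lambda>V. - (V * wd [i])" "\<lambda>U. wd [i] * U" n 1 1, OF lin_ad]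
    by (simp add: ad_def algebra_simps wd_pow)
  also have "\<dots> = (\<Sum>r\<le>n. of_int ((- 1) ^ r * int (n choose r)) *\<^sub>C (wd (replicate (n - r) i) * X * wd (replicate r i)))"
    by (intro sum.cong HOL.refl) (simp add: pow falg_scale_right scaleC_scaleC mult.commute mult.assoc)
  finally show ?thesis by simp
qed

text \<open>Higher Serre relations: in every term of the Leibniz expansion, some single factor f_j
  receives more than -\<open>A $ i $ j\<close> commutators with f_i.\<close>

lemma ad_divided_J0: "i \<noteq> j \<Longrightarrow> int n > int b * (- (A $ i $ j)) \<Longrightarrow> (ad i ^^ n) (wd (replicate b j)) \<in> J0"
proof (induction b arbitrary: n)
  case 0
  have "(ad i ^^ Suc k) 1 = 0" for k
    by (induction k) (simp_all add: ad_def)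
  with 0 show ?case by (cases n) (simp_all add: wd_Nil complex_vector.subspace_0[OF J0_subspace] del: funpow.simps)
next
  case (Suc b)
  have J: "(ad i ^^ k) (wd [j]) \<in> J0" if "int k > - (A $ i $ j)" for k
  proof -
    have "(ad i ^^ (l + nat (1 - A $ i $ j))) (wd [j]) \<in> J0" for l
      by (induction l) (use serre_J0[OF Suc.prems(1)] in \<open>auto simp: serre_def ad_J0\<close>)
    from this[of "k - nat (1 - A $ i $ j)"] that show ?thesis by simp
  qed
  have "wd (replicate (Suc b) j) = wd [j] * wd (replicate b j)" by (simp add: wd_mult)
  then show ?case
    unfolding ad_pow_mult
  proof (simp only: ad_pow_mult, intro subspace_intros J0_subspace)
    fix k assume "k \<in> {..n}"
    then have "int k > - (A $ i $ j) \<or> int (n - k) > int b * (- (A $ i $ j))"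
      using Suc.prems(2) by (auto simp: of_nat_diff algebra_simps)
    then show "(ad i ^^ k) (wd [j]) * (ad i ^^ (n - k)) (wd (replicate b j)) \<in> J0"
      using J Suc.IH[OF Suc.prems(1)] by (auto intro: J0_mult_left J0_mult_right)
  qed
qed

end

context hom_data
begin

lemma divided_functional:
  assumes "\<And>x. dval \<eta> x \<in> \<int>"
  obtains h where "divided_functional A h" "\<And>x. of_int (h x) = dval \<eta> x"
proof -
  have "\<forall>x. \<exists>k::int. of_int k = dval \<eta> x" using assms by (metis Ints_cases)
  then obtain h where h: "\<And>x. of_int (h x) = dval \<eta> x" by (metis (no_types))
  have val: "ext \<eta> (dv u * X * dv v) = 0" if "X \<in> J0" for u v X
    by (rule R) (intro J0_Jk J0_mult_right J0_mult_left that)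
  have "divided_functional A h"
  proof
    fix u v i a b
    have "(of_int (h (u @ (i, 0) # v)) :: complex) = of_int (h (u @ v))"
      unfolding h dval_def dv_append by (simp add: wd_Nil)
    then show "h (u @ (i, 0) # v) = h (u @ v)" by simp
    have c: "1 / fact a * (1 / fact b) = of_nat ((a + b) choose a) * (1 / fact (a + b) :: complex)"
      by (simp add: binomial_fact)
    have "dv ((i, a) # (i, b) # v) = of_nat ((a + b) choose a) *\<^sub>C dv ((i, a + b) # v)"
      by (simp add: falg_scale_right scaleC_scaleC wd_mult mult.assoc[symmetric] replicate_add c[simplified])
    then have "(of_int (h (u @ (i, a) # (i, b) # v)) :: complex) = of_int (int ((a + b) choose a) * h (u @ (i, a + b) # v))"
      unfolding of_int_mult h dval_def dv_append by (simp only: falg_scale_right clinear_scale[OF clinear_ext] scaleC_cmul of_int_of_nat_eq)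
    then show "h (u @ (i, a) # (i, b) # v) = int ((a + b) choose a) * h (u @ (i, a + b) # v)" by (simp only: of_int_eq_iff)
  next
    fix i j n b u v assume ij: "(i::'a) \<noteq> j" and n: "int n > int b * (- (A $ i $ j))"
    have "dv (u @ (i, n - r) # (j, b) # (i, r) # v) = (of_nat (n choose r) / (fact n * fact b)) *\<^sub>C
        (dv u * (wd (replicate (n - r) i) * wd (replicate b j) * wd (replicate r i)) * dv v)" if "r \<le> n" for r
    proof -
      have c: "1 / (fact (n - r) * (fact b * fact r)) = (of_nat (n choose r) / (fact n * fact b) :: complex)"
        using that by (simp add: binomial_fact field_simps)
      show ?thesis
        unfolding c[symmetric] by (simp add: dv_append falg_scale_left falg_scale_right scaleC_scaleC mult.assoc field_simps)
    qed
    then have "(\<Sum>r\<le>n. of_int ((- 1) ^ r) * dval \<eta> (u @ (i, n - r) # (j, b) # (i, r) # v))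
        = (\<Sum>r\<le>n. of_int ((- 1) ^ r) * ((of_nat (n choose r) / (fact n * fact b)) *
        ext \<eta> (dv u * (wd (replicate (n - r) i) * wd (replicate b j) * wd (replicate r i)) * dv v)))"
      unfolding dval_def by (intro sum.cong HOL.refl) (simp add: clinear_scale[OF clinear_ext] scaleC_cmul)
    also have "\<dots> = (1 / (fact n * fact b)) * ext \<eta> (dv u * (ad i ^^ n) (wd (replicate b j)) * dv v)"
      unfolding ad_pow_expand sum_distrib_left sum_distrib_right falg_scale_left falg_scale_right clinear_sum[OF clinear_ext] clinear_scale[OF clinear_ext] scaleC_cmul
      by (intro sum.cong HOL.refl) (simp add: field_simps)
    also have "\<dots> = 0" using val[OF ad_divided_J0[OF ij n]] by simp
    finally have "(of_int (\<Sum>r\<le>n. (- 1) ^ r * h (u @ (i, n - r) # (j, b) # (i, r) # v)) :: complex) = 0"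
      by (simp add: h)
    then show "(\<Sum>r\<le>n. (- 1) ^ r * h (u @ (i, n - r) # (j, b) # (i, r) # v)) = 0" by (simp only: of_int_eq_0_iff)
  qed
  with h that show ?thesis by blast
qed

end

section \<open>Rational and integral solutions\<close>

lemma rational_functional:
  assumes "w \<noteq> (0::complex)"
  obtains \<pi> :: "complex \<Rightarrow> complex" where "\<And>x y. \<pi> (x + y) = \<pi> x + \<pi> y" "\<And>k x. \<pi> (of_int k * x) = of_int k * \<pi> x"
    "\<And>x. \<pi> x \<in> \<rat>" "\<pi> w = 1"
proof -
  interpret vs: vector_space_pair "\<lambda>(q::rat) (z::complex). of_rat q * z" "(*) :: rat \<Rightarrow> rat \<Rightarrow> rat"
    by unfold_locales (simp_all add: algebra_simps of_rat_add of_rat_mult)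
  have "\<not> vs.vs1.dependent {w}" using assms by (simp add: vs.vs1.dependent_single)
  from vs.linear_independent_extend[OF this, of "\<lambda>_. 1"] obtain g where
    g: "Vector_Spaces.linear (\<lambda>(q::rat) (z::complex). of_rat q * z) ((*) :: rat \<Rightarrow> rat \<Rightarrow> rat) g" "g w = 1" by auto
  show ?thesis
  proof (rule that[of "\<lambda>z. of_rat (g z)"])
    show "of_rat (g (x + y)) = of_rat (g x) + (of_rat (g y) :: complex)" for x y
      by (simp add: vs.linear_add[OF g(1)] of_rat_add)
    show "of_rat (g (of_int k * x)) = of_int k * (of_rat (g x) :: complex)" for k x
      using vs.linear_scale[OF g(1), of "of_int k" x] by (simp add: of_rat_mult)
  qed (simp_all add: g(2))
qed

lemma common_denominator:
  assumes "finite S" "\<And>u. u \<in> S \<Longrightarrow> f u \<in> (\<rat> :: complex set)"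
  shows "\<exists>M::nat. M > 0 \<and> (\<forall>u\<in>S. of_nat M * f u \<in> \<int>)"
  using assms
proof (induction S)
  case (insert u S)
  then obtain M where M: "M > 0" "\<forall>u\<in>S. of_nat M * f u \<in> \<int>" by auto
  have "f u \<in> \<rat>" using insert.prems by simp
  then obtain a b where "b > 0" and fu: "f u = of_int a / of_int (b::int)" by (rule Rats_cases')
  then have ab: "b \<noteq> 0" "f u = of_int a / of_int b" by simp_all
  let ?M = "M * nat \<bar>b\<bar>"
  have b: "(of_nat (nat \<bar>b\<bar>) :: complex) = of_int \<bar>b\<bar>" by simp
  have "of_nat (nat \<bar>b\<bar>) * f u \<in> \<int>"
    unfolding b ab(2) using ab(1) by (cases "b \<ge> 0") (auto simp: minus_divide_right[symmetric])
  then have "of_nat ?M * f u \<in> \<int>" by (simp add: mult.assoc del: of_nat_nat)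
  moreover have "of_nat ?M * f v \<in> \<int>" if "v \<in> S" for v
    using M(2) that by (metis Ints_mult Ints_of_nat mult.assoc mult.commute of_nat_mult)
  ultimately show ?case using M(1) ab(1) by (intro exI[of _ ?M]) auto
qed (intro exI[of _ 1], simp)

text \<open>Generated by addition and subtraction of words alone, so that any additive map of the
  scalars commutes with evaluation on it (\<open>ZF_ext\<close>).\<close>

inductive_set ZF :: "'n falg set" where
  zero: "0 \<in> ZF"
| add: "X \<in> ZF \<Longrightarrow> X + wd u \<in> ZF"
| sub: "X \<in> ZF \<Longrightarrow> X - wd u \<in> ZF"

lemma ZF_wd: "wd u \<in> ZF"
  using ZF.add[OF ZF.zero] by simp

lemma ZF_plus: "Y \<in> ZF \<Longrightarrow> X \<in> ZF \<Longrightarrow> X + Y \<in> ZF"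
  by (induction rule: ZF.induct) (auto intro: ZF.intros simp: add.assoc[symmetric] add_diff_eq)

lemma ZF_minus: "Y \<in> ZF \<Longrightarrow> X \<in> ZF \<Longrightarrow> X - Y \<in> ZF"
proof (induction rule: ZF.induct)
  case (add Y u)
  then show ?case using ZF.sub[of "X - Y" u] by (simp add: algebra_simps)
next
  case (sub Y u)
  then show ?case using ZF.add[of "X - Y" u] by (simp add: algebra_simps)
qed simp

lemma ZF_mult: "X \<in> ZF \<Longrightarrow> Y \<in> ZF \<Longrightarrow> X * Y \<in> ZF"
proof -
  assume X: "X \<in> ZF" and Y: "Y \<in> ZF"
  have "wd u * Y \<in> ZF" for u
    using Y by induction (auto intro: ZF.intros simp: distrib_left right_diff_distrib wd_mult)
  with X show ?thesis by induction (auto intro: ZF.zero ZF_plus ZF_minus simp: distrib_right left_diff_distrib)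
qed

lemma ZF_lookup: "X \<in> ZF \<Longrightarrow> Poly_Mapping.lookup X u \<in> \<int>"
  by (induction rule: ZF.induct) (auto simp: lookup_add lookup_minus lookup_single when_def)

lemma additive_simps:
  assumes "\<And>x y. \<pi> (x + y) = \<pi> x + \<pi> (y :: complex)"
  shows "\<pi> 0 = (0::complex)" "\<pi> (x - y) = \<pi> x - \<pi> y" "\<pi> (sum f S) = (\<Sum>s\<in>S. \<pi> (f s))"
proof -
  show 0: "\<pi> 0 = 0" using assms[of 0 0] by simp
  show "\<pi> (x - y) = \<pi> x - \<pi> y" using assms[of "x - y" y] by simp
  show "\<pi> (sum f S) = (\<Sum>s\<in>S. \<pi> (f s))"
    by (induction S rule: infinite_finite_induct) (simp_all add: 0 assms)
qed

lemma ZF_ext: "X \<in> ZF \<Longrightarrow> (\<And>x y. \<pi> (x + y) = \<pi> x + \<pi> (y :: complex)) \<Longrightarrow> ext (\<lambda>u. \<pi> (\<eta> u)) X = (\<pi> (ext \<eta> X) :: complex)"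
  by (induction rule: ZF.induct)
     (simp_all add: clinear_zero[OF clinear_ext] clinear_add[OF clinear_ext] clinear_diff[OF clinear_ext] additive_simps[of \<pi>])

text \<open>Apply to the coefficients a rational-linear map of the complex numbers that fixes 1 and
  has rational values: as all vectors have integral coordinates, a complex combination becomes a
  rational one, and a common denominator makes it integral.\<close>

lemma span_integral:
  assumes v: "v \<in> cspan R" and R: "R \<subseteq> ZF" and vZ: "v \<in> (ZF :: 'n falg set)"
  shows "\<exists>c t n. (0::nat) < c \<and> finite t \<and> t \<subseteq> R \<and> of_nat c *\<^sub>C v = (\<Sum>r\<in>t. of_int (n r) *\<^sub>C r)"
proof -
  obtain t k where t: "finite t" "t \<subseteq> R" "v = (\<Sum>r\<in>t. k r *\<^sub>C r)"
    using v unfolding complex_vector.span_explicit by blast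
  obtain \<pi> :: "complex \<Rightarrow> complex" where pi: "\<And>x y. \<pi> (x + y) = \<pi> x + \<pi> y" "\<And>k x. \<pi> (of_int k * x) = of_int k * \<pi> x"
    "\<And>x. \<pi> x \<in> \<rat>" "\<pi> 1 = 1" by (rule rational_functional[OF one_neq_zero], rule that)
  have int: "\<pi> (x * z) = \<pi> x * z" if "z \<in> \<int>" for x z
    using that pi(2) by (metis Ints_cases mult.commute)
  have "v = (\<Sum>r\<in>t. \<pi> (k r) *\<^sub>C r)"
  proof (rule poly_mapping_eqI)
    fix u
    have "Poly_Mapping.lookup v u = (\<Sum>r\<in>t. k r * Poly_Mapping.lookup r u)"
      unfolding t(3) by (simp add: lookup_sum lookup_scaleC scaleC_cmul)
    moreover have "\<pi> (Poly_Mapping.lookup v u) = Poly_Mapping.lookup v u"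
      using int[OF ZF_lookup[OF vZ, of u], of 1] pi(4) by simp
    ultimately have "Poly_Mapping.lookup v u = \<pi> (\<Sum>r\<in>t. k r * Poly_Mapping.lookup r u)" by simp
    also have "\<dots> = (\<Sum>r\<in>t. \<pi> (k r * Poly_Mapping.lookup r u))"
      by (rule additive_simps(3)[of \<pi>, OF pi(1)])
    also have "\<dots> = (\<Sum>r\<in>t. \<pi> (k r) * Poly_Mapping.lookup r u)"
      using t(2) R ZF_lookup by (intro sum.cong HOL.refl int) blast
    finally show "Poly_Mapping.lookup v u = Poly_Mapping.lookup (\<Sum>r\<in>t. \<pi> (k r) *\<^sub>C r) u"
      by (simp add: lookup_sum lookup_scaleC scaleC_cmul)
  qed
  moreover obtain c where c: "c > 0" "\<forall>r\<in>t. of_nat c * \<pi> (k r) \<in> \<int>"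
    using common_denominator[OF t(1), of "\<lambda>r. \<pi> (k r)"] pi(3) by blast
  then have "\<forall>r. \<exists>n::int. r \<in> t \<longrightarrow> of_nat c * \<pi> (k r) = of_int n" by (metis Ints_cases)
  then obtain n where n: "\<And>r. r \<in> t \<Longrightarrow> of_nat c * \<pi> (k r) = of_int (n r)" by metis
  ultimately have "of_nat c *\<^sub>C v = (\<Sum>r\<in>t. of_int (n r) *\<^sub>C r)"
    by (simp add: complex_vector.scale_sum_right scaleC_scaleC)
  with c t show ?thesis by blast
qed

context km
begin

lemma serre_ZF: "serre i j \<in> ZF"
proof -
  have "(ad i ^^ n) (wd [j]) \<in> ZF" for n
    by (induction n) (auto simp: ad_def intro: ZF_wd ZF_minus ZF_mult)
  then show ?thesis by (simp add: serre_def)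
qed

lemma fc_dvd: "fc x dvd fact (size (cont x))"
proof (induction x)
  case (Cons ia x)
  have "fact (snd ia) * fc x dvd fact (snd ia) * fact (size (cont x))"
    using Cons by (intro mult_dvd_mono) auto
  also have "\<dots> dvd (fact (snd ia + size (cont x)) :: nat)"
    by (rule fact_fact_dvd_fact)
  finally show ?case by (simp add: fc_def)
qed (simp add: fc_def)

end

context hom_data
begin

text \<open>The relations are integer combinations of words, so composing \<eta> with a
  rational-linear map of the scalars preserves them.\<close>

lemma rationalize:
  assumes "\<eta> u0 \<noteq> 0"
  shows "\<exists>\<eta>'. hom_data A d \<kappa> m \<nu> \<beta> \<eta>' \<and> (\<forall>x. dval \<eta>' x \<in> \<int>) \<and> \<eta>' u0 \<noteq> 0"
proof -
  obtain \<pi> :: "complex \<Rightarrow> complex" where pi: "\<And>x y. \<pi> (x + y) = \<pi> x + \<pi> y"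
    and "\<And>k x. \<pi> (of_int k * x) = of_int k * \<pi> x" and pi': "\<And>x. \<pi> x \<in> \<rat>" "\<pi> (\<eta> u0) = 1"
    by (rule rational_functional[OF assms], rule that)
  have fin: "finite {w. mset w = \<beta>}"
    by (rule finite_subset[OF _ finite_lists_length_eq[of UNIV "size \<beta>"]]) auto
  obtain M where M: "M > 0" "\<forall>u\<in>{w. mset w = \<beta>}. of_nat M * \<pi> (\<eta> u) \<in> \<int>"
    using common_denominator[OF fin, of "\<lambda>u. \<pi> (\<eta> u)"] pi'(1) by blast
  note pi0 = additive_simps(1)[of \<pi>, OF pi]
  \<comment> \<open>\<open>M\<close> clears the denominators of the finitely many values in degree
    \<beta>, the factorial those of the divided powers, by \<open>fc_dvd\<close>.\<close>
  let ?c = "of_nat (M * fact (size \<beta>)) :: complex"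
  define \<eta>' where "\<eta>' u = ?c * \<pi> (\<eta> u)" for u
  have ext': "ext \<eta>' X = ?c * \<pi> (ext \<eta> X)" if "X \<in> ZF" for X
    unfolding \<eta>'_def[abs_def] ext_cmul_fun ZF_ext[OF that pi] ..
  have supp': "mset u = \<beta>" if "\<eta>' u \<noteq> 0" for u
    using that supp[of u] by (cases "\<eta> u = 0") (auto simp: \<eta>'_def pi0)
  have "hom_data A d \<kappa> m \<nu> \<beta> \<eta>'"
  proof
    show "\<eta>' u \<noteq> 0 \<Longrightarrow> mset u = \<beta>" for u by (rule supp')
    show "int (\<nu> i) = int (\<kappa> i) + int (m i) - pm i \<beta>" for i by (rule nu)
    show "ext \<eta>' X = 0" if "X \<in> Jk m" for X
    proof -
      have "ext \<eta>' X \<in> {0}"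
      proof (rule Jk_induct[OF clinear_ext complex_vector.subspace_single_0 _ _ that])
        show "ext \<eta>' (wd u * serre i j * wd v) \<in> {0}" if "i \<noteq> j" for u v i j
          using R[OF J0_Jk[OF J0_base[OF that, of u v]]] by (simp add: ext' ZF_mult ZF_wd serre_ZF pi0)
        show "ext \<eta>' (wd u * wd (replicate (Suc (m j)) j)) \<in> {0}" for u j
          using R[OF Jk_base[of u m j]] by (simp add: ext' ZF_mult ZF_wd pi0 del: replicate_Suc)
      qed
      then show ?thesis by simp
    qed
    show "ext \<eta>' (wd (replicate (Suc (\<kappa> j)) j) * X) = 0" for j X
    proof (rule clinear_eq_singleI[where X=X])
      show "ext \<eta>' (wd (replicate (Suc (\<kappa> j)) j) * wd u) = 0" for u
        using L[of j "wd u"] by (simp add: ext' ZF_mult ZF_wd pi0 del: replicate_Suc)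
    qed (intro clinear_comps[OF clinear_ext] clinear_intros)+
  qed
  moreover have "dval \<eta>' x \<in> \<int>" for x
  proof (cases "\<eta>' (wrd x) = 0")
    case False
    then have c: "cont x = \<beta>" using supp'[OF False] by simp
    then obtain k where k: "fact (size \<beta>) = fc x * k" using fc_dvd[of x] by (metis dvdE)
    have "dval \<eta>' x = of_nat k * (of_nat M * \<pi> (\<eta> (wrd x)))"
      using fc_pos[of x] by (simp add: dval_wrd \<eta>'_def k)
    also have "\<dots> \<in> \<int>" by (rule Ints_mult[OF Ints_of_nat]) (use M(2) c in simp)
    finally show ?thesis .
  qed (simp add: dval_wrd)
  moreover have "\<eta>' u0 \<noteq> 0" using M(1) pi'(2) by (simp add: \<eta>'_def)
  ultimately show ?thesis by blast
qed

end

context km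
begin

lemma proj_Fc_eq: "X \<in> Fc c \<Longrightarrow> proj b X = (if c = b then X else 0)"
proof -
  assume X: "X \<in> Fc c"
  show ?thesis
  proof (cases "c = b")
    case True
    have "proj b X = X"
      by (rule Fc_eqI[OF _ clinear_id _ X]) (simp_all add: proj_def clinear_ext True)
    with True show ?thesis by simp
  next
    case False
    have "proj b X = 0"
      by (rule Fc_eqI[OF _ clinear_zero_map _ X]) (use False in \<open>auto simp: proj_def clinear_ext\<close>)
    with False show ?thesis by simp
  qed
qed

text \<open>Homogeneous integral generators of the conditions \<open>R\<close> and \<open>L\<close>:
  the functionals of degree \<beta> that kill them are the solutions of level 1.\<close>

definition relations :: "('n \<Rightarrow> nat) \<Rightarrow> ('n \<Rightarrow> nat) \<Rightarrow> 'n falg set"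
  where "relations \<kappa> m = {wd u * serre i j * wd v | u v i j. i \<noteq> j}
    \<union> {wd u * wd (replicate (Suc (m j)) j) | u j. True} \<union> {wd (replicate (Suc (\<kappa> j)) j) * wd v | v j. True}"

lemma relations_ZF: "relations \<kappa> m \<subseteq> ZF"
  unfolding relations_def by (auto intro!: ZF_mult ZF_wd serre_ZF)

lemma relations_Fc: "r \<in> relations \<kappa> m \<Longrightarrow> \<exists>c. r \<in> Fc c"
proof -
  assume "r \<in> relations \<kappa> m"
  moreover have "wd u * serre i j * wd v \<in> Fc (mset u + (replicate_mset (nat (1 - A $ i $ j)) i + {#j#}) + mset v)" for u v i j
    by (intro Fc_mult wd_Fc serre_Fc HOL.refl)
  moreover have "wd u * wd v \<in> Fc (mset u + mset v)" for u v :: "'n list"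
    by (intro Fc_mult wd_Fc HOL.refl)
  ultimately show ?thesis unfolding relations_def by blast
qed

lemma separating_functional:
  assumes nu: "\<And>i. int (\<nu> i) = int (\<kappa> i) + int (m i) - pm i \<beta>"
    and u0: "mset u0 = \<beta>" and ns: "wd u0 \<notin> cspan (relations \<kappa> m)"
  shows "\<exists>\<eta>. hom_data A d \<kappa> m \<nu> \<beta> \<eta> \<and> \<eta> u0 \<noteq> 0"
proof -
  obtain B where B: "B \<subseteq> relations \<kappa> m" "cindependent B" "relations \<kappa> m \<subseteq> cspan B"
    using complex_vector.maximal_independent_subset by blast
  then have "wd u0 \<notin> cspan B"
    using ns complex_vector.span_mono[OF B(1)] by blast
  then have ind: "cindependent (insert (wd u0) B)" and nB: "wd u0 \<notin> B"
    using B(2) complex_vector.independent_insert complex_vector.span_base by (metis, metis)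
  interpret vp: vector_space_pair "scaleC :: complex \<Rightarrow> 'n falg \<Rightarrow> 'n falg" "scaleC :: complex \<Rightarrow> complex \<Rightarrow> complex"
    by unfold_locales
  from vp.linear_independent_extend[OF ind[unfolded cdependent_def], of "\<lambda>x. if x = wd u0 then 1 else 0"]
  obtain \<phi> :: "'n falg \<Rightarrow> complex" where \<phi>: "clinear \<phi>" "\<forall>x\<in>insert (wd u0) B. \<phi> x = (if x = wd u0 then 1 else 0)"
    by blast
  have \<phi>R: "\<phi> r = 0" if "r \<in> relations \<kappa> m" for r
  proof -
    have "\<phi> r \<in> {0}"
      by (rule span_image_sub[OF \<phi>(1) complex_vector.subspace_single_0 _ set_mp[OF B(3) that]]) (use \<phi>(2) nB in auto)
    then show ?thesis by simp
  qed
  \<comment> \<open>Cutting the functional down to degree \<beta> keeps the relations, because they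
    are homogeneous.\<close>
  define \<eta> where "\<eta> u = (if mset u = \<beta> then \<phi> (wd u) else 0)" for u
  have ext: "ext \<eta> X = \<phi> (proj \<beta> X)" for X
    by (rule clinear_eq_singleI[where X=X])
       (auto simp: clinear_ext proj_def \<eta>_def clinear_zero[OF \<phi>(1)] intro: clinear_compose[OF \<phi>(1) clinear_ext])
  have R: "ext \<eta> r = 0" if "r \<in> relations \<kappa> m" for r
    using relations_Fc[OF that] \<phi>R[OF that] by (auto simp: ext proj_Fc_eq clinear_zero[OF \<phi>(1)])
  have "hom_data A d \<kappa> m \<nu> \<beta> \<eta>"
  proof
    show "\<eta> u \<noteq> 0 \<Longrightarrow> mset u = \<beta>" for u by (auto simp: \<eta>_def split: if_splits)
    show "int (\<nu> i) = int (\<kappa> i) + int (m i) - pm i \<beta>" for i by (rule nu)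
    show "ext \<eta> X = 0" if "X \<in> Jk m" for X
    proof -
      have "ext \<eta> X \<in> {0}"
        by (rule Jk_induct[OF clinear_ext complex_vector.subspace_single_0 _ _ that]; simp del: replicate_Suc; rule R; unfold relations_def; blast)
      then show ?thesis by simp
    qed
    show "ext \<eta> (wd (replicate (Suc (\<kappa> j)) j) * X) = 0" for j X
    proof (rule clinear_eq_singleI[where X=X])
      show "ext \<eta> (wd (replicate (Suc (\<kappa> j)) j) * wd u) = 0" for u
        by (rule R) (unfold relations_def, blast)
    qed (intro clinear_comps[OF clinear_ext] clinear_intros)+
  qed
  moreover have "\<eta> u0 \<noteq> 0" using \<phi>(2) u0 by (simp add: \<eta>_def)
  ultimately show ?thesis by blast
qed

section \<open>Frobenius descent\<close>

text \<open>Divided powers \<open>f\<^sub>j\<^bsup>(p)\<^esup>\<close> satisfy the Serre relations modulo \<open>p\<close>, so restricting an integral functional of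
  level \<open>p\<close> to words in them gives a functional of level 1 modulo \<open>p\<close>.\<close>

lemma frobenius_relations:
  assumes p: "prime p" and hd: "hom_data A d (\<lambda>i. p * \<kappa> i) (\<lambda>i. p * m i) \<nu> \<beta> \<eta>"
    and h: "divided_functional A h" "\<And>x. of_int (h x) = dval \<eta> x" and r: "r \<in> relations \<kappa> m"
  shows "\<exists>k. ext (\<lambda>u. of_int (h (map (\<lambda>j. (j, p)) u)) :: complex) r = of_int (int p * k)"
proof -
  let ?g = "\<lambda>u. of_int (h (map (\<lambda>j. (j, p)) u)) :: complex"
  interpret hom_data A d "\<lambda>i. p * \<kappa> i" "\<lambda>i. p * m i" \<nu> \<beta> \<eta> by fact
  interpret h: divided_functional A h by fact
  have p0: "p > 0" using p by (rule prime_gt_0_nat)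
  let ?Q = "\<lambda>r. \<exists>k. ext ?g r = of_int (int p * k)"
  have 1: "?Q (wd u * serre i j * wd v)" if ij: "i \<noteq> j" for u v i j
  proof -
    obtain M where M: "A $ i $ j = - int M" using off[OF ij] by (metis nonpos_int_cases)
    have n: "nat (1 - A $ i $ j) = Suc M" by (simp add: M)
    let ?t = "\<lambda>r. h (map (\<lambda>j. (j, p)) u @ replicate (Suc M - r) (i, p) @ (j, p) # replicate r (i, p) @ map (\<lambda>j. (j, p)) v)"
    have w: "wd u * (wd (replicate a i) * wd [j] * wd (replicate b i)) * wd v = wd (u @ replicate a i @ j # replicate b i @ v)" for a b
      by (simp add: wd_mult)
    have "ext ?g (wd u * serre i j * wd v) = (\<Sum>r\<le>Suc M. of_int ((- 1) ^ r * int (Suc M choose r)) * of_int (?t r))"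
      unfolding serre_def n ad_pow_expand sum_distrib_left sum_distrib_right falg_scale_left falg_scale_right clinear_sum[OF clinear_ext] clinear_scale[OF clinear_ext] w
      by (intro sum.cong HOL.refl) (simp add: scaleC_cmul del: binomial_Suc_Suc)
    also have "\<dots> = of_int (\<Sum>r\<le>Suc M. (- 1) ^ r * int (Suc M choose r) * ?t r)"
      by (simp only: of_int_sum of_int_mult)
    finally have eq: "ext ?g (wd u * serre i j * wd v) = of_int (\<Sum>r\<le>Suc M. (- 1) ^ r * int (Suc M choose r) * ?t r)" .
    from h.serre_mod_p[OF p ij M] obtain k where "(\<Sum>r\<le>Suc M. (- 1) ^ r * int (Suc M choose r) * ?t r) = int p * k"
      by (rule dvdE)
    then show ?thesis unfolding eq by (intro exI[of _ k]) (rule arg_cong)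
  qed
  \<comment> \<open>Since p \<open>Suc (m j)\<close> exceeds p \<open>m j\<close>, this relation
    holds exactly and not only modulo p; the same happens in \<open>3\<close>.\<close>
  have 2: "?Q (wd u * wd (replicate (Suc (m j)) j))" for u j
  proof -
    have "wd (replicate (p * Suc (m j)) j) \<in> Jk (\<lambda>i. p * m i)"
      using Jk_base[of "replicate (p * Suc (m j) - Suc (p * m j)) j" "\<lambda>i. p * m i" j] p0
      by (simp add: wd_mult replicate_add[symmetric] del: replicate_Suc)
    then have "ext \<eta> (dv v * wd (replicate (p * Suc (m j)) j)) = 0" for v by (intro R Jk_mult_left)
    then have "dval \<eta> (v @ [(j, p * Suc (m j))]) = 0" for v
      by (simp add: dval_def dv_append falg_scale_right clinear_scale[OF clinear_ext] del: mult_Suc_right)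
    then have "h (v @ [(j, p * Suc (m j))]) = 0" for v
      by (simp add: h(2)[symmetric] del: mult_Suc_right)
    then have "h (map (\<lambda>j. (j, p)) (u @ replicate (Suc (m j)) j)) = 0"
      using h.replicate_p[of "map (\<lambda>j. (j, p)) u" "Suc (m j)" j p "[]"] by (simp del: replicate_Suc mult_Suc_right)
    then show ?thesis
      unfolding wd_mult by (intro exI[of _ 0]) (simp del: replicate_Suc)
  qed
  have 3: "?Q (wd (replicate (Suc (\<kappa> j)) j) * wd v)" for v j
  proof -
    have "ext \<eta> (wd (replicate (p * Suc (\<kappa> j)) j) * dv v) = 0" for v
      using L[of j "wd (replicate (p * Suc (\<kappa> j) - Suc (p * \<kappa> j)) j) * dv v"] p0
      by (simp add: add.commute wd_mult mult.assoc[symmetric] replicate_add[symmetric] del: replicate_Suc)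
    then have "dval \<eta> ((j, p * Suc (\<kappa> j)) # v) = 0" for v
      by (simp add: dval_def clinear_scale[OF clinear_ext] del: mult_Suc_right)
    then have "h ((j, p * Suc (\<kappa> j)) # v) = 0" for v
      by (simp add: h(2)[symmetric] del: mult_Suc_right)
    then have "h (map (\<lambda>j. (j, p)) (replicate (Suc (\<kappa> j)) j @ v)) = 0"
      using h.replicate_p[of "[]" "Suc (\<kappa> j)" j p "map (\<lambda>j. (j, p)) v"] by (simp del: replicate_Suc mult_Suc_right)
    then show ?thesis
      unfolding wd_mult by (intro exI[of _ 0]) (simp del: replicate_Suc)
  qed
  from r show ?thesis
    unfolding relations_def by (elim UnE CollectE exE conjE; hypsubst) (erule 1, rule 2, rule 3)
qed

text \<open>The integer \<open>v\<close> is kept explicit because it multiplies when levels are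
  added, which controls its prime divisors.\<close>

definition integral_level :: "('n \<Rightarrow> nat) \<Rightarrow> ('n \<Rightarrow> nat) \<Rightarrow> ('n \<Rightarrow> nat) \<Rightarrow> 'n multiset \<Rightarrow> ('n \<times> nat) list \<Rightarrow> ('n \<times> nat) list \<Rightarrow> nat \<Rightarrow> int \<Rightarrow> bool"
  where "integral_level \<kappa> m \<nu> \<beta> y z N v \<longleftrightarrow> (\<exists>\<eta>. hom_data A d (\<lambda>i. N * \<kappa> i) (\<lambda>i. N * m i) (\<lambda>i. N * \<nu> i) (repeat_mset N \<beta>) \<eta>
    \<and> (\<forall>x. dval \<eta> x \<in> \<int>) \<and> dval \<eta> (rev (scale N y) @ scale N z) = of_int v)"

lemma integral_level_add:
  assumes y: "chain \<kappa> y" and z: "chain m z"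
    and "integral_level \<kappa> m \<nu> \<beta> y z N v" "integral_level \<kappa> m \<nu> \<beta> y z N' v'"
  shows "integral_level \<kappa> m \<nu> \<beta> y z (N + N') (v * v')"
proof -
  from assms(3,4) obtain \<eta> \<eta>' where
    a: "hom_data A d (\<lambda>i. N * \<kappa> i) (\<lambda>i. N * m i) (\<lambda>i. N * \<nu> i) (repeat_mset N \<beta>) \<eta>" "\<And>x. dval \<eta> x \<in> \<int>"
      "dval \<eta> (rev (scale N y) @ scale N z) = of_int v"
    and b: "hom_data A d (\<lambda>i. N' * \<kappa> i) (\<lambda>i. N' * m i) (\<lambda>i. N' * \<nu> i) (repeat_mset N' \<beta>) \<eta>'" "\<And>x. dval \<eta>' x \<in> \<int>"
      "dval \<eta>' (rev (scale N' y) @ scale N' z) = of_int v'"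
    unfolding integral_level_def by blast
  have "hom_data A d (\<lambda>i. (N + N') * \<kappa> i) (\<lambda>i. (N + N') * m i) (\<lambda>i. (N + N') * \<nu> i) (repeat_mset (N + N') \<beta>) (conv \<eta> \<eta>')"
    using hom_data_conv[OF a(1) b(1)] by (simp add: distrib_right repeat_mset_distrib)
  moreover have "dval (conv \<eta> \<eta>') x \<in> \<int>" for x
    unfolding dval_conv by (intro cv_Ints a b)
  ultimately show ?thesis
    unfolding integral_level_def using dval_conv_value[OF a(1) b(1) y z] a(3) b(3) by (intro exI[of _ "conv \<eta> \<eta>'"]) simp
qed

lemma integral_level_mult:
  assumes "chain \<kappa> y" "chain m z" "integral_level \<kappa> m \<nu> \<beta> y z N v"
  shows "integral_level \<kappa> m \<nu> \<beta> y z (Suc k * N) (v ^ Suc k)"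
proof (induction k)
  case (Suc k)
  from integral_level_add[OF assms Suc] show ?case by simp
qed (use assms in simp)

theorem level_one:
  assumes y: "chain \<kappa> y" and z: "chain m z" and \<beta>: "\<beta> = cont y + cont z"
    and nu: "\<And>i. int (\<nu> i) = int (\<kappa> i) + int (m i) - pm i \<beta>" and B: "B > 0"
    and lev: "\<And>N. N = B \<or> N = Suc B \<Longrightarrow> \<exists>\<eta>. hom_data A d (\<lambda>i. N * \<kappa> i) (\<lambda>i. N * m i) (\<lambda>i. N * \<nu> i) (repeat_mset N \<beta>) \<eta>
      \<and> \<eta> (wrd (rev (scale N y) @ scale N z)) \<noteq> 0"
  shows "\<exists>\<eta>. hom_data A d \<kappa> m \<nu> \<beta> \<eta> \<and> \<eta> (rev (wrd y) @ wrd z) \<noteq> 0"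
proof (rule ccontr)
  let ?u = "wrd (rev y @ z)"
  assume contra: "\<not> ?thesis"
  have u: "?u = rev (wrd y) @ wrd z" by (simp add: wrd_append wrd_rev)
  have mu: "mset ?u = \<beta>" unfolding u by (simp add: \<beta>)
  have "wd ?u \<in> cspan (relations \<kappa> m)"
    using contra separating_functional[OF nu mu] unfolding u by blast
  \<comment> \<open>An integral certificate that level 1 is unsolvable; its constants are fixed
    before the prime is chosen.\<close>
  from span_integral[OF this relations_ZF ZF_wd] obtain c t n where
    c: "0 < (c::nat)" "finite t" "t \<subseteq> relations \<kappa> m" "of_nat c *\<^sub>C wd ?u = (\<Sum>r\<in>t. of_int (n r) *\<^sub>C r)" by blast
  have int: "\<exists>v. v \<noteq> 0 \<and> integral_level \<kappa> m \<nu> \<beta> y z N v" if "N = B \<or> N = Suc B" for N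
  proof -
    from lev[OF that] obtain \<eta> where h: "hom_data A d (\<lambda>i. N * \<kappa> i) (\<lambda>i. N * m i) (\<lambda>i. N * \<nu> i) (repeat_mset N \<beta>) \<eta>"
      "\<eta> (wrd (rev (scale N y) @ scale N z)) \<noteq> 0" by blast
    from hom_data.rationalize[OF h] obtain \<eta>' where
      h': "hom_data A d (\<lambda>i. N * \<kappa> i) (\<lambda>i. N * m i) (\<lambda>i. N * \<nu> i) (repeat_mset N \<beta>) \<eta>'" "\<And>x. dval \<eta>' x \<in> \<int>"
      "\<eta>' (wrd (rev (scale N y) @ scale N z)) \<noteq> 0" by blast
    obtain v where "dval \<eta>' (rev (scale N y) @ scale N z) = of_int v" using h'(2) by (metis Ints_cases)
    moreover from this have "v \<noteq> 0" using h'(3) fc_pos[of "rev (scale N y) @ scale N z"] by (auto simp: dval_wrd)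
    ultimately show ?thesis using h' unfolding integral_level_def by blast
  qed
  obtain v1 v2 where v: "v1 \<noteq> 0" "integral_level \<kappa> m \<nu> \<beta> y z B v1" "v2 \<noteq> 0" "integral_level \<kappa> m \<nu> \<beta> y z (Suc B) v2"
    using int[of B] int[of "Suc B"] by blast
  \<comment> \<open>A prime beyond \<open>bound\<close> divides neither \<open>c\<close>,
    \<open>v1\<close>, \<open>v2\<close> nor any \<open>mult_p\<close> factor of the word, and is
    large enough to be a positive combination of \<open>B\<close> and \<open>Suc B\<close>.\<close>
  define bound where "bound = c + nat \<bar>v1\<bar> + nat \<bar>v2\<bar> + sum_list (map snd (rev y @ z)) + B * (B + 3)"
  obtain p where p: "prime p" "bound < p" using bigger_prime by blast
  \<comment> \<open>With p - 1 = q B + b one has p = (q - b - 1) B + (b + 1) (B + 1); the two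
    coefficients are \<open>Suc a\<close> and \<open>Suc b\<close>.\<close>
  define b where "b = (p - 1) mod B"
  define a where "a = (p - 1) div B - Suc b - 1"
  have "b < B" using B by (simp add: b_def)
  have dm: "p - 1 = ((p - 1) div B) * B + b" by (simp add: b_def)
  have "(B + 2) * B \<le> p - 1" using p(2) by (simp add: bound_def algebra_simps)
  then have "B + 2 \<le> (p - 1) div B" using B by (simp add: less_eq_div_iff_mult_less_eq)
  with \<open>b < B\<close> have "(p - 1) div B = Suc a + Suc b" by (simp add: a_def)
  with dm p(2) have pab: "p = Suc a * B + Suc b * Suc B" by (simp add: algebra_simps)
  have lp: "integral_level \<kappa> m \<nu> \<beta> y z p (v1 ^ Suc a * v2 ^ Suc b)"
    unfolding pab by (intro integral_level_add y z integral_level_mult v)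
  then obtain \<eta> where \<eta>: "hom_data A d (\<lambda>i. p * \<kappa> i) (\<lambda>i. p * m i) (\<lambda>i. p * \<nu> i) (repeat_mset p \<beta>) \<eta>"
    "\<And>x. dval \<eta> x \<in> \<int>" "dval \<eta> (rev (scale p y) @ scale p z) = of_int (v1 ^ Suc a * v2 ^ Suc b)"
    unfolding integral_level_def by blast
  obtain h where h: "divided_functional A h" "\<And>x. of_int (h x) = dval \<eta> x"
    using hom_data.divided_functional[OF \<eta>(1,2)] by blast
  let ?g = "\<lambda>u. of_int (h (map (\<lambda>j. (j, p)) u)) :: complex"
  have "\<forall>r. \<exists>k. r \<in> relations \<kappa> m \<longrightarrow> ext ?g r = of_int (int p * k)"
    using frobenius_relations[OF p(1) \<eta>(1) h] by blast
  from choice[OF this] obtain k where k: "\<And>r. r \<in> relations \<kappa> m \<Longrightarrow> ext ?g r = of_int (int p * k r)" by blast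
  have "of_nat c * ?g ?u = ext ?g (of_nat c *\<^sub>C wd ?u)"
    by (simp add: clinear_scale[OF clinear_ext] scaleC_cmul)
  also have "\<dots> = (\<Sum>r\<in>t. of_int (n r) * of_int (int p * k r))"
    unfolding c(4) clinear_sum[OF clinear_ext] clinear_scale[OF clinear_ext] scaleC_cmul
    using k c(3) by (intro sum.cong HOL.refl) (simp add: subset_iff)
  finally have "of_int (int c * h (map (\<lambda>j. (j, p)) ?u)) = (of_int (int p * (\<Sum>r\<in>t. n r * k r)) :: complex)"
    by (simp add: sum_distrib_left mult_ac)
  then have "int p dvd int c * h (map (\<lambda>j. (j, p)) ?u)" unfolding of_int_eq_iff by simp
  moreover have "h (map (\<lambda>j. (j, p)) ?u) = prod_list (map (\<lambda>ia. mult_p p (snd ia)) (rev y @ z)) * (v1 ^ Suc a * v2 ^ Suc b)"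
  proof -
    have "scale p (rev y @ z) = rev (scale p y) @ scale p z" by (simp add: scale_def rev_map)
    then have "(of_int (h (scale p (rev y @ z))) :: complex) = of_int (v1 ^ Suc a * v2 ^ Suc b)" using h(2) \<eta>(3) by simp
    then have "h (scale p (rev y @ z)) = v1 ^ Suc a * v2 ^ Suc b" unfolding of_int_eq_iff .
    then show ?thesis using map_wrd_p[OF h(1), of "[]" p "rev y @ z" "[]"] by simp
  qed
  moreover have pp: "prime (int p)" using p(1) by simp
  moreover have "\<not> int p dvd int c" using c(1) p(2) by (auto simp: bound_def int_dvd_int_iff dest: dvd_imp_le)
  moreover have "\<not> int p dvd v" if "v \<noteq> 0" "nat \<bar>v\<bar> < p" for v
    using that zdvd_imp_le[of "int p" "\<bar>v\<bar>"] by auto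
  then have "\<not> int p dvd v1" "\<not> int p dvd v2" using v(1,3) p(2) by (auto simp: bound_def)
  then have "\<not> int p dvd v1 ^ Suc a * v2 ^ Suc b"
    using pp by (metis prime_dvd_mult_iff prime_dvd_power)
  moreover have nd: "\<not> int p dvd prod_list (map (\<lambda>ia. mult_p p (snd ia)) x)" if "sum_list (map snd x) < p" for x :: "('n \<times> nat) list"
    using that
  proof (induction x)
    case Nil
    then show ?case using prime_gt_1_nat[OF p(1)] by auto
  next
    case (Cons ia x)
    then show ?case using mult_p_not_dvd[OF p(1), of "snd ia"] pp by (auto simp: prime_dvd_mult_iff)
  qed
  have "sum_list (map snd (rev y @ z)) < p" using p(2) unfolding bound_def by linarith
  then have "\<not> int p dvd prod_list (map (\<lambda>ia. mult_p p (snd ia)) (rev y @ z))" by (rule nd)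
  ultimately show False by (metis prime_dvd_mult_iff)
qed

section \<open>Simultaneous reflections of pairs of extremal vectors\<close>

definition extremal :: "('n \<Rightarrow> nat) \<Rightarrow> 'n multiset \<Rightarrow> 'n falg \<Rightarrow> bool"
  where "extremal \<kappa> c Y \<longleftrightarrow> Y \<in> Fc c \<and> Y \<notin> Jk \<kappa> \<and> qq (ik \<kappa>) c = 0"

text \<open>Subtracting \<open>rcont \<kappa> i c\<close> from \<kappa> gives the image under s_i of
  the extremal weight \<kappa> - c; \<open>rvec\<close> realizes the reflection on vectors by a
  power of f_i or e_i, according to the sign of the pairing.\<close>

definition rcont :: "('n \<Rightarrow> nat) \<Rightarrow> 'n \<Rightarrow> 'n multiset \<Rightarrow> 'n multiset"
  where "rcont \<kappa> i c = (if pm i c \<le> int (\<kappa> i) then replicate_mset (nat (int (\<kappa> i) - pm i c)) i + c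
    else c - replicate_mset (nat (pm i c - int (\<kappa> i))) i)"

definition rvec :: "('n \<Rightarrow> nat) \<Rightarrow> 'n \<Rightarrow> 'n multiset \<Rightarrow> 'n falg \<Rightarrow> 'n falg"
  where "rvec \<kappa> i c Y = (if pm i c \<le> int (\<kappa> i) then wd (replicate (nat (int (\<kappa> i) - pm i c)) i) * Y
    else (EE (ik \<kappa>) i ^^ nat (pm i c - int (\<kappa> i))) Y)"

lemma qq_reflect:
  assumes "\<And>j. int (count e' j) = int (count e j) + (if j = i then \<kappa> i - pm i e else 0)"
  shows "qq \<kappa> e' = qq \<kappa> e"
proof (cases "pm i e \<le> \<kappa> i")
  case True
  let ?n = "nat (\<kappa> i - pm i e)"
  have "count e' j = count (replicate_mset ?n i + e) j" for j
    using assms[of j] True by auto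
  then have "e' = replicate_mset ?n i + e" by (rule multiset_eqI)
  then show ?thesis using True by (simp add: qq_add_replicate)
next
  case False
  let ?n = "nat (pm i e - \<kappa> i)"
  have "count e j = count (replicate_mset ?n i + e') j" for j
    using assms[of j] False by auto
  then have e: "e = replicate_mset ?n i + e'" by (rule multiset_eqI)
  have "pm i e = 2 * int ?n + pm i e'" by (subst e) simp
  then have "int ?n - (\<kappa> i - pm i e') = 0" using False by simp
  then have "qq \<kappa> (replicate_mset ?n i + e') = qq \<kappa> e'"
    by (simp only: qq_add_replicate of_int_0 mult_zero_right add_0_right)
  with arg_cong[OF e, of "qq \<kappa>"] show ?thesis by simp
qed

lemma rcont_reflect:
  assumes "extremal \<kappa> c Y"
  shows "extremal \<kappa> (rcont \<kappa> i c) (rvec \<kappa> i c Y)" "int (count (rcont \<kappa> i c) j) = int (count c j) + (if j = i then int (\<kappa> i) - pm i c else 0)"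
    and "pm i (rcont \<kappa> i c) = 2 * int (\<kappa> i) - pm i c"
    and "int (size (rcont \<kappa> i c)) = int (size c) + (int (\<kappa> i) - pm i c)"
    and "rcont \<kappa> i (rcont \<kappa> i c) = c"
proof -
  have Y: "Y \<in> Fc c" "Y \<notin> Jk \<kappa>" and q: "qq (ik \<kappa>) c = 0" using assms by (auto simp: extremal_def)
  have *: "extremal \<kappa> (rcont \<kappa> i c) (rvec \<kappa> i c Y) \<and> (\<forall>j. int (count (rcont \<kappa> i c) j) = int (count c j) + (if j = i then int (\<kappa> i) - pm i c else 0))
    \<and> pm i (rcont \<kappa> i c) = 2 * int (\<kappa> i) - pm i c \<and> int (size (rcont \<kappa> i c)) = int (size c) + (int (\<kappa> i) - pm i c)"
  proof (cases "pm i c \<le> int (\<kappa> i)")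
    case True
    let ?n = "nat (int (\<kappa> i) - pm i c)"
    have n: "int ?n = int (\<kappa> i) - pm i c" using True by simp
    have "wd (replicate ?n i) * Y \<in> Fc (replicate_mset ?n i + c)"
      using Y(1) by (intro Fc_mult wd_Fc) auto
    moreover have "wd (replicate ?n i) * Y \<notin> Jk \<kappa>" using F_inj[OF Y(1), of ?n i] Y(2) n by auto
    moreover have "qq (ik \<kappa>) (replicate_mset ?n i + c) = 0"
      unfolding qq_add_replicate n using q by simp
    ultimately show ?thesis using True by (auto simp: rcont_def rvec_def extremal_def)
  next
    case False
    let ?n = "nat (pm i c - int (\<kappa> i))"
    have n: "int ?n = - (int (\<kappa> i) - pm i c)" using False by simp
    from reflect_up[OF Y n] obtain c' where c': "c = replicate_mset ?n i + c'" "(EE (ik \<kappa>) i ^^ ?n) Y \<in> Fc c'"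
      "(EE (ik \<kappa>) i ^^ ?n) Y \<notin> Jk \<kappa>" "int ?n = int (\<kappa> i) - pm i c'" "qq (ik \<kappa>) c' = qq (ik \<kappa>) c" by metis
    have r: "rcont \<kappa> i c = c'"
    proof -
      have "c - replicate_mset ?n i = c'" by (subst c'(1)) simp
      then show ?thesis using False by (simp add: rcont_def)
    qed
    have rv: "rvec \<kappa> i c Y = (EE (ik \<kappa>) i ^^ ?n) Y" using False by (simp add: rvec_def)
    have cnt: "count c j = (if j = i then ?n else 0) + count c' j" for j
      by (subst c'(1)) simp
    have "size c = ?n + size c'" by (subst c'(1)) simp
    then have "int (size c') = int (size c) + (int (\<kappa> i) - pm i c)" using n by simp
    moreover have "int (count c' j) = int (count c j) + (if j = i then int (\<kappa> i) - pm i c else 0)" for j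
      using n by (simp add: cnt)
    moreover have "pm i c' = 2 * int (\<kappa> i) - pm i c" using c'(4) n by simp
    ultimately show ?thesis
      unfolding r rv extremal_def using c'(2,3,5) q by simp
  qed
  then show "extremal \<kappa> (rcont \<kappa> i c) (rvec \<kappa> i c Y)" and cnt: "int (count (rcont \<kappa> i c) j) = int (count c j) + (if j = i then int (\<kappa> i) - pm i c else 0)"
    and p: "pm i (rcont \<kappa> i c) = 2 * int (\<kappa> i) - pm i c"
    and "int (size (rcont \<kappa> i c)) = int (size c) + (int (\<kappa> i) - pm i c)" for j by blast+
  show "rcont \<kappa> i (rcont \<kappa> i c) = c"
  proof (rule multiset_eqI)
    fix j
    have cnt: "int (count (rcont \<kappa> i c) j) = int (count c j) + (if j = i then int (\<kappa> i) - pm i c else 0)" for j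
      using * by blast
    show "count (rcont \<kappa> i (rcont \<kappa> i c)) j = count c j"
      using cnt[of j] unfolding rcont_def[of \<kappa> i "rcont \<kappa> i c"] p by auto
  qed
qed

lemma tri_F_pow:
  assumes t: "tri \<kappa> m \<beta> \<nu> \<Phi>"
  shows "wd (replicate n i) * \<Phi> Y Z - (\<Sum>k\<le>n. of_nat (n choose k) *\<^sub>C \<Phi> (wd (replicate k i) * Y) (wd (replicate (n - k) i) * Z)) \<in> Jk \<nu>"
  using leibniz_mod[of "\<lambda>X. wd [i] * X" "Jk \<nu>" \<Phi> "\<lambda>X. wd [i] * X" "\<lambda>X. wd [i] * X" n Y Z, OF _ Jk_subspace Jk_mult_left tri_f[OF t]]
  unfolding wd_pow by (simp add: clinear_intros)

lemma tri_E_pow: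
  assumes t: "tri \<kappa> m \<beta> \<nu> \<Phi>"
  shows "(EE (ik \<nu>) i ^^ n) (\<Phi> 1 Z) - \<Phi> 1 ((EE (ik m) i ^^ n) Z) \<in> Jk \<nu>"
proof (induction n)
  case (Suc n)
  have "EE (ik \<nu>) i (\<Phi> 1 ((EE (ik m) i ^^ n) Z)) - \<Phi> 1 ((EE (ik m) i ^^ Suc n) Z) \<in> Jk \<nu>"
    using tri_EE[OF t, of i 1 "(EE (ik m) i ^^ n) Z"] by (simp add: clinear_zero[OF tri_lin1[OF t]])
  from complex_vector.subspace_add[OF Jk_subspace EE_Jk[OF Suc, of i] this]
  show ?case by (simp add: EE_simps)
qed (simp add: complex_vector.subspace_0[OF Jk_subspace])

text \<open>When f_i to the power a1 + a2 acts on \<open>\<Phi> Y Z\<close>, all terms except the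
  one with exponents a1 and a2 pass the end of a string. This power is injective on the weight of
  \<open>\<Phi> Y Z\<close>, which gives both directions.\<close>

lemma tri_reflect_pos:
  assumes t: "tri \<kappa> m \<beta> \<nu> \<Phi>" and Y: "extremal \<kappa> c1 Y" and Z: "extremal m c2 Z"
    and a: "int a1 = int (\<kappa> i) - pm i c1" "int a2 = int (m i) - pm i c2"
  shows "\<Phi> Y Z \<in> Jk \<nu> \<longleftrightarrow> \<Phi> (wd (replicate a1 i) * Y) (wd (replicate a2 i) * Z) \<in> Jk \<nu>"
proof -
  let ?n = "a1 + a2"
  let ?t = "\<lambda>k. of_nat (?n choose k) *\<^sub>C \<Phi> (wd (replicate k i) * Y) (wd (replicate (?n - k) i) * Z)"
  have Y': "Y \<in> Fc c1" "qq (ik \<kappa>) c1 = 0" and Z': "Z \<in> Fc c2" "qq (ik m) c2 = 0"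
    using Y Z by (auto simp: extremal_def)
  have "(\<Sum>k\<le>?n. ?t k) = ?t a1 + (\<Sum>k\<in>{..?n} - {a1}. ?t k)"
    by (rule sum.remove) auto
  moreover have "(\<Sum>k\<in>{..?n} - {a1}. ?t k) \<in> Jk \<nu>"
  proof (intro complex_vector.subspace_sum[OF Jk_subspace] complex_vector.subspace_scale[OF Jk_subspace])
    fix k assume "k \<in> {..?n} - {a1}"
    then have "a1 < k \<or> a2 < ?n - k" by auto
    then show "\<Phi> (wd (replicate k i) * Y) (wd (replicate (?n - k) i) * Z) \<in> Jk \<nu>"
    proof
      assume "a1 < k"
      then show ?thesis using a by (intro tri_Jk1[OF t] extremal_F[OF Y']) auto
    next
      assume "a2 < ?n - k"
      then show ?thesis using a by (intro tri_Jk2[OF t] extremal_F[OF Z']) auto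
    qed
  qed
  ultimately have "wd (replicate ?n i) * \<Phi> Y Z - of_nat (?n choose a1) *\<^sub>C \<Phi> (wd (replicate a1 i) * Y) (wd (replicate a2 i) * Z) \<in> Jk \<nu>"
    using complex_vector.subspace_add[OF Jk_subspace tri_F_pow[OF t, of ?n i Y Z], of "\<Sum>k\<in>{..?n} - {a1}. ?t k"] by simp
  then have "wd (replicate ?n i) * \<Phi> Y Z \<in> Jk \<nu> \<longleftrightarrow> \<Phi> (wd (replicate a1 i) * Y) (wd (replicate a2 i) * Z) \<in> Jk \<nu>"
    by (rule Jk_cancel) simp
  moreover have "wd (replicate ?n i) * \<Phi> Y Z \<in> Jk \<nu> \<longleftrightarrow> \<Phi> Y Z \<in> Jk \<nu>"
  proof
    assume *: "wd (replicate ?n i) * \<Phi> Y Z \<in> Jk \<nu>"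
    show "\<Phi> Y Z \<in> Jk \<nu>"
    proof (cases "\<beta> \<subseteq># c1 + c2")
      case True
      then obtain e where e: "c1 + c2 = \<beta> + e" by (auto simp: mset_subset_eq_exists_conv)
      from arg_cong[OF this, of "pm i"] have "pm i c1 + pm i c2 = pm i \<beta> + pm i e" by simp
      then have "int ?n \<le> int (\<nu> i) - pm i e" using a tri_nu[OF t, of i] by simp
      moreover have "\<Phi> Y Z \<in> Fc e" using tri_Fc[OF t Y'(1) Z'(1) True] by (simp add: e)
      ultimately show ?thesis using F_inj * by blast
    next
      case False
      then show ?thesis using tri_Fc0[OF t Y'(1) Z'(1)] by (simp add: complex_vector.subspace_0[OF Jk_subspace])
    qed
  qed (rule Jk_mult_left)
  ultimately show ?thesis by simp
qed

text \<open>A highest weight vector tensored with a lowest weight vector generates the tensor product of two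
  \<open>sl\<^sub>2\<close>-modules.\<close>

lemma tri_cyclic:
  assumes t: "tri \<kappa> m \<beta> \<nu> \<Phi>" and Y: "EE (ik \<kappa>) i Y \<in> Jk \<kappa>" and Z: "wd [i] * Z \<in> Jk m" "Z \<in> Fc c"
    and YZ: "\<Phi> Y Z \<in> Jk \<nu>"
  shows "\<Phi> (wd (replicate r i) * Y) ((EE (ik m) i ^^ s) Z) \<in> Jk \<nu>"
proof (induction r arbitrary: s)
  case 0
  show ?case
  proof (induction s)
    case (Suc s)
    let ?Z = "(EE (ik m) i ^^ s) Z"
    have 1: "EE (ik \<nu>) i (\<Phi> Y ?Z) \<in> Jk \<nu>" using EE_Jk[of "\<Phi> Y ?Z" \<nu> i] Suc by (simp add: wd_Nil)
    have 2: "\<Phi> (EE (ik \<kappa>) i Y) ?Z \<in> Jk \<nu>" by (rule tri_Jk1[OF t Y])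
    from complex_vector.subspace_diff[OF Jk_subspace complex_vector.subspace_diff[OF Jk_subspace 1 tri_EE[OF t, of i Y ?Z]] 2]
    show ?case by (simp add: wd_Nil)
  qed (use YZ in \<open>simp add: wd_Nil\<close>)
next
  case (Suc r)
  interpret sl2_mod "\<lambda>X. wd [i] * X" "EE (ik m) i" "\<lambda>p. {X. Hp (ik m) i X = of_int (- p) *\<^sub>C X}" "Jk m"
    by (rule sl2_FE)
  let ?Y = "wd (replicate r i) * Y" and ?Z = "(EE (ik m) i ^^ s) Z"
  let ?p = "- (int (m i) - pm i c)"
  let ?c = "of_int (int s * (?p - int s + 1)) :: complex"
  have "Z \<in> {X. Hp (ik m) i X = of_int (- ?p) *\<^sub>C X}" using Hp_Fc[OF Z(2), of "ik m" i] by simp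
  from e_f_pow[OF this, of s]
  have "wd [i] * ?Z - (EE (ik m) i ^^ s) (wd [i] * Z) - ?c *\<^sub>C (EE (ik m) i ^^ (s - 1)) Z \<in> Jk m" .
  from drop_middle[OF this pow_M(2)[OF Z(1)]]
  have "\<Phi> ?Y (wd [i] * ?Z) - ?c *\<^sub>C \<Phi> ?Y ((EE (ik m) i ^^ (s - 1)) Z) \<in> Jk \<nu>" by (rule tri_cong_Jk2[OF t])
  from complex_vector.subspace_add[OF Jk_subspace this complex_vector.subspace_scale[OF Jk_subspace Suc, of ?c "s - 1"]]
  have 1: "\<Phi> ?Y (wd [i] * ?Z) \<in> Jk \<nu>" by simp
  from complex_vector.subspace_diff[OF Jk_subspace complex_vector.subspace_diff[OF Jk_subspace Jk_mult_left[OF Suc[of s], of "wd [i]"] tri_f[OF t, of i ?Y ?Z]] 1]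
  have "\<Phi> (wd [i] * ?Y) ?Z \<in> Jk \<nu>" by simp
  moreover have "wd [i] * ?Y = wd (replicate (Suc r) i) * Y" by (simp add: mult.assoc[symmetric] wd_mult)
  ultimately show ?case by simp
qed

text \<open>One vector is highest and the other lowest for the i-th sl_2, so
  \<open>tri_cyclic\<close> reaches the reflected pair. The reflected pair is in the same situation
  with the factors exchanged, and \<open>tri_flip\<close> gives the converse.\<close>

lemma tri_reflect_mixed:
  assumes t: "tri \<kappa> m \<beta> \<nu> \<Phi>" and Y: "extremal \<kappa> c1 Y" and Z: "extremal m c2 Z"
    and a: "int a = int (\<kappa> i) - pm i c1" "int b = - (int (m i) - pm i c2)"
  shows "\<Phi> Y Z \<in> Jk \<nu> \<longleftrightarrow> \<Phi> (wd (replicate a i) * Y) ((EE (ik m) i ^^ b) Z) \<in> Jk \<nu>"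
proof
  have Y': "Y \<in> Fc c1" "qq (ik \<kappa>) c1 = 0" and Z': "Z \<in> Fc c2" "qq (ik m) c2 = 0"
    using Y Z by (auto simp: extremal_def)
  have EY: "EE (ik \<kappa>) i Y \<in> Jk \<kappa>" using extremal_E[OF Y', of 1 i] a by simp
  have FZ: "wd [i] * Z \<in> Jk m" using extremal_F[OF Z', of 1 i] a by simp
  show "\<Phi> Y Z \<in> Jk \<nu> \<Longrightarrow> \<Phi> (wd (replicate a i) * Y) ((EE (ik m) i ^^ b) Z) \<in> Jk \<nu>"
    by (rule tri_cyclic[OF t EY FZ Z'(1)])
  let ?Y = "wd (replicate a i) * Y" and ?Z = "(EE (ik m) i ^^ b) Z"
  assume *: "\<Phi> ?Y ?Z \<in> Jk \<nu>"
  have n: "nat (int (\<kappa> i) - pm i c1) = a" "nat (pm i c2 - int (m i)) = b" using a by simp_all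
  have Y1: "extremal \<kappa> (rcont \<kappa> i c1) ?Y" "pm i (rcont \<kappa> i c1) = 2 * int (\<kappa> i) - pm i c1"
    using rcont_reflect(1,3)[OF Y, of i] a by (auto simp: rvec_def n)
  have "?Z = rvec m i c2 Z"
  proof (cases "b = 0")
    case True
    then show ?thesis using a by (simp add: rvec_def n wd_Nil)
  next
    case False
    then show ?thesis using a by (simp add: rvec_def n)
  qed
  then have Z1: "extremal m (rcont m i c2) ?Z" "pm i (rcont m i c2) = 2 * int (m i) - pm i c2"
    using rcont_reflect(1,3)[OF Z, of i] by auto
  have "EE (ik m) i ?Z \<in> Jk m" using extremal_E[of ?Z "rcont m i c2" m 1 i] Z1 a by (simp add: extremal_def)
  moreover have "wd [i] * ?Y \<in> Jk \<kappa>" using extremal_F[of ?Y "rcont \<kappa> i c1" \<kappa> 1 i] Y1 a by (simp add: extremal_def)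
  ultimately have 1: "\<Phi> ((EE (ik \<kappa>) i ^^ a) ?Y) (wd (replicate b i) * ?Z) \<in> Jk \<nu>"
    using tri_cyclic[OF tri_flip[OF t], where i=i and Y="?Z" and Z="?Y" and c="rcont \<kappa> i c1" and r=b and s=a] * Y1(1)
    by (simp add: extremal_def)
  obtain s where s: "s \<noteq> 0" "(EE (ik \<kappa>) i ^^ a) ?Y - s *\<^sub>C Y \<in> Jk \<kappa>"
    using EF_extremal[OF Y', of a i] a by auto
  obtain s' where s': "s' \<noteq> 0" "wd (replicate b i) * ?Z - s' *\<^sub>C Z \<in> Jk m"
    using FE_extremal[OF Z', of b i] a by auto
  from Jk_trans[OF tri_cong_Jk1[OF t s(2)] tri_cong_Jk2[OF t s'(2)]]
  have "\<Phi> ((EE (ik \<kappa>) i ^^ a) ?Y) (wd (replicate b i) * ?Z) - (s * s') *\<^sub>C \<Phi> Y Z \<in> Jk \<nu>" .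
  from Jk_cancel[OF this] 1 s(1) s'(1) show "\<Phi> Y Z \<in> Jk \<nu>" by simp
qed

lemma tri_reflect:
  assumes t: "tri \<kappa> m \<beta> \<nu> \<Phi>" and Y: "extremal \<kappa> c1 Y" and Z: "extremal m c2 Z"
  shows "\<Phi> Y Z \<in> Jk \<nu> \<longleftrightarrow> \<Phi> (rvec \<kappa> i c1 Y) (rvec m i c2 Z) \<in> Jk \<nu>"
proof -
  let ?p1 = "int (\<kappa> i) - pm i c1" and ?p2 = "int (m i) - pm i c2"
  consider "?p1 \<ge> 0" "?p2 \<ge> 0" | "?p1 \<ge> 0" "?p2 < 0" | "?p1 < 0" "?p2 \<ge> 0" | "?p1 < 0" "?p2 < 0" by linarith
  then show ?thesis
  proof cases
    case 1
    then show ?thesis using tri_reflect_pos[OF t Y Z, of "nat ?p1" i "nat ?p2"] by (simp add: rvec_def)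
  next
    case 2
    then show ?thesis using tri_reflect_mixed[OF t Y Z, of "nat ?p1" i "nat (- ?p2)"] by (simp add: rvec_def)
  next
    case 3
    then show ?thesis using tri_reflect_mixed[OF tri_flip[OF t] Z Y, of "nat ?p2" i "nat (- ?p1)"] by (simp add: rvec_def)
  next
    case 4
    let ?Y = "rvec \<kappa> i c1 Y" and ?Z = "rvec m i c2 Z"
    let ?b1 = "nat (- ?p1)" and ?b2 = "nat (- ?p2)"
    have r: "?Y = (EE (ik \<kappa>) i ^^ ?b1) Y" "?Z = (EE (ik m) i ^^ ?b2) Z" using 4 by (simp_all add: rvec_def)
    have "\<Phi> ?Y ?Z \<in> Jk \<nu> \<longleftrightarrow> \<Phi> (wd (replicate ?b1 i) * ?Y) (wd (replicate ?b2 i) * ?Z) \<in> Jk \<nu>"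
      using 4 rcont_reflect(3)[OF Y, of i] rcont_reflect(3)[OF Z, of i]
      by (intro tri_reflect_pos[OF t rcont_reflect(1)[OF Y] rcont_reflect(1)[OF Z]]) auto
    moreover obtain s where s: "s \<noteq> 0" "wd (replicate ?b1 i) * ?Y - s *\<^sub>C Y \<in> Jk \<kappa>"
      using FE_extremal[of Y c1 \<kappa> ?b1 i] Y 4 unfolding r extremal_def by auto
    moreover obtain s' where s': "s' \<noteq> 0" "wd (replicate ?b2 i) * ?Z - s' *\<^sub>C Z \<in> Jk m"
      using FE_extremal[of Z c2 m ?b2 i] Z 4 unfolding r extremal_def by auto
    moreover have "\<Phi> (wd (replicate ?b1 i) * ?Y) (wd (replicate ?b2 i) * ?Z) - (s * s') *\<^sub>C \<Phi> Y Z \<in> Jk \<nu>"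
      by (rule Jk_trans[OF tri_cong_Jk1[OF t s(2)] tri_cong_Jk2[OF t s'(2)]])
    ultimately show ?thesis using Jk_cancel by (metis mult_eq_0_iff)
  qed
qed

lemma extremal_zz: "chain \<kappa> x \<Longrightarrow> extremal \<kappa> (cont x) (zz x)"
  by (simp add: extremal_def zz_Fc chain_extremal)

lemma extremal_proportional:
  assumes "extremal \<kappa> c Y" "chain \<kappa> x" "cont x = c"
  obtains s where "s \<noteq> 0" "Y - s *\<^sub>C zz x \<in> Jk \<kappa>"
proof -
  obtain s where s: "Y - s *\<^sub>C zz x \<in> Jk \<kappa>"
    using extremal_unique[OF assms(2), of Y] assms by (auto simp: extremal_def)
  with assms(1) have "s \<noteq> 0" by (auto simp: extremal_def)
  with s that show ?thesis by blast
qed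

lemma tri_proportional:
  assumes t: "tri \<kappa> m \<beta> \<nu> \<Phi>" and "extremal \<kappa> c1 Y" "chain \<kappa> x1" "cont x1 = c1" "extremal m c2 Z" "chain m x2" "cont x2 = c2"
  shows "\<Phi> Y Z \<in> Jk \<nu> \<longleftrightarrow> \<Phi> (zz x1) (zz x2) \<in> Jk \<nu>"
proof -
  obtain s where s: "s \<noteq> 0" "Y - s *\<^sub>C zz x1 \<in> Jk \<kappa>" by (rule extremal_proportional[OF assms(2-4)])
  obtain s' where s': "s' \<noteq> 0" "Z - s' *\<^sub>C zz x2 \<in> Jk m" by (rule extremal_proportional[OF assms(5-7)])
  have "\<Phi> Y Z - (s * s') *\<^sub>C \<Phi> (zz x1) (zz x2) \<in> Jk \<nu>"
    by (rule Jk_trans[OF tri_cong_Jk1[OF t s(2)] tri_cong_Jk2[OF t s'(2)]])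
  then show ?thesis by (rule Jk_cancel) (simp add: s(1) s'(1))
qed

lemma rcont_scale: "rcont (\<lambda>i. N * \<kappa> i) i (repeat_mset N c) = repeat_mset N (rcont \<kappa> i c)"
proof (cases "N = 0")
  case False
  have d: "int (N * \<kappa> i) - pm i (repeat_mset N c) = int N * (int (\<kappa> i) - pm i c)" by (simp add: right_diff_distrib)
  have d': "pm i (repeat_mset N c) - int (N * \<kappa> i) = int N * (pm i c - int (\<kappa> i))" by (simp add: right_diff_distrib)
  have le: "pm i (repeat_mset N c) \<le> int (N * \<kappa> i) \<longleftrightarrow> pm i c \<le> int (\<kappa> i)"
    using False by simp
  show ?thesis
    unfolding rcont_def le d d'
    by (rule multiset_eqI) (simp add: nat_mult_distrib add_mult_distrib2 diff_mult_distrib2)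
qed (simp add: rcont_def)

text \<open>The condition on \<open>qq\<close> says that the image has extremal weight in L(\<nu>);
  both properties travel together along the orbit of the pair.\<close>

definition nonvanishing :: "('n \<Rightarrow> nat) \<Rightarrow> ('n \<Rightarrow> nat) \<Rightarrow> nat \<Rightarrow> 'n multiset \<Rightarrow> ('n \<Rightarrow> nat) \<Rightarrow> ('n falg \<Rightarrow> 'n falg \<Rightarrow> 'n falg)
    \<Rightarrow> 'n multiset \<Rightarrow> 'n multiset \<Rightarrow> bool"
  where "nonvanishing \<kappa> m N \<beta> \<nu> \<Phi> c1 c2 \<longleftrightarrow> (\<exists>x1 x2. chain \<kappa> x1 \<and> cont x1 = c1 \<and> chain m x2 \<and> cont x2 = c2
    \<and> \<Phi> (zz (scale N x1)) (zz (scale N x2)) \<notin> Jk \<nu> \<and> qq (ik \<nu>) (repeat_mset N (c1 + c2) - \<beta>) = 0)"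

lemma nonvanishing_reflect:
  assumes t: "tri (\<lambda>i. N * \<kappa> i) (\<lambda>i. N * m i) \<beta> \<nu> \<Phi>" and nv: "nonvanishing \<kappa> m N \<beta> \<nu> \<Phi> c1 c2"
  shows "nonvanishing \<kappa> m N \<beta> \<nu> \<Phi> (rcont \<kappa> i c1) (rcont m i c2)"
proof -
  from nv obtain x1 x2 where x: "chain \<kappa> x1" "cont x1 = c1" "chain m x2" "cont x2 = c2"
    and nz: "\<Phi> (zz (scale N x1)) (zz (scale N x2)) \<notin> Jk \<nu>" and q: "qq (ik \<nu>) (repeat_mset N (c1 + c2) - \<beta>) = 0"
    unfolding nonvanishing_def by blast
  let ?\<kappa> = "\<lambda>i. N * \<kappa> i" and ?m = "\<lambda>i. N * m i"
  have e1: "extremal ?\<kappa> (repeat_mset N c1) (zz (scale N x1))" and e2: "extremal ?m (repeat_mset N c2) (zz (scale N x2))"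
    using extremal_zz[OF chain_scale[OF x(1)], of N] extremal_zz[OF chain_scale[OF x(3)], of N] x by auto
  have b1: "extremal \<kappa> c1 (zz x1)" and b2: "extremal m c2 (zz x2)"
    using extremal_zz[OF x(1)] extremal_zz[OF x(3)] x by auto
  obtain x1' where x1': "chain \<kappa> x1'" "cont x1' = rcont \<kappa> i c1"
    using chain_exists rcont_reflect(1)[OF b1, of i] unfolding extremal_def by blast
  obtain x2' where x2': "chain m x2'" "cont x2' = rcont m i c2"
    using chain_exists rcont_reflect(1)[OF b2, of i] unfolding extremal_def by blast
  have "\<Phi> (rvec ?\<kappa> i (repeat_mset N c1) (zz (scale N x1))) (rvec ?m i (repeat_mset N c2) (zz (scale N x2))) \<notin> Jk \<nu>"
    using nz tri_reflect[OF t e1 e2, of i] by simp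
  then have nz': "\<Phi> (zz (scale N x1')) (zz (scale N x2')) \<notin> Jk \<nu>"
    using tri_proportional[OF t rcont_reflect(1)[OF e1] chain_scale[OF x1'(1)] _ rcont_reflect(1)[OF e2] chain_scale[OF x2'(1)], of i i]
    by (simp add: rcont_scale x1' x2')
  have sub: "\<beta> \<subseteq># repeat_mset N (cont y1 + cont y2)" if "\<Phi> (zz (scale N y1)) (zz (scale N y2)) \<notin> Jk \<nu>" for y1 y2
  proof (rule ccontr)
    assume "\<not> ?thesis"
    then have "\<Phi> (zz (scale N y1)) (zz (scale N y2)) = 0"
      by (intro tri_Fc0[OF t zz_Fc zz_Fc]) (simp add: repeat_mset_distrib2)
    with that show False by (simp add: complex_vector.subspace_0[OF Jk_subspace])
  qed
  have "qq (ik \<nu>) (repeat_mset N (rcont \<kappa> i c1 + rcont m i c2) - \<beta>) = qq (ik \<nu>) (repeat_mset N (c1 + c2) - \<beta>)"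
  proof (rule qq_reflect)
    fix j
    let ?e = "repeat_mset N (c1 + c2) - \<beta>"
    have s1: "\<beta> \<subseteq># repeat_mset N (c1 + c2)" and s2: "\<beta> \<subseteq># repeat_mset N (rcont \<kappa> i c1 + rcont m i c2)"
      using sub[OF nz] sub[OF nz'] x x1' x2' by auto
    have "pm i (repeat_mset N (c1 + c2)) = pm i \<beta> + pm i ?e"
      using arg_cong[OF subset_mset.add_diff_inverse[OF s1], of "pm i"] by simp
    then have h1: "int (\<nu> i) - pm i ?e = int N * ((int (\<kappa> i) - pm i c1) + (int (m i) - pm i c2))"
      using tri_nu[OF t, of i] by (simp add: algebra_simps)
    have h2: "int (count ?e j) = int N * (int (count c1 j) + int (count c2 j)) - int (count \<beta> j)"
      using mset_subset_eq_count[OF s1, of j] by (simp add: of_nat_diff distrib_left)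
    have h3: "int (count (repeat_mset N (rcont \<kappa> i c1 + rcont m i c2) - \<beta>) j)
        = int N * (int (count (rcont \<kappa> i c1) j) + int (count (rcont m i c2) j)) - int (count \<beta> j)"
      using mset_subset_eq_count[OF s2, of j] by (simp add: of_nat_diff distrib_left)
    show "int (count (repeat_mset N (rcont \<kappa> i c1 + rcont m i c2) - \<beta>) j) = int (count ?e j) + (if j = i then int (\<nu> i) - pm i ?e else 0)"
      unfolding h1 h2 h3 rcont_reflect(2)[OF b1] rcont_reflect(2)[OF b2] by (cases "j = i") (simp_all add: algebra_simps)
  qed
  with q nz' x1' x2' show ?thesis unfolding nonvanishing_def by metis
qed

definition extr :: "('n \<Rightarrow> nat) \<Rightarrow> 'n multiset \<Rightarrow> bool" where "extr \<kappa> c \<longleftrightarrow> (\<exists>x. chain \<kappa> x \<and> cont x = c)"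

lemma extr_extremal: "extr \<kappa> c \<longleftrightarrow> (\<exists>Y. extremal \<kappa> c Y)"
proof
  show "\<exists>Y. extremal \<kappa> c Y" if "extr \<kappa> c" using that extremal_zz unfolding extr_def by blast
  show "extr \<kappa> c" if "\<exists>Y. extremal \<kappa> c Y" using that chain_exists unfolding extr_def extremal_def by blast
qed

text \<open>The pairs obtained by applying one and the same Weyl group element to both
  weights.\<close>

inductive reach :: "('n \<Rightarrow> nat) \<Rightarrow> ('n \<Rightarrow> nat) \<Rightarrow> 'n multiset \<Rightarrow> 'n multiset \<Rightarrow> 'n multiset \<Rightarrow> 'n multiset \<Rightarrow> bool"
  for \<kappa> m c1 c2 where
  refl: "reach \<kappa> m c1 c2 c1 c2"
| step: "reach \<kappa> m c1 c2 e1 e2 \<Longrightarrow> reach \<kappa> m c1 c2 (rcont \<kappa> i e1) (rcont m i e2)"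

lemma reach_extr: "reach \<kappa> m c1 c2 e1 e2 \<Longrightarrow> extr \<kappa> c1 \<Longrightarrow> extr m c2 \<Longrightarrow> extr \<kappa> e1 \<and> extr m e2"
  by (induction rule: reach.induct) (auto simp: extr_extremal dest: rcont_reflect(1))

lemma nonvanishing_reach:
  assumes t: "tri (\<lambda>i. N * \<kappa> i) (\<lambda>i. N * m i) \<beta> \<nu> \<Phi>" and "reach \<kappa> m c1 c2 e1 e2"
  shows "nonvanishing \<kappa> m N \<beta> \<nu> \<Phi> c1 c2 \<Longrightarrow> nonvanishing \<kappa> m N \<beta> \<nu> \<Phi> e1 e2"
    and "extr \<kappa> c1 \<Longrightarrow> extr m c2 \<Longrightarrow> nonvanishing \<kappa> m N \<beta> \<nu> \<Phi> e1 e2 \<Longrightarrow> nonvanishing \<kappa> m N \<beta> \<nu> \<Phi> c1 c2"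
proof -
  show "nonvanishing \<kappa> m N \<beta> \<nu> \<Phi> c1 c2 \<Longrightarrow> nonvanishing \<kappa> m N \<beta> \<nu> \<Phi> e1 e2"
    using assms(2) by (induction rule: reach.induct) (auto intro: nonvanishing_reflect[OF t])
  show "extr \<kappa> c1 \<Longrightarrow> extr m c2 \<Longrightarrow> nonvanishing \<kappa> m N \<beta> \<nu> \<Phi> e1 e2 \<Longrightarrow> nonvanishing \<kappa> m N \<beta> \<nu> \<Phi> c1 c2"
    using assms(2)
  proof (induction rule: reach.induct)
    case (step e1 e2 i)
    from reach_extr[OF step.hyps step.prems(1,2)] obtain Y Z where "extremal \<kappa> e1 Y" "extremal m e2 Z"
      unfolding extr_extremal by blast
    then have "rcont \<kappa> i (rcont \<kappa> i e1) = e1" "rcont m i (rcont m i e2) = e2" using rcont_reflect(5) by blast+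
    with nonvanishing_reflect[OF t step.prems(3), of i] step show ?case by simp
  qed
qed

lemma tri_scalar:
  assumes t: "tri \<kappa> m \<beta> \<nu> \<Phi>" and "X \<in> Fc c" "Y \<in> Fc c'" "c + c' = \<beta>" "\<Phi> X Y \<notin> Jk \<nu>"
  obtains s where "s \<noteq> 0" "\<Phi> X Y = s *\<^sub>C 1" "s = Poly_Mapping.lookup (\<Phi> X Y) []"
proof -
  have "\<Phi> X Y \<in> Fc {#}" using tri_Fc[OF t assms(2,3)] assms(4) by simp
  from Fc_empty[OF this] have 1: "\<Phi> X Y = Poly_Mapping.lookup (\<Phi> X Y) [] *\<^sub>C 1" .
  moreover have "Poly_Mapping.lookup (\<Phi> X Y) [] \<noteq> 0"
    using assms(5) 1 complex_vector.subspace_0[OF Jk_subspace] by (metis scaleC_zero(2))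
  ultimately show ?thesis using that by blast
qed

lemma one_Fc: "(1 :: 'n falg) \<in> Fc {#}"
  using wd_Fc[of "[]"] by (simp add: wd_Nil)

text \<open>Converse of \<open>tri_exists\<close>: the coefficient of the highest weight vector
  vanishes on the image of every f_i, so letters can be carried from the first argument to the
  second.\<close>

lemma tri_functional:
  assumes t: "tri \<kappa> m \<beta> \<nu> \<Phi>"
  shows "\<exists>\<eta>. hom_data A d \<kappa> m \<nu> \<beta> \<eta> \<and> (\<forall>u v. mset u + mset v = \<beta> \<longrightarrow> \<Phi> (wd u) (wd v) \<notin> Jk \<nu> \<longrightarrow> \<eta> (rev u @ v) \<noteq> 0)"
proof -
  let ?l = "\<lambda>X :: 'n falg. Poly_Mapping.lookup X []"
  have lin: "clinear ?l" by (rule clinearI) (simp_all add: lookup_add lookup_scaleC scaleC_cmul)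
  have lJ: "?l X = 0" if "X \<in> Jk \<nu>" for X using ecoef_Jk[OF that, of "[]"] by simp
  define \<eta> where "\<eta> u = ?l (\<Phi> 1 (wd u))" for u
  have ext: "ext \<eta> X = ?l (\<Phi> 1 X)" for X
    by (rule clinear_eq_singleI[where X=X])
       (auto simp: clinear_ext \<eta>_def intro: clinear_compose[OF lin tri_lin2[OF t]])
  have move: "?l (\<Phi> (wd [i] * Y) Z) = - ?l (\<Phi> Y (wd [i] * Z))" for i Y Z
  proof -
    have "?l (wd [i] * X) = 0" for X
      by (rule clinear_eq_singleI[where X=X])
         (rule clinearI | simp add: wd_mult lookup_single when_def distrib_left lookup_add falg_scale_right lookup_scaleC)+
    then have "- ?l (\<Phi> (wd [i] * Y) Z) = ?l (\<Phi> Y (wd [i] * Z))"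
      using lJ[OF tri_f[OF t, of i Y Z]] by (simp add: lookup_minus lookup_add)
    then show ?thesis by (simp only: minus_equation_iff[of _ "?l (\<Phi> Y (wd [i] * Z))"])
  qed
  have moves: "?l (\<Phi> (wd u) X) = (- 1) ^ length u * ?l (\<Phi> 1 (wd (rev u) * X))" for u X
  proof (induction u arbitrary: X)
    case (Cons i u)
    have "wd (rev u) * (wd [i] * X) = wd (rev (i # u)) * X" by (simp add: mult.assoc[symmetric] wd_mult)
    then show ?case using Cons[of "wd [i] * X"] unfolding wd_Cons[of i u] move by simp
  qed (simp add: wd_Nil)
  have "hom_data A d \<kappa> m \<nu> \<beta> \<eta>"
  proof
    show "mset u = \<beta>" if "\<eta> u \<noteq> 0" for u
    proof (cases "\<beta> \<subseteq># mset u")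
      case True
      then have "\<Phi> 1 (wd u) \<in> Fc (mset u - \<beta>)" using tri_Fc[OF t one_Fc wd_Fc[OF HOL.refl]] by simp
      from ecoef_Fc[OF this, of "ik \<nu>" "[]"] that have "mset u - \<beta> = {#}" by (simp add: \<eta>_def)
      with True show ?thesis by (metis Diff_eq_empty_iff_mset subset_mset.antisym)
    next
      case False
      then show ?thesis using that tri_Fc0[OF t one_Fc wd_Fc[OF HOL.refl], of u] by (simp add: \<eta>_def)
    qed
    show "X \<in> Jk m \<Longrightarrow> ext \<eta> X = 0" for X unfolding ext by (rule lJ[OF tri_Jk2[OF t]])
    show "int (\<nu> i) = int (\<kappa> i) + int (m i) - pm i \<beta>" for i by (rule tri_nu[OF t])
    fix j X
    have "wd (replicate (Suc (\<kappa> j)) j) \<in> Jk \<kappa>" using Jk_base[of "[]" \<kappa> j] by (simp add: wd_Nil)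
    from lJ[OF tri_Jk1[OF t this, of X]] show "ext \<eta> (wd (replicate (Suc (\<kappa> j)) j) * X) = 0"
      unfolding ext moves rev_replicate by simp
  qed
  moreover have "\<eta> (rev u @ v) \<noteq> 0" if uv: "mset u + mset v = \<beta>" "\<Phi> (wd u) (wd v) \<notin> Jk \<nu>" for u v
  proof -
    obtain s where "s \<noteq> 0" "s = ?l (\<Phi> (wd u) (wd v))" by (rule tri_scalar[OF t wd_Fc wd_Fc]) (use uv in auto)
    then show ?thesis using moves[of u "wd v"] by (auto simp: \<eta>_def wd_mult)
  qed
  ultimately show ?thesis by blast
qed

lemma scale_scale: "scale a (scale b x) = scale (a * b) x"
  by (induction x) (simp_all add: mult.assoc)

lemma scale_1: "scale (Suc 0) x = x"
  by (induction x) simp_all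

lemma zz_empty: "cont x = {#} \<Longrightarrow> zz x = 1"
  by (metis mset_wrd mset_zero_iff wd_Nil)

section \<open>The theorem of Parthasarathy, Ranga Rao and Varadarajan\<close>

text \<open>Reduction of the Parthasarathy--Ranga Rao--Varadarajan theorem from level 1 to all multiples of some
  level: split off the largest part of \<open>\<mu>\<close> for which the path from \<open>la\<close> in direction \<open>\<mu> - cont x\<close>
  stays dominant, and reflect the remainder in the first wall.\<close>

lemma prv_multiple:
  assumes ch: "chain \<mu> x"
    and IH: "\<And>x' la N. chain \<mu> x' \<Longrightarrow> size (cont x') < size (cont x) \<Longrightarrow>
      \<exists>\<beta> \<nu> \<Phi>. tri la (\<lambda>i. N * \<mu> i) \<beta> \<nu> \<Phi> \<and> \<Phi> 1 (zz (scale N x')) \<notin> Jk \<nu> \<and> qq (ik \<nu>) (repeat_mset N (cont x') - \<beta>) = 0"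
    and nd: "int (la i) + int N * (int (\<mu> i) - pm i (cont x)) < 0"
  shows "\<exists>m>0. \<forall>b. \<exists>\<beta> \<nu> \<Phi>. tri (\<lambda>i. b * m * la i) (\<lambda>i. b * m * N * \<mu> i) \<beta> \<nu> \<Phi>
    \<and> \<Phi> 1 (zz (scale (b * m * N) x)) \<notin> Jk \<nu> \<and> qq (ik \<nu>) (repeat_mset (b * m * N) (cont x) - \<beta>) = 0"
proof -
  define p where "p i = int N * (int (\<mu> i) - pm i (cont x))" for i
  define S where "S = {i. p i < 0}"
  \<comment> \<open>The parameter at which the path from \<open>la\<close> in direction
    \<open>p\<close> meets the i-th wall. The first wall met is that of \<open>i0\<close> below, at
    the rational parameter a / l.\<close>
  define r where "r i = real (la i) / real_of_int (- p i)" for i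
  have "i \<in> S" using nd by (simp add: S_def p_def)
  then have "Min (r ` S) \<in> r ` S" by (intro Min_in) auto
  then obtain i0 where i0: "i0 \<in> S" "r i0 = Min (r ` S)" by auto
  have rmin: "r i0 \<le> r j" if "j \<in> S" for j using that by (simp add: i0(2))
  define a where "a = la i0"
  define l where "l = nat (- p i0)"
  have l: "int l = - p i0" "l > 0" using i0(1) by (simp_all add: l_def S_def)
  have ratio: "int a * - p j \<le> int (la j) * int l" if "j \<in> S" for j
  proof -
    have pos: "0 < real_of_int (- p j)" "0 < real_of_int (- p i0)" using that i0(1) by (simp_all add: S_def)
    have "real a * real_of_int (- p j) \<le> real (la j) * real_of_int (- p i0)"
      using rmin[OF that] pos by (simp add: r_def a_def divide_simps split: if_splits)
    then have "of_int (int a * - p j) \<le> (of_int (int (la j) * - p i0) :: real)" by simp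
    then show ?thesis unfolding of_int_le_iff l(1) .
  qed
  have al: "a < l"
  proof -
    have "real (la i) < real_of_int (- p i)" using nd unfolding p_def by linarith
    then have "r i < 1" using \<open>i \<in> S\<close> by (simp add: r_def S_def divide_simps)
    with rmin[OF \<open>i \<in> S\<close>] have "r i0 < 1" by simp
    then have "real a < real_of_int (- p i0)" using i0(1) by (simp add: r_def a_def S_def divide_simps split: if_splits)
    then have "int a < - p i0" by linarith
    with l show ?thesis by simp
  qed
  \<comment> \<open>\<open>l\<close> times the point where the path meets the wall; it is integral,
    and dominant by the minimality of \<open>i0\<close>.\<close>
  define la' where "la' j = nat (int l * int (la j) + int a * p j)" for j
  have la': "int (la' j) = int l * int (la j) + int a * p j" for j
  proof -
    have "0 \<le> int l * int (la j) + int a * p j"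
    proof (cases "j \<in> S")
      case True
      from ratio[OF this] show ?thesis by (simp add: algebra_simps)
    next
      case False
      then show ?thesis by (simp add: S_def)
    qed
    then show ?thesis by (simp add: la'_def)
  qed
  have laz: "la' i0 = 0"
    using la'[of i0] l(1) by (simp add: a_def)
  have N: "N > 0" and pi0: "int (\<mu> i0) - pm i0 (cont x) < 0"
    using i0(1) by (auto simp: S_def p_def mult_less_0_iff)
  define n where "n = nat (pm i0 (cont x) - int (\<mu> i0))"
  have n: "int n = - (int (\<mu> i0) - pm i0 (cont x))" "n > 0" using pi0 by (simp_all add: n_def)
  from reflect_up[OF zz_Fc chain_extremal(2)[OF ch] n(1)] obtain c' where
    c': "cont x = replicate_mset n i0 + c'" "(EE (ik \<mu>) i0 ^^ n) (zz x) \<in> Fc c'"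
      "(EE (ik \<mu>) i0 ^^ n) (zz x) \<notin> Jk \<mu>" "int n = int (\<mu> i0) - pm i0 c'" "qq (ik \<mu>) c' = qq (ik \<mu>) (cont x)" by metis
  obtain x' where x': "chain \<mu> x'" "cont x' = c'"
    using chain_exists[OF c'(2,3)] c'(5) chain_extremal(1)[OF ch] by auto
  have "size (cont x) = n + size c'" by (subst c'(1)) simp
  then have sz: "size (cont x') < size (cont x)" using n x' by simp
  have main: "\<exists>\<beta> \<nu> \<Phi>. tri (\<lambda>i. b * l * la i) (\<lambda>i. b * l * N * \<mu> i) \<beta> \<nu> \<Phi>
    \<and> \<Phi> 1 (zz (scale (b * l * N) x)) \<notin> Jk \<nu> \<and> qq (ik \<nu>) (repeat_mset (b * l * N) (cont x) - \<beta>) = 0" for b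
  proof -
    \<comment> \<open>The direction is split in the ratio a : (l - a), so that the first piece ends
      on the wall.\<close>
    define N1 where "N1 = b * a * N"
    define N2 where "N2 = b * (l - a) * N"
    have N12: "b * l * N = N1 + N2" using al by (simp add: N1_def N2_def flip: distrib_right distrib_left)
    have "int (b * la' j) = int (b * l * la j) + int (N1 * \<mu> j) - pm j (cont (scale N1 x))" for j
      by (simp add: la' p_def N1_def algebra_simps)
    from tri_dominant[OF chain_scale[OF ch] this] obtain \<Phi>1 where
      t1: "tri (\<lambda>j. b * l * la j) (\<lambda>j. N1 * \<mu> j) (cont (scale N1 x)) (\<lambda>j. b * la' j) \<Phi>1" "\<Phi>1 1 (zz (scale N1 x)) \<notin> Jk (\<lambda>j. b * la' j)"
      by blast
    obtain s1 where s1: "s1 \<noteq> 0" "\<Phi>1 1 (zz (scale N1 x)) = s1 *\<^sub>C 1"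
      by (rule tri_scalar[OF t1(1) one_Fc zz_Fc _ t1(2)]) (simp, rule that)
    \<comment> \<open>Beyond the wall the shorter reflected direction \<open>x'\<close> is used;
      since s_i for the wall fixes the point reached, reflecting back does not change the orbit of
      the end point.\<close>
    from IH[OF x'(1) sz] obtain \<beta>2 \<nu> \<Phi>2 where
      t2: "tri (\<lambda>j. b * la' j) (\<lambda>j. N2 * \<mu> j) \<beta>2 \<nu> \<Phi>2" and nz: "\<Phi>2 1 (zz (scale N2 x')) \<notin> Jk \<nu>"
      and q: "qq (ik \<nu>) (repeat_mset N2 c' - \<beta>2) = 0" unfolding x'(2) by blast
    have sub: "\<beta>2 \<subseteq># repeat_mset N2 c'"
    proof (rule ccontr)
      assume "\<not> ?thesis"
      then have "\<Phi>2 1 (zz (scale N2 x')) = 0" by (intro tri_Fc0[OF t2 one_Fc zz_Fc]) (simp add: x'(2))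
      with nz show False by (simp add: complex_vector.subspace_0[OF Jk_subspace])
    qed
    have rep: "repeat_mset N2 (cont x) = replicate_mset (N2 * n) i0 + repeat_mset N2 c'"
      by (subst c'(1)) (rule multiset_eqI, simp add: distrib_left)
    have nz2: "\<Phi>2 1 (zz (scale N2 x)) \<notin> Jk \<nu>"
    proof
      assume *: "\<Phi>2 1 (zz (scale N2 x)) \<in> Jk \<nu>"
      let ?Z = "(EE (ik (\<lambda>j. N2 * \<mu> j)) i0 ^^ (N2 * n)) (zz (scale N2 x))"
      have ext: "extremal (\<lambda>j. N2 * \<mu> j) (repeat_mset N2 c') ?Z"
      proof -
        have "int (N2 * n) = - (int (N2 * \<mu> i0) - pm i0 (cont (scale N2 x)))"
          by (simp add: n(1) algebra_simps)
        from reflect_up[OF zz_Fc chain_extremal(2)[OF chain_scale[OF ch]] this] obtain e where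
          e: "cont (scale N2 x) = replicate_mset (N2 * n) i0 + e" "?Z \<in> Fc e" "?Z \<notin> Jk (\<lambda>j. N2 * \<mu> j)"
            "qq (ik (\<lambda>j. N2 * \<mu> j)) e = qq (ik (\<lambda>j. N2 * \<mu> j)) (cont (scale N2 x))" by metis
        have "e = repeat_mset N2 c'" using e(1) rep by simp
        with e chain_extremal(1)[OF chain_scale[OF ch], of N2] show ?thesis by (simp add: extremal_def)
      qed
      obtain s where s: "s \<noteq> 0" "?Z - s *\<^sub>C zz (scale N2 x') \<in> Jk (\<lambda>j. N2 * \<mu> j)"
        by (rule extremal_proportional[OF ext chain_scale[OF x'(1)]]) (simp add: x'(2), rule that)
      have "(EE (ik \<nu>) i0 ^^ k) (\<Phi>2 1 (zz (scale N2 x))) \<in> Jk \<nu>" for k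
        by (induction k) (simp_all add: * EE_Jk)
      from complex_vector.subspace_diff[OF Jk_subspace this[of "N2 * n"] tri_E_pow[OF t2, where i = i0 and n = "N2 * n" and Z = "zz (scale N2 x)"]]
      have "\<Phi>2 1 ?Z \<in> Jk \<nu>" by simp
      with Jk_cancel[OF tri_cong_Jk2[OF t2 s(2)] s(1), of 1] nz show False by simp
    qed
    have q2: "qq (ik \<nu>) (repeat_mset N2 (cont x) - \<beta>2) = 0"
      unfolding q[symmetric]
    proof (rule qq_reflect)
      fix j
      have "pm i0 (repeat_mset N2 c') = pm i0 \<beta>2 + pm i0 (repeat_mset N2 c' - \<beta>2)"
        using arg_cong[OF subset_mset.add_diff_inverse[OF sub], of "pm i0"] by simp
      then have "int (\<nu> i0) - pm i0 (repeat_mset N2 c' - \<beta>2) = int (N2 * n)"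
        using tri_nu[OF t2, of i0] laz by (simp add: c'(4) algebra_simps)
      then show "int (count (repeat_mset N2 (cont x) - \<beta>2) j) = int (count (repeat_mset N2 c' - \<beta>2) j) + (if j = i0 then int (\<nu> i0) - pm i0 (repeat_mset N2 c' - \<beta>2) else 0)"
        using mset_subset_eq_count[OF sub, of j] unfolding rep by (auto simp: of_nat_diff)
    qed
    obtain \<Xi> where \<Xi>: "tri (\<lambda>j. b * l * la j) (\<lambda>i. N1 * \<mu> i + N2 * \<mu> i) (cont (scale N1 x) + \<beta>2) \<nu> \<Xi>"
      "\<And>X Y Y1 Y2 s. cop Y - s *\<^sub>C (Y1 \<otimes>\<^sub>C Y2) \<in> TM (\<lambda>j. N1 * \<mu> j) (\<lambda>j. N2 * \<mu> j) \<Longrightarrow> \<Xi> X Y - s *\<^sub>C \<Phi>2 (\<Phi>1 X Y1) Y2 \<in> Jk \<nu>"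
      using tri_comp[OF t1(1) t2] by blast
    obtain s where s: "s \<noteq> 0" "cop (zz (scale (N1 + N2) x)) - s *\<^sub>C (zz (scale N1 x) \<otimes>\<^sub>C zz (scale N2 x)) \<in> TM (\<lambda>j. N1 * \<mu> j) (\<lambda>j. N2 * \<mu> j)"
      using cop_zz[OF ch] by blast
    have "\<Xi> 1 (zz (scale (N1 + N2) x)) - (s * s1) *\<^sub>C \<Phi>2 1 (zz (scale N2 x)) \<in> Jk \<nu>"
      using \<Xi>(2)[OF s(2), of 1] unfolding s1(2) by (simp add: clinear_scale[OF tri_lin1[OF t2]] scaleC_scaleC)
    from Jk_cancel[OF this] have "\<Xi> 1 (zz (scale (N1 + N2) x)) \<notin> Jk \<nu>" using nz2 s(1) s1(1) by simp
    moreover have "repeat_mset (N1 + N2) (cont x) - (cont (scale N1 x) + \<beta>2) = repeat_mset N2 (cont x) - \<beta>2"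
      by (simp add: repeat_mset_distrib)
    ultimately show ?thesis
      unfolding N12 using \<Xi>(1) q2 by (intro exI[of _ "cont (scale N1 x) + \<beta>2"] exI[of _ \<nu>] exI[of _ \<Xi>]) (simp add: distrib_right)
  qed
  with l(2) show ?thesis by blast
qed

lemma rcont_size_sum:
  assumes "extr \<kappa> c1" "extr m c2"
  shows "int (size (rcont \<kappa> i c1 + rcont m i c2)) = int (size (c1 + c2)) + (int (\<kappa> i) + int (m i) - pm i (c1 + c2))"
    and "int (size (rcont \<kappa> i c1)) = int (size c1) + (int (\<kappa> i) - pm i c1)"
proof -
  obtain Y Z where "extremal \<kappa> c1 Y" "extremal m c2 Z" using assms unfolding extr_extremal by blast
  note r = rcont_reflect(4)[OF this(1), of i] rcont_reflect(4)[OF this(2), of i]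
  from r show "int (size (rcont \<kappa> i c1 + rcont m i c2)) = int (size (c1 + c2)) + (int (\<kappa> i) + int (m i) - pm i (c1 + c2))"
    by simp
  from r show "int (size (rcont \<kappa> i c1)) = int (size c1) + (int (\<kappa> i) - pm i c1)" by simp
qed

text \<open>Least total degree makes the sum of the two weights dominant. Among such pairs, least
  degree of the first weight makes it nonnegative on the coroots vanishing on the sum, the only ones
  where adding a large multiple of the sum would not help.\<close>

lemma dominant_pair:
  assumes "extr \<kappa> c1" "extr m c2"
  obtains e1 e2 where "reach \<kappa> m c1 c2 e1 e2" "\<And>i. pm i (e1 + e2) \<le> int (\<kappa> i) + int (m i)"
    "\<And>i. pm i (e1 + e2) = int (\<kappa> i) + int (m i) \<Longrightarrow> pm i e1 \<le> int (\<kappa> i)"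
proof -
  let ?P = "\<lambda>e. reach \<kappa> m c1 c2 (fst e) (snd e)"
  obtain e where e: "?P e" "\<And>e'. ?P e' \<Longrightarrow> size (fst e + snd e) \<le> size (fst e' + snd e')"
    using ex_has_least_nat[of ?P "(c1, c2)" "\<lambda>e. size (fst e + snd e)"] reach.refl by auto
  let ?Q = "\<lambda>e'. ?P e' \<and> size (fst e' + snd e') = size (fst e + snd e)"
  obtain e' where e': "?Q e'" "\<And>e''. ?Q e'' \<Longrightarrow> size (fst e') \<le> size (fst e'')"
    using ex_has_least_nat[of ?Q e "\<lambda>e. size (fst e)"] e by blast
  have ex: "extr \<kappa> (fst e')" "extr m (snd e')" using reach_extr[OF _ assms] e'(1) by blast+
  have st: "?P (rcont \<kappa> i (fst e'), rcont m i (snd e'))" for i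
    using reach.step e'(1) by simp
  have dom: "pm i (fst e' + snd e') \<le> int (\<kappa> i) + int (m i)" for i
    using e(2)[OF st[of i]] rcont_size_sum(1)[OF ex, of i] e'(1) by simp
  have "pm i (fst e') \<le> int (\<kappa> i)" if "pm i (fst e' + snd e') = int (\<kappa> i) + int (m i)" for i
  proof -
    have "int (size (rcont \<kappa> i (fst e') + rcont m i (snd e'))) = int (size (fst e' + snd e'))"
      using rcont_size_sum(1)[OF ex, of i] that by simp
    then have "?Q (rcont \<kappa> i (fst e'), rcont m i (snd e'))" using st[of i] e'(1) by simp
    from e'(2)[OF this] show ?thesis using rcont_size_sum(2)[OF ex, of i] by simp
  qed
  with e'(1) dom show ?thesis by (intro that[of "fst e'" "snd e'"]) blast+
qed

lemma chain_of_empty: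
  assumes "tri \<kappa> m \<beta> \<nu> \<Phi>" "chain m X" "nonvanishing \<kappa> m 1 \<beta> \<nu> \<Phi> {#} (cont X)"
  shows "\<Phi> 1 (zz X) \<notin> Jk \<nu>"
proof -
  from assms(3) obtain x1 x2 where x: "chain \<kappa> x1" "cont x1 = {#}" "chain m x2" "cont x2 = cont X"
    "\<Phi> (zz x1) (zz x2) \<notin> Jk \<nu>" unfolding nonvanishing_def by (auto simp: scale_1)
  from tri_proportional[OF assms(1) extremal_zz[OF x(1)] x(1) HOL.refl extremal_zz[OF assms(2)] x(3)] x
  show ?thesis by (simp add: zz_empty)
qed

text \<open>By \<open>chain_exists\<close>, the condition on \<open>qq\<close> places the weight of
  the image in the Weyl orbit of \<nu>, so that \<nu> is the dominant conjugate of that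
  weight.\<close>

theorem prv:
  assumes "chain \<mu> x"
  shows "\<exists>\<beta> \<nu> \<Phi>. tri la (\<lambda>i. N * \<mu> i) \<beta> \<nu> \<Phi> \<and> \<Phi> 1 (zz (scale N x)) \<notin> Jk \<nu> \<and> qq (ik \<nu>) (repeat_mset N (cont x) - \<beta>) = 0"
  using assms
proof (induction "size (cont x)" arbitrary: x la N rule: less_induct)
  case less
  define m where "m i = N * \<mu> i" for i
  define X where "X = scale N x"
  have X: "chain m X" "cont X = repeat_mset N (cont x)"
    unfolding X_def m_def[abs_def] using chain_scale[OF less.prems] by auto
  have goal: "?case \<longleftrightarrow> (\<exists>\<beta> \<nu> \<Phi>. tri la m \<beta> \<nu> \<Phi> \<and> \<Phi> 1 (zz X) \<notin> Jk \<nu> \<and> qq (ik \<nu>) (cont X - \<beta>) = 0)"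
    by (simp add: m_def[abs_def] X_def)
  show ?case
  proof (cases "\<forall>i. pm i (cont X) \<le> int (la i) + int (m i)")
    case True
    then have "int (nat (int (la i) + int (m i) - pm i (cont X))) = int (la i) + int (m i) - pm i (cont X)" for i by simp
    from tri_dominant[OF X(1) this] show ?thesis unfolding goal by (elim exE, intro exI) (auto simp: qq_empty)
  next
    case False
    then obtain i where i: "int (la i) + int N * (int (\<mu> i) - pm i (cont x)) < 0"
      by (auto simp: not_le X m_def algebra_simps)
    have "\<exists>l>0. \<forall>b. \<exists>\<beta> \<nu> \<Phi>. tri (\<lambda>i. b * l * la i) (\<lambda>i. b * l * N * \<mu> i) \<beta> \<nu> \<Phi>
        \<and> \<Phi> 1 (zz (scale (b * l * N) x)) \<notin> Jk \<nu> \<and> qq (ik \<nu>) (repeat_mset (b * l * N) (cont x) - \<beta>) = 0"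
      using less.prems less.hyps(1)[rotated] i by (rule prv_multiple)
    then obtain l where l: "l > 0"
      and lev: "\<And>b. \<exists>\<beta> \<nu> \<Phi>. tri (\<lambda>i. b * l * la i) (\<lambda>i. b * l * m i) \<beta> \<nu> \<Phi>
        \<and> \<Phi> 1 (zz (scale (b * l) X)) \<notin> Jk \<nu> \<and> qq (ik \<nu>) (repeat_mset (b * l) (cont X) - \<beta>) = 0"
      unfolding X(2) unfolding m_def X_def scale_scale repeat_mset_right mult.assoc by blast
    have ex: "extr la {#}" "extr m (cont X)" using X(1) unfolding extr_def by (auto intro: exI[of _ "[]"])
    obtain c1 c2 where c: "reach la m {#} (cont X) c1 c2" "\<And>i. pm i (c1 + c2) \<le> int (la i) + int (m i)"
      "\<And>i. pm i (c1 + c2) = int (la i) + int (m i) \<Longrightarrow> pm i c1 \<le> int (la i)"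
      by (rule dominant_pair[OF ex]) blast
    define \<nu>b where "\<nu>b i = nat (int (la i) + int (m i) - pm i (c1 + c2))" for i
    have \<nu>b: "int (\<nu>b i) = int (la i) + int (m i) - pm i (c1 + c2)" for i using c(2)[of i] by (simp add: \<nu>b_def)
    \<comment> \<open>Large enough for \<open>B\<close> times \<open>\<nu>b\<close> plus the first
      weight to be dominant; on the walls containing \<open>\<nu>b\<close> the choice of the pair
      takes care of this.\<close>
    define b where "b = Suc (\<Sum>i\<in>UNIV. nat (pm i c1))"
    define B where "B = b * l"
    have B0: "B > 0" using l by (simp add: B_def b_def)
    have Bd: "pm i c1 \<le> int (B * \<nu>b i) + int (la i)" for i
    proof (cases "\<nu>b i = 0")
      case True
      then have "pm i (c1 + c2) = int (la i) + int (m i)" using \<nu>b[of i] by simp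
      from c(3)[OF this] True show ?thesis by simp
    next
      case False
      have "nat (pm i c1) \<le> (\<Sum>i\<in>UNIV. nat (pm i c1))" by (rule member_le_sum) auto
      also have "\<dots> \<le> b" by (simp add: b_def)
      also have "\<dots> \<le> B * \<nu>b i" using l False by (simp add: B_def)
      finally show ?thesis by linarith
    qed
    from lev[of b] obtain \<beta> \<nu> \<Phi> where t: "tri (\<lambda>i. B * la i) (\<lambda>i. B * m i) \<beta> \<nu> \<Phi>"
      and nz: "\<Phi> 1 (zz (scale B X)) \<notin> Jk \<nu>" "qq (ik \<nu>) (repeat_mset B (cont X) - \<beta>) = 0" unfolding B_def by blast
    have "nonvanishing la m B \<beta> \<nu> \<Phi> {#} (cont X)"
      unfolding nonvanishing_def using nz X(1) by (intro exI[of _ "[]"] exI[of _ X]) (simp add: wd_Nil)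
    from nonvanishing_reach(1)[OF t c(1) this] obtain x1 x2 where x: "chain la x1" "cont x1 = c1" "chain m x2" "cont x2 = c2"
      and nz': "\<Phi> (zz (scale B x1)) (zz (scale B x2)) \<notin> Jk \<nu>" "qq (ik \<nu>) (repeat_mset B (c1 + c2) - \<beta>) = 0"
      unfolding nonvanishing_def by blast
    have F: "zz (scale B x1) \<in> Fc (repeat_mset B c1)" "zz (scale B x2) \<in> Fc (repeat_mset B c2)"
      using zz_Fc[of "scale B x1"] zz_Fc[of "scale B x2"] x by auto
    \<comment> \<open>The image has a weight that is dominant and of maximal norm, hence the highest
      weight; this determines \<nu> as \<open>B\<close> times \<open>\<nu>b\<close>.\<close>
    have \<beta>: "\<beta> = repeat_mset B (c1 + c2)"
    proof -
      have sub: "\<beta> \<subseteq># repeat_mset B (c1 + c2)"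
      proof (rule ccontr)
        assume "\<not> ?thesis"
        then have "\<Phi> (zz (scale B x1)) (zz (scale B x2)) = 0"
          by (intro tri_Fc0[OF t F]) (simp add: repeat_mset_distrib2)
        with nz'(1) show False by (simp add: complex_vector.subspace_0[OF Jk_subspace])
      qed
      let ?e = "repeat_mset B (c1 + c2) - \<beta>"
      have "\<Phi> (zz (scale B x1)) (zz (scale B x2)) \<in> Fc ?e"
        using tri_Fc[OF t F] sub by (simp add: repeat_mset_distrib2)
      moreover have "pm i ?e \<le> int (\<nu> i)" for i
      proof -
        have "pm i (repeat_mset B (c1 + c2)) = pm i \<beta> + pm i ?e"
          using arg_cong[OF subset_mset.add_diff_inverse[OF sub], of "pm i"] by simp
        then have "int (\<nu> i) - pm i ?e = int (B * \<nu>b i)" using tri_nu[OF t, of i] by (simp add: \<nu>b algebra_simps)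
        then show ?thesis using of_nat_0_le_iff[of "B * \<nu>b i"] by linarith
      qed
      ultimately have "?e = {#}" using dominant_qq_0 nz' by blast
      with sub show ?thesis by (metis Diff_eq_empty_iff_mset subset_mset.antisym)
    qed
    have \<nu>: "\<nu> = (\<lambda>i. B * \<nu>b i)"
    proof
      fix i
      have "int (\<nu> i) = int (B * \<nu>b i)" using tri_nu[OF t, of i] by (simp add: \<beta> \<nu>b algebra_simps)
      then show "\<nu> i = B * \<nu>b i" by (simp only: of_nat_eq_iff)
    qed
    obtain s0 where s0: "s0 \<noteq> 0" "\<Phi> (zz (scale B x1)) (zz (scale B x2)) = s0 *\<^sub>C 1"
      by (rule tri_scalar[OF t F _ nz'(1)]) (simp add: \<beta> repeat_mset_distrib2, rule that)
    \<comment> \<open>Level \<open>Suc B\<close> arises from level \<open>B\<close> by adding la -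
      c1 and then m - c2 to the highest weight. Both resulting weights are dominant, so each step is
      an instance of \<open>tri_dominant\<close>.\<close>
    define \<nu>3 where "\<nu>3 i = nat (int (\<nu> i) + int (la i) - pm i c1)" for i
    have \<nu>3: "int (\<nu>3 i) = int (\<nu> i) + int (la i) - pm i (cont x1)" for i
      using Bd[of i] by (simp add: \<nu>3_def \<nu> x)
    define \<nu>4 where "\<nu>4 i = Suc B * \<nu>b i" for i
    have \<nu>4: "int (\<nu>4 i) = int (\<nu>3 i) + int (m i) - pm i (cont x2)" for i
      by (simp add: \<nu>4_def \<nu>3 \<nu> x \<nu>b[of i] algebra_simps) (use \<nu>b[of i] in \<open>simp add: algebra_simps\<close>)?
    obtain \<Phi>3 where t3: "tri \<nu> la (cont x1) \<nu>3 \<Phi>3" "\<Phi>3 1 (zz x1) \<notin> Jk \<nu>3" using tri_dominant[OF x(1) \<nu>3] by blast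
    obtain \<Phi>4 where t4: "tri \<nu>3 m (cont x2) \<nu>4 \<Phi>4" "\<Phi>4 1 (zz x2) \<notin> Jk \<nu>4" using tri_dominant[OF x(3) \<nu>4] by blast
    obtain s3 where s3: "s3 \<noteq> 0" "\<Phi>3 1 (zz x1) = s3 *\<^sub>C 1"
      by (rule tri_scalar[OF t3(1) one_Fc zz_Fc _ t3(2)]) (simp, rule that)
    have t3': "tri \<nu> (\<lambda>i. Suc 0 * la i) (cont x1) \<nu>3 \<Phi>3" using t3(1) by simp
    have t4': "tri \<nu>3 (\<lambda>i. Suc 0 * m i) (cont x2) \<nu>4 \<Phi>4" using t4(1) by simp
    \<comment> \<open>\<open>tri_comp\<close> enlarges the second factor; a flip in between extends
      both factors.\<close>
    obtain \<Xi>1 where \<Xi>1: "tri (\<lambda>i. B * m i) (\<lambda>i. B * la i + Suc 0 * la i) (\<beta> + cont x1) \<nu>3 \<Xi>1"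
      "\<And>X Y Y1 Y2 s. cop Y - s *\<^sub>C (Y1 \<otimes>\<^sub>C Y2) \<in> TM (\<lambda>i. B * la i) (\<lambda>i. Suc 0 * la i) \<Longrightarrow> \<Xi>1 X Y - s *\<^sub>C \<Phi>3 (\<Phi> Y1 X) Y2 \<in> Jk \<nu>3"
      using tri_comp[OF tri_flip[OF t] t3'] by blast
    obtain \<Xi>2 where \<Xi>2: "tri (\<lambda>i. B * la i + Suc 0 * la i) (\<lambda>i. B * m i + Suc 0 * m i) (\<beta> + cont x1 + cont x2) \<nu>4 \<Xi>2"
      "\<And>X Y Y1 Y2 s. cop Y - s *\<^sub>C (Y1 \<otimes>\<^sub>C Y2) \<in> TM (\<lambda>i. B * m i) (\<lambda>i. Suc 0 * m i) \<Longrightarrow> \<Xi>2 X Y - s *\<^sub>C \<Phi>4 (\<Xi>1 Y1 X) Y2 \<in> Jk \<nu>4"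
      using tri_comp[OF tri_flip[OF \<Xi>1(1)] t4'] by blast
    obtain s1 where s1: "s1 \<noteq> 0" "cop (zz (scale (B + Suc 0) x1)) - s1 *\<^sub>C (zz (scale B x1) \<otimes>\<^sub>C zz (scale (Suc 0) x1)) \<in> TM (\<lambda>i. B * la i) (\<lambda>i. Suc 0 * la i)"
      using cop_zz[OF x(1)] by blast
    obtain s2 where s2: "s2 \<noteq> 0" "cop (zz (scale (B + Suc 0) x2)) - s2 *\<^sub>C (zz (scale B x2) \<otimes>\<^sub>C zz (scale (Suc 0) x2)) \<in> TM (\<lambda>i. B * m i) (\<lambda>i. Suc 0 * m i)"
      using cop_zz[OF x(3)] by blast
    let ?Y = "zz (scale (B + Suc 0) x1)" and ?Z = "zz (scale (B + Suc 0) x2)"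
    have "\<Xi>1 (zz (scale B x2)) ?Y - (s1 * (s0 * s3)) *\<^sub>C 1 \<in> Jk \<nu>3"
      using \<Xi>1(2)[OF s1(2), of "zz (scale B x2)"] unfolding s0(2) scale_1
      by (simp add: clinear_scale[OF tri_lin1[OF t3(1)]] s3(2) scaleC_scaleC)
    from tri_cong_Jk1[OF t4(1) this, of "zz x2"]
    have 1: "\<Phi>4 (\<Xi>1 (zz (scale B x2)) ?Y) (zz x2) - (s1 * (s0 * s3)) *\<^sub>C \<Phi>4 1 (zz x2) \<in> Jk \<nu>4" .
    have "\<Xi>2 ?Y ?Z - (s2 * (s1 * (s0 * s3))) *\<^sub>C \<Phi>4 1 (zz x2) \<in> Jk \<nu>4"
      using Jk_trans[OF \<Xi>2(2)[OF s2(2), of ?Y, unfolded scale_1] 1] .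
    from Jk_cancel[OF this] have nz2: "\<Xi>2 ?Y ?Z \<notin> Jk \<nu>4"
      using t4(2) s0(1) s1(1) s2(1) s3(1) by simp
    have \<Xi>2': "tri (\<lambda>i. Suc B * la i) (\<lambda>i. Suc B * m i) (repeat_mset (Suc B) (c1 + c2)) (\<lambda>i. Suc B * \<nu>b i) \<Xi>2"
    proof -
      have 1: "(\<lambda>i. B * k i + Suc 0 * k i) = (\<lambda>i. Suc B * k i)" for k :: "'n \<Rightarrow> nat" by (simp add: fun_eq_iff)
      have 2: "\<beta> + cont x1 + cont x2 = repeat_mset (Suc B) (c1 + c2)" by (simp add: \<beta> x add_ac)
      show ?thesis using \<Xi>2(1) unfolding 1 2 \<nu>4_def[abs_def] .
    qed
    have fn: "\<exists>\<eta>. hom_data A d (\<lambda>i. M * la i) (\<lambda>i. M * m i) (\<lambda>i. M * \<nu>b i) (repeat_mset M (c1 + c2)) \<eta>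
        \<and> \<eta> (wrd (rev (scale M x1) @ scale M x2)) \<noteq> 0"
      if tM: "tri (\<lambda>i. M * la i) (\<lambda>i. M * m i) (repeat_mset M (c1 + c2)) (\<lambda>i. M * \<nu>b i) \<Psi>"
        and nM: "\<Psi> (zz (scale M x1)) (zz (scale M x2)) \<notin> Jk (\<lambda>i. M * \<nu>b i)" for M \<Psi>
    proof -
      have "mset (wrd (scale M x1)) + mset (wrd (scale M x2)) = repeat_mset M (c1 + c2)"
        by (simp add: x repeat_mset_distrib2)
      with tri_functional[OF tM] nM show ?thesis unfolding wrd_append wrd_rev by blast
    qed
    have "\<exists>\<eta>. hom_data A d (\<lambda>i. M * la i) (\<lambda>i. M * m i) (\<lambda>i. M * \<nu>b i) (repeat_mset M (c1 + c2)) \<eta>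
        \<and> \<eta> (wrd (rev (scale M x1) @ scale M x2)) \<noteq> 0" if "M = B \<or> M = Suc B" for M
      using that
    proof
      assume M: "M = B"
      show ?thesis unfolding M by (rule fn[of B \<Phi>]) (use t nz'(1) in \<open>simp_all add: \<beta> \<nu>\<close>)
    next
      assume M: "M = Suc B"
      show ?thesis unfolding M by (rule fn[OF \<Xi>2']) (use nz2 in \<open>simp add: \<nu>4_def[abs_def] fun_eq_iff\<close>)
    qed
    from level_one[OF x(1,3) _ \<nu>b B0 this] x(2,4) obtain \<eta> where
      \<eta>: "hom_data A d la m \<nu>b (c1 + c2) \<eta>" "\<eta> (rev (wrd x1) @ wrd x2) \<noteq> 0" by blast
    from hom_data.tri_exists[OF \<eta>(1)] obtain \<Psi> where
      \<Psi>: "tri la m (c1 + c2) \<nu>b \<Psi>" "\<And>X Y. Poly_Mapping.lookup (\<Psi> X Y) [] = ext \<eta> (anti X * Y)" by blast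
    have "Poly_Mapping.lookup (\<Psi> (zz x1) (zz x2)) [] \<noteq> 0"
      using \<eta>(2) by (simp add: \<Psi>(2) anti_wd falg_scale_left wd_mult clinear_scale[OF clinear_ext] scaleC_cmul)
    then have "nonvanishing la m 1 (c1 + c2) \<nu>b \<Psi> c1 c2"
      unfolding nonvanishing_def using x lookup_notin_Jk by (intro exI[of _ x1] exI[of _ x2]) (simp add: scale_1)
    moreover have \<Psi>1: "tri (\<lambda>i. 1 * la i) (\<lambda>i. 1 * m i) (c1 + c2) \<nu>b \<Psi>" using \<Psi>(1) by simp
    ultimately have nv: "nonvanishing la m 1 (c1 + c2) \<nu>b \<Psi> {#} (cont X)"
      using nonvanishing_reach(2)[OF \<Psi>1 c(1) ex] by blast
    then have "qq (ik \<nu>b) (cont X - (c1 + c2)) = 0" unfolding nonvanishing_def by auto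
    with chain_of_empty[OF \<Psi>(1) X(1) nv] \<Psi>(1) show ?thesis unfolding goal by blast
  qed
qed

end

section \<open>Highest weight modules\<close>

text \<open>Vectors of pairwise distinct weights are independent: apply \<open>h - \<delta> h\<close> to remove one weight \<open>\<delta>\<close>.\<close>

lemma weight_separation:
  fixes \<iota> :: "'h \<Rightarrow> 'g" and act :: "'g \<Rightarrow> 'v::complex_vector \<Rightarrow> 'v"
  assumes lin: "\<And>x. clinear (act x)" and x: "x \<in> cspan (\<Union>\<delta>\<in>D. weight_space \<iota> act \<delta>)"
    and xw: "x \<in> weight_space \<iota> act \<gamma>" and D: "\<gamma> \<notin> D"
  shows "x = 0"
proof -
  have sep: "x = 0" if "finite I" "\<And>i. i \<in> I \<Longrightarrow> b i \<in> weight_space \<iota> act (w i)" "x \<in> weight_space \<iota> act \<gamma>"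
    "\<gamma> \<notin> w ` I" "x = sum b I" for I :: "'v set" and w b x
    using that
  proof (induction I arbitrary: b x rule: finite_induct)
    case (insert a I)
    have "(\<gamma> h - w a h) *\<^sub>C x = 0" for h
    proof (rule insert.IH)
      let ?b = "\<lambda>i. (w i h - w a h) *\<^sub>C b i"
      show "?b i \<in> weight_space \<iota> act (w i)" if "i \<in> I" for i
        using insert.prems(1)[of i] that by (simp add: weight_space_def clinear_scale[OF lin] scaleC_scaleC mult.commute)
      show "(\<gamma> h - w a h) *\<^sub>C x \<in> weight_space \<iota> act \<gamma>"
        using insert.prems(2) by (simp add: weight_space_def clinear_scale[OF lin] scaleC_scaleC mult.commute)
      have act: "act (\<iota> h) (b i) = w i h *\<^sub>C b i" if "i \<in> insert a I" for i
        using insert.prems(1)[OF that] by (simp add: weight_space_def)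
      have "\<gamma> h *\<^sub>C x = act (\<iota> h) (sum b (insert a I))"
        using insert.prems(2,4) by (simp add: weight_space_def)
      also have "\<dots> = (\<Sum>i\<in>insert a I. w i h *\<^sub>C b i)"
        unfolding clinear_sum[OF lin] by (rule sum.cong[OF HOL.refl act])
      also have "\<dots> - w a h *\<^sub>C x = (\<Sum>i\<in>insert a I. ?b i)"
        unfolding insert.prems(4) complex_vector.scale_sum_right
        by (simp add: sum_subtractf[symmetric] complex_vector.scale_left_diff_distrib)
      also have "\<dots> = (\<Sum>i\<in>I. ?b i)" using insert.hyps by simp
      finally show "(\<gamma> h - w a h) *\<^sub>C x = (\<Sum>i\<in>I. ?b i)" by (simp add: complex_vector.scale_left_diff_distrib)
    qed (use insert.prems(3) in auto)
    moreover have "\<gamma> \<noteq> w a" using insert.prems(3) by auto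
    then obtain h where "\<gamma> h \<noteq> w a h" by auto
    ultimately show ?case by (metis complex_vector.scale_eq_0_iff right_minus_eq)
  qed simp
  from x obtain T r where T: "finite T" "T \<subseteq> (\<Union>\<delta>\<in>D. weight_space \<iota> act \<delta>)" "x = (\<Sum>a\<in>T. r a *\<^sub>C a)"
    unfolding complex_vector.span_explicit by blast
  define w where "w a = (SOME \<delta>. \<delta> \<in> D \<and> a \<in> weight_space \<iota> act \<delta>)" for a
  have w: "w a \<in> D \<and> a \<in> weight_space \<iota> act (w a)" if "a \<in> T" for a
    using someI_ex[of "\<lambda>\<delta>. \<delta> \<in> D \<and> a \<in> weight_space \<iota> act \<delta>"] that T(2) unfolding w_def by blast
  show ?thesis
  proof (rule sep[OF T(1) _ xw _ T(3)])
    show "r a *\<^sub>C a \<in> weight_space \<iota> act (w a)" if "a \<in> T" for a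
      using w[OF that] by (simp add: weight_space_def clinear_scale[OF lin] scaleC_scaleC mult.commute)
    show "\<gamma> \<notin> w ` T" using w D by auto
  qed
qed

lemma submodule_Ug_span:
  assumes lin: "\<And>x. clinear (act x)"
  shows "submodule act (Ug_span act v)" and "v \<in> Ug_span act v"
proof -
  show "submodule act (Ug_span act v)"
    unfolding submodule_def
  proof (intro conjI allI ballI)
    show "csubspace (Ug_span act v)" by (simp add: Ug_span_def complex_vector.subspace_span)
    fix x u assume u: "u \<in> Ug_span act v"
    show "act x u \<in> Ug_span act v"
    proof (rule span_image_sub[OF lin _ _ u[unfolded Ug_span_def]])
      show "csubspace (Ug_span act v)" by (simp add: Ug_span_def complex_vector.subspace_span)
      fix y assume "y \<in> {foldr act xs v |xs. True}"
      then obtain xs where "act x y = foldr act (x # xs) v" by auto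
      then show "act x y \<in> Ug_span act v"
        unfolding Ug_span_def by (metis (mono_tags, lifting) complex_vector.span_base mem_Collect_eq)
    qed
  qed
  have "foldr act [] v \<in> Ug_span act v"
    unfolding Ug_span_def by (rule complex_vector.span_base) blast
  then show "v \<in> Ug_span act v" by simp
qed

lemma Ug_span_minimal:
  assumes "submodule act N" "v \<in> N"
  shows "Ug_span act v \<subseteq> N"
  unfolding Ug_span_def
proof (rule complex_vector.span_minimal)
  have "foldr act xs v \<in> N" for xs
    using assms by (induction xs) (auto simp: submodule_def)
  then show "{foldr act xs v |xs. True} \<subseteq> N" by auto
  show "csubspace N" using assms by (simp add: submodule_def)
qed

locale kac_moody = km A d for A :: "int ^ 'n ^ 'n" and d :: "'n \<Rightarrow> real" +
  fixes \<alpha>v :: "'n \<Rightarrow> 'h::complex_vector" and \<alpha> :: "'n \<Rightarrow> 'h \<Rightarrow> complex"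
    and lb :: "'g::complex_vector \<Rightarrow> 'g \<Rightarrow> 'g" and \<iota> :: "'h \<Rightarrow> 'g" and e f :: "'n \<Rightarrow> 'g"
  assumes kac: "kac_moody_algebra A \<alpha>v \<alpha> lb \<iota> e f"
begin

lemma km_rel: "km_eq A \<alpha>v \<alpha> s t \<Longrightarrow> km_eval lb \<iota> e f s = km_eval lb \<iota> e f t"
  using kac unfolding kac_moody_algebra_def by blast

lemma generator_brackets:
  "lb (\<iota> h) (f i) = - \<alpha> i h *\<^sub>C f i"
  "lb (e i) (f j) = (if i = j then \<iota> (\<alpha>v i) else 0)"
  using km_rel[OF km_eq.cartan_f[of A \<alpha>v \<alpha> h i]]
    km_rel[OF km_eq.e_f_same[of A \<alpha>v \<alpha> i]] km_rel[OF km_eq.e_f_diff[of i j A \<alpha>v \<alpha>]] by auto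

lemma bracket_cartan_e: "lb (\<iota> h) (e i) = \<alpha> i h *\<^sub>C e i"
  using km_rel[OF km_eq.cartan_e[of A \<alpha>v \<alpha> h i]] by simp

lemma root_coroot: "\<alpha> j (\<alpha>v i) = of_int (A $ i $ j)" and clinear_root: "clinear (\<alpha> j)"
  using kac unfolding kac_moody_algebra_def realization_def by auto

definition asum :: "'n multiset \<Rightarrow> 'h \<Rightarrow> complex"
  where "asum c = (\<Sum>i\<in>UNIV. of_nat (count c i) *\<^sub>C \<alpha> i)"

lemma asum_add: "asum (c + c') = asum c + asum c'"
  by (simp add: asum_def scaleC_add_left sum.distrib)

lemma asum_replicate: "asum (replicate_mset n i) = of_nat n *\<^sub>C \<alpha> i"
proof -
  have "asum (replicate_mset n i) = (\<Sum>j\<in>UNIV. if j = i then of_nat n *\<^sub>C \<alpha> j else 0)"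
    unfolding asum_def by (rule sum.cong) auto
  then show ?thesis by simp
qed

lemma asum_empty [simp]: "asum {#} = 0"
  by (simp add: asum_def)

lemma asum_single [simp]: "asum {#i#} = \<alpha> i"
  using asum_replicate[of 1 i] by simp

lemma asum_add_mset: "asum (add_mset i c) = \<alpha> i + asum c"
  using asum_add[of "{#i#}" c] by simp

lemma asum_inj: "asum c = asum c' \<longleftrightarrow> c = c'"
proof
  assume eq: "asum c = asum c'"
  have ind: "cindependent (range \<alpha>)" and inj: "inj \<alpha>"
    using kac unfolding kac_moody_algebra_def realization_def by auto
  let ?u = "\<lambda>a. of_nat (count c (inv \<alpha> a)) - of_nat (count c' (inv \<alpha> a)) :: complex"
  have "(\<Sum>a\<in>range \<alpha>. ?u a *\<^sub>C a) = (\<Sum>i\<in>UNIV. ?u (\<alpha> i) *\<^sub>C \<alpha> i)"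
    by (rule sum.reindex[OF inj, unfolded o_def])
  also have "\<dots> = asum c - asum c'"
    by (simp add: asum_def inj complex_vector.scale_left_diff_distrib sum_subtractf)
  finally have "(\<Sum>a\<in>range \<alpha>. ?u a *\<^sub>C a) = 0" using eq by simp
  from complex_vector.independentD[OF ind _ _ this]
  have "?u (\<alpha> i) = 0" for i by auto
  then show "c = c'" by (intro multiset_eqI) (simp add: inj)
qed simp

lemma asum_coroot: "asum c (\<alpha>v i) = of_int (pm i c)"
  by (induction c) (simp_all add: asum_add_mset root_coroot)

lemma clinear_asum: "clinear (asum c)"
  by (induction c) (auto simp: asum_add_mset zero_fun_def plus_fun_def intro!: clinear_plus clinear_root clinear_zero_map)

lemma weight_ge_asum: "weight_ge \<alpha> \<gamma> (\<gamma> - asum c)"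
  unfolding weight_ge_def by (intro exI[of _ "count c"]) (simp add: asum_def)

text \<open>Evaluation of expressions is onto the Lie algebra, so stability under the generators
  passes to all elements by induction on expressions.\<close>

lemma generated_stable:
  assumes mod: "lie_module lb act" and S: "csubspace S"
    and gen: "\<And>i v. v \<in> S \<Longrightarrow> act (e i) v \<in> S" "\<And>i v. v \<in> S \<Longrightarrow> act (f i) v \<in> S" "\<And>h v. v \<in> S \<Longrightarrow> act (\<iota> h) v \<in> S"
  shows "submodule act S"
proof -
  have lin: "clinear (act x)" "clinear (\<lambda>x. act x v)" for x v
    using mod by (auto simp: lie_module_def cbilinear_def)
  have br: "act (lb x y) v = act x (act y v) - act y (act x v)" for x y v
    using mod by (auto simp: lie_module_def)
  have "act (km_eval lb \<iota> e f t) v \<in> S" if "v \<in> S" for t v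
    using that
    by (induction t arbitrary: v)
       (simp_all add: gen br clinear_add[OF lin(2)] clinear_scale[OF lin(2)] clinear_zero[OF lin(2)]
          subspace_intros[OF S] complex_vector.subspace_0[OF S])
  moreover have "surj (km_eval lb \<iota> e f)" using kac by (simp add: kac_moody_algebra_def)
  ultimately have "act x v \<in> S" if "v \<in> S" for x v using that by (metis surjD)
  with S show ?thesis by (simp add: submodule_def)
qed

end

locale hw_module = kac_moody A d \<alpha>v \<alpha> lb \<iota> e f
  for A :: "int ^ 'n ^ 'n" and d :: "'n \<Rightarrow> real"
    and \<alpha>v :: "'n \<Rightarrow> 'h::complex_vector" and \<alpha> :: "'n \<Rightarrow> 'h \<Rightarrow> complex"
    and lb :: "'g::complex_vector \<Rightarrow> 'g \<Rightarrow> 'g" and \<iota> :: "'h \<Rightarrow> 'g" and e f :: "'n \<Rightarrow> 'g" +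
  fixes act :: "'g \<Rightarrow> 'v::complex_vector \<Rightarrow> 'v" and v :: 'v and \<gamma> :: "'h \<Rightarrow> complex" and \<kappa> :: "'n \<Rightarrow> nat"
  assumes mod: "lie_module lb act" and irr: "irreducible_module act"
    and v: "v \<noteq> 0" "v \<in> weight_space \<iota> act \<gamma>" "act (e i) v = 0" "Ug_span act v = UNIV"
    and \<gamma>: "\<gamma> (\<alpha>v i) = of_nat (\<kappa> i)"
begin

lemma lin: "clinear (act x)"
  using mod by (auto simp: lie_module_def cbilinear_def)

lemma lin1: "clinear (\<lambda>x. act x u)"
  using mod by (auto simp: lie_module_def cbilinear_def)

lemma act_bracket: "act x (act y u) = act (lb x y) u + act y (act x u)"
  using mod by (simp add: lie_module_def)

text \<open>The surjection from the free algebra, seen as a Verma module, onto the given module; its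
  kernel turns out to be \<open>Jk \<kappa>\<close>.\<close>

definition ev :: "'n falg \<Rightarrow> 'v" where "ev = ext (\<lambda>u. foldr (\<lambda>i. act (f i)) u v)"

lemma lin_ev: "clinear ev"
  by (simp add: ev_def clinear_ext)

lemma ev_wd: "ev (wd u) = foldr (\<lambda>i. act (f i)) u v"
  by (simp add: ev_def)

lemma ev_one [simp]: "ev 1 = v"
  using ev_wd[of "[]"] by (simp add: wd_Nil)

lemma ev_f: "ev (wd [i] * X) = act (f i) (ev X)"
  by (rule clinear_eq_singleI[where X = X])
     (auto intro!: clinear_comps[OF lin_ev] clinear_comps[OF lin] clinear_intros lin_ev simp: wd_mult ev_wd)

lemma ev_weight_word: "act (\<iota> h) (ev (wd u)) = (\<gamma> - asum (mset u)) h *\<^sub>C ev (wd u)"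
proof (induction u)
  case Nil
  then show ?case using v(2) by (simp add: ev_wd weight_space_def)
next
  case (Cons i u)
  have "act (\<iota> h) (ev (wd (i # u))) = act (lb (\<iota> h) (f i)) (ev (wd u)) + act (f i) (act (\<iota> h) (ev (wd u)))"
    unfolding wd_Cons[of i u] ev_f by (rule act_bracket)
  also have "\<dots> = (\<gamma> - asum (mset (i # u))) h *\<^sub>C ev (wd (i # u))"
    unfolding wd_Cons[of i u] ev_f Cons generator_brackets
    by (simp add: clinear_scale[OF lin1] clinear_neg[OF lin1] clinear_scale[OF lin] clinear_diff[OF lin] asum_add_mset algebra_simps scaleC_add_left
        complex_vector.scale_left_diff_distrib)
  finally show ?case .
qed

lemma ev_weight: "X \<in> Fc c \<Longrightarrow> ev X \<in> weight_space \<iota> act (\<gamma> - asum c)"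
  unfolding weight_space_def mem_Collect_eq
proof
  fix h assume X: "X \<in> Fc c"
  show "act (\<iota> h) (ev X) = (\<gamma> - asum c) h *\<^sub>C ev X"
    by (rule Fc_eqI[OF _ _ _ X]) (auto intro!: clinear_comps[OF lin] clinear_smult lin_ev simp: ev_weight_word)
qed

lemma ev_e: "ev (EE (ik \<kappa>) i X) = act (e i) (ev X)"
proof (rule clinear_eq_singleI[where X = X])
  show "ev (EE (ik \<kappa>) i (wd u)) = act (e i) (ev (wd u))" for u
  proof (induction u)
    case Nil
    then show ?case using v(3) by (simp add: wd_Nil clinear_zero[OF lin_ev])
  next
    case (Cons j u)
    have c: "act (\<iota> (\<alpha>v i)) (ev (wd u)) = ev (Hp (ik \<kappa>) i (wd u))"
      unfolding ev_weight_word Hp_wd by (simp add: \<gamma> asum_coroot clinear_scale[OF lin_ev])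
    have "act (e i) (ev (wd (j # u))) = act (lb (e i) (f j)) (ev (wd u)) + act (f j) (act (e i) (ev (wd u)))"
      unfolding wd_Cons[of j u] ev_f by (rule act_bracket)
    also have "\<dots> = ev (EE (ik \<kappa>) i (wd (j # u)))"
      unfolding wd_Cons[of j u] EE_f Cons[symmetric]
      using c by (auto simp: generator_brackets ev_f clinear_add[OF lin_ev] clinear_zero[OF lin1] clinear_zero[OF lin_ev])
    finally show ?case ..
  qed
qed (intro clinear_comps[OF lin_ev] clinear_comps[OF lin] lin_EE lin_ev)+

lemma range_ev: "range ev = UNIV"
proof -
  have sub: "csubspace (range ev)"
    using lin_ev by (auto simp: complex_vector.subspace_def clinear_add[symmetric] clinear_scale[symmetric] clinear_zero intro: range_eqI[of _ ev 0])
  have "submodule act (range ev)"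
  proof (rule generated_stable[OF mod sub])
    show "act (\<iota> h) u \<in> range ev" if "u \<in> range ev" for h u
    proof -
      from that obtain X where u: "u = ev X" by auto
      show ?thesis unfolding u
        by (rule clinear_sub_singleI[where X = X, OF clinear_comps[OF lin lin_ev] sub])
           (simp add: ev_weight_word complex_vector.subspace_scale[OF sub])
    qed
  qed (auto simp: ev_e[symmetric] ev_f[symmetric])
  moreover have "v \<in> range ev" using ev_one by (metis rangeI)
  ultimately show ?thesis using Ug_span_minimal v(4) by blast
qed

lemma ev_component:
  assumes "ev X \<in> weight_space \<iota> act (\<gamma> - asum c)"
  shows "ev X = ev (proj c X)"
proof -
  let ?D = "{\<gamma> - asum c' | c'. c' \<noteq> c}"
  have "ev (X - proj c X) = 0"
  proof (rule weight_separation[OF lin])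
    show "ev (X - proj c X) \<in> weight_space \<iota> act (\<gamma> - asum c)"
      using assms ev_weight[OF proj_Fc[of c X]]
      by (simp add: weight_space_def clinear_diff[OF lin_ev] clinear_diff[OF lin] complex_vector.scale_right_diff_distrib)
    show "\<gamma> - asum c \<notin> ?D" by (auto simp: asum_inj)
    show "ev (X - proj c X) \<in> cspan (\<Union>\<delta>\<in>?D. weight_space \<iota> act \<delta>)"
    proof (rule clinear_sub_singleI[where X = X, OF _ complex_vector.subspace_span])
      show "clinear (\<lambda>X. ev (X - proj c X))"
        unfolding proj_def by (intro clinear_comps[OF lin_ev] clinear_intros)
      fix u
      show "ev (wd u - proj c (wd u)) \<in> cspan (\<Union>\<delta>\<in>?D. weight_space \<iota> act \<delta>)"
      proof (cases "mset u = c")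
        case False
        then have "ev (wd u) \<in> (\<Union>\<delta>\<in>?D. weight_space \<iota> act \<delta>)" using ev_weight[OF wd_Fc[OF HOL.refl]] by blast
        with False show ?thesis by (simp add: proj_def complex_vector.span_base)
      qed (simp add: proj_def clinear_zero[OF lin_ev] complex_vector.span_zero)
    qed
  qed
  then show ?thesis by (simp add: clinear_diff[OF lin_ev])
qed

lemma ev_eq_0_imp: "ev X = 0 \<Longrightarrow> X \<in> Jk \<kappa>"
proof (rule Rad_Jk)
  fix w
  show "ev X = 0 \<Longrightarrow> ecoef (ik \<kappa>) w X = 0"
  proof (induction w arbitrary: X)
    case Nil
    have "ev (proj {#} X) = 0"
      using ev_component[of X "{#}"] Nil by (simp add: weight_space_def clinear_zero[OF lin])
    moreover have "proj {#} X = Poly_Mapping.lookup X [] *\<^sub>C 1"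
    proof (rule clinear_eq_singleI[where X = X])
      show "clinear (\<lambda>X :: 'n falg. Poly_Mapping.lookup X [] *\<^sub>C (1 :: 'n falg))"
        by (rule clinearI) (simp_all add: lookup_add lookup_scaleC scaleC_add_left scaleC_scaleC scaleC_cmul)
      show "clinear (proj {#})" by (simp add: proj_def clinear_ext)
    qed (auto simp: proj_def lookup_single wd_Nil)
    ultimately show ?case using v(1) by (simp add: clinear_scale[OF lin_ev])
  next
    case (Cons i w)
    then show ?case by (simp add: ev_e clinear_zero[OF lin])
  qed
qed

text \<open>The image of \<open>Jk \<kappa>\<close> is a proper submodule, hence zero by
  irreducibility. Conversely, raising the zero vector gives zero coefficients at the highest weight
  vector, and \<open>Rad_Jk\<close> applies.\<close>

lemma ev_eq_0_iff: "ev X = 0 \<longleftrightarrow> X \<in> Jk \<kappa>"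
proof
  assume X: "X \<in> Jk \<kappa>"
  have sub: "csubspace (ev ` Jk \<kappa>)"
    using lin_ev Jk_subspace[of \<kappa>]
    by (auto simp: complex_vector.subspace_def clinear_add[symmetric] clinear_scale[symmetric] intro!: imageI)
       (metis clinear_zero image_eqI)
  have "submodule act (ev ` Jk \<kappa>)"
  proof (rule generated_stable[OF mod sub])
    fix h u assume "u \<in> ev ` Jk \<kappa>"
    then obtain X where X: "X \<in> Jk \<kappa>" "u = ev X" by auto
    define H where "H = ext (\<lambda>u. (\<gamma> - asum (mset u)) h *\<^sub>C (wd u :: 'n falg))"
    have "act (\<iota> h) (ev X) = ev (H X)"
      unfolding H_def
      by (rule clinear_eq_singleI[where X = X])
         (auto intro!: clinear_comps[OF lin] clinear_comps[OF lin_ev] clinear_ext lin_ev simp: ev_weight_word clinear_scale[OF lin_ev])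
    moreover have "H X \<in> Jk \<kappa>"
    proof (rule Rad_Jk)
      fix w
      have "ecoef (ik \<kappa>) w (H X) = (\<gamma> - asum (mset w)) h *\<^sub>C ecoef (ik \<kappa>) w X"
        unfolding H_def
      proof (rule clinear_eq_singleI[where X = X])
        fix u
        show "ecoef (ik \<kappa>) w (ext (\<lambda>u. (\<gamma> - asum (mset u)) h *\<^sub>C wd u) (wd u)) = (\<gamma> - asum (mset w)) h *\<^sub>C ecoef (ik \<kappa>) w (wd u)"
          using ecoef_Fc[OF wd_Fc[OF HOL.refl], of "ik \<kappa>" w u]
          by (cases "ecoef (ik \<kappa>) w (wd u) = 0") (auto simp: clinear_scale[OF lin_ecoef])
      qed (intro clinear_comps[OF lin_ecoef] clinear_smult lin_ecoef clinear_ext)+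
      then show "ecoef (ik \<kappa>) w (H X) = 0" using ecoef_Jk[OF X(1)] by simp
    qed
    ultimately show "act (\<iota> h) u \<in> ev ` Jk \<kappa>" using X(2) by auto
  qed (auto simp: ev_e[symmetric] ev_f[symmetric] intro: EE_Jk Jk_mult_left)
  moreover have "ev ` Jk \<kappa> \<noteq> UNIV"
  proof
    assume "ev ` Jk \<kappa> = UNIV"
    then obtain Y where Y: "Y \<in> Jk \<kappa>" "v = ev Y" by blast
    then have "ev (1 - Y) = 0" by (simp add: clinear_diff[OF lin_ev])
    from complex_vector.subspace_add[OF Jk_subspace ev_eq_0_imp[OF this] Y(1)] one_notin_Jk show False by simp
  qed
  ultimately have "ev ` Jk \<kappa> = {0}" using irr unfolding irreducible_module_def by blast
  with X show "ev X = 0" by blast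
qed (rule ev_eq_0_imp)

lemma weight_vector:
  assumes "u \<in> weight_space \<iota> act (\<gamma> - asum c)"
  obtains X where "X \<in> Fc c" "u = ev X"
proof -
  obtain X where "u = ev X" using range_ev by (metis surjD)
  with assms ev_component[of X c] proj_Fc that show ?thesis by metis
qed

lemma highest_weight_vector:
  assumes "u \<in> weight_space \<iota> act \<gamma>"
  obtains t where "u = t *\<^sub>C v"
proof -
  obtain X where X: "X \<in> Fc {#}" "u = ev X" using weight_vector[of u "{#}"] assms by auto
  with Fc_empty[OF X(1)] that show ?thesis by (metis clinear_scale[OF lin_ev] ev_one)
qed

lemma extremal_weight_vector:
  assumes "u \<in> weight_space \<iota> act (\<gamma> - asum (cont x))" "chain \<kappa> x"
  obtains t where "u = t *\<^sub>C ev (zz x)"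
proof -
  obtain X where X: "X \<in> Fc (cont x)" "u = ev X" using weight_vector[OF assms(1)] by auto
  from extremal_unique[OF assms(2) X(1)] obtain t where "X - t *\<^sub>C zz x \<in> Jk \<kappa>" by blast
  then have "ev (X - t *\<^sub>C zz x) = 0" by (simp add: ev_eq_0_iff)
  with X(2) have "u = t *\<^sub>C ev (zz x)" by (simp add: clinear_diff[OF lin_ev] clinear_scale[OF lin_ev])
  then show ?thesis by (rule that)
qed

end

section \<open>Tensor products and the Weyl group\<close>

lemma lie_module_tensor:
  assumes "lie_module lb act" "lie_module lb act'"
  shows "lie_module lb (tensor_action act act')"
proof -
  note T = tensor_action_tens[OF assms]
  have lin: "clinear (\<lambda>x. act x v)" "clinear (\<lambda>x. act' x w)" for v w
    using assms by (auto simp: lie_module_def cbilinear_def)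
  have br: "act (lb x y) v = act x (act y v) - act y (act x v)" "act' (lb x y) w = act' x (act' y w) - act' y (act' x w)" for x y v w
    using assms by (auto simp: lie_module_def)
  have tens: "clinear (\<lambda>v. v \<otimes>\<^sub>C w)" "clinear (\<lambda>w. v \<otimes>\<^sub>C w)" for v :: 'b and w :: 'c
    using cbilinear_tens by (auto simp: cbilinear_def)
  note s = T(1) clinear_add[OF T(2)] clinear_add[OF lin(1)] clinear_add[OF lin(2)] clinear_scale[OF lin(1)] clinear_scale[OF lin(2)]
    clinear_add[OF tens(1)] clinear_add[OF tens(2)] clinear_scale[OF tens(1)] clinear_scale[OF tens(2)]
    clinear_diff[OF tens(1)] clinear_diff[OF tens(2)] scaleC_add_right
  have "tensor_action act act' (x + y) t = tensor_action act act' x t + tensor_action act act' y t" for x y t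
    by (rule tensor_eqI[where t = t]) (simp_all add: s clinear_plus T(2))
  moreover have "tensor_action act act' (c *\<^sub>C x) t = c *\<^sub>C tensor_action act act' x t" for c x t
    by (rule tensor_eqI[where t = t]) (simp_all add: s clinear_smult T(2))
  moreover have "tensor_action act act' (lb x y) t = tensor_action act act' x (tensor_action act act' y t)
      - tensor_action act act' y (tensor_action act act' x t)" for x y t
    by (rule tensor_eqI[where t = t]) (auto intro!: clinear_minus clinear_comps[OF T(2)] T(2) simp: s br)
  ultimately show ?thesis
    unfolding lie_module_def by (auto intro!: cbilinearI T(2) clinearI)
qed

lemma tensor_weight:
  fixes act :: "'g::complex_vector \<Rightarrow> 'v::complex_vector \<Rightarrow> 'v" and act' :: "'g::complex_vector \<Rightarrow> 'w::complex_vector \<Rightarrow> 'w"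
  assumes "lie_module lb act" "lie_module lb act'" "x \<in> weight_space \<iota> act \<gamma>" "y \<in> weight_space \<iota> act' \<delta>"
  shows "x \<otimes>\<^sub>C y \<in> weight_space \<iota> (tensor_action act act') (\<gamma> + \<delta>)"
proof -
  have tens: "clinear (\<lambda>v. v \<otimes>\<^sub>C w)" "clinear (\<lambda>w. v \<otimes>\<^sub>C w)" for v :: 'v and w :: 'w
    using cbilinear_tens by (auto simp: cbilinear_def)
  show ?thesis
    using assms(3,4) unfolding weight_space_def mem_Collect_eq
    by (simp add: tensor_action_tens[OF assms(1,2)] clinear_scale[OF tens(1)] clinear_scale[OF tens(2)] scaleC_add_left)
qed

context kac_moody
begin

lemma simple_reflection_involutive: "simple_reflection \<alpha>v \<alpha> i (simple_reflection \<alpha>v \<alpha> i \<gamma>) = \<gamma>"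
  by (rule ext) (simp add: simple_reflection_def root_coroot scaleC_cmul algebra_simps)

lemma weyl_comp: "\<sigma> \<in> weyl_group \<alpha>v \<alpha> \<Longrightarrow> \<tau> \<in> weyl_group \<alpha>v \<alpha> \<Longrightarrow> \<sigma> \<circ> \<tau> \<in> weyl_group \<alpha>v \<alpha>"
  by (induction rule: weyl_group.induct) (auto simp: comp_assoc intro: weyl_group.intros)

lemma simple_reflection_weyl: "simple_reflection \<alpha>v \<alpha> i \<in> weyl_group \<alpha>v \<alpha>"
  using weyl_group.step[OF weyl_group.one] by simp

lemma weyl_inverse: "\<sigma> \<in> weyl_group \<alpha>v \<alpha> \<Longrightarrow> \<exists>\<tau>\<in>weyl_group \<alpha>v \<alpha>. \<forall>\<gamma>. \<tau> (\<sigma> \<gamma>) = \<gamma>"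
proof (induction rule: weyl_group.induct)
  case (step \<sigma> i)
  then obtain \<tau> where \<tau>: "\<tau> \<in> weyl_group \<alpha>v \<alpha>" "\<And>\<gamma>. \<tau> (\<sigma> \<gamma>) = \<gamma>" by blast
  then show ?case
    by (intro bexI[of _ "\<tau> \<circ> simple_reflection \<alpha>v \<alpha> i"] weyl_comp simple_reflection_weyl)
       (simp_all add: simple_reflection_involutive)
qed (auto intro!: bexI[of _ id] weyl_group.one)

lemma asum_shift:
  assumes "\<And>j. int (count c' j) = int (count c j) + (if j = i then p else 0)"
  shows "asum c' = asum c + of_int p *\<^sub>C \<alpha> i"
proof -
  have "of_nat (count c' j) *\<^sub>C \<alpha> j = of_nat (count c j) *\<^sub>C \<alpha> j + (if j = i then of_int p *\<^sub>C \<alpha> j else 0)" for j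
  proof -
    have "(of_nat (count c' j) :: complex) = of_int (int (count c j) + (if j = i then p else 0))"
      unfolding assms[symmetric] by simp
    then show ?thesis by (simp add: scaleC_add_left)
  qed
  then show ?thesis by (simp add: asum_def sum.distrib)
qed

lemma weight_coroot:
  assumes "\<And>i. \<gamma> (\<alpha>v i) = of_nat (\<kappa> i)"
  shows "(\<gamma> - asum c) (\<alpha>v i) = of_int (int (\<kappa> i) - pm i c)"
  by (simp add: assms asum_coroot)

lemma weyl_chain:
  assumes \<gamma>: "\<And>i. \<gamma> (\<alpha>v i) = of_nat (\<kappa> i)" and "\<sigma> \<in> weyl_group \<alpha>v \<alpha>"
  obtains x where "chain \<kappa> x" "\<sigma> \<gamma> = \<gamma> - asum (cont x)"
proof -
  have "\<exists>c. extr \<kappa> c \<and> \<sigma> \<gamma> = \<gamma> - asum c"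
    using assms(2)
  proof (induction rule: weyl_group.induct)
    case one
    show ?case by (intro exI[of _ "{#}"]) (auto simp: extr_def intro: exI[of _ "[]"])
  next
    case (step \<sigma> i)
    then obtain c Y where c: "extremal \<kappa> c Y" "\<sigma> \<gamma> = \<gamma> - asum c" unfolding extr_extremal by blast
    have "asum (rcont \<kappa> i c) = asum c + of_int (int (\<kappa> i) - pm i c) *\<^sub>C \<alpha> i"
      by (rule asum_shift) (rule rcont_reflect(2)[OF c(1)])
    then have "simple_reflection \<alpha>v \<alpha> i (\<gamma> - asum c) = \<gamma> - asum (rcont \<kappa> i c)"
      unfolding simple_reflection_def weight_coroot[where \<gamma>=\<gamma> and \<kappa>=\<kappa>, OF \<gamma>] by (simp add: algebra_simps)
    with c rcont_reflect(1)[OF c(1), of i] show ?case unfolding extr_extremal by auto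
  qed
  with that show ?thesis unfolding extr_def by blast
qed

lemma chain_weyl:
  assumes \<gamma>: "\<And>i. \<gamma> (\<alpha>v i) = of_nat (\<kappa> i)" and "chain \<kappa> x"
  shows "\<exists>\<sigma>\<in>weyl_group \<alpha>v \<alpha>. \<sigma> \<gamma> = \<gamma> - asum (cont x)"
  using assms(2)
proof (induction x)
  case Nil
  show ?case by (auto intro!: bexI[of _ id] weyl_group.one)
next
  case (Cons ia x)
  then have "chain \<kappa> x" by simp
  from Cons.IH[OF this] obtain \<sigma> where \<sigma>: "\<sigma> \<in> weyl_group \<alpha>v \<alpha>" "\<sigma> \<gamma> = \<gamma> - asum (cont x)" by blast
  have "of_nat (snd ia) = (of_int (int (snd ia)) :: complex)" by simp
  also have "\<dots> = (\<gamma> - asum (cont x)) (\<alpha>v (fst ia))"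
    unfolding weight_coroot[where \<gamma>=\<gamma> and \<kappa>=\<kappa>, OF \<gamma>] using Cons.prems by simp
  finally have "simple_reflection \<alpha>v \<alpha> (fst ia) (\<gamma> - asum (cont x)) = \<gamma> - asum (cont (ia # x))"
    by (simp add: simple_reflection_def asum_add asum_replicate)
  with \<sigma> show ?case by (intro bexI[OF _ weyl_group.step[OF \<sigma>(1), of "fst ia"]]) simp
qed

lemma dominant_weights_iff:
  "\<gamma> \<in> dominant_weights \<alpha>v \<longleftrightarrow> clinear \<gamma> \<and> (\<exists>\<kappa>. \<forall>i. \<gamma> (\<alpha>v i) = of_nat (\<kappa> i))"
proof
  assume \<gamma>: "\<gamma> \<in> dominant_weights \<alpha>v"
  have "\<exists>k. \<gamma> (\<alpha>v i) = of_nat k" for i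
  proof -
    from \<gamma> obtain z where z: "\<gamma> (\<alpha>v i) = of_int z" by (auto simp: dominant_weights_def integral_weights_def elim!: Ints_cases)
    then have "z \<ge> 0" using \<gamma> by (auto simp: dominant_weights_def dest: spec[of _ i])
    with z have "\<gamma> (\<alpha>v i) = of_nat (nat z)" by simp
    then show ?thesis ..
  qed
  with \<gamma> show "clinear \<gamma> \<and> (\<exists>\<kappa>. \<forall>i. \<gamma> (\<alpha>v i) = of_nat (\<kappa> i))"
    by (auto simp: dominant_weights_def integral_weights_def intro: choice)
qed (auto simp: dominant_weights_def integral_weights_def)

text \<open>By \<open>weyl_chain\<close>, each of two dominant elements of one orbit arises from the
  other by subtracting simple roots; independence of the simple roots leaves only the empty
  sums.\<close>

lemma dominant_conjugate_eq:
  assumes "\<sigma> \<in> weyl_group \<alpha>v \<alpha>" "\<sigma> \<gamma> \<in> dominant_weights \<alpha>v"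
  shows "dominant_conjugate \<alpha>v \<alpha> \<gamma> = \<sigma> \<gamma>"
  unfolding dominant_conjugate_def
proof (rule the_equality)
  show "\<sigma> \<gamma> \<in> dominant_weights \<alpha>v \<and> (\<exists>\<tau>\<in>weyl_group \<alpha>v \<alpha>. \<sigma> \<gamma> = \<tau> \<gamma>)" using assms by blast
  have le: "\<exists>c. \<tau>' \<gamma> = \<tau> \<gamma> - asum c"
    if \<tau>: "\<tau> \<in> weyl_group \<alpha>v \<alpha>" "\<tau>' \<in> weyl_group \<alpha>v \<alpha>" "\<tau> \<gamma> \<in> dominant_weights \<alpha>v" for \<tau> \<tau>'
  proof -
    obtain \<rho> where \<rho>: "\<rho> \<in> weyl_group \<alpha>v \<alpha>" "\<rho> (\<tau> \<gamma>) = \<gamma>" using weyl_inverse[OF \<tau>(1)] by blast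
    from \<tau>(3) obtain \<kappa> where \<kappa>: "\<And>i. \<tau> \<gamma> (\<alpha>v i) = of_nat (\<kappa> i)" unfolding dominant_weights_iff by blast
    obtain x where "(\<tau>' \<circ> \<rho>) (\<tau> \<gamma>) = \<tau> \<gamma> - asum (cont x)"
      by (rule weyl_chain[where \<gamma>="\<tau> \<gamma>" and \<kappa>=\<kappa>, OF \<kappa> weyl_comp[OF \<tau>(2) \<rho>(1)]])
    with \<rho>(2) show ?thesis by auto
  qed
  fix \<nu> assume "\<nu> \<in> dominant_weights \<alpha>v \<and> (\<exists>\<tau>\<in>weyl_group \<alpha>v \<alpha>. \<nu> = \<tau> \<gamma>)"
  then obtain \<tau> where \<tau>: "\<tau> \<in> weyl_group \<alpha>v \<alpha>" "\<nu> = \<tau> \<gamma>" "\<tau> \<gamma> \<in> dominant_weights \<alpha>v" by blast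
  from le[OF assms(1) \<tau>(1) assms(2)] le[OF \<tau>(1) assms(1) \<tau>(3)] obtain c c' where
    c: "\<tau> \<gamma> = \<sigma> \<gamma> - asum c" "\<sigma> \<gamma> = \<tau> \<gamma> - asum c'" by blast
  have "asum (c + c') = \<sigma> \<gamma> - \<tau> \<gamma> + (\<tau> \<gamma> - \<sigma> \<gamma>)"
    unfolding asum_add using c by (metis add_diff_cancel_left' diff_add_cancel diff_diff_eq2)
  then have "asum (c + c') = asum {#}" by simp
  then show "\<nu> = \<sigma> \<gamma>" using c(1) \<tau>(2) unfolding asum_inj by simp
qed

text \<open>Reflecting a weight of V(\<kappa>) upwards keeps a nonzero vector of the new weight and
  shortens the degree, so a dominant weight below \<gamma> is reached.\<close>

lemma dominant_conjugate_weight: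
  assumes \<gamma>: "\<And>i. \<gamma> (\<alpha>v i) = of_nat (\<kappa> i)" "clinear \<gamma>" and "X \<in> Fc c" "X \<notin> Jk \<kappa>"
  obtains c' where "dominant_conjugate \<alpha>v \<alpha> (\<gamma> - asum c) = \<gamma> - asum c'"
proof -
  have "\<exists>\<sigma>\<in>weyl_group \<alpha>v \<alpha>. \<exists>c'. \<sigma> (\<gamma> - asum c) = \<gamma> - asum c' \<and> \<gamma> - asum c' \<in> dominant_weights \<alpha>v"
    using assms(3,4)
  proof (induction "size c" arbitrary: c X rule: less_induct)
    case less
    show ?case
    proof (cases "\<forall>i. pm i c \<le> int (\<kappa> i)")
      case True
      have 1: "(\<gamma> - asum c) (\<alpha>v i) = of_nat (nat (int (\<kappa> i) - pm i c))" for i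
        unfolding weight_coroot[where \<gamma>=\<gamma> and \<kappa>=\<kappa>, OF \<gamma>(1)] using True by (simp add: of_nat_nat)
      have 2: "clinear (\<gamma> - asum c)"
        using clinear_minus[OF \<gamma>(2) clinear_asum] by (simp add: fun_diff_def)
      have "\<gamma> - asum c \<in> dominant_weights \<alpha>v"
        unfolding dominant_weights_iff by (rule conjI[OF 2 exI], rule allI, rule 1)
      then show ?thesis by (intro bexI[of _ id] weyl_group.one) auto
    next
      case False
      then obtain i where i: "int (\<kappa> i) - pm i c < 0" by (auto simp: not_le)
      define n where "n = nat (pm i c - int (\<kappa> i))"
      have n: "int n = - (int (\<kappa> i) - pm i c)" using i by (simp add: n_def)
      from reflect_up[OF less.prems n] obtain c' where
        c': "c = replicate_mset n i + c'" "(EE (ik \<kappa>) i ^^ n) X \<in> Fc c'" "(EE (ik \<kappa>) i ^^ n) X \<notin> Jk \<kappa>" by metis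
      have "size c = n + size c'" by (subst c'(1)) simp
      then have "size c' < size c" using i by (simp add: n_def)
      from less.hyps[OF this c'(2,3)] obtain \<sigma> b where \<sigma>: "\<sigma> \<in> weyl_group \<alpha>v \<alpha>"
        "\<sigma> (\<gamma> - asum c') = \<gamma> - asum b" "\<gamma> - asum b \<in> dominant_weights \<alpha>v" by blast
      have "(\<gamma> - asum c) (\<alpha>v i) = - of_nat n"
        unfolding weight_coroot[where \<gamma>=\<gamma> and \<kappa>=\<kappa>, OF \<gamma>(1)] using arg_cong[OF n, of "of_int :: int \<Rightarrow> complex"] by simp
      then have "simple_reflection \<alpha>v \<alpha> i (\<gamma> - asum c) = \<gamma> - asum c + of_nat n *\<^sub>C \<alpha> i"
        by (simp add: simple_reflection_def)
      moreover have "asum c = of_nat n *\<^sub>C \<alpha> i + asum c'" by (subst c'(1)) (simp add: asum_add asum_replicate)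
      ultimately have "simple_reflection \<alpha>v \<alpha> i (\<gamma> - asum c) = \<gamma> - asum c'" by simp
      with \<sigma> show ?thesis
        by (intro bexI[OF _ weyl_comp[OF \<sigma>(1) simple_reflection_weyl[of i]]] exI[of _ b]) simp
    qed
  qed
  with dominant_conjugate_eq that show ?thesis by metis
qed

lemma weight_shift:
  assumes mod: "lie_module lb act" and x: "x \<in> weight_space \<iota> act \<delta>"
  shows "act (e i) x \<in> weight_space \<iota> act (\<delta> + \<alpha> i)" "act (f i) x \<in> weight_space \<iota> act (\<delta> - \<alpha> i)"
    "act (\<iota> h) x \<in> weight_space \<iota> act \<delta>"
proof -
  have lin: "clinear (act y)" "clinear (\<lambda>y. act y u)" for y u
    using mod by (auto simp: lie_module_def cbilinear_def)
  have br: "act y (act z u) = act (lb y z) u + act z (act y u)" for y z u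
    using mod by (simp add: lie_module_def)
  have x: "act (\<iota> h) x = \<delta> h *\<^sub>C x" for h using x by (simp add: weight_space_def)
  show "act (e i) x \<in> weight_space \<iota> act (\<delta> + \<alpha> i)"
    unfolding weight_space_def mem_Collect_eq br[of "\<iota> _"] bracket_cartan_e x
    by (simp add: clinear_scale[OF lin(1)] clinear_scale[OF lin(2)] scaleC_add_left add.commute)
  show "act (f i) x \<in> weight_space \<iota> act (\<delta> - \<alpha> i)"
    unfolding weight_space_def mem_Collect_eq br[of "\<iota> _"] generator_brackets x
    by (simp add: clinear_scale[OF lin(1)] clinear_scale[OF lin(2)] clinear_neg[OF lin(2)] complex_vector.scale_left_diff_distrib)
  show "act (\<iota> h) x \<in> weight_space \<iota> act \<delta>"
    by (simp add: weight_space_def x clinear_scale[OF lin(1)] scaleC_scaleC mult.commute)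
qed

text \<open>The map provided by Schur positivity is controlled only on the submodule, so weight
  components have to be found inside it.\<close>

lemma Ug_span_weights:
  assumes mod: "lie_module lb act" and k: "k \<in> weight_space \<iota> act \<gamma>"
  shows "Ug_span act k \<subseteq> cspan (\<Union>\<delta>. Ug_span act k \<inter> weight_space \<iota> act \<delta>)"
proof (rule Ug_span_minimal)
  have lin: "clinear (act y)" for y using mod by (auto simp: lie_module_def cbilinear_def)
  note K = submodule_Ug_span[of act k, OF lin]
  let ?S = "cspan (\<Union>\<delta>. Ug_span act k \<inter> weight_space \<iota> act \<delta>)"
  show "k \<in> ?S" using K(2) k by (intro complex_vector.span_base) blast
  have st: "act y u \<in> ?S" if "\<And>\<delta> u. u \<in> weight_space \<iota> act \<delta> \<Longrightarrow> \<exists>\<delta>'. act y u \<in> weight_space \<iota> act \<delta>'" "u \<in> ?S" for y u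
  proof (rule span_image_sub[OF lin _ _ that(2)])
    show "act y u \<in> ?S" if "u \<in> (\<Union>\<delta>. Ug_span act k \<inter> weight_space \<iota> act \<delta>)" for u
    proof (rule complex_vector.span_base)
      from that K(1) have "act y u \<in> Ug_span act k" by (auto simp: submodule_def)
      with that \<open>\<And>\<delta> u. u \<in> weight_space \<iota> act \<delta> \<Longrightarrow> \<exists>\<delta>'. act y u \<in> weight_space \<iota> act \<delta>'\<close>
      show "act y u \<in> (\<Union>\<delta>. Ug_span act k \<inter> weight_space \<iota> act \<delta>)" by blast
    qed
  qed (rule complex_vector.subspace_span)
  show "submodule act ?S"
  proof (rule generated_stable[OF mod complex_vector.subspace_span])
    show "act (e i) u \<in> ?S" if "u \<in> ?S" for i u by (rule st[OF _ that]) (blast intro: weight_shift[OF mod])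
    show "act (f i) u \<in> ?S" if "u \<in> ?S" for i u by (rule st[OF _ that]) (blast intro: weight_shift[OF mod])
    show "act (\<iota> h) u \<in> ?S" if "u \<in> ?S" for h u by (rule st[OF _ that]) (blast intro: weight_shift[OF mod])
  qed
qed

end

lemma clinear_applyD: "clinear \<Theta> \<Longrightarrow> clinear (\<lambda>t. \<Theta> t Y)"
  by (rule clinearI) (simp_all add: clinear_add clinear_scale)

locale tensor_pair =
  L: hw_module A d \<alpha>v \<alpha> lb \<iota> e f L u lam \<kappa> + M: hw_module A d \<alpha>v \<alpha> lb \<iota> e f M v mu m
  for A :: "int ^ 'n ^ 'n" and d :: "'n \<Rightarrow> real"
    and \<alpha>v :: "'n \<Rightarrow> 'h::complex_vector" and \<alpha> :: "'n \<Rightarrow> 'h \<Rightarrow> complex"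
    and lb :: "'g::complex_vector \<Rightarrow> 'g \<Rightarrow> 'g" and \<iota> :: "'h \<Rightarrow> 'g" and e f :: "'n \<Rightarrow> 'g"
    and L :: "'g \<Rightarrow> 'l::complex_vector \<Rightarrow> 'l" and u :: 'l and lam :: "'h \<Rightarrow> complex" and \<kappa> :: "'n \<Rightarrow> nat"
    and M :: "'g \<Rightarrow> 'm::complex_vector \<Rightarrow> 'm" and v :: 'm and mu :: "'h \<Rightarrow> complex" and m :: "'n \<Rightarrow> nat"
begin

abbreviation T :: "'g \<Rightarrow> ('l, 'm) tensor \<Rightarrow> ('l, 'm) tensor" where "T \<equiv> tensor_action L M"

lemmas T_tens = tensor_action_tens(1)[OF L.mod M.mod] and lin_T = tensor_action_tens(2)[OF L.mod M.mod]
lemmas mod_T = lie_module_tensor[OF L.mod M.mod]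

lemma ev_eqI:
  assumes "clinear F" "clinear G" "\<And>X Y. F (L.ev X \<otimes>\<^sub>C M.ev Y) = G (L.ev X \<otimes>\<^sub>C M.ev Y)"
  shows "F t = G t"
proof (rule tensor_eqI[OF assms(1,2)])
  fix x y
  obtain X Y where "x = L.ev X" "y = M.ev Y" using L.range_ev M.range_ev by (metis surjD)
  with assms(3) show "F (x \<otimes>\<^sub>C y) = G (x \<otimes>\<^sub>C y)" by simp
qed

lemma word_subI:
  assumes "clinear F" "csubspace S" "\<And>a b. F (L.ev (wd a) \<otimes>\<^sub>C M.ev (wd b)) \<in> S"
  shows "F t \<in> S"
proof (rule tensor_subI[OF assms(1,2)])
  fix x y
  obtain X Y where xy: "x = L.ev X" "y = M.ev Y" using L.range_ev M.range_ev by (metis surjD)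
  have "F (L.ev (wd a) \<otimes>\<^sub>C M.ev Y) \<in> S" for a
    by (intro clinear_sub_singleI[where X = Y and f = "\<lambda>Y. F (L.ev (wd a) \<otimes>\<^sub>C M.ev Y)", OF _ assms(2)] assms(3)
        clinear_comps[OF assms(1)] clinear_tens2 M.lin_ev)
  then show "F (x \<otimes>\<^sub>C y) \<in> S" unfolding xy
    by (intro clinear_sub_singleI[where X = X and f = "\<lambda>X. F (L.ev X \<otimes>\<^sub>C M.ev Y)", OF _ assms(2)] clinear_comps[OF assms(1)] clinear_tens1 L.lin_ev)
qed

lemma tensor_weight_le:
  assumes "t \<in> weight_space \<iota> T \<delta>" "t \<noteq> 0"
  obtains c where "\<delta> = lam + mu - L.asum c"
proof -
  have "t = 0" if *: "\<delta> \<notin> {lam + mu - L.asum c | c. True}"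
  proof (rule weight_separation[OF lin_T _ assms(1) *])
    show "t \<in> cspan (\<Union>\<delta>\<in>{lam + mu - L.asum c | c. True}. weight_space \<iota> T \<delta>)"
    proof (rule word_subI[OF clinear_id complex_vector.subspace_span])
      fix a b
      have "L.ev (wd a) \<otimes>\<^sub>C M.ev (wd b) \<in> weight_space \<iota> T ((lam - L.asum (mset a)) + (mu - L.asum (mset b)))"
        by (intro tensor_weight[OF L.mod M.mod] L.ev_weight M.ev_weight L.wd_Fc HOL.refl)
      also have "(lam - L.asum (mset a)) + (mu - L.asum (mset b)) = lam + mu - L.asum (mset a + mset b)"
        by (simp add: L.asum_add)
      finally show "L.ev (wd a) \<otimes>\<^sub>C M.ev (wd b) \<in> cspan (\<Union>\<delta>\<in>{lam + mu - L.asum c | c. True}. weight_space \<iota> T \<delta>)"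
        by (intro complex_vector.span_base) blast
    qed
  qed
  with assms(2) that show ?thesis by blast
qed

text \<open>The homomorphism to the dual of a Verma module, with image \<open>L(\<nu>)\<close>, induced by \<open>\<Phi>\<close>.\<close>

lemma tensor_functional:
  assumes t: "L.tri \<kappa> m \<beta> \<nu> \<Phi>"
  obtains \<Theta> :: "('l, 'm) tensor \<Rightarrow> 'n falg \<Rightarrow> complex" where
    "clinear \<Theta>" "\<And>X Y. \<Theta> (L.ev X \<otimes>\<^sub>C M.ev Y) = L.SS (L.ik \<nu>) (\<Phi> X Y)"
    "\<And>t. \<Theta> t \<in> range (L.SS (L.ik \<nu>))"
    "\<And>i t Z. \<Theta> (T (e i) t) Z = \<Theta> t (wd [i] * Z)" "\<And>i t Z. \<Theta> (T (f i) t) Z = \<Theta> t (L.EE (L.ik \<nu>) i Z)"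
    "\<And>h t w. \<Theta> (T (\<iota> h) t) (wd w) = (lam + mu - L.asum (\<beta> + mset w)) h *\<^sub>C \<Theta> t (wd w)"
proof -
  let ?S = "\<lambda>X. L.SS (L.ik \<nu>) X"
  have lS: "clinear ?S"
    by (rule clinearI) (simp_all add: fun_eq_iff clinear_add[OF L.lin_SS1] clinear_scale[OF L.lin_SS1])
  \<comment> \<open>Defined through chosen preimages under \<open>ev\<close>; changing them by
    elements of \<open>Jk\<close> changes \<Phi> only within \<open>Jk \<nu>\<close>, the radical of
    the form.\<close>
  define B where "B x y = ?S (\<Phi> (inv L.ev x) (inv M.ev y))" for x y
  have B: "B (L.ev X) (M.ev Y) = ?S (\<Phi> X Y)" for X Y
  proof -
    have "inv L.ev (L.ev X) - 1 *\<^sub>C X \<in> L.Jk \<kappa>" "inv M.ev (M.ev Y) - 1 *\<^sub>C Y \<in> L.Jk m"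
      unfolding L.ev_eq_0_iff[symmetric] M.ev_eq_0_iff[symmetric]
      by (simp_all add: clinear_diff[OF L.lin_ev] clinear_diff[OF M.lin_ev] surj_f_inv_f[OF L.range_ev] surj_f_inv_f[OF M.range_ev])
    from L.Jk_trans[OF L.tri_cong_Jk1[OF t this(1)] L.tri_cong_Jk2[OF t this(2)]]
    have "?S (\<Phi> (inv L.ev (L.ev X)) (inv M.ev (M.ev Y)) - \<Phi> X Y) = 0"
      by (simp add: fun_eq_iff L.SS_Jk)
    then show ?thesis by (simp add: B_def clinear_diff[OF lS])
  qed
  have lB2: "clinear (\<lambda>Y. ?S (\<Phi> X Y))" and lB1: "clinear (\<lambda>X. ?S (\<Phi> X Y))" for X Y
    using L.tri_lin1[OF t] L.tri_lin2[OF t] by (auto intro: clinear_comps[OF lS])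
  have "cbilinear B"
  proof (rule cbilinearI)
    show "clinear (B x)" for x
    proof (rule clinearI)
      fix y y' and c
      obtain X Y Y' where xy: "x = L.ev X" "y = M.ev Y" "y' = M.ev Y'" using L.range_ev M.range_ev by (metis surjD)
      show "B x (y + y') = B x y + B x y'" "B x (c *\<^sub>C y) = c *\<^sub>C B x y"
        unfolding xy clinear_add[OF M.lin_ev, symmetric] clinear_scale[OF M.lin_ev, symmetric] B
        by (rule clinear_add[OF lB2], rule clinear_scale[OF lB2])
    qed
    show "clinear (\<lambda>x. B x y)" for y
    proof (rule clinearI)
      fix x x' and c
      obtain X X' Y where xy: "x = L.ev X" "x' = L.ev X'" "y = M.ev Y" using L.range_ev M.range_ev by (metis surjD)
      show "B (x + x') y = B x y + B x' y" "B (c *\<^sub>C x) y = c *\<^sub>C B x y"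
        unfolding xy clinear_add[OF L.lin_ev, symmetric] clinear_scale[OF L.lin_ev, symmetric] B
        by (rule clinear_add[OF lB1], rule clinear_scale[OF lB1])
    qed
  qed
  note \<Theta> = clinear_tensor_lift[OF this] tensor_lift_tens[OF this]
  let ?T = "tensor_lift B"
  have ev: "?T (L.ev X \<otimes>\<^sub>C M.ev Y) = ?S (\<Phi> X Y)" for X Y by (simp add: \<Theta>(2) B)
  note l\<Theta> = clinear_applyD[OF \<Theta>(1)]
  note l\<Theta>T = clinear_comps[OF l\<Theta> lin_T]
  have "?T (T (e i) t) Z = ?T t (wd [i] * Z)" for i t Z
  proof (rule ev_eqI[where t = t, OF l\<Theta>T l\<Theta>])
    fix X Y
    have "?S (L.EE (L.ik \<nu>) i (\<Phi> X Y) - (\<Phi> (L.EE (L.ik \<kappa>) i X) Y + \<Phi> X (L.EE (L.ik m) i Y))) Z = 0"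
      by (rule L.SS_Jk[OF L.tri_EE[OF t]])
    then show "?T (T (e i) (L.ev X \<otimes>\<^sub>C M.ev Y)) Z = ?T (L.ev X \<otimes>\<^sub>C M.ev Y) (wd [i] * Z)"
      unfolding T_tens L.ev_e[symmetric] M.ev_e[symmetric] clinear_add[OF \<Theta>(1)] ev
      by (simp add: clinear_diff[OF lS] clinear_add[OF lS] L.SS_EE1)
  qed
  moreover have "?T (T (f i) t) Z = ?T t (L.EE (L.ik \<nu>) i Z)" for i t Z
  proof (rule ev_eqI[where t = t, OF l\<Theta>T l\<Theta>])
    fix X Y
    have "?S (wd [i] * \<Phi> X Y - (\<Phi> (wd [i] * X) Y + \<Phi> X (wd [i] * Y))) Z = 0"
      by (rule L.SS_Jk[OF L.tri_f[OF t]])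
    then show "?T (T (f i) (L.ev X \<otimes>\<^sub>C M.ev Y)) Z = ?T (L.ev X \<otimes>\<^sub>C M.ev Y) (L.EE (L.ik \<nu>) i Z)"
      unfolding T_tens L.ev_f[symmetric] M.ev_f[symmetric] clinear_add[OF \<Theta>(1)] ev
      by (simp add: clinear_diff[OF lS] clinear_add[OF lS] L.SS_EE2)
  qed
  moreover have "?T (T (\<iota> h) t) (wd w) = (lam + mu - L.asum (\<beta> + mset w)) h *\<^sub>C ?T t (wd w)" for h t w
  proof -
    have "?T (T (\<iota> h) t) (wd w) - (lam + mu - L.asum (\<beta> + mset w)) h *\<^sub>C ?T t (wd w) \<in> {0}"
    proof (rule word_subI[where t = t, OF clinear_minus[OF l\<Theta>T clinear_smult[OF l\<Theta>]] complex_vector.subspace_single_0])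
      fix a b
      have "L.ev (wd a) \<otimes>\<^sub>C M.ev (wd b) \<in> weight_space \<iota> T ((lam - L.asum (mset a)) + (mu - L.asum (mset b)))"
        by (intro tensor_weight[OF L.mod M.mod] L.ev_weight M.ev_weight L.wd_Fc HOL.refl)
      also have "(lam - L.asum (mset a)) + (mu - L.asum (mset b)) = lam + mu - L.asum (mset a + mset b)"
        by (simp add: L.asum_add)
      finally have "?T (T (\<iota> h) (L.ev (wd a) \<otimes>\<^sub>C M.ev (wd b))) = (lam + mu - L.asum (mset a + mset b)) h *\<^sub>C ?S (\<Phi> (wd a) (wd b))"
        by (simp add: weight_space_def clinear_scale[OF \<Theta>(1)] ev)
      moreover have "\<beta> + mset w = mset a + mset b" if "?S (\<Phi> (wd a) (wd b)) (wd w) \<noteq> 0"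
      proof -
        have nz: "L.ecoef (L.ik \<nu>) w (\<Phi> (wd a) (wd b)) \<noteq> 0" using that by (simp add: L.SS_def)
        note F = L.wd_Fc[OF HOL.refl, of a] L.wd_Fc[OF HOL.refl, of b]
        have sub: "\<beta> \<subseteq># mset a + mset b"
        proof (rule ccontr)
          assume "\<not> ?thesis"
          from L.tri_Fc0[OF t F this] nz show False by (simp add: clinear_zero[OF L.lin_ecoef])
        qed
        from L.ecoef_Fc[OF L.tri_Fc[OF t F sub] nz] sub show ?thesis by simp
      qed
      ultimately show "?T (T (\<iota> h) (L.ev (wd a) \<otimes>\<^sub>C M.ev (wd b))) (wd w)
          - (lam + mu - L.asum (\<beta> + mset w)) h *\<^sub>C ?T (L.ev (wd a) \<otimes>\<^sub>C M.ev (wd b)) (wd w) \<in> {0}"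
        unfolding ev by (cases "?S (\<Phi> (wd a) (wd b)) (wd w) = 0") auto
    qed
    then show ?thesis by simp
  qed
  moreover have "?T t \<in> range ?S" for t
  proof (rule word_subI[OF \<Theta>(1)])
    show "csubspace (range ?S)"
      using lS by (auto simp: complex_vector.subspace_def clinear_add[symmetric] clinear_scale[symmetric] clinear_zero
          intro: range_eqI[of _ ?S 0])
  qed (simp add: ev)
  ultimately show ?thesis using that[OF \<Theta>(1) ev] by blast
qed

text \<open>A tensor in the quotient construction is shown to be nonzero by a functional, here from
  the homomorphism to V(\<kappa> + m).\<close>

lemma highest_nonzero: "u \<otimes>\<^sub>C v \<noteq> 0"
proof
  assume z: "u \<otimes>\<^sub>C v = 0"
  obtain \<Phi> where \<Phi>: "L.tri \<kappa> m {#} (\<lambda>i. \<kappa> i + m i) \<Phi>" "\<Phi> 1 1 \<notin> L.Jk (\<lambda>i. \<kappa> i + m i)"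
    using L.tri_dominant[of m "[]" "\<lambda>i. \<kappa> i + m i" \<kappa>] by (auto simp: wd_Nil)
  from tensor_functional[OF \<Phi>(1)] obtain \<Theta> :: "('l, 'm) tensor \<Rightarrow> 'n falg \<Rightarrow> complex" where
    "clinear \<Theta>" "\<And>X Y. \<Theta> (L.ev X \<otimes>\<^sub>C M.ev Y) = L.SS (L.ik (\<lambda>i. \<kappa> i + m i)) (\<Phi> X Y)" by metis
  then have "L.SS (L.ik (\<lambda>i. \<kappa> i + m i)) (\<Phi> 1 1) = 0" using z by (metis L.ev_one M.ev_one clinear_zero)
  with L.Jk_SS \<Phi>(2) show False by (metis zero_fun_def)
qed

text \<open>Every e_i kills \<open>u\<close>, so on \<open>u \<otimes>\<^sub>C M.ev X\<close> it
  acts through the second factor alone, and the word \<open>w\<close> of raising operators leads to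
  the highest weight vector.\<close>

lemma raise_to_highest:
  assumes K: "submodule T K"
  shows "u \<otimes>\<^sub>C M.ev X \<in> K \<Longrightarrow> X \<in> L.Fc c \<Longrightarrow> L.ecoef (L.ik m) w X \<noteq> 0 \<Longrightarrow> u \<otimes>\<^sub>C v \<in> K"
proof (induction w arbitrary: X c)
  case Nil
  have l: "clinear (\<lambda>y. u \<otimes>\<^sub>C y)" by (intro clinear_tens2 clinear_id)
  have "X \<in> L.Fc {#}" using L.ecoef_Fc[OF Nil(2,3)] Nil(2) by simp
  then have "u \<otimes>\<^sub>C M.ev X = Poly_Mapping.lookup X [] *\<^sub>C (u \<otimes>\<^sub>C v)"
    using L.Fc_empty by (metis M.ev_one clinear_scale[OF M.lin_ev] clinear_scale[OF l])
  then have "u \<otimes>\<^sub>C v = (1 / Poly_Mapping.lookup X []) *\<^sub>C (u \<otimes>\<^sub>C M.ev X)" using Nil(3) by (simp add: scaleC_scaleC)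
  with Nil(1) K show ?case by (simp add: submodule_def complex_vector.subspace_scale)
next
  case (Cons i w)
  have "T (e i) (u \<otimes>\<^sub>C M.ev X) = u \<otimes>\<^sub>C M.ev (L.EE (L.ik m) i X)"
    using clinear_zero[OF clinear_tens1[OF clinear_id], of "M.ev X"] by (simp add: T_tens L.v(3) M.ev_e)
  then have 1: "u \<otimes>\<^sub>C M.ev (L.EE (L.ik m) i X) \<in> K" using Cons.prems(1) K by (metis submodule_def)
  have "i \<in># c" using L.EE_Fc0[OF Cons.prems(2), of i "L.ik m"] Cons.prems(3)
    by (cases "i \<in># c") (auto simp: clinear_zero[OF L.lin_ecoef])
  from Cons.IH[OF 1 L.EE_Fc[OF Cons.prems(2) this]] Cons.prems(3) show ?case by simp
qed

end

text \<open>The symmetrizing numbers may be complex. As off-diagonal entries are nonpositive, taking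
  absolute values in the symmetry relation loses nothing and gives positive reals.\<close>

lemma symmetrizable_km:
  fixes A :: "int ^ 'n ^ 'n"
  assumes "generalized_cartan_matrix A" "symmetrizable A"
  obtains d where "km A d"
proof -
  from assms(2) obtain D B where D: "\<And>i. D i \<noteq> 0" and B: "transpose B = B"
    and AB: "complex_matrix A = (\<chi> i j. if i = j then D i else 0) ** B"
    unfolding symmetrizable_def by blast
  have A: "of_int (A $ i $ j) = D i * B $ i $ j" for i j
  proof -
    have "of_int (A $ i $ j) = complex_matrix A $ i $ j" by (simp add: complex_matrix_def)
    also have "\<dots> = (\<Sum>k\<in>UNIV. (if i = k then D i else 0) * B $ k $ j)"
      by (simp add: AB matrix_matrix_mult_def)
    also have "\<dots> = (\<Sum>k\<in>UNIV. if i = k then D i * B $ k $ j else 0)"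
      by (rule sum.cong) auto
    finally show ?thesis by simp
  qed
  have "B $ i $ j = B $ j $ i" for i j
    using arg_cong[OF B, of "\<lambda>B. B $ j $ i"] by (simp add: transpose_def)
  then have "of_int (A $ i $ j) / D i = of_int (A $ j $ i) / D j" for i j
    using A[of i j] A[of j i] D by simp
  then have n: "real_of_int \<bar>A $ i $ j\<bar> / cmod (D i) = real_of_int \<bar>A $ j $ i\<bar> / cmod (D j)" for i j
    by (metis norm_divide norm_of_int of_int_abs)
  show ?thesis
  proof (rule that[of "\<lambda>i. 1 / cmod (D i)"], unfold_locales)
    show "A $ i $ i = 2" "i \<noteq> j \<Longrightarrow> A $ i $ j \<le> 0" "A $ i $ j = 0 \<Longrightarrow> A $ j $ i = 0" for i j
      using assms(1) by (auto simp: generalized_cartan_matrix_def)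
    show "1 / cmod (D i) > 0" for i using D by simp
    show "1 / cmod (D i) * of_int (A $ i $ j) = 1 / cmod (D j) * of_int (A $ j $ i)" for i j
    proof (cases "i = j")
      case False
      then have "A $ i $ j \<le> 0" "A $ j $ i \<le> 0" using assms(1) unfolding generalized_cartan_matrix_def by metis+
      with n[of i j] show ?thesis by simp
    qed simp
  qed
qed

lemma (in kac_moody) is_V_hw_module:
  assumes "is_V lb \<iota> e f act \<gamma>" "\<gamma> \<in> dominant_weights \<alpha>v"
  obtains v \<kappa> where "hw_module A d \<alpha>v \<alpha> lb \<iota> e f act v \<gamma> \<kappa>"
proof -
  from assms(2) obtain \<kappa> where \<kappa>: "\<And>i. \<gamma> (\<alpha>v i) = of_nat (\<kappa> i)" unfolding dominant_weights_iff by blast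
  from assms(1) obtain v where "v \<noteq> 0" "v \<in> weight_space \<iota> act \<gamma>" "\<And>i. act (e i) v = 0" "Ug_span act v = UNIV"
    unfolding is_V_def highest_weight_module_def by blast
  with assms(1) \<kappa> have "hw_module A d \<alpha>v \<alpha> lb \<iota> e f act v \<gamma> \<kappa>"
    by (intro hw_module.intro kac_moody_axioms hw_module_axioms.intro) (auto simp: is_V_def)
  with that show ?thesis .
qed

theorem proposition6p1:
  fixes A :: "int ^ 'n ^ 'n"
    and \<alpha>v :: "'n \<Rightarrow> 'h::complex_vector" and \<alpha> :: "'n \<Rightarrow> 'h \<Rightarrow> complex"
    and br :: "'g::complex_vector \<Rightarrow> 'g \<Rightarrow> 'g"
    and \<iota> :: "'h \<Rightarrow> 'g" and e f :: "'n \<Rightarrow> 'g"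
    and lam\<^sub>1 lam\<^sub>2 \<mu>\<^sub>1 \<mu>\<^sub>2 :: "'h \<Rightarrow> complex"
    and w\<^sub>1 w\<^sub>2 :: "('h \<Rightarrow> complex) \<Rightarrow> 'h \<Rightarrow> complex"
    and L\<^sub>1 :: "'g \<Rightarrow> 'l1::complex_vector \<Rightarrow> 'l1" and M\<^sub>1 :: "'g \<Rightarrow> 'm1::complex_vector \<Rightarrow> 'm1"
    and L\<^sub>2 :: "'g \<Rightarrow> 'l2::complex_vector \<Rightarrow> 'l2" and M\<^sub>2 :: "'g \<Rightarrow> 'm2::complex_vector \<Rightarrow> 'm2"
    and u\<^sub>1 :: 'l1 and v\<^sub>1 :: 'm1 and u\<^sub>2 :: 'l2 and v\<^sub>2 :: 'm2
  assumes "kac_moody_algebra A \<alpha>v \<alpha> br \<iota> e f" and "symmetrizable A"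
    and "lam\<^sub>1 \<in> dominant_weights \<alpha>v" and "lam\<^sub>2 \<in> dominant_weights \<alpha>v"
    and "\<mu>\<^sub>1 \<in> dominant_weights \<alpha>v" and "\<mu>\<^sub>2 \<in> dominant_weights \<alpha>v"
    and "w\<^sub>1 \<in> weyl_group \<alpha>v \<alpha>" and "w\<^sub>2 \<in> weyl_group \<alpha>v \<alpha>"
    and "is_V br \<iota> e f L\<^sub>1 lam\<^sub>1" and "is_V br \<iota> e f M\<^sub>1 \<mu>\<^sub>1"
    and "is_V br \<iota> e f L\<^sub>2 lam\<^sub>2" and "is_V br \<iota> e f M\<^sub>2 \<mu>\<^sub>2"
    and "u\<^sub>1 \<in> weight_space \<iota> L\<^sub>1 lam\<^sub>1" and "u\<^sub>1 \<noteq> 0"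
    and "v\<^sub>1 \<in> weight_space \<iota> M\<^sub>1 (w\<^sub>1 \<mu>\<^sub>1)" and "v\<^sub>1 \<noteq> 0"
    and "u\<^sub>2 \<in> weight_space \<iota> L\<^sub>2 lam\<^sub>2" and "u\<^sub>2 \<noteq> 0"
    and "v\<^sub>2 \<in> weight_space \<iota> M\<^sub>2 (w\<^sub>2 \<mu>\<^sub>2)" and "v\<^sub>2 \<noteq> 0"
    and "schur_positive (tensor_action L\<^sub>1 M\<^sub>1) (kostant_kumar L\<^sub>1 M\<^sub>1 u\<^sub>1 v\<^sub>1)
           (tensor_action L\<^sub>2 M\<^sub>2) (kostant_kumar L\<^sub>2 M\<^sub>2 u\<^sub>2 v\<^sub>2)"
  shows "weight_ge \<alpha> (lam\<^sub>1 + \<mu>\<^sub>1) (lam\<^sub>2 + \<mu>\<^sub>2) \<and>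
    weight_ge \<alpha> (lam\<^sub>2 + \<mu>\<^sub>2) (dominant_conjugate \<alpha>v \<alpha> (lam\<^sub>2 + w\<^sub>2 \<mu>\<^sub>2)) \<and>
    weight_ge \<alpha> (dominant_conjugate \<alpha>v \<alpha> (lam\<^sub>2 + w\<^sub>2 \<mu>\<^sub>2))
      (dominant_conjugate \<alpha>v \<alpha> (lam\<^sub>1 + w\<^sub>1 \<mu>\<^sub>1))"
proof -
  obtain d where d: "km A d"
    using symmetrizable_km assms(1,2) unfolding kac_moody_algebra_def by blast
  interpret K: kac_moody A d \<alpha>v \<alpha> br \<iota> e f
    by (intro kac_moody.intro d kac_moody_axioms.intro assms)
  obtain x1 k1 where L1: "hw_module A d \<alpha>v \<alpha> br \<iota> e f L\<^sub>1 x1 lam\<^sub>1 k1" by (rule K.is_V_hw_module[OF assms(9,3)])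
  obtain y1 m1 where M1: "hw_module A d \<alpha>v \<alpha> br \<iota> e f M\<^sub>1 y1 \<mu>\<^sub>1 m1" by (rule K.is_V_hw_module[OF assms(10,5)])
  obtain x2 k2 where L2: "hw_module A d \<alpha>v \<alpha> br \<iota> e f L\<^sub>2 x2 lam\<^sub>2 k2" by (rule K.is_V_hw_module[OF assms(11,4)])
  obtain y2 m2 where M2: "hw_module A d \<alpha>v \<alpha> br \<iota> e f M\<^sub>2 y2 \<mu>\<^sub>2 m2" by (rule K.is_V_hw_module[OF assms(12,6)])
  interpret P1: tensor_pair A d \<alpha>v \<alpha> br \<iota> e f L\<^sub>1 x1 lam\<^sub>1 k1 M\<^sub>1 y1 \<mu>\<^sub>1 m1 by (intro tensor_pair.intro L1 M1)
  interpret P2: tensor_pair A d \<alpha>v \<alpha> br \<iota> e f L\<^sub>2 x2 lam\<^sub>2 k2 M\<^sub>2 y2 \<mu>\<^sub>2 m2 by (intro tensor_pair.intro L2 M2)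
  define K1 where "K1 = kostant_kumar L\<^sub>1 M\<^sub>1 u\<^sub>1 v\<^sub>1"
  define K2 where "K2 = kostant_kumar L\<^sub>2 M\<^sub>2 u\<^sub>2 v\<^sub>2"
  have K1: "submodule P1.T K1" "u\<^sub>1 \<otimes>\<^sub>C v\<^sub>1 \<in> K1"
    unfolding K1_def kostant_kumar_def by (intro submodule_Ug_span P1.lin_T)+
  have K2: "submodule P2.T K2" "u\<^sub>2 \<otimes>\<^sub>C v\<^sub>2 \<in> K2"
    unfolding K2_def kostant_kumar_def by (intro submodule_Ug_span P2.lin_T)+
  from assms(21) obtain \<phi> where \<phi>: "\<And>s t. s \<in> K1 \<Longrightarrow> t \<in> K1 \<Longrightarrow> \<phi> (s + t) = \<phi> s + \<phi> t"
    "\<And>c t. t \<in> K1 \<Longrightarrow> \<phi> (c *\<^sub>C t) = c *\<^sub>C \<phi> t"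
    "\<And>x t. t \<in> K1 \<Longrightarrow> \<phi> (P1.T x t) = P2.T x (\<phi> t)" "\<phi> ` K1 = K2"
    unfolding schur_positive_def K1_def[symmetric] K2_def[symmetric] by blast
  have sK1: "csubspace K1" using K1 by (simp add: submodule_def)
  have \<phi>0: "\<phi> 0 = 0" using \<phi>(2)[of 0 0] complex_vector.subspace_0[OF sK1] by simp
  have \<phi>_sub: "csubspace {s \<in> K1. \<phi> s \<in> S}" if "csubspace S" for S
    using sK1 that \<phi> \<phi>0 by (auto simp: complex_vector.subspace_def)
  have \<phi>_weight: "\<phi> s \<in> weight_space \<iota> P2.T \<delta>" if "s \<in> K1" "s \<in> weight_space \<iota> P1.T \<delta>" for s \<delta>
    using that by (simp add: weight_space_def \<phi>(2,3)[symmetric])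
  have k1: "u\<^sub>1 \<otimes>\<^sub>C v\<^sub>1 \<in> weight_space \<iota> P1.T (lam\<^sub>1 + w\<^sub>1 \<mu>\<^sub>1)"
    by (intro tensor_weight[OF P1.L.mod P1.M.mod] assms)

  obtain x where x: "K.chain m2 x" "w\<^sub>2 \<mu>\<^sub>2 = \<mu>\<^sub>2 - K.asum (K.cont x)"
    by (rule K.weyl_chain[where \<gamma>=\<mu>\<^sub>2 and \<kappa>=m2, OF P2.M.\<gamma> assms(8)])
  obtain a where a: "u\<^sub>2 = a *\<^sub>C x2" by (rule P2.L.highest_weight_vector[OF assms(17)])
  obtain b where b: "v\<^sub>2 = b *\<^sub>C P2.M.ev (K.zz x)"
    by (rule P2.M.extremal_weight_vector[OF assms(19)[unfolded x(2)] x(1)])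
  have ab: "a \<noteq> 0" "b \<noteq> 0" using a b assms(18,20) by auto
  have k2: "u\<^sub>2 \<otimes>\<^sub>C v\<^sub>2 = (a * b) *\<^sub>C (x2 \<otimes>\<^sub>C P2.M.ev (K.zz x))"
    unfolding a b
    by (simp only: clinear_scale[OF clinear_tens1[OF clinear_id]] clinear_scale[OF clinear_tens2[OF clinear_id]] scaleC_scaleC mult.commute)

  \<comment> \<open>All weights of the first Kostant--Kumar module, hence of its image, lie below
    \<open>lam\<^sub>1 + \<mu>\<^sub>1\<close>, and the image contains the highest weight vector of
    the second tensor product.\<close>
  have 1: "weight_ge \<alpha> (lam\<^sub>1 + \<mu>\<^sub>1) (lam\<^sub>2 + \<mu>\<^sub>2)"
  proof -
    let ?D = "{lam\<^sub>1 + \<mu>\<^sub>1 - K.asum c | c. True}"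
    let ?S = "cspan (\<Union>\<delta>\<in>?D. weight_space \<iota> P2.T \<delta>)"
    have "K1 \<subseteq> {s \<in> K1. \<phi> s \<in> ?S}"
    proof (rule subset_trans)
      show "K1 \<subseteq> cspan (\<Union>\<delta>. K1 \<inter> weight_space \<iota> P1.T \<delta>)"
        using K.Ug_span_weights[OF P1.mod_T k1] by (simp add: K1_def kostant_kumar_def)
      show "cspan (\<Union>\<delta>. K1 \<inter> weight_space \<iota> P1.T \<delta>) \<subseteq> {s \<in> K1. \<phi> s \<in> ?S}"
      proof (rule complex_vector.span_minimal[OF _ \<phi>_sub[OF complex_vector.subspace_span]])
        show "(\<Union>\<delta>. K1 \<inter> weight_space \<iota> P1.T \<delta>) \<subseteq> {s \<in> K1. \<phi> s \<in> ?S}"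
        proof
          fix s assume "s \<in> (\<Union>\<delta>. K1 \<inter> weight_space \<iota> P1.T \<delta>)"
          then obtain \<delta> where s: "s \<in> K1" "s \<in> weight_space \<iota> P1.T \<delta>" by blast
          have "\<phi> s \<in> ?S"
          proof (cases "s = 0")
            case False
            then obtain c where "\<delta> = lam\<^sub>1 + \<mu>\<^sub>1 - K.asum c" by (rule P1.tensor_weight_le[OF s(2)])
            with \<phi>_weight[OF s] show ?thesis by (intro complex_vector.span_base) blast
          qed (simp add: \<phi>0 complex_vector.span_zero)
          with s show "s \<in> {s \<in> K1. \<phi> s \<in> ?S}" by simp
        qed
      qed
    qed
    then have S: "K2 \<subseteq> ?S" using \<phi>(4) by blast
    have "(1 / (a * b)) *\<^sub>C (u\<^sub>2 \<otimes>\<^sub>C v\<^sub>2) \<in> K2"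
      using K2 by (simp add: submodule_def complex_vector.subspace_scale)
    then have "x2 \<otimes>\<^sub>C P2.M.ev (K.zz x) \<in> K2" unfolding k2 using ab by (simp add: scaleC_scaleC)
    moreover obtain w where "K.ecoef (K.ik m2) w (K.zz x) \<noteq> 0"
      using K.Rad_Jk K.chain_extremal(2)[OF x(1)] by blast
    ultimately have "x2 \<otimes>\<^sub>C y2 \<in> ?S" using S P2.raise_to_highest[OF K2(1) _ K.zz_Fc] by blast
    moreover have "x2 \<otimes>\<^sub>C y2 \<in> weight_space \<iota> P2.T (lam\<^sub>2 + \<mu>\<^sub>2)"
      by (intro tensor_weight[OF P2.L.mod P2.M.mod] P2.L.v P2.M.v)
    ultimately have "lam\<^sub>2 + \<mu>\<^sub>2 \<in> ?D"
      using weight_separation[where act = P2.T, OF P2.lin_T] P2.highest_nonzero by blast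
    then show ?thesis using K.weight_ge_asum by auto
  qed

  obtain \<beta> \<nu> \<Phi> where t: "K.tri k2 m2 \<beta> \<nu> \<Phi>" and nz: "\<Phi> 1 (K.zz x) \<notin> K.Jk \<nu>"
    and q: "K.qq (K.ik \<nu>) (K.cont x - \<beta>) = 0"
    using K.prv[OF x(1), of k2 1] by (auto simp: K.scale_1)
  \<comment> \<open>The highest weight of the target of \<Phi>, shown below to be the dominant
    conjugate of \<open>lam\<^sub>2 + w\<^sub>2 \<mu>\<^sub>2\<close>.\<close>
  define N where "N = lam\<^sub>2 + \<mu>\<^sub>2 - K.asum \<beta>"
  have N: "N (\<alpha>v i) = of_nat (\<nu> i)" for i
  proof -
    have "(of_nat (\<nu> i) :: complex) = of_int (int (\<nu> i))" by simp
    then show ?thesis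
      unfolding K.tri_nu[OF t] by (simp add: N_def P2.L.\<gamma> P2.M.\<gamma> K.asum_coroot)
  qed
  have linN: "clinear N"
    using assms(4,6) K.clinear_asum unfolding N_def fun_diff_def plus_fun_def K.dominant_weights_iff
    by (intro clinear_minus clinear_plus) auto
  have Ndom: "N \<in> dominant_weights \<alpha>v" unfolding K.dominant_weights_iff using linN N by blast
  have sub: "\<beta> \<subseteq># K.cont x"
  proof (rule ccontr)
    assume "\<not> ?thesis"
    then have "\<Phi> 1 (K.zz x) = 0" by (intro K.tri_Fc0[OF t K.one_Fc K.zz_Fc]) simp
    with nz show False by (simp add: complex_vector.subspace_0[OF K.Jk_subspace])
  qed
  have "\<Phi> 1 (K.zz x) \<in> K.Fc (K.cont x - \<beta>)"
    using K.tri_Fc[OF t K.one_Fc K.zz_Fc] sub by simp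
  from K.chain_exists[OF this nz q] obtain y where y: "K.chain \<nu> y" "K.cont y = K.cont x - \<beta>" by blast
  obtain \<sigma> where \<sigma>: "\<sigma> \<in> weyl_group \<alpha>v \<alpha>" "\<sigma> N = N - K.asum (K.cont y)"
    using K.chain_weyl[where \<gamma>=N and \<kappa>=\<nu>, OF N y(1)] by blast
  have "K.asum (K.cont x) = K.asum \<beta> + K.asum (K.cont y)"
    unfolding y(2) K.asum_add[symmetric] using sub by simp
  then have orbit: "lam\<^sub>2 + w\<^sub>2 \<mu>\<^sub>2 = \<sigma> N" unfolding \<sigma>(2) x(2) by (simp add: N_def algebra_simps)
  obtain \<tau> where "\<tau> \<in> weyl_group \<alpha>v \<alpha>" "\<tau> (\<sigma> N) = N" using K.weyl_inverse[OF \<sigma>(1)] by blast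
  with K.dominant_conjugate_eq[of \<tau> "\<sigma> N"] Ndom have 2: "dominant_conjugate \<alpha>v \<alpha> (lam\<^sub>2 + w\<^sub>2 \<mu>\<^sub>2) = N"
    unfolding orbit by simp

  obtain \<Theta> :: "('l2, 'm2) tensor \<Rightarrow> 'n falg \<Rightarrow> complex" where \<Theta>:
    "clinear \<Theta>" "\<And>X Y. \<Theta> (P2.L.ev X \<otimes>\<^sub>C P2.M.ev Y) = K.SS (K.ik \<nu>) (\<Phi> X Y)"
    "\<And>t. \<Theta> t \<in> range (K.SS (K.ik \<nu>))" "\<And>i t Z. \<Theta> (P2.T (e i) t) Z = \<Theta> t (wd [i] * Z)" "\<And>i t Z. \<Theta> (P2.T (f i) t) Z = \<Theta> t (K.EE (K.ik \<nu>) i Z)"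
    "\<And>h t w. \<Theta> (P2.T (\<iota> h) t) (wd w) = (lam\<^sub>2 + \<mu>\<^sub>2 - K.asum (\<beta> + mset w)) h *\<^sub>C \<Theta> t (wd w)"
    by (rule P2.tensor_functional[OF t]) blast
  have \<Theta>_lin: "clinear (\<Theta> t)" for t
    using \<Theta>(3)[of t] K.lin_SS by auto
  let ?Z = "{t. \<Theta> t = 0}"
  have Z: "submodule P2.T ?Z"
  proof (rule K.generated_stable[OF P2.mod_T clinear_ker_subspace[OF \<Theta>(1)]])
    fix h t assume t: "t \<in> ?Z"
    have "\<Theta> (P2.T (\<iota> h) t) X = 0" for X
      by (rule clinear_eq_singleI[where X = X, OF \<Theta>_lin clinear_zero_map]) (use t in \<open>simp add: \<Theta>(6)\<close>)
    then show "P2.T (\<iota> h) t \<in> ?Z" by (simp add: fun_eq_iff)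
  qed (simp_all add: fun_eq_iff \<Theta>(4,5))
  \<comment> \<open>Otherwise the composite would vanish on the whole module generated by this
    vector, hence on the generator of the second module, where \<Theta> is nonzero.\<close>
  have \<Theta>1: "\<Theta> (\<phi> (u\<^sub>1 \<otimes>\<^sub>C v\<^sub>1)) \<noteq> 0"
  proof
    assume 0: "\<Theta> (\<phi> (u\<^sub>1 \<otimes>\<^sub>C v\<^sub>1)) = 0"
    have "submodule P1.T {s \<in> K1. \<phi> s \<in> ?Z}"
      using \<phi>_sub[of ?Z] Z K1(1) by (auto simp: submodule_def \<phi>(3))
    from Ug_span_minimal[OF this, of "u\<^sub>1 \<otimes>\<^sub>C v\<^sub>1"] 0 K1(2) have "K1 \<subseteq> {s \<in> K1. \<phi> s \<in> ?Z}"
      by (simp add: K1_def kostant_kumar_def)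
    moreover obtain s where "s \<in> K1" "u\<^sub>2 \<otimes>\<^sub>C v\<^sub>2 = \<phi> s" using K2(2) unfolding \<phi>(4)[symmetric] by (rule imageE)
    ultimately have "\<Theta> (u\<^sub>2 \<otimes>\<^sub>C v\<^sub>2) = 0" by auto
    then have "\<Theta> (P2.L.ev 1 \<otimes>\<^sub>C P2.M.ev (K.zz x)) = 0"
      unfolding k2 clinear_scale[OF \<Theta>(1)] using ab by simp
    then have "\<Phi> 1 (K.zz x) \<in> K.Jk \<nu>" unfolding \<Theta>(2) by (intro K.Jk_SS) simp
    with nz show False ..
  qed
  obtain w where w: "\<Theta> (\<phi> (u\<^sub>1 \<otimes>\<^sub>C v\<^sub>1)) (wd w) \<noteq> 0"
  proof (rule ccontr)
    assume "\<not> thesis"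
    then have "\<Theta> (\<phi> (u\<^sub>1 \<otimes>\<^sub>C v\<^sub>1)) X = 0" for X
      using that by (intro clinear_eq_singleI[where X = X, OF \<Theta>_lin clinear_zero_map]) blast
    with \<Theta>1 show False by (simp add: fun_eq_iff)
  qed
  have "lam\<^sub>1 + w\<^sub>1 \<mu>\<^sub>1 = N - K.asum (mset w)"
  proof
    fix h
    have "\<Theta> (P2.T (\<iota> h) (\<phi> (u\<^sub>1 \<otimes>\<^sub>C v\<^sub>1))) = (lam\<^sub>1 + w\<^sub>1 \<mu>\<^sub>1) h *\<^sub>C \<Theta> (\<phi> (u\<^sub>1 \<otimes>\<^sub>C v\<^sub>1))"
      using \<phi>_weight[OF K1(2) k1] by (simp add: weight_space_def clinear_scale[OF \<Theta>(1)])
    from \<Theta>(6)[of h "\<phi> (u\<^sub>1 \<otimes>\<^sub>C v\<^sub>1)" w, unfolded this] w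
    have "(lam\<^sub>1 + w\<^sub>1 \<mu>\<^sub>1) h = (lam\<^sub>2 + \<mu>\<^sub>2 - K.asum (\<beta> + mset w)) h"
      unfolding scaleC_fun_apply scaleC_cmul mult_cancel_right by blast
    then show "(lam\<^sub>1 + w\<^sub>1 \<mu>\<^sub>1) h = (N - K.asum (mset w)) h"
      by (simp add: N_def K.asum_add algebra_simps)
  qed
  \<comment> \<open>A nonzero value at the word \<open>w\<close> exhibits a nonzero vector of degree
    \<open>mset w\<close> in V(\<nu>), so that \<open>N - K.asum (mset w)\<close> is one of its
    weights.\<close>
  moreover obtain X where "X \<in> K.Fc (mset w)" "X \<notin> K.Jk \<nu>"
  proof -
    obtain Y where "\<Theta> (\<phi> (u\<^sub>1 \<otimes>\<^sub>C v\<^sub>1)) = K.SS (K.ik \<nu>) Y" using \<Theta>(3) by blast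
    then have "K.ecoef (K.ik \<nu>) w (\<Sum>c\<in>mset ` Poly_Mapping.keys Y. K.proj c Y) \<noteq> 0"
      using w unfolding K.sum_proj[symmetric] by (simp add: K.SS_wd)
    then obtain c where c: "K.ecoef (K.ik \<nu>) w (K.proj c Y) \<noteq> 0"
      unfolding clinear_sum[OF K.lin_ecoef] by (metis sum.neutral)
    with K.ecoef_Fc[OF K.proj_Fc c] K.ecoef_Jk K.proj_Fc that show ?thesis by metis
  qed
  ultimately obtain c where "dominant_conjugate \<alpha>v \<alpha> (lam\<^sub>1 + w\<^sub>1 \<mu>\<^sub>1) = N - K.asum c"
    using K.dominant_conjugate_weight[where \<gamma>=N and \<kappa>=\<nu>, OF N linN] by (metis (no_types))
  then have 3: "weight_ge \<alpha> N (dominant_conjugate \<alpha>v \<alpha> (lam\<^sub>1 + w\<^sub>1 \<mu>\<^sub>1))"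
    by (simp add: K.weight_ge_asum)
  show ?thesis unfolding 2 using 1 3 K.weight_ge_asum[of "lam\<^sub>2 + \<mu>\<^sub>2" \<beta>] by (simp add: N_def)
qed

end
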